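(* Let $N\ge2$ and let $\Omega\subset\mathbb{R}^N$ be a bounded open set with smooth boundary. Let $0<s_2<s_1\le1$ and $1<p<N$. Let $\alpha\in\mathbb{R}$ and $g\in L^{\frac p{p-1}}(\Omega)$. Then there exists $\alpha_0>0$ depending on $N$ and $\Omega$ such that if $\alpha<\alpha_0$, then the problem $$\begin{cases}(-\Delta)^{s_1}_pu-\alpha(-\Delta)^{s_2}_pu=g(x)&\text{in }\Omega,\\ u=0&\text{in }\mathbb{R}^N\setminus\Omega\end{cases}$$ admits a nontrivial (weak) solution corresponding to a global minimizer of the associated energy functional. In addition, the problem $$\begin{cases}(-\Delta)^{s_1}_pu=g(x)&\text{in }\Omega,\\ u=0&\text{in }\mathbb{R}^N\setminus\Omega\end{cases}$$ has a unique (weak) solution.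
   Context: For $s\in(0,1)$ and $p\in(1,N)$ set $c_{N,s,p}:=\dfrac{s\,2^{2s}\,\Gamma\left(\frac{ps+p+N-2}{2}\right)}{\pi^{N/2}\,\Gamma(1-s)}$ and $$(-\Delta)^s_pu(x):=c_{N,s,p}\lim_{\varepsilon\searrow0}\int_{\mathbb{R}^N\setminus B_\varepsilon(x)}\frac{|u(x)-u(y)|^{p-2}(u(x)-u(y))}{|x-y|^{N+sp}}\,dy,$$ and $(-\Delta)^1_pu:=-\Delta_pu=-\operatorname{div}(|\nabla u|^{p-2}\nabla u)$. Seminorms: $[u]_{s,p}:=\Big(c_{N,s,p}\iint_{\mathbb{R}^{2N}}\frac{|u(x)-u(y)|^p}{|x-y|^{N+sp}}\,dx\,dy\Big)^{1/p}$ for $s\in(0,1)$, $[u]_{1,p}:=\|\nabla u\|_{L^p(\mathbb{R}^N)}$. The function space $\mathcal{X}$ is the completion of $C_0^\infty(\Omega)$ with respect to $[\cdot]_{s_1,p}$ (elements are regarded as functions vanishing a.e. outside $\Omega$). Put $\mathcal{E}_{s,p}(u,v):=\frac{c_{N,s,p}}{2}\iint_{\mathbb{R}^{2N}}\frac{|u(x)-u(y)|^{p-2}(u(x)-u(y))(v(x)-v(y))}{|x-y|^{N+sp}}\,dx\,dy$ for $s\in(0,1)$ and $\mathcal{E}_{1,p}(u,v):=\frac12\int_\Omega|\nabla u|^{p-2}\nabla u\cdot\nabla v\,dx$. $u\in\mathcal{X}$ is a (weak) solution of the first problem if $\mathcal{E}_{s_1,p}(u,v)-\alpha\,\mathcal{E}_{s_2,p}(u,v)=\int_\Omega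 gv\,dx$ for all $v\in\mathcal{X}$; the second problem is the case $\alpha=0$. The associated energy functional is $J(u):=\frac1{2p}[u]^p_{s_1,p}-\frac{\alpha}{2p}[u]^p_{s_2,p}-\int_\Omega gu\,dx$ on $\mathcal{X}$. A solution is nontrivial if it is not identically zero.
   Formalization: The solution is claimed to be nontrivial only when g is not a.e. zero in Ω: for g = 0 and α ≤ 0, testing with v = u shows that u = 0 is the only solution. Existence of a solution that is a global minimizer is still claimed for every g. *)

theory Defs
  imports "HOL-Analysis.Analysis"
begin

text \<open>
  Functions are Lebesgue measurable and are identified when they agree almost everywhere;
  the dimension $N$ is \<open>DIM('a)\<close>.
\<close>

section \<open>Smooth functions and domains\<close>

primrec Ck_on :: "nat \<Rightarrow> ('a::euclidean_space \<Rightarrow> real) \<Rightarrow> 'a set \<Rightarrow> bool" where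
  "Ck_on 0 f U \<longleftrightarrow> continuous_on U f"
| "Ck_on (Suc k) f U \<longleftrightarrow> f differentiable_on U \<and>
     (\<forall>i\<in>Basis. Ck_on k (\<lambda>x. frechet_derivative f (at x) i) U)"

definition smooth :: "('a::euclidean_space \<Rightarrow> real) \<Rightarrow> bool" where
  "smooth f \<longleftrightarrow> (\<forall>k. Ck_on k f UNIV)"

definition test_function :: "'a::euclidean_space set \<Rightarrow> ('a \<Rightarrow> real) \<Rightarrow> bool" where
  "test_function \<Omega> \<phi> \<longleftrightarrow> smooth \<phi> \<and> compact (closure {x. \<phi> x \<noteq> 0}) \<and> closure {x. \<phi> x \<noteq> 0} \<subseteq> \<Omega>"

text \<open>
  Near each boundary point the set is the strict epigraph of a smooth function of $N-1$
  variables, in coordinates whose last axis is the unit vector \<open>e\<close>.  The remaining $N-1$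
  coordinates of \<open>x\<close> are its orthogonal projection \<open>x - (x \<bullet> e) *\<^sub>R e\<close>; a smooth function
  on the hyperplane orthogonal to \<open>e\<close> is the same as the restriction of a smooth function
  on the whole space.
\<close>

definition smooth_boundary :: "'a::euclidean_space set \<Rightarrow> bool" where
  "smooth_boundary \<Omega> \<longleftrightarrow>
     (\<forall>x0\<in>frontier \<Omega>. \<exists>r>0. \<exists>e \<gamma>. norm e = 1 \<and> smooth \<gamma> \<and>
        \<Omega> \<inter> ball x0 r = {x \<in> ball x0 r. x \<bullet> e > \<gamma> (x - (x \<bullet> e) *\<^sub>R e)})"

section \<open>Lebesgue spaces and weak gradients\<close>

definition in_Lp :: "real \<Rightarrow> 'a::euclidean_space set \<Rightarrow> ('a \<Rightarrow> real) \<Rightarrow> bool" where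
  "in_Lp q \<Omega> g \<longleftrightarrow> g \<in> borel_measurable (lebesgue_on \<Omega>) \<and>
     integrable (lebesgue_on \<Omega>) (\<lambda>x. \<bar>g x\<bar> powr q)"

definition has_weak_gradient :: "('a::euclidean_space \<Rightarrow> real) \<Rightarrow> ('a \<Rightarrow> 'a) \<Rightarrow> bool" where
  "has_weak_gradient u G \<longleftrightarrow>
     (\<forall>K. compact K \<longrightarrow> set_integrable lebesgue K u \<and> set_integrable lebesgue K G) \<and>
     (\<forall>\<phi>. test_function UNIV \<phi> \<longrightarrow>
        (\<forall>i\<in>Basis. (\<integral>x. u x * frechet_derivative \<phi> (at x) i \<partial>lebesgue) =
                    - (\<integral>x. (G x \<bullet> i) * \<phi> x \<partial>lebesgue)))"

text \<open>Well defined up to null sets when some weak gradient exists.\<close>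

definition weak_gradient :: "('a::euclidean_space \<Rightarrow> real) \<Rightarrow> 'a \<Rightarrow> 'a" where
  "weak_gradient u = (SOME G. has_weak_gradient u G)"

section \<open>Fractional seminorms and the energy space\<close>

definition frac_const :: "nat \<Rightarrow> real \<Rightarrow> real \<Rightarrow> real" where
  "frac_const N s p = s * 2 powr (2 * s) * Gamma ((p * s + p + real N - 2) / 2) /
     (pi powr (real N / 2) * Gamma (1 - s))"

text \<open>
  The $p$-th power of the seminorm, with value \<open>\<infinity>\<close> outside the natural domain.  On the
  diagonal the quotient is \<open>0 / 0 = 0\<close>, which is harmless since the diagonal is a null set.
  The case \<open>s < 1\<close> is meant for \<open>0 < s < 1\<close>, the other one for \<open>s = 1\<close>.
\<close>

definition seminorm_pow :: "real \<Rightarrow> real \<Rightarrow> ('a::euclidean_space \<Rightarrow> real) \<Rightarrow> ennreal" where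
  "seminorm_pow s p u =
     (if s < 1 then
        ennreal (frac_const DIM('a) s p) *
          (\<integral>\<^sup>+z. ennreal (\<bar>u (fst z) - u (snd z)\<bar> powr p /
                  norm (fst z - snd z) powr (real DIM('a) + s * p)) \<partial>(lebesgue :: ('a \<times> 'a) measure))
      else if \<exists>G. has_weak_gradient u G then
        (\<integral>\<^sup>+x. ennreal (norm (weak_gradient u x) powr p) \<partial>lebesgue)
      else \<infinity>)"

definition seminorm :: "real \<Rightarrow> real \<Rightarrow> ('a::euclidean_space \<Rightarrow> real) \<Rightarrow> ennreal" where
  "seminorm s p u =
     (if seminorm_pow s p u = \<infinity> then \<infinity> else ennreal (enn2real (seminorm_pow s p u) powr (1 / p)))"

text \<open>
  The completion of the test functions on \<open>\<Omega>\<close> with respect to the seminorm, realised as a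
  space of functions: its elements are the functions vanishing almost everywhere outside
  \<open>\<Omega>\<close> that are limits, in the seminorm, of sequences of test functions.  For bounded \<open>\<Omega>\<close>
  the ambient space of functions of finite seminorm vanishing almost everywhere outside \<open>\<Omega>\<close>
  is complete and the seminorm is a norm on it (modulo null sets), so that this closure is
  the completion.
\<close>

definition energy_space :: "'a::euclidean_space set \<Rightarrow> real \<Rightarrow> real \<Rightarrow> ('a \<Rightarrow> real) set" where
  "energy_space \<Omega> s p =
     {u \<in> borel_measurable lebesgue.
        (AE x in lebesgue. x \<notin> \<Omega> \<longrightarrow> u x = 0) \<and> seminorm s p u < \<infinity> \<and>
        (\<exists>\<phi> :: nat \<Rightarrow> 'a \<Rightarrow> real. (\<forall>n. test_function \<Omega> (\<phi> n)) \<and>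
           (\<lambda>n. seminorm s p (\<lambda>x. \<phi> n x - u x)) \<longlonglongrightarrow> 0)}"

section \<open>Weak solutions and the energy functional\<close>

text \<open>
  Where a difference or a gradient vanishes, the factor \<open>0 powr (p - 2)\<close> is \<open>0\<close>, so the
  integrands below are \<open>0\<close> there, also for \<open>p < 2\<close>.
\<close>

definition energy_form ::
  "'a::euclidean_space set \<Rightarrow> real \<Rightarrow> real \<Rightarrow> ('a \<Rightarrow> real) \<Rightarrow> ('a \<Rightarrow> real) \<Rightarrow> real" where
  "energy_form \<Omega> s p u v =
     (if s < 1 then
        frac_const DIM('a) s p / 2 *
          (\<integral>z. \<bar>u (fst z) - u (snd z)\<bar> powr (p - 2) * (u (fst z) - u (snd z)) * (v (fst z) - v (snd z)) /
               norm (fst z - snd z) powr (real DIM('a) + s * p) \<partial>(lebesgue :: ('a \<times> 'a) measure))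
      else
        1 / 2 * (\<integral>x. norm (weak_gradient u x) powr (p - 2) *
                      (weak_gradient u x \<bullet> weak_gradient v x) \<partial>(lebesgue_on \<Omega>)))"

definition weak_solution ::
  "'a::euclidean_space set \<Rightarrow> real \<Rightarrow> real \<Rightarrow> real \<Rightarrow> real \<Rightarrow> ('a \<Rightarrow> real) \<Rightarrow> ('a \<Rightarrow> real) \<Rightarrow> bool" where
  "weak_solution \<Omega> s1 s2 p \<alpha> g u \<longleftrightarrow> u \<in> energy_space \<Omega> s1 p \<and>
     (\<forall>v\<in>energy_space \<Omega> s1 p.
        energy_form \<Omega> s1 p u v - \<alpha> * energy_form \<Omega> s2 p u v = (\<integral>x. g x * v x \<partial>(lebesgue_on \<Omega>)))"

definition energy ::
  "'a::euclidean_space set \<Rightarrow> real \<Rightarrow> real \<Rightarrow> real \<Rightarrow> real \<Rightarrow> ('a \<Rightarrow> real) \<Rightarrow> ('a \<Rightarrow> real) \<Rightarrow> real" where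
  "energy \<Omega> s1 s2 p \<alpha> g u =
     1 / (2 * p) * enn2real (seminorm s1 p u) powr p
     - \<alpha> / (2 * p) * enn2real (seminorm s2 p u) powr p
     - (\<integral>x. g x * u x \<partial>(lebesgue_on \<Omega>))"

definition global_minimizer ::
  "'a::euclidean_space set \<Rightarrow> real \<Rightarrow> real \<Rightarrow> real \<Rightarrow> real \<Rightarrow> ('a \<Rightarrow> real) \<Rightarrow> ('a \<Rightarrow> real) \<Rightarrow> bool" where
  "global_minimizer \<Omega> s1 s2 p \<alpha> g u \<longleftrightarrow> u \<in> energy_space \<Omega> s1 p \<and>
     (\<forall>w\<in>energy_space \<Omega> s1 p. energy \<Omega> s1 s2 p \<alpha> g u \<le> energy \<Omega> s1 s2 p \<alpha> g w)"

definition nontrivial :: "('a::euclidean_space \<Rightarrow> real) \<Rightarrow> bool" where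
  "nontrivial u \<longleftrightarrow> \<not> (AE x in lebesgue. u x = 0)"

end

theory Submission
  imports Defs "HOL-Complex_Analysis.Great_Picard"
begin

text \<open>
  A solution is obtained as a minimizer of the energy, without weak topologies.  Decomposing the
  fractional energy over dyadic annuli and summing by parts gives
  \<open>[u]\<^bsub>s\<^sub>2,p\<^esub>\<^sup>p \<le> C [u]\<^bsub>s\<^sub>1,p\<^esub>\<^sup>p\<close> and a Poincare inequality, with \<open>C\<close> depending only on \<open>\<Omega>\<close>: the
  constants \<open>c\<^bsub>N,s,p\<^esub>\<close> absorb the degeneration of the integrals as \<open>s\<close> tends to \<open>0\<close> or \<open>1\<close>.  Hence
  the energy is coercive for \<open>\<alpha> < 1 / C\<close>.  Bounded sequences are compact for \<open>[\<cdot>]\<^bsub>s\<^sub>2,p\<^esub>\<close> (by averaging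
  over the cells of a grid and interpolation), and \<open>[\<cdot>]\<^bsub>s\<^sub>1,p\<^esub>\<^sup>p\<close> is uniformly convex, so a minimizing
  sequence has a subsequence that is Cauchy in \<open>[\<cdot>]\<^bsub>s\<^sub>1,p\<^esub>\<close>.  The Euler-Lagrange equation is the
  stationarity of the energy, a minimizer for \<open>g \<noteq> 0\<close> is nontrivial because \<open>0\<close> does not solve the
  equation, and uniqueness for \<open>\<alpha> = 0\<close> is the strict monotonicity of \<open>z \<mapsto> |z|\<^bsup>p-2\<^esup>z\<close>.
\<close>

section \<open>Pointwise inequalities for powers of the norm\<close>

text \<open>The threshold \<alpha>0 is fixed before s1, s2 and p, so every comparison constant must
  be uniform in these parameters, including s near 0 and 1 and p near 1 and N. This dictates the
  route: the energy of order s, as an integral over displacements, splits into dyadic sums of ratio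
  q = 2^(-p(1-s)) for small and q = 2^(-sp) for large displacements. Their normalizations 1 - q are
  of size 1 - s and s, while c_{N,s,p} is s(1 - s) times a positive continuous function of (s,p) on
  [0,1] x [1,N]; the two degenerations cancel. A second obstacle is the endpoint s1 = 1, where the
  double integral becomes a gradient integral. Both cases are written as c ||D u||_p^p with a linear
  map D into an L^p space, a difference quotient or the weak gradient, and the variational argument
  is carried out once for such D. Estimates at s1 = 1 are proved for test functions and passed to
  limits. p-th powers replace norms throughout; the triangle inequality then costs a factor 2^p,
  which stays below 2^N.\<close>

lemma powr_tangent:
  fixes x y p :: real
  assumes p: "1 < p" and "0 \<le> x" "0 \<le> y" "x \<noteq> y"
  shows "x powr p + p * x powr (p - 1) * (y - x) < y powr p"
proof (cases "x = 0")
  case True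
  then show ?thesis using assms by simp
next
  case False
  then have x: "0 < x" using assms by simp
  \<comment> \<open>By homogeneity only the ratio r = y / x matters. The derivative p (r^(p-1) - 1)
    changes sign at 1, so f has its strict minimum f 1 = 1 there. Monotonicity needs the derivative
    only in the open intervals, which admits the endpoint r = 0.\<close>
  define f where "f r = r powr p - p * (r - 1)" for r :: real
  have d: "(f has_real_derivative (p * (r powr (p - 1) - 1))) (at r)" if "0 < r" for r
    unfolding f_def using that
    by (auto intro!: derivative_eq_intros simp: algebra_simps)
  have c: "continuous_on {0..} f"
    unfolding f_def using p by (intro continuous_intros continuous_on_powr') auto
  have main: "1 < f r" if r: "0 \<le> r" "r \<noteq> 1" for r
  proof (cases "r < 1")
    case True
    have "f 1 < f r"
    proof (rule DERIV_neg_imp_decreasing_open[OF True])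
      fix z assume z: "r < z" "z < 1"
      then have "z powr (p - 1) < 1 powr (p - 1)" using r p by (intro powr_less_mono2) auto
      then show "\<exists>y. DERIV f z :> y \<and> y < 0"
        using d[of z] z r p by (intro exI conjI) (auto simp: mult_pos_neg)
    next
      show "continuous_on {r..1} f" using c r by (auto intro: continuous_on_subset)
    qed
    then show ?thesis by (simp add: f_def)
  next
    case False
    then have 1: "1 < r" using r by simp
    have "f 1 < f r"
    proof (rule DERIV_pos_imp_increasing_open[OF 1])
      fix z assume z: "1 < z" "z < r"
      then have "1 powr (p - 1) < z powr (p - 1)" using r p by (intro powr_less_mono2) auto
      then show "\<exists>y. DERIV f z :> y \<and> y > 0"
        using d[of z] z r p by (intro exI conjI) auto
    next
      show "continuous_on {1..r} f" using c r by (auto intro: continuous_on_subset)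
    qed
    then show ?thesis by (simp add: f_def)
  qed
  have "1 < f (y / x)" using main[of "y / x"] assms x by auto
  then have "x powr p * 1 < x powr p * f (y / x)" using x by simp
  also have "\<dots> = y powr p - p * x powr (p - 1) * (y - x)"
    using x assms by (simp add: f_def powr_divide powr_diff field_simps)
  finally show ?thesis by simp
qed

lemma powr_tangent_le:
  fixes x y p :: real
  assumes "1 < p" and "0 \<le> x" "0 \<le> y"
  shows "x powr p + p * x powr (p - 1) * (y - x) \<le> y powr p"
  using powr_tangent[OF assms] by (cases "x = y") auto

lemma powr_minus_2_mult: "norm a powr (p - 2) * norm a = norm a powr (p - 1)"
  for a :: "'e::real_normed_vector"
  by (cases "a = 0") (auto simp: powr_mult_base[symmetric] powr_diff power2_eq_square)

lemma powr_minus_2_mult_inner: "norm a powr (p - 2) * (a \<bullet> a) = norm a powr p"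
  for a :: "'e::real_inner"
  by (cases "a = 0") (auto simp: powr_diff dot_square_norm)

text \<open>Strict convexity of |z|^p, with two sources of strictness: for different norms the
  scalar inequality is strict, for equal norms and a \<noteq> b the Cauchy-Schwarz inequality
  is.\<close>

lemma norm_powr_tangent:
  fixes a b :: "'e::real_inner"
  assumes p: "1 < p" and "a \<noteq> b"
  shows "norm a powr p + p * (norm a powr (p - 2) * (a \<bullet> (b - a))) < norm b powr p"
proof -
  have eq: "norm a powr (p - 2) * (a \<bullet> (b - a)) = norm a powr (p - 2) * (a \<bullet> b) - norm a powr p"
    by (simp add: inner_diff_right right_diff_distrib powr_minus_2_mult_inner)
  have eq2: "norm a powr (p - 1) * (norm b - norm a) = norm a powr (p - 2) * (norm a * norm b) - norm a powr p"
    using powr_minus_2_mult[of a p] powr_minus_2_mult_inner[of a p]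
    by (simp add: algebra_simps dot_square_norm power2_eq_square)
  have le: "norm a powr (p - 2) * (a \<bullet> b) \<le> norm a powr (p - 2) * (norm a * norm b)"
    by (intro mult_left_mono norm_cauchy_schwarz) auto
  show ?thesis
  proof (cases "norm a = norm b")
    case False
    then have "norm a powr p + p * norm a powr (p - 1) * (norm b - norm a) < norm b powr p"
      using p by (intro powr_tangent) auto
    moreover have "p * (norm a powr (p - 2) * (a \<bullet> (b - a))) \<le> p * (norm a powr (p - 1) * (norm b - norm a))"
      unfolding eq eq2 using le p by (intro mult_left_mono) auto
    ultimately show ?thesis by (simp add: mult.assoc)
  next
    case True
    then have a0: "norm a \<noteq> 0" using \<open>a \<noteq> b\<close> by auto
    have "a \<bullet> b \<noteq> norm a * norm b"
      using norm_cauchy_schwarz_eq[of a b] True a0 \<open>a \<noteq> b\<close> by auto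
    then have "a \<bullet> b < norm a * norm b" using norm_cauchy_schwarz[of a b] by simp
    then have "norm a powr (p - 2) * (a \<bullet> b) < norm a powr (p - 2) * (norm a * norm b)"
      using a0 by simp
    also have "\<dots> = norm a powr p"
      using powr_minus_2_mult_inner[of a p] True by (simp add: dot_square_norm power2_eq_square)
    finally have "p * (norm a powr (p - 2) * (a \<bullet> (b - a))) < 0"
      unfolding eq using p by (simp add: mult_pos_neg)
    then show ?thesis using True by simp
  qed
qed

text \<open>Adding the tangent inequality at a towards b to the one at b towards a cancels the
  powers. What is left is the strict monotonicity of |z|^(p-2) z, the source of uniqueness.\<close>

lemma norm_powr_monotone:
  fixes a b :: "'e::real_inner"
  assumes "1 < p" "a \<noteq> b"
  shows "0 < norm a powr (p - 2) * (a \<bullet> (a - b)) - norm b powr (p - 2) * (b \<bullet> (a - b))"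
proof -
  have "p * (norm a powr (p - 2) * (a \<bullet> (b - a))) + p * (norm b powr (p - 2) * (b \<bullet> (a - b))) < 0"
    using norm_powr_tangent[of p a b] norm_powr_tangent[of p b a] assms by simp
  then have "p * (norm a powr (p - 2) * (a \<bullet> (b - a)) + norm b powr (p - 2) * (b \<bullet> (a - b))) < 0"
    by (simp add: algebra_simps)
  then have "norm a powr (p - 2) * (a \<bullet> (b - a)) + norm b powr (p - 2) * (b \<bullet> (a - b)) < 0"
    using assms by (simp add: mult_less_0_iff)
  then show ?thesis by (simp add: inner_diff_right algebra_simps)
qed

text \<open>Average the tangent inequalities at the midpoint m towards a and towards b: the linear
  terms cancel because b - m = -(a - m).\<close>

lemma norm_powr_midpoint_less:
  fixes a b :: "'e::real_inner"
  assumes "1 < p" "a \<noteq> b"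
  shows "norm ((1/2) *\<^sub>R (a + b)) powr p < (norm a powr p + norm b powr p) / 2"
proof -
  let ?m = "(1/2) *\<^sub>R (a + b)"
  have "?m \<noteq> a" "?m \<noteq> b"
  proof -
    have "2 *\<^sub>R ?m \<noteq> 2 *\<^sub>R a" "2 *\<^sub>R ?m \<noteq> 2 *\<^sub>R b" using assms by (auto simp: scaleR_2)
    then show "?m \<noteq> a" "?m \<noteq> b" by metis+
  qed
  note * = this[THEN norm_powr_tangent[OF assms(1)]]
  have "b - m = - (a - m)" if "m = ?m" for m
  proof -
    have "m + m = a + b" using that scaleR_half_double[of "a + b"] by (simp add: scaleR_add_right)
    then show ?thesis by (simp add: algebra_simps)
  qed
  then have "b - ?m = - (a - ?m)" by blast
  then have "?m \<bullet> (b - ?m) = - (?m \<bullet> (a - ?m))" by (metis inner_minus_right)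
  with * show ?thesis by (simp only:) argo
qed

lemma norm_powr_midpoint_le:
  fixes a b :: "'e::real_inner"
  assumes "1 < p"
  shows "norm ((1/2) *\<^sub>R (a + b)) powr p \<le> (norm a powr p + norm b powr p) / 2"
proof (cases "a = b")
  case True
  then have "(1/2) *\<^sub>R (a + b) = b" by (metis scaleR_half_double)
  then show ?thesis using True by simp
qed (use norm_powr_midpoint_less[OF assms, of a b] in auto)

lemma norm_add_powr_le:
  fixes a b :: "'e::real_normed_vector"
  assumes "0 < p"
  shows "norm (a + b) powr p \<le> 2 powr p * (norm a powr p + norm b powr p)"
proof -
  have "norm (a + b) \<le> 2 * max (norm a) (norm b)" using norm_triangle_ineq[of a b] by linarith
  then have "norm (a + b) powr p \<le> (2 * max (norm a) (norm b)) powr p"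
    using assms by (intro powr_mono2) auto
  also have "\<dots> = 2 powr p * max (norm a) (norm b) powr p" by (simp add: powr_mult)
  also have "\<dots> \<le> 2 powr p * (norm a powr p + norm b powr p)"
    by (intro mult_left_mono) (auto simp: max_def)
  finally show ?thesis .
qed

lemma norm_diff_powr_le:
  fixes a b :: "'e::real_normed_vector"
  assumes "0 < p"
  shows "norm (a - b) powr p \<le> 2 powr p * (norm a powr p + norm b powr p)"
  using norm_add_powr_le[OF assms, of a "- b"] by simp

text \<open>A quantitative form of strict convexity, by compactness and homogeneity; it replaces
  Clarkson's inequalities and treats all exponents alike.\<close>

lemma norm_powr_uniformly_convex:
  assumes p: "1 < p" and eps: "0 < \<epsilon>"
  obtains C where "0 < C" and "\<And>a b :: 'e::euclidean_space. norm (a - b) powr p \<le>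
      \<epsilon> * (norm a powr p + norm b powr p) +
      C * ((norm a powr p + norm b powr p) / 2 - norm ((1/2) *\<^sub>R (a + b)) powr p)"
proof -
  define n :: "'e \<times> 'e \<Rightarrow> real" where "n z = norm (fst z) powr p + norm (snd z) powr p" for z
  define gap :: "'e \<times> 'e \<Rightarrow> real"
    where "gap z = n z / 2 - norm ((1/2) *\<^sub>R (fst z + snd z)) powr p" for z
  \<comment> \<open>Among pairs normalized to |a|^p + |b|^p = 1 the \<epsilon> term alone suffices
    unless the pair lies in \<open>K\<close>. There a \<noteq> b, so the convexity gap is positive,
    and by compactness at least some \<delta>. As |a - b|^p is at most 2^p, the choice C = 2^p /
    \<delta> works.\<close>
  define K where "K = {z. n z = 1 \<and> \<epsilon> \<le> norm (fst z - snd z) powr p}"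
  have cn: "continuous_on UNIV n"
    unfolding n_def using p by (intro continuous_intros continuous_on_powr') auto
  have cg: "continuous_on UNIV gap"
    unfolding gap_def using p by (intro continuous_intros continuous_on_powr' cn) auto
  have cd: "continuous_on UNIV (\<lambda>z :: 'e \<times> 'e. norm (fst z - snd z) powr p)"
    using p by (intro continuous_intros continuous_on_powr') auto
  have "closed K"
    unfolding K_def by (intro closed_Collect_conj closed_Collect_eq closed_Collect_le cn cd continuous_intros)
  moreover have "bounded K"
  proof -
    have "K \<subseteq> cball 0 1 \<times> cball 0 1"
    proof
      fix z assume "z \<in> K"
      then have "norm (fst z) powr p \<le> 1" "norm (snd z) powr p \<le> 1"
        by (auto simp: K_def n_def) (smt (verit) powr_ge_zero)+
      then have "norm (fst z) \<le> 1" "norm (snd z) \<le> 1"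
        using powr_less_mono2[of p 1 "norm (fst z)"] powr_less_mono2[of p 1 "norm (snd z)"] p
          by fastforce+
      then show "z \<in> cball 0 1 \<times> cball 0 1" by (cases z) auto
    qed
    then show ?thesis by (metis bounded_Times bounded_cball bounded_subset)
  qed
  ultimately have K: "compact K" by (simp add: compact_eq_bounded_closed)
  have pos: "0 < gap z" if "z \<in> K" for z
  proof -
    have "fst z \<noteq> snd z" using that eps p by (auto simp: K_def)
    then show ?thesis using norm_powr_midpoint_less[OF p, of "fst z" "snd z"] by (simp add: gap_def n_def)
  qed
  have nn: "0 \<le> gap z" for z
    using norm_powr_midpoint_le[OF p, of "fst z" "snd z"] by (simp add: gap_def n_def)
  obtain \<delta> where \<delta>: "0 < \<delta>" "\<And>z. z \<in> K \<Longrightarrow> \<delta> \<le> gap z"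
  proof (cases "K = {}")
    case False
    then obtain z0 where "z0 \<in> K" "\<forall>z\<in>K. gap z0 \<le> gap z"
      using continuous_attains_inf[OF K False continuous_on_subset[OF cg]] by auto
    then show ?thesis using that pos by blast
  qed (use that[of 1] in auto)
  define C where "C = 2 powr p / \<delta>"
  have C: "0 < C" using \<delta> by (simp add: C_def)
  show ?thesis
  proof (rule that[OF C])
    fix a b :: 'e
    have "norm (a - b) powr p \<le> \<epsilon> * n (a, b) + C * gap (a, b)"
    proof (cases "n (a, b) = 0")
      case True
      then have "a = 0" "b = 0" by (auto simp: n_def add_nonneg_eq_0_iff)
      then show ?thesis using p by (simp add: n_def gap_def)
    next
      case False
      then have n0: "0 < n (a, b)" by (smt (verit) n_def powr_ge_zero)
      define t where "t = n (a, b) powr (1 / p)"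
      have t: "0 < t" "t powr p = n (a, b)" using n0 p by (auto simp: t_def powr_powr)
      define z where "z = ((1/t) *\<^sub>R a, (1/t) *\<^sub>R b)"
      have sc: "norm ((1/t) *\<^sub>R x) powr p = norm x powr p / n (a, b)" for x :: 'e
        using t by (simp add: powr_divide)
      have "n z = norm a powr p / n (a, b) + norm b powr p / n (a, b)"
        by (simp only: n_def z_def fst_conv snd_conv sc)
      also have "\<dots> = n (a, b) / n (a, b)"
        unfolding n_def[of "(a, b)"] by (simp only: fst_conv snd_conv add_divide_distrib)
      finally have nz: "n z = 1" using n0 by simp
      have dz: "norm (fst z - snd z) powr p = norm (a - b) powr p / n (a, b)"
        using sc[of "a - b"] by (simp add: z_def scaleR_diff_right[symmetric] del: norm_scaleR)
      have "(1/2) *\<^sub>R (fst z + snd z) = (1/t) *\<^sub>R ((1/2) *\<^sub>R (a + b))"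
        by (simp add: z_def scaleR_add_right mult.commute)
      then have "norm ((1/2) *\<^sub>R (fst z + snd z)) powr p = norm ((1/2) *\<^sub>R (a + b)) powr p / n (a, b)"
        using sc[of "(1/2) *\<^sub>R (a + b)"] by (simp del: norm_scaleR)
      then have gz: "gap z = gap (a, b) / n (a, b)"
        using n0 by (simp add: gap_def nz diff_divide_distrib del: norm_scaleR)
      have "norm (fst z - snd z) powr p \<le> \<epsilon> + C * gap z"
      proof (cases "z \<in> K")
        case True
        have "norm (fst z - snd z) powr p \<le> 2 powr p * n z"
          unfolding n_def using p by (intro norm_diff_powr_le) auto
        also have "\<dots> = C * \<delta>" using \<delta> by (simp add: C_def nz)
        also have "\<dots> \<le> C * gap z" using \<delta>(2)[OF True] C by simp
        finally show ?thesis using eps by simp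
      next
        case False
        moreover have "0 \<le> C * gap z" using C nn by (simp add: mult_nonneg_nonneg)
        ultimately show ?thesis by (auto simp: K_def nz)
      qed
      then show ?thesis unfolding dz gz using n0 by (simp add: field_simps)
    qed
    then show "norm (a - b) powr p \<le> \<epsilon> * (norm a powr p + norm b powr p) +
        C * ((norm a powr p + norm b powr p) / 2 - norm ((1/2) *\<^sub>R (a + b)) powr p)"
      by (simp add: n_def gap_def del: norm_scaleR)
  qed
qed

text \<open>If |a - b| < \<delta> |a|, the ratio of the norms is close to 1 and the \<epsilon> term
  suffices; otherwise both norms are dominated by |a - b|. The additive form integrates as it stands
  and so gives the continuity of energies without the triangle inequality for L^p norms.\<close>

lemma norm_powr_continuity:
  fixes p \<epsilon> :: real
  assumes p: "0 < p" and eps: "0 < \<epsilon>"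
  obtains C where "0 < C" and "\<And>a b :: 'e::real_normed_vector.
    \<bar>norm a powr p - norm b powr p\<bar> \<le> \<epsilon> * norm a powr p + C * norm (a - b) powr p"
proof -
  have "((\<lambda>t::real. t powr p) \<longlongrightarrow> 1 powr p) (at 1)"
    by (intro tendsto_intros) auto
  then obtain \<delta> where \<delta>: "0 < \<delta>" "\<And>t. t \<noteq> 1 \<Longrightarrow> \<bar>t - 1\<bar> < \<delta> \<Longrightarrow> \<bar>t powr p - 1\<bar> < \<epsilon>"
    using eps unfolding LIM_eq by auto
  define C where "C = (1 / \<delta>) powr p + (1 / \<delta> + 1) powr p"
  show ?thesis
  proof (rule that)
    have "0 < 1 / \<delta>" using \<delta> by simp
    then have "0 < (1 / \<delta>) powr p" "0 \<le> (1 / \<delta> + 1) powr p" by auto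
    then show "0 < C" unfolding C_def by linarith
    fix a b :: 'e
    show "\<bar>norm a powr p - norm b powr p\<bar> \<le> \<epsilon> * norm a powr p + C * norm (a - b) powr p"
    proof (cases "norm (a - b) < \<delta> * norm a")
      case True
      then have a: "0 < norm a" using \<delta> by (cases "a = 0") auto
      define t where "t = norm b / norm a"
      have "\<bar>norm b - norm a\<bar> < \<delta> * norm a"
        using True norm_triangle_ineq3[of b a] by (simp add: norm_minus_commute)
      then have "\<bar>t - 1\<bar> < \<delta>" using a
        by (simp add: t_def field_simps abs_less_iff)
      then have "\<bar>t powr p - 1\<bar> \<le> \<epsilon>" using \<delta>(2)[of t] eps by (cases "t = 1") auto
      then have "norm a powr p * \<bar>t powr p - 1\<bar> \<le> norm a powr p * \<epsilon>"
        by (intro mult_left_mono) auto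
      moreover have "norm a powr p * \<bar>t powr p - 1\<bar> = \<bar>norm b powr p - norm a powr p\<bar>"
        using a by (simp add: t_def powr_divide flip: abs_mult_pos') (simp add: abs_mult_pos field_simps)
      moreover have "0 \<le> C * norm (a - b) powr p" by (simp add: C_def)
      ultimately show ?thesis by (simp add: mult.commute abs_minus_commute)
    next
      case False
      then have 1: "norm a \<le> (1 / \<delta>) * norm (a - b)" using \<delta> by (simp add: field_simps)
      have 2: "norm b \<le> (1 / \<delta> + 1) * norm (a - b)"
        using 1 norm_triangle_ineq2[of b a] by (simp add: algebra_simps norm_minus_commute)
      have "norm a powr p \<le> (1 / \<delta>) powr p * norm (a - b) powr p"
        using powr_mono2[OF _ _ 1, of p] p \<delta> by (simp only: powr_mult) simp
      moreover have "norm b powr p \<le> (1 / \<delta> + 1) powr p * norm (a - b) powr p"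
        using powr_mono2[OF _ _ 2, of p] p \<delta> by (simp only: powr_mult) simp
      ultimately have "\<bar>norm a powr p - norm b powr p\<bar> \<le> C * norm (a - b) powr p"
        by (smt (verit) C_def distrib_right powr_ge_zero)
      then show ?thesis using eps by (smt (verit) powr_ge_zero mult_nonneg_nonneg)
    qed
  qed
qed

text \<open>For a \<noteq> 0 this is the chain rule for (|z|^2)^(p/2). At a = 0 the difference
  quotient has modulus |t|^(p-1) |b|^p, which tends to 0 because p > 1.\<close>

lemma has_derivative_norm_powr_line:
  fixes a b :: "'e::real_inner"
  assumes p: "1 < p"
  shows "((\<lambda>t. norm (a + t *\<^sub>R b) powr p) has_real_derivative p * (norm a powr (p - 2) * (a \<bullet> b))) (at 0)"
proof (cases "a = 0")
  case True
  have "((\<lambda>t::real. \<bar>t\<bar> powr (p - 1) * norm b powr p) \<longlongrightarrow> 0 powr (p - 1) * norm b powr p) (at 0)"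
    using p by (intro tendsto_intros tendsto_powr' tendsto_rabs) (auto intro!: tendsto_eq_intros)
  then have "((\<lambda>t::real. \<bar>t\<bar> powr (p - 1) * norm b powr p) \<longlongrightarrow> 0) (at 0)" using p by simp
  then have "((\<lambda>t. norm (t *\<^sub>R b) powr p / t) \<longlongrightarrow> 0) (at 0)"
  proof (rule Lim_null_comparison[rotated])
    show "\<forall>\<^sub>F t in at 0. norm (norm (t *\<^sub>R b) powr p / t) \<le> \<bar>t\<bar> powr (p - 1) * norm b powr p"
      by (auto simp: eventually_at_filter powr_mult powr_diff abs_mult)
  qed
  then show ?thesis using True p by (simp add: DERIV_def)
next
  case False
  have "((\<lambda>t. ((a + t *\<^sub>R b) \<bullet> (a + t *\<^sub>R b)) powr (p / 2)) has_real_derivative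
      (p / 2) * (a \<bullet> a) powr (p / 2 - 1) * (2 * (a \<bullet> b))) (at 0)"
  proof -
    have "((\<lambda>t. (a \<bullet> a) + 2 * t * (a \<bullet> b) + t^2 * (b \<bullet> b)) has_real_derivative 2 * (a \<bullet> b)) (at 0)"
      by (auto intro!: derivative_eq_intros)
    moreover have "(\<lambda>t. (a \<bullet> a) + 2 * t * (a \<bullet> b) + t^2 * (b \<bullet> b)) = (\<lambda>t. (a + t *\<^sub>R b) \<bullet> (a + t *\<^sub>R b))"
      by (auto simp: inner_add_left inner_add_right power2_eq_square inner_commute algebra_simps)
    ultimately have "((\<lambda>t. (a + t *\<^sub>R b) \<bullet> (a + t *\<^sub>R b)) has_real_derivative 2 * (a \<bullet> b)) (at 0)" by simp
    from DERIV_fun_powr[OF this, of "p / 2"] show ?thesis using False by (simp add: mult_ac)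
  qed
  moreover have "(x \<bullet> x) powr q = norm x powr (2 * q)" for x :: 'e and q
  proof -
    have "x \<bullet> x = norm x powr 2" by (simp add: dot_square_norm)
    then show ?thesis by (simp only: powr_powr)
  qed
  moreover have "2 * (p / 2 - 1) = p - 2" by simp
  ultimately show ?thesis by (simp add: mult_ac)
qed

lemma abs_powr_diff_le:
  fixes x y m p :: real
  assumes p: "1 < p" and "0 \<le> x" "x \<le> m" "0 \<le> y" "y \<le> m"
  shows "\<bar>x powr p - y powr p\<bar> \<le> p * m powr (p - 1) * \<bar>x - y\<bar>"
proof -
  have *: "v powr p - u powr p \<le> p * m powr (p - 1) * \<bar>v - u\<bar>" if "0 \<le> u" "0 \<le> v" "v \<le> m" for u v
  proof -
    have "v powr p + p * v powr (p - 1) * (u - v) \<le> u powr p"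
      using p that by (intro powr_tangent_le) auto
    then have "v powr p - u powr p \<le> p * v powr (p - 1) * (v - u)" by (simp add: algebra_simps)
    also have "\<dots> \<le> p * v powr (p - 1) * \<bar>v - u\<bar>" using p by (intro mult_left_mono) auto
    also have "\<dots> \<le> p * m powr (p - 1) * \<bar>v - u\<bar>"
      using p that by (intro mult_right_mono mult_left_mono powr_mono2) auto
    finally show ?thesis .
  qed
  from *[of x y] *[of y x] show ?thesis using assms by (auto simp: abs_minus_commute abs_le_iff)
qed

text \<open>The bound is linear in |t| with a factor free of t: divided by |t| it is the dominating
  function for differentiation under the integral sign.\<close>

lemma norm_powr_line_diff_le:
  fixes a b :: "'e::real_normed_vector"
  assumes p: "1 < p" and t: "\<bar>t\<bar> \<le> 1"
  shows "\<bar>norm (a + t *\<^sub>R b) powr p - norm a powr p\<bar> \<le> \<bar>t\<bar> * (p * (norm a + norm b) powr p)"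
proof -
  let ?m = "norm a + norm b"
  have tb: "norm (t *\<^sub>R b) \<le> norm b" using t by (simp add: mult_left_le_one_le)
  have "\<bar>norm (a + t *\<^sub>R b) powr p - norm a powr p\<bar> \<le> p * ?m powr (p - 1) * \<bar>norm (a + t *\<^sub>R b) - norm a\<bar>"
    using tb norm_triangle_ineq[of a "t *\<^sub>R b"] p by (intro abs_powr_diff_le) auto
  also have "\<dots> \<le> p * ?m powr (p - 1) * (\<bar>t\<bar> * ?m)"
  proof (intro mult_left_mono)
    have "\<bar>norm (a + t *\<^sub>R b) - norm a\<bar> \<le> norm (t *\<^sub>R b)"
      using norm_triangle_ineq3[of "a + t *\<^sub>R b" a] by simp
    also have "\<dots> \<le> \<bar>t\<bar> * ?m" by (auto intro: mult_left_mono)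
    finally show "\<bar>norm (a + t *\<^sub>R b) - norm a\<bar> \<le> \<bar>t\<bar> * ?m" .
  qed (use p in auto)
  also have "?m powr (p - 1) * ?m = ?m powr p"
    by (cases "?m = 0") (auto simp: powr_diff)
  then have "p * ?m powr (p - 1) * (\<bar>t\<bar> * ?m) = \<bar>t\<bar> * (p * ?m powr p)" by (simp add: mult_ac)
  finally show ?thesis .
qed

text \<open>Replaces Hoelder's inequality throughout.\<close>

lemma powr_mult_le:
  fixes x y p :: real
  assumes "1 < p" "0 \<le> x" "0 \<le> y"
  shows "x powr (p - 1) * y \<le> x powr p + y powr p"
proof (cases "x = 0 \<or> y = 0")
  case False
  show ?thesis
  proof (cases "x \<le> y")
    case True
    then have "x powr (p - 1) * y \<le> y powr (p - 1) * y"
      using assms False by (intro mult_right_mono powr_mono2) auto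
    also have "\<dots> = y powr p" using False assms by (simp add: powr_diff)
    finally show ?thesis by (smt (verit) powr_ge_zero)
  next
    case False
    then have "x powr (p - 1) * y \<le> x powr (p - 1) * x"
      using assms by (intro mult_left_mono) auto
    also have "\<dots> = x powr p" using False assms by (simp add: powr_diff)
    finally show ?thesis by (smt (verit) powr_ge_zero)
  qed
qed (use assms in auto)

lemma young_le:
  fixes x y p :: real
  assumes "1 < p" "0 \<le> x" "0 \<le> y"
  shows "x * y \<le> x powr (p / (p - 1)) + y powr p"
proof -
  have "(x powr (1 / (p - 1))) powr (p - 1) * y \<le> (x powr (1 / (p - 1))) powr p + y powr p"
    using assms by (intro powr_mult_le) auto
  then show ?thesis using assms by (simp add: powr_powr)
qed

lemma young_eps_le:
  fixes x y p \<epsilon> :: real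
  assumes "1 < p" "0 \<le> x" "0 \<le> y" "0 < \<epsilon>"
  shows "x * y \<le> (1 / \<epsilon>) powr (p / (p - 1)) * x powr (p / (p - 1)) + \<epsilon> powr p * y powr p"
  using young_le[of p "x / \<epsilon>" "\<epsilon> * y"] assms by (simp add: powr_mult powr_divide)

section \<open>Spaces of p-integrable functions\<close>

text \<open>Functions are kept without a quotient by null sets, and with values in a Euclidean
  space, so that scalar difference quotients on the product space and vector-valued gradients are
  both covered.\<close>

definition Lp_fun :: "'m measure \<Rightarrow> real \<Rightarrow> ('m \<Rightarrow> 'e::euclidean_space) \<Rightarrow> bool" where
  "Lp_fun M p f \<longleftrightarrow> f \<in> borel_measurable M \<and> integrable M (\<lambda>x. norm (f x) powr p)"

definition Lp_pow :: "'m measure \<Rightarrow> real \<Rightarrow> ('m \<Rightarrow> 'e::euclidean_space) \<Rightarrow> real" where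
  "Lp_pow M p f = (\<integral>x. norm (f x) powr p \<partial>M)"

lemma Lp_fun_iff:
  "Lp_fun M p f \<longleftrightarrow> f \<in> borel_measurable M \<and> (\<integral>\<^sup>+x. ennreal (norm (f x) powr p) \<partial>M) < \<infinity>"
proof (cases "f \<in> borel_measurable M")
  case True
  then have "(\<lambda>x. norm (f x) powr p) \<in> borel_measurable M" by measurable
  then show ?thesis using True unfolding Lp_fun_def by (auto simp: integrable_iff_bounded)
qed (simp add: Lp_fun_def)

lemma Lp_fun_measurable: "Lp_fun M p f \<Longrightarrow> f \<in> borel_measurable M"
  and Lp_fun_integrable: "Lp_fun M p f \<Longrightarrow> integrable M (\<lambda>x. norm (f x) powr p)"
  by (auto simp: Lp_fun_def)

lemma nn_integral_Lp_fun:
  "Lp_fun M p f \<Longrightarrow> (\<integral>\<^sup>+x. ennreal (norm (f x) powr p) \<partial>M) = ennreal (Lp_pow M p f)"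
  unfolding Lp_pow_def Lp_fun_def by (intro nn_integral_eq_integral) auto

lemma Lp_pow_nonneg: "0 \<le> Lp_pow M p f"
  unfolding Lp_pow_def by (rule Bochner_Integration.integral_nonneg) auto

lemma Lp_fun_scaleR: "Lp_fun M p f \<Longrightarrow> Lp_fun M p (\<lambda>x. c *\<^sub>R f x)"
  by (auto simp: Lp_fun_def powr_mult)

lemma Lp_pow_scaleR: "Lp_pow M p (\<lambda>x. c *\<^sub>R f x) = \<bar>c\<bar> powr p * Lp_pow M p f"
  by (simp add: Lp_pow_def powr_mult)

lemma Lp_fun_add:
  assumes "0 < p" "Lp_fun M p f" "Lp_fun M p g"
  shows "Lp_fun M p (\<lambda>x. f x + g x)"
  unfolding Lp_fun_def
proof
  show m: "(\<lambda>x. f x + g x) \<in> borel_measurable M" using assms by (auto simp: Lp_fun_def)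
  show "integrable M (\<lambda>x. norm (f x + g x) powr p)"
  proof (rule Bochner_Integration.integrable_bound)
    show "integrable M (\<lambda>x. 2 powr p * (norm (f x) powr p + norm (g x) powr p))"
      using assms by (auto simp: Lp_fun_def)
    show "AE x in M. norm (norm (f x + g x) powr p) \<le> norm (2 powr p * (norm (f x) powr p + norm (g x) powr p))"
      using norm_add_powr_le[OF assms(1)] by (auto intro!: AE_I2 simp: abs_mult)
  qed (use m in measurable)
qed

lemma Lp_fun_diff:
  assumes "0 < p" "Lp_fun M p f" "Lp_fun M p g"
  shows "Lp_fun M p (\<lambda>x. f x - g x)"
  using Lp_fun_add[OF assms(1,2) Lp_fun_scaleR[OF assms(3), of "-1"]] by simp

text \<open>The pointwise inequality is linear in p-th powers and integrates directly, so
  \<open>C\<close> depends neither on the measure nor on the functions.\<close>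

lemma Lp_uniformly_convex:
  assumes "1 < p" "0 < \<epsilon>"
  obtains C where "0 < C"
    and "\<And>(M :: 'm measure) (f :: 'm \<Rightarrow> 'e::euclidean_space) g. Lp_fun M p f \<Longrightarrow> Lp_fun M p g \<Longrightarrow>
      Lp_pow M p (\<lambda>x. f x - g x) \<le> \<epsilon> * (Lp_pow M p f + Lp_pow M p g) +
      C * ((Lp_pow M p f + Lp_pow M p g) / 2 - Lp_pow M p (\<lambda>x. (1/2) *\<^sub>R (f x + g x)))"
proof -
  obtain C where C: "0 < C" "\<And>a b :: 'e. norm (a - b) powr p \<le>
      \<epsilon> * (norm a powr p + norm b powr p) +
      C * ((norm a powr p + norm b powr p) / 2 - norm ((1/2) *\<^sub>R (a + b)) powr p)"
    using norm_powr_uniformly_convex[OF assms] by blast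
  show ?thesis
  proof (rule that[OF C(1)])
    fix M :: "'m measure" and f g :: "'m \<Rightarrow> 'e"
    assume f: "Lp_fun M p f" and g: "Lp_fun M p g"
    have h: "Lp_fun M p (\<lambda>x. (1/2) *\<^sub>R (f x + g x))"
      using assms f g by (intro Lp_fun_scaleR Lp_fun_add) auto
    have "Lp_pow M p (\<lambda>x. f x - g x) \<le> (\<integral>x. \<epsilon> * (norm (f x) powr p + norm (g x) powr p) +
      C * ((norm (f x) powr p + norm (g x) powr p) / 2 - norm ((1/2) *\<^sub>R (f x + g x)) powr p) \<partial>M)"
      unfolding Lp_pow_def
      using C(2) Lp_fun_diff[OF _ f g] f g h assms
      by (intro integral_mono Bochner_Integration.integrable_add integrable_mult_right
          Bochner_Integration.integrable_diff integrable_divide_zero) (auto simp: Lp_fun_def)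
    also have "\<dots> = \<epsilon> * (Lp_pow M p f + Lp_pow M p g) +
      C * ((Lp_pow M p f + Lp_pow M p g) / 2 - Lp_pow M p (\<lambda>x. (1/2) *\<^sub>R (f x + g x)))"
      using f g h unfolding Lp_pow_def Lp_fun_def by (simp del: norm_scaleR)
    finally show "Lp_pow M p (\<lambda>x. f x - g x) \<le> \<epsilon> * (Lp_pow M p f + Lp_pow M p g) +
      C * ((Lp_pow M p f + Lp_pow M p g) / 2 - Lp_pow M p (\<lambda>x. (1/2) *\<^sub>R (f x + g x)))" .
  qed
qed

lemma Lp_pow_continuity:
  assumes "0 < p" "0 < \<epsilon>"
  obtains C where "0 < C"
    and "\<And>(M :: 'm measure) (f :: 'm \<Rightarrow> 'e::euclidean_space) g. Lp_fun M p f \<Longrightarrow> Lp_fun M p g \<Longrightarrow>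
      \<bar>Lp_pow M p f - Lp_pow M p g\<bar> \<le> \<epsilon> * Lp_pow M p f + C * Lp_pow M p (\<lambda>x. f x - g x)"
proof -
  obtain C where C: "0 < C" "\<And>a b :: 'e.
      \<bar>norm a powr p - norm b powr p\<bar> \<le> \<epsilon> * norm a powr p + C * norm (a - b) powr p"
    using norm_powr_continuity[OF assms] by blast
  show ?thesis
  proof (rule that[OF C(1)])
    fix M :: "'m measure" and f g :: "'m \<Rightarrow> 'e"
    assume f: "Lp_fun M p f" and g: "Lp_fun M p g"
    note h = Lp_fun_diff[OF assms(1) f g]
    have "\<bar>Lp_pow M p f - Lp_pow M p g\<bar> = \<bar>\<integral>x. norm (f x) powr p - norm (g x) powr p \<partial>M\<bar>"
      using f g unfolding Lp_pow_def Lp_fun_def by simp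
    also have "\<dots> \<le> (\<integral>x. \<bar>norm (f x) powr p - norm (g x) powr p\<bar> \<partial>M)"
      by (rule integral_abs_bound)
    also have "\<dots> \<le> (\<integral>x. \<epsilon> * norm (f x) powr p + C * norm (f x - g x) powr p \<partial>M)"
      using C(2) f g h by (intro integral_mono) (auto simp: Lp_fun_def)
    also have "\<dots> = \<epsilon> * Lp_pow M p f + C * Lp_pow M p (\<lambda>x. f x - g x)"
      using f h unfolding Lp_pow_def Lp_fun_def by simp
    finally show "\<bar>Lp_pow M p f - Lp_pow M p g\<bar> \<le> \<epsilon> * Lp_pow M p f + C * Lp_pow M p (\<lambda>x. f x - g x)" .
  qed
qed

lemma Lp_pairing_integrable:
  fixes f g :: "'m \<Rightarrow> 'e::euclidean_space"
  assumes "1 < p" "Lp_fun M p f" "Lp_fun M p g"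
  shows "integrable M (\<lambda>x. norm (f x) powr (p - 2) * (f x \<bullet> g x))"
proof (rule Bochner_Integration.integrable_bound)
  show "integrable M (\<lambda>x. norm (f x) powr p + norm (g x) powr p)"
    using assms by (auto simp: Lp_fun_def)
  have "\<bar>norm (f x) powr (p - 2) * (f x \<bullet> g x)\<bar> \<le> norm (f x) powr p + norm (g x) powr p" for x
  proof -
    have "\<bar>norm (f x) powr (p - 2) * (f x \<bullet> g x)\<bar> \<le> norm (f x) powr (p - 2) * (norm (f x) * norm (g x))"
      unfolding abs_mult using Cauchy_Schwarz_ineq2[of "f x" "g x"] by (intro mult_mono) auto
    also have "\<dots> = norm (f x) powr (p - 1) * norm (g x)"
      using powr_minus_2_mult[of "f x" p] by (simp add: mult.assoc[symmetric])
    also have "\<dots> \<le> norm (f x) powr p + norm (g x) powr p"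
      using assms by (intro powr_mult_le) auto
    finally show ?thesis .
  qed
  then show "AE x in M. norm (norm (f x) powr (p - 2) * (f x \<bullet> g x)) \<le> norm (norm (f x) powr p + norm (g x) powr p)"
    by (intro AE_I2) auto
  show "(\<lambda>x. norm (f x) powr (p - 2) * (f x \<bullet> g x)) \<in> borel_measurable M"
  proof -
    have [measurable]: "f \<in> borel_measurable M" "g \<in> borel_measurable M"
      using assms by (auto simp: Lp_fun_def)
    show ?thesis by measurable
  qed
qed

text \<open>Dominated convergence for difference quotients along arbitrary null sequences, with the
  dominating function p (|f| + |g|)^p.\<close>

lemma Lp_pow_has_derivative:
  fixes f g :: "'m \<Rightarrow> 'e::euclidean_space"
  assumes p: "1 < p" and f: "Lp_fun M p f" and g: "Lp_fun M p g"
  shows "((\<lambda>t. Lp_pow M p (\<lambda>x. f x + t *\<^sub>R g x)) has_real_derivative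
    p * (\<integral>x. norm (f x) powr (p - 2) * (f x \<bullet> g x) \<partial>M)) (at 0)"
proof -
  have ft: "Lp_fun M p (\<lambda>x. f x + t *\<^sub>R g x)" for t
    using p f g by (intro Lp_fun_add Lp_fun_scaleR) auto
  have [measurable]: "f \<in> borel_measurable M" "g \<in> borel_measurable M"
    using f g by (auto simp: Lp_fun_def)
  define D where "D t x = (norm (f x + t *\<^sub>R g x) powr p - norm (f x) powr p) / t" for t x
  have [measurable]: "D t \<in> borel_measurable M" for t unfolding D_def by measurable
  have int: "integrable M (\<lambda>x. p * (norm (f x) + norm (g x)) powr p)"
  proof (rule Bochner_Integration.integrable_bound)
    show "integrable M (\<lambda>x. p * (2 powr p * (norm (f x) powr p + norm (g x) powr p)))"
      using f g by (auto simp: Lp_fun_def)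
    have "(norm (f x) + norm (g x)) powr p \<le> 2 powr p * (norm (f x) powr p + norm (g x) powr p)" for x
      using norm_add_powr_le[of p "norm (f x)" "norm (g x)"] p by simp
    then show "AE x in M. norm (p * (norm (f x) + norm (g x)) powr p)
        \<le> norm (p * (2 powr p * (norm (f x) powr p + norm (g x) powr p)))"
      using p by (intro AE_I2) (auto simp: abs_mult)
  qed measurable
  have lim: "(\<lambda>n. \<integral>x. D (s n) x \<partial>M) \<longlonglongrightarrow> (\<integral>x. p * (norm (f x) powr (p - 2) * (f x \<bullet> g x)) \<partial>M)"
    if s: "\<And>n. s n \<noteq> 0" "s \<longlonglongrightarrow> 0" for s :: "nat \<Rightarrow> real"
  proof -
    \<comment> \<open>The domination holds for |t| \<le> 1 only, so finitely many terms of the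
      sequence are dropped.\<close>
    obtain N where N: "\<And>n. n \<ge> N \<Longrightarrow> \<bar>s n\<bar> \<le> 1"
      using LIMSEQ_D[OF s(2), of 1] by (auto intro: less_imp_le)
    have "(\<lambda>n. \<integral>x. D (s (n + N)) x \<partial>M) \<longlonglongrightarrow> (\<integral>x. p * (norm (f x) powr (p - 2) * (f x \<bullet> g x)) \<partial>M)"
    proof (rule integral_dominated_convergence[OF _ _ int])
      have sN: "filterlim (\<lambda>n. s (n + N)) (at 0) sequentially"
        using s by (auto simp: filterlim_at LIMSEQ_ignore_initial_segment)
      have "(\<lambda>n. D (s (n + N)) x) \<longlonglongrightarrow> p * (norm (f x) powr (p - 2) * (f x \<bullet> g x))" for x
        using filterlim_compose[OF has_derivative_norm_powr_line[OF p, of "f x" "g x", unfolded DERIV_def] sN]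
        by (simp add: D_def)
      then show "AE x in M. (\<lambda>n. D (s (n + N)) x) \<longlonglongrightarrow> p * (norm (f x) powr (p - 2) * (f x \<bullet> g x))"
        by (intro AE_I2)
      have "\<bar>D (s (n + N)) x\<bar> \<le> p * (norm (f x) + norm (g x)) powr p" for n x
        using norm_powr_line_diff_le[OF p N[of "n + N"], of "f x" "g x"] s(1)[of "n + N"]
        by (simp add: D_def abs_divide pos_divide_le_eq mult_ac)
      then show "AE x in M. norm (D (s (n + N)) x) \<le> p * (norm (f x) + norm (g x)) powr p" for n
        by (intro AE_I2) simp
    qed measurable
    then show ?thesis by (rule LIMSEQ_offset)
  qed
  have "(Lp_pow M p (\<lambda>x. f x + t *\<^sub>R g x) - Lp_pow M p f) / t = (\<integral>x. D t x \<partial>M)" for t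
    using ft[of t] f unfolding Lp_pow_def D_def Lp_fun_def by simp
  then show ?thesis
    unfolding DERIV_def using lim
    by (auto simp: tendsto_at_iff_sequentially o_def)
qed

text \<open>The difference of the two integrands is nonnegative and, by strict monotonicity, zero
  only where f = g; a vanishing integral therefore forces equality almost everywhere.\<close>

lemma Lp_monotone_eq:
  fixes f g :: "'m \<Rightarrow> 'e::euclidean_space"
  assumes p: "1 < p" and f: "Lp_fun M p f" and g: "Lp_fun M p g"
    and eq: "(\<integral>x. norm (f x) powr (p - 2) * (f x \<bullet> (f x - g x)) \<partial>M) =
             (\<integral>x. norm (g x) powr (p - 2) * (g x \<bullet> (f x - g x)) \<partial>M)"
  shows "AE x in M. f x = g x"
proof -
  let ?d = "\<lambda>x. norm (f x) powr (p - 2) * (f x \<bullet> (f x - g x)) - norm (g x) powr (p - 2) * (g x \<bullet> (f x - g x))"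
  have h: "Lp_fun M p (\<lambda>x. f x - g x)" using p f g by (intro Lp_fun_diff) auto
  note i = Lp_pairing_integrable[OF p f h] Lp_pairing_integrable[OF p g h]
  have "integrable M ?d" using i by (rule Bochner_Integration.integrable_diff)
  moreover have "(\<integral>x. ?d x \<partial>M) = 0" using i eq by simp
  moreover have nn: "0 \<le> ?d x" for x
    using norm_powr_monotone[OF p, of "f x" "g x"] by (cases "f x = g x") auto
  ultimately have "AE x in M. ?d x = 0"
    by (subst (asm) integral_nonneg_eq_0_iff_AE) auto
  then show ?thesis
  proof eventually_elim
    fix x assume "?d x = 0"
    then show "f x = g x" using norm_powr_monotone[OF p, of "f x" "g x"] by auto
  qed
qed

section \<open>Fatou's lemma and completeness of L^p\<close>

lemma nn_integral_Fatou_le: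
  assumes "\<And>n. g n \<in> borel_measurable M" "AE x in M. (\<lambda>n. g n x) \<longlonglongrightarrow> h x"
    and "eventually (\<lambda>n. (\<integral>\<^sup>+x. g n x \<partial>M) \<le> B) sequentially"
  shows "(\<integral>\<^sup>+x. h x \<partial>M) \<le> (B :: ennreal)"
proof -
  have "(\<integral>\<^sup>+x. h x \<partial>M) = (\<integral>\<^sup>+x. liminf (\<lambda>n. g n x) \<partial>M)"
    using assms(2) by (intro nn_integral_cong_AE) (auto elim!: eventually_mono dest!: lim_imp_Liminf[rotated])
  also have "\<dots> \<le> liminf (\<lambda>n. \<integral>\<^sup>+x. g n x \<partial>M)" using assms(1) by (intro nn_integral_liminf)
  also have "\<dots> \<le> B"
    by (rule order_trans[OF Liminf_mono[OF assms(3)]]) (simp add: Liminf_const)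
  finally show ?thesis .
qed

lemma nn_integral_powr_Fatou:
  fixes f :: "nat \<Rightarrow> 'm \<Rightarrow> 'e::euclidean_space"
  assumes p: "0 < p" and m: "\<And>n. f n \<in> borel_measurable M" and l: "AE x in M. (\<lambda>n. f n x) \<longlonglongrightarrow> h x"
    and "eventually (\<lambda>n. (\<integral>\<^sup>+x. ennreal (norm (f n x) powr p) \<partial>M) \<le> B) sequentially"
  shows "(\<integral>\<^sup>+x. ennreal (norm (h x) powr p) \<partial>M) \<le> B"
proof (rule nn_integral_Fatou_le[OF _ _ assms(4)])
  show "(\<lambda>x. ennreal (norm (f n x) powr p)) \<in> borel_measurable M" for n using m by measurable
  show "AE x in M. (\<lambda>n. ennreal (norm (f n x) powr p)) \<longlonglongrightarrow> ennreal (norm (h x) powr p)"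
    using l p by (auto elim!: eventually_mono intro!: tendsto_intros tendsto_powr2)
qed

lemma ennreal_le_suminf: "f k \<le> (\<Sum>k. f k)" for f :: "nat \<Rightarrow> ennreal"
  using sum_le_suminf[of f "{k}"] by simp

lemma Lp_complete:
  fixes f :: "nat \<Rightarrow> 'm \<Rightarrow> 'e::euclidean_space"
  assumes p: "0 < p" and m[measurable]: "\<And>n. f n \<in> borel_measurable M"
    and cauchy: "\<And>e. 0 < e \<Longrightarrow> \<exists>N. \<forall>m\<ge>N. \<forall>n\<ge>N. (\<integral>\<^sup>+x. ennreal (norm (f m x - f n x) powr p) \<partial>M) \<le> ennreal e"
  obtains h r where "h \<in> borel_measurable M" "strict_mono r" "AE x in M. (\<lambda>n. f (r n) x) \<longlonglongrightarrow> h x"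
    "(\<lambda>n. \<integral>\<^sup>+x. ennreal (norm (f n x - h x) powr p) \<partial>M) \<longlonglongrightarrow> 0"
proof -
  \<comment> \<open>Chosen so that 2^(kp) e k = 2^(-k) is summable. Then the sum of 2^(kp) |d k x|^p
    is a finite number B for almost every x, whence |d k x| \<le> B^(1/p) 2^(-k): the increments are
    summable pointwise.\<close>
  define e where "e k = (1 / (2 ^ k) powr p) * (1/2) ^ k" for k :: nat
  have e0: "0 < e k" for k by (simp add: e_def)
  obtain N where N: "\<And>k m n. m \<ge> N k \<Longrightarrow> n \<ge> N k \<Longrightarrow> (\<integral>\<^sup>+x. ennreal (norm (f m x - f n x) powr p) \<partial>M) \<le> ennreal (e k)"
    using cauchy[OF e0] by metis
  define r where "r k = (\<Sum>i\<le>k. N i) + k" for k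
  have r: "strict_mono r" unfolding r_def by (intro strict_monoI_Suc) simp
  have rN: "N k \<le> r k" for k
  proof -
    have "N k \<le> (\<Sum>i\<le>k. N i)" by (rule member_le_sum) auto
    then show ?thesis by (simp add: r_def)
  qed
  define d where "d k x = f (r (Suc k)) x - f (r k) x" for k x
  have [measurable]: "d k \<in> borel_measurable M" for k unfolding d_def by measurable
  have dk: "(\<integral>\<^sup>+x. ennreal (norm (d k x) powr p) \<partial>M) \<le> ennreal (e k)" for k
    unfolding d_def using rN[of k] strict_mono_less_eq[OF r, of k "Suc k"] by (intro N) auto
  have "(\<integral>\<^sup>+x. (\<Sum>k. ennreal ((2 ^ k) powr p * norm (d k x) powr p)) \<partial>M) =
      (\<Sum>k. \<integral>\<^sup>+x. ennreal ((2 ^ k) powr p * norm (d k x) powr p) \<partial>M)"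
    by (intro nn_integral_suminf) measurable
  also have "\<dots> = (\<Sum>k. ennreal ((2 ^ k) powr p) * (\<integral>\<^sup>+x. ennreal (norm (d k x) powr p) \<partial>M))"
    by (subst nn_integral_cmult[symmetric]) (auto simp: ennreal_mult')
  also have "\<dots> \<le> (\<Sum>k. ennreal ((1/2) ^ k))"
  proof (intro suminf_le summableI)
    fix k
    have "ennreal ((2 ^ k) powr p) * (\<integral>\<^sup>+x. ennreal (norm (d k x) powr p) \<partial>M) \<le> ennreal ((2 ^ k) powr p) * ennreal (e k)"
      by (intro mult_left_mono dk) auto
    also have "\<dots> = ennreal ((1/2) ^ k)" using e0[of k] by (simp add: e_def flip: ennreal_mult)
    finally show "ennreal ((2 ^ k) powr p) * (\<integral>\<^sup>+x. ennreal (norm (d k x) powr p) \<partial>M) \<le> ennreal ((1/2) ^ k)" .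
  qed
  also have "\<dots> = ennreal (\<Sum>k. (1/2) ^ k)" by (intro suminf_ennreal2) (auto intro: summable_geometric)
  finally have "(\<integral>\<^sup>+x. (\<Sum>k. ennreal ((2 ^ k) powr p * norm (d k x) powr p)) \<partial>M) \<noteq> \<infinity>"
    by (auto simp: top_unique)
  then have "AE x in M. (\<Sum>k. ennreal ((2 ^ k) powr p * norm (d k x) powr p)) \<noteq> \<infinity>"
    by (intro nn_integral_noteq_infinite) measurable
  then have conv: "AE x in M. convergent (\<lambda>n. f (r n) x)"
  proof (rule eventually_mono)
    have fin: "s \<noteq> \<infinity> \<Longrightarrow> \<exists>B\<ge>0. s = ennreal B" for s :: ennreal by (cases s) auto
    fix x assume fin': "(\<Sum>k. ennreal ((2 ^ k) powr p * norm (d k x) powr p)) \<noteq> \<infinity>"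
    obtain B where B: "0 \<le> B" "(\<Sum>k. ennreal ((2 ^ k) powr p * norm (d k x) powr p)) = ennreal B"
      using fin[OF fin'] by (elim exE conjE) (rule that)
    have "norm (d k x) \<le> B powr (1 / p) * (1/2) ^ k" for k
    proof -
      have "ennreal ((2 ^ k) powr p * norm (d k x) powr p) \<le> ennreal B"
        unfolding B(2)[symmetric] by (rule ennreal_le_suminf)
      then have "(2 ^ k * norm (d k x)) powr p \<le> B" using B(1) by (simp add: powr_mult)
      then have "((2 ^ k * norm (d k x)) powr p) powr (1 / p) \<le> B powr (1 / p)"
        using p by (intro powr_mono2) auto
      then show ?thesis using p by (simp add: powr_powr power_divide field_simps)
    qed
    note bound = this
    have "summable (\<lambda>k. B powr (1 / p) * (1/2) ^ k)" by (intro summable_mult summable_geometric) simp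
    from this bound have "summable (\<lambda>k. d k x)" by (rule summable_comparison_test')
    then have "convergent (\<lambda>n. \<Sum>k<n. d k x)" by (simp add: summable_iff_convergent)
    then have "convergent (\<lambda>n. (\<Sum>k<n. d k x) + f (r 0) x)" by (intro convergent_add convergent_const)
    moreover have "(\<Sum>k<n. d k x) + f (r 0) x = f (r n) x" for n
      unfolding d_def using sum_lessThan_telescope[of "\<lambda>k. f (r k) x" n] by simp
    ultimately show "convergent (\<lambda>n. f (r n) x)" by simp
  qed
  define h where "h x = lim (\<lambda>n. f (r n) x)" for x
  have h: "h \<in> borel_measurable M" unfolding h_def by (rule borel_measurable_lim_metric) measurable
  have lim: "AE x in M. (\<lambda>n. f (r n) x) \<longlonglongrightarrow> h x"
    using conv unfolding h_def convergent_LIMSEQ_iff .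
  have "(\<lambda>n. \<integral>\<^sup>+x. ennreal (norm (f n x - h x) powr p) \<partial>M) \<longlonglongrightarrow> 0"
  proof (rule tendsto_zero_ennreal)
    fix \<epsilon> :: real assume "0 < \<epsilon>"
    then obtain N where N: "\<And>m n. m \<ge> N \<Longrightarrow> n \<ge> N \<Longrightarrow> (\<integral>\<^sup>+x. ennreal (norm (f m x - f n x) powr p) \<partial>M) \<le> ennreal (\<epsilon> / 2)"
      using cauchy[of "\<epsilon> / 2"] by auto
    have "(\<integral>\<^sup>+x. ennreal (norm (f n x - h x) powr p) \<partial>M) < ennreal \<epsilon>" if "n \<ge> N" for n
    proof -
      have "(\<integral>\<^sup>+x. ennreal (norm (f n x - h x) powr p) \<partial>M) \<le> ennreal (\<epsilon> / 2)"
      proof (rule nn_integral_powr_Fatou[OF p])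
        show "AE x in M. (\<lambda>k. f n x - f (r k) x) \<longlonglongrightarrow> f n x - h x"
          using lim by (auto elim!: eventually_mono intro!: tendsto_intros)
        have "(\<integral>\<^sup>+x. ennreal (norm (f n x - f (r k) x) powr p) \<partial>M) \<le> ennreal (\<epsilon> / 2)" if "k \<ge> N" for k
          using that seq_suble[OF r, of k] \<open>n \<ge> N\<close> by (intro N) auto
        then show "\<forall>\<^sub>F k in sequentially. (\<integral>\<^sup>+x. ennreal (norm (f n x - f (r k) x) powr p) \<partial>M) \<le> ennreal (\<epsilon> / 2)"
          using eventually_sequentially by auto
      qed measurable
      also have "\<dots> < ennreal \<epsilon>" using \<open>0 < \<epsilon>\<close> by (simp add: ennreal_lessI)
      finally show ?thesis .
    qed
    then show "\<forall>\<^sub>F n in sequentially. (\<integral>\<^sup>+x. ennreal (norm (f n x - h x) powr p) \<partial>M) < ennreal \<epsilon>"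
      using eventually_sequentially by auto
  qed
  then show ?thesis using that h r lim by blast
qed

section \<open>Minimization by uniform convexity\<close>

text \<open>The functional need not be convex when \<open>\<alpha> > 0\<close>.  Compactness of \<open>Q\<close> makes the perturbation
  negligible along a minimizing sequence, and uniform convexity of \<open>P\<close> then forces the
  sequence to be Cauchy, so that no weak topology is involved.\<close>

lemma minimizer_exists:
  fixes X :: "('a \<Rightarrow> real) set" and P Q L :: "('a \<Rightarrow> real) \<Rightarrow> real" and \<alpha> K :: real
  assumes zero: "(\<lambda>x. 0) \<in> X"
    and lin: "\<And>u v a b. u \<in> X \<Longrightarrow> v \<in> X \<Longrightarrow> (\<lambda>x. a * u x + b * v x) \<in> X"
    and P0: "\<And>u. u \<in> X \<Longrightarrow> 0 \<le> P u" and Q0: "\<And>u. u \<in> X \<Longrightarrow> 0 \<le> Q u"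
    and QP: "\<And>u. u \<in> X \<Longrightarrow> Q u \<le> K * P u" and K: "0 < K" and \<alpha>: "\<alpha> * K < 1"
    and uc: "\<And>\<epsilon>. 0 < \<epsilon> \<Longrightarrow> \<exists>C>0. \<forall>u\<in>X. \<forall>v\<in>X. P (\<lambda>x. u x - v x) \<le>
        \<epsilon> * (P u + P v) + C * ((P u + P v) / 2 - P (\<lambda>x. (u x + v x) / 2))"
    and contP: "\<And>\<epsilon>. 0 < \<epsilon> \<Longrightarrow> \<exists>C>0. \<forall>u\<in>X. \<forall>v\<in>X. \<bar>P u - P v\<bar> \<le> \<epsilon> * P u + C * P (\<lambda>x. u x - v x)"
    and contQ: "\<And>\<epsilon>. 0 < \<epsilon> \<Longrightarrow> \<exists>C>0. \<forall>u\<in>X. \<forall>v\<in>X. \<bar>Q u - Q v\<bar> \<le> \<epsilon> * Q u + C * Q (\<lambda>x. u x - v x)"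
    and Qhalf: "\<And>u. u \<in> X \<Longrightarrow> Q (\<lambda>x. u x / 2) \<le> Q u"
    and L: "\<And>u v a b. u \<in> X \<Longrightarrow> v \<in> X \<Longrightarrow> L (\<lambda>x. a * u x + b * v x) = a * L u + b * L v"
    and Lcoerc: "\<And>\<epsilon>. 0 < \<epsilon> \<Longrightarrow> \<exists>C. \<forall>u\<in>X. \<bar>L u\<bar> \<le> \<epsilon> * P u + C"
    and Lcont: "\<And>\<epsilon>. 0 < \<epsilon> \<Longrightarrow> \<exists>C>0. \<forall>u\<in>X. \<bar>L u\<bar> \<le> \<epsilon> + C * P u"
    and compact: "\<And>f B. (\<And>n::nat. f n \<in> X) \<Longrightarrow> (\<And>n. P (f n) \<le> B) \<Longrightarrow>
        \<exists>r :: nat \<Rightarrow> nat. strict_mono r \<and> (\<forall>e>0. \<exists>N. \<forall>m\<ge>N. \<forall>n\<ge>N. Q (\<lambda>x. f (r m) x - f (r n) x) \<le> e)"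
    and complete: "\<And>f. (\<And>n::nat. f n \<in> X) \<Longrightarrow>
        (\<And>e. 0 < e \<Longrightarrow> \<exists>N. \<forall>m\<ge>N. \<forall>n\<ge>N. P (\<lambda>x. f m x - f n x) \<le> e) \<Longrightarrow>
        \<exists>u\<in>X. (\<lambda>n. P (\<lambda>x. f n x - u x)) \<longlonglongrightarrow> 0"
  shows "\<exists>u\<in>X. \<forall>w\<in>X. P u - \<alpha> * Q u - L u \<le> P w - \<alpha> * Q w - L w"
proof -
  define J where "J u = P u - \<alpha> * Q u - L u" for u
  have diff: "(\<lambda>x. u x - v x) \<in> X" and mid: "(\<lambda>x. (u x + v x) / 2) \<in> X" and half: "(\<lambda>x. u x / 2) \<in> X"
    if "u \<in> X" "v \<in> X" for u v
    using lin[OF that, of 1 "-1"] lin[OF that, of "1/2" "1/2"] lin[OF that, of "1/2" 0]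
    by (simp_all add: add_divide_distrib)
  have Lmid: "L (\<lambda>x. (u x + v x) / 2) = (L u + L v) / 2" and Ldiff: "L (\<lambda>x. u x - v x) = L u - L v"
    if "u \<in> X" "v \<in> X" for u v
    using L[OF that, of "1/2" "1/2"] L[OF that, of 1 "-1"] by (simp_all add: add_divide_distrib)
  \<comment> \<open>The share of P that the perturbation can consume. A negative \<alpha> only
    helps, hence max \<alpha> 0. Of the remaining 1 - \<kappa>, one half absorbs L and the other
    half is the coercivity constant.\<close>
  define \<kappa> where "\<kappa> = max \<alpha> 0 * K"
  have \<kappa>: "\<kappa> < 1" using \<alpha> K by (auto simp: \<kappa>_def max_def)
  have aQ: "\<alpha> * Q u \<le> \<kappa> * P u" if "u \<in> X" for u
  proof -
    have "\<alpha> * Q u \<le> max \<alpha> 0 * Q u" using Q0[OF that] by (intro mult_right_mono) auto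
    also have "\<dots> \<le> max \<alpha> 0 * (K * P u)" using QP[OF that] by (intro mult_left_mono) auto
    finally show ?thesis by (simp add: \<kappa>_def mult_ac)
  qed
  obtain C0 where C0: "\<And>u. u \<in> X \<Longrightarrow> \<bar>L u\<bar> \<le> (1 - \<kappa>) / 2 * P u + C0"
    using Lcoerc[of "(1 - \<kappa>) / 2"] \<kappa> by auto
  have low: "(1 - \<kappa>) / 2 * P u \<le> J u + C0" if "u \<in> X" for u
    using aQ[OF that] C0[OF that] unfolding J_def by (simp add: field_simps)
  have bdd: "bdd_below (J ` X)"
  proof (rule bdd_belowI2)
    fix u assume "u \<in> X"
    moreover have "0 \<le> (1 - \<kappa>) / 2 * P u" using \<kappa> P0[OF \<open>u \<in> X\<close>] by (intro mult_nonneg_nonneg) auto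
    ultimately show "- C0 \<le> J u" using low[of u] by linarith
  qed
  define m where "m = Inf (J ` X)"
  have mJ: "m \<le> J u" if "u \<in> X" for u unfolding m_def using bdd that by (intro cInf_lower) auto
  have "\<exists>u\<in>X. J u < m + 1 / real (Suc n)" for n
    using cInf_lessD[of "J ` X" "m + 1 / real (Suc n)"] zero unfolding m_def by auto
  then obtain f0 where f0: "\<And>n. f0 n \<in> X" "\<And>n. J (f0 n) < m + 1 / real (Suc n)" by metis
  define B where "B = max 1 ((m + 1 + C0) / ((1 - \<kappa>) / 2))"
  have B1: "1 \<le> B" by (simp add: B_def)
  have PB0: "P (f0 n) \<le> B" for n
  proof -
    have "1 / real (Suc n) \<le> 1" by simp
    then have "(1 - \<kappa>) / 2 * P (f0 n) \<le> m + 1 + C0" using low[OF f0(1)[of n]] f0(2)[of n] by linarith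
    then have "P (f0 n) \<le> (m + 1 + C0) / ((1 - \<kappa>) / 2)" using \<kappa> by (simp add: field_simps)
    then show ?thesis by (simp add: B_def)
  qed
  obtain r :: "nat \<Rightarrow> nat" where r: "strict_mono r"
    "\<And>e. 0 < e \<Longrightarrow> \<exists>N. \<forall>m\<ge>N. \<forall>n\<ge>N. Q (\<lambda>x. f0 (r m) x - f0 (r n) x) \<le> e"
  proof -
    obtain r :: "nat \<Rightarrow> nat" where "strict_mono r \<and> (\<forall>e>0. \<exists>N. \<forall>m\<ge>N. \<forall>n\<ge>N. Q (\<lambda>x. f0 (r m) x - f0 (r n) x) \<le> e)"
      using compact[of f0 B, OF f0(1) PB0] by (rule exE) (rule that)
    then show ?thesis by (intro that[of r]) simp_all
  qed
  define f where "f n = f0 (r n)" for n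
  have fX: "f n \<in> X" for n using f0 by (simp add: f_def)
  have PB: "P (f n) \<le> B" for n using PB0 by (simp add: f_def)
  have Jf: "J (f n) < m + 1 / real (Suc n)" for n
  proof -
    have "1 / real (Suc (r n)) \<le> 1 / real (Suc n)" using seq_suble[OF r(1), of n] by (intro divide_left_mono) auto
    then show ?thesis using f0(2)[of "r n"] by (simp add: f_def)
  qed
  have QB: "Q (f n) \<le> K * B" for n
    using QP[OF fX[of n]] PB[of n] K by (smt (verit) mult_left_mono)
  have "\<exists>N. \<forall>m\<ge>N. \<forall>n\<ge>N. P (\<lambda>x. f m x - f n x) \<le> e" if e: "0 < e" for e
  proof -
    obtain C where C: "0 < C" "\<And>u v. u \<in> X \<Longrightarrow> v \<in> X \<Longrightarrow> P (\<lambda>x. u x - v x) \<le>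
        e / (4 * B) * (P u + P v) + C * ((P u + P v) / 2 - P (\<lambda>x. (u x + v x) / 2))"
      using uc[of "e / (4 * B)"] e B1 by auto
    \<comment> \<open>The tolerance for Q: its contribution |\<alpha>| d to the convexity gap must
      not exceed e / (4 C). The summand 1 avoids dividing by 0 for \<alpha> = 0.\<close>
    define d where "d = e / (4 * C * (\<bar>\<alpha>\<bar> + 1))"
    have d: "0 < d" using e C by (simp add: d_def)
    obtain C' where C': "0 < C'" "\<And>u v. u \<in> X \<Longrightarrow> v \<in> X \<Longrightarrow> \<bar>Q u - Q v\<bar> \<le> d / (2 * (K * B)) * Q u + C' * Q (\<lambda>x. u x - v x)"
      using contQ[of "d / (2 * (K * B))"] d B1 K by auto
    obtain N1 where N1: "\<And>m n. m \<ge> N1 \<Longrightarrow> n \<ge> N1 \<Longrightarrow> Q (\<lambda>x. f m x - f n x) \<le> d / (2 * C')"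
    proof -
      have "0 < d / (2 * C')" using d C' by simp
      from r(2)[OF this] obtain N where "\<forall>m\<ge>N. \<forall>n\<ge>N. Q (\<lambda>x. f0 (r m) x - f0 (r n) x) \<le> d / (2 * C')" ..
      then show ?thesis by (intro that[of N]) (simp add: f_def)
    qed
    obtain N2 where N2: "1 / real (Suc N2) < e / (4 * C)"
      using reals_Archimedean[of "e / (4 * C)"] e C by (auto simp: inverse_eq_divide)
    have "P (\<lambda>x. f i x - f j x) \<le> e" if ij: "i \<ge> max N1 N2" "j \<ge> max N1 N2" for i j
    proof -
      let ?w = "\<lambda>x. (f i x + f j x) / 2"
      have w: "?w \<in> X" using mid[OF fX fX] .
      have Qd: "\<bar>Q (f k) - Q ?w\<bar> \<le> d" if k: "k = i \<and> l = j \<or> k = j \<and> l = i" for k l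
      proof -
        have eqw: "(\<lambda>x. f k x - ?w x) = (\<lambda>x. (f k x - f l x) / 2)" using k by (auto simp: field_simps)
        have "Q (\<lambda>x. f k x - ?w x) \<le> Q (\<lambda>x. f k x - f l x)"
          unfolding eqw using Qhalf[OF diff[OF fX fX]] .
        also have "\<dots> \<le> d / (2 * C')" using k ij by (intro N1) auto
        finally have "C' * Q (\<lambda>x. f k x - ?w x) \<le> d / 2" using C' by (simp add: field_simps)
        moreover have "d / (2 * (K * B)) * Q (f k) \<le> d / (2 * (K * B)) * (K * B)"
          using d B1 K QB by (intro mult_left_mono) auto
        moreover have "d / (2 * (K * B)) * (K * B) = d / 2" using K B1 by simp
        ultimately show ?thesis using C'(2)[OF fX w, of k] by linarith
      qed
      \<comment> \<open>L is linear and drops out of the gap. The gap of J is small because the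
        midpoint has energy at least m while both ends are almost minimal; the gap of Q is small by
        compactness. So the gap of P is small, and uniform convexity bounds P of the
        difference.\<close>
      have "(P (f i) + P (f j)) / 2 - P ?w =
          (J (f i) + J (f j)) / 2 - J ?w + \<alpha> * ((Q (f i) - Q ?w) + (Q (f j) - Q ?w)) / 2"
        unfolding J_def Lmid[OF fX fX] by (simp add: field_simps)
      also have "\<dots> \<le> e / (4 * C) + \<bar>\<alpha>\<bar> * d"
      proof (rule add_mono)
        have "1 / real (Suc k) \<le> 1 / real (Suc N2)" if "k \<ge> N2" for k
          using that by (intro divide_left_mono) auto
        from this[of i] this[of j] have "1 / real (Suc i) \<le> 1 / real (Suc N2)" "1 / real (Suc j) \<le> 1 / real (Suc N2)"
          using ij by auto
        then have "J (f i) < m + e / (4 * C)" "J (f j) < m + e / (4 * C)"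
          using Jf[of i] Jf[of j] N2 by linarith+
        then show "(J (f i) + J (f j)) / 2 - J ?w \<le> e / (4 * C)"
          using mJ[OF w] by argo
        have "\<alpha> * ((Q (f i) - Q ?w) + (Q (f j) - Q ?w)) \<le> \<bar>\<alpha>\<bar> * \<bar>(Q (f i) - Q ?w) + (Q (f j) - Q ?w)\<bar>"
          by (simp flip: abs_mult)
        also have "\<dots> \<le> \<bar>\<alpha>\<bar> * (d + d)"
          using Qd[of i j] Qd[of j i] by (intro mult_left_mono) auto
        finally show "\<alpha> * ((Q (f i) - Q ?w) + (Q (f j) - Q ?w)) / 2 \<le> \<bar>\<alpha>\<bar> * d" by simp
      qed
      also have "\<bar>\<alpha>\<bar> * d \<le> e / (4 * C)"
      proof -
        have "\<bar>\<alpha>\<bar> * d \<le> (\<bar>\<alpha>\<bar> + 1) * d" using d by simp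
        also have "\<dots> = e / (4 * C)"
        proof -
          have "\<bar>\<alpha>\<bar> + 1 \<noteq> 0" by linarith
          then show ?thesis by (simp add: d_def)
        qed
        finally show ?thesis .
      qed
      finally have "(P (f i) + P (f j)) / 2 - P ?w \<le> e / (2 * C)" by simp
      then have "C * ((P (f i) + P (f j)) / 2 - P ?w) \<le> C * (e / (2 * C))" using C by (intro mult_left_mono) auto
      also have "\<dots> = e / 2" using C by simp
      finally have "C * ((P (f i) + P (f j)) / 2 - P ?w) \<le> e / 2" .
      moreover have "e / (4 * B) * (P (f i) + P (f j)) \<le> e / (4 * B) * (B + B)"
        using PB e B1 by (intro mult_left_mono add_mono) auto
      moreover have "e / (4 * B) * (B + B) = e / 2" using B1 by (simp add: field_simps)
      ultimately show ?thesis using C(2)[OF fX fX, of i j] by linarith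
    qed
    then show ?thesis by blast
  qed
  then obtain u where u: "u \<in> X" "(\<lambda>n. P (\<lambda>x. f n x - u x)) \<longlonglongrightarrow> 0"
    using complete[of f] fX by blast
  have "J u \<le> m"
  proof (rule field_le_epsilon)
    fix e :: real assume e: "0 < e"
    \<comment> \<open>One quarter for the distance of J (f n) from m and one each for the variation
      of P, of \<alpha> Q and of L between f n and u.\<close>
    define e' where "e' = e / 4"
    have e': "0 < e'" using e by (simp add: e'_def)
    obtain C1 where C1: "0 < C1" "\<And>u v. u \<in> X \<Longrightarrow> v \<in> X \<Longrightarrow> \<bar>P u - P v\<bar> \<le> (e' / 2 / B) * P u + C1 * P (\<lambda>x. u x - v x)"
      using contP[of "e' / 2 / B"] e' B1 by auto
    obtain C2 where C2: "0 < C2" "\<And>u v. u \<in> X \<Longrightarrow> v \<in> X \<Longrightarrow> \<bar>Q u - Q v\<bar> \<le> (e' / 2 / ((\<bar>\<alpha>\<bar> + 1) * (K * B))) * Q u + C2 * Q (\<lambda>x. u x - v x)"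
      using contQ[of "e' / 2 / ((\<bar>\<alpha>\<bar> + 1) * (K * B))"] e' B1 K by (auto simp: mult_pos_pos)
    obtain C3 where C3: "0 < C3" "\<And>u. u \<in> X \<Longrightarrow> \<bar>L u\<bar> \<le> e' / 2 + C3 * P u"
      using Lcont[of "e' / 2"] e' by auto
    define \<eta> where "\<eta> = Min {e' / (2 * C1), e' / (2 * ((\<bar>\<alpha>\<bar> + 1) * (C2 * K))), e' / (2 * C3)}"
    have \<eta>: "0 < \<eta>" "\<eta> \<le> e' / (2 * C1)" "\<eta> \<le> e' / (2 * ((\<bar>\<alpha>\<bar> + 1) * (C2 * K)))" "\<eta> \<le> e' / (2 * C3)"
      unfolding \<eta>_def using C1 C2 C3 e' K by (auto simp: mult_pos_pos)
    obtain N1 where "\<forall>n\<ge>N1. norm (P (\<lambda>x. f n x - u x) - 0) < \<eta>"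
      using LIMSEQ_D[OF u(2) \<eta>(1)] ..
    then have N1: "\<And>n. n \<ge> N1 \<Longrightarrow> P (\<lambda>x. f n x - u x) < \<eta>" by fastforce
    obtain N2 where N2: "1 / real (Suc N2) < e'"
      using reals_Archimedean[OF e'] by (auto simp: inverse_eq_divide)
    define n where "n = max N1 N2"
    let ?d = "\<lambda>x. f n x - u x"
    have d: "?d \<in> X" using diff[OF fX u(1)] .
    have Pd: "P ?d \<le> \<eta>" using N1[of n] by (simp add: n_def)
    have P: "\<bar>P (f n) - P u\<bar> \<le> e'"
    proof -
      have "(e' / 2 / B) * P (f n) \<le> (e' / 2 / B) * B" using PB e' B1 by (intro mult_left_mono) auto
      moreover have "(e' / 2 / B) * B = e' / 2" using B1 by simp
      moreover have "C1 * P ?d \<le> C1 * (e' / (2 * C1))" using C1 Pd \<eta> by (intro mult_left_mono) auto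
      moreover have "C1 * (e' / (2 * C1)) = e' / 2" using C1 by simp
      ultimately show ?thesis using C1(2)[OF fX u(1), of n] by linarith
    qed
    have "(\<bar>\<alpha>\<bar> + 1) * \<bar>Q (f n) - Q u\<bar> \<le> e'"
    proof -
      have "(\<bar>\<alpha>\<bar> + 1) * \<bar>Q (f n) - Q u\<bar> \<le> (\<bar>\<alpha>\<bar> + 1) * ((e' / 2 / ((\<bar>\<alpha>\<bar> + 1) * (K * B))) * (K * B) + C2 * (K * \<eta>))"
      proof (intro mult_left_mono order_trans[OF C2(2)[OF fX u(1)]] add_mono)
        show "0 \<le> e' / 2 / ((\<bar>\<alpha>\<bar> + 1) * (K * B))" using e' K B1 by (simp add: mult_pos_pos)
        show "Q (\<lambda>x. f n x - u x) \<le> K * \<eta>" using QP[OF d] Pd K by (smt (verit) mult_left_mono)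
      qed (use QB C2 in auto)
      also have "\<dots> = e' / 2 + ((\<bar>\<alpha>\<bar> + 1) * (C2 * K)) * \<eta>"
      proof -
        have "a * (d / (a * k) * k + c * (K * y)) = d + a * (c * K) * y" if "a \<noteq> 0" "k \<noteq> 0" for a k c d y :: real
          using that by (simp add: field_simps)
        moreover have "\<bar>\<alpha>\<bar> + 1 \<noteq> 0" "K * B \<noteq> 0" using K B1 by auto
        ultimately show ?thesis .
      qed
      also have "\<dots> \<le> e' / 2 + ((\<bar>\<alpha>\<bar> + 1) * (C2 * K)) * (e' / (2 * ((\<bar>\<alpha>\<bar> + 1) * (C2 * K))))"
        using \<eta> C2 K by (intro add_mono mult_left_mono) auto
      also have "((\<bar>\<alpha>\<bar> + 1) * (C2 * K)) * (e' / (2 * ((\<bar>\<alpha>\<bar> + 1) * (C2 * K)))) = e' / 2"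
      proof -
        have "(\<bar>\<alpha>\<bar> + 1) * (C2 * K) \<noteq> 0" using C2 K by auto
        then show ?thesis by simp
      qed
      finally show ?thesis by simp
    qed
    then have Q: "\<bar>\<alpha> * Q (f n) - \<alpha> * Q u\<bar> \<le> e'"
    proof -
      assume *: "(\<bar>\<alpha>\<bar> + 1) * \<bar>Q (f n) - Q u\<bar> \<le> e'"
      have "\<bar>\<alpha> * Q (f n) - \<alpha> * Q u\<bar> = \<bar>\<alpha>\<bar> * \<bar>Q (f n) - Q u\<bar>"
        by (simp only: abs_mult[symmetric] right_diff_distrib)
      also have "\<dots> \<le> (\<bar>\<alpha>\<bar> + 1) * \<bar>Q (f n) - Q u\<bar>" by (intro mult_right_mono) auto
      finally show ?thesis using * by linarith
    qed
    have L: "\<bar>L (f n) - L u\<bar> \<le> e'"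
    proof -
      have "C3 * P ?d \<le> C3 * (e' / (2 * C3))" using C3 Pd \<eta> by (intro mult_left_mono) auto
      moreover have "C3 * (e' / (2 * C3)) = e' / 2" using C3 by simp
      ultimately show ?thesis using C3(2)[OF d] Ldiff[OF fX u(1), of n] by linarith
    qed
    have "1 / real (Suc n) \<le> 1 / real (Suc N2)" by (intro divide_left_mono) (auto simp: n_def)
    then have "J (f n) \<le> m + e'" using Jf[of n] N2 by linarith
    then have "J u \<le> m + 4 * e'" using P Q L unfolding J_def by linarith
    then show "J u \<le> m + e" by (simp add: e'_def)
  qed
  then show ?thesis using mJ u(1) unfolding J_def by force
qed

section \<open>Fractional energies and dyadic annuli\<close>

lemma nn_integral_lborel_scale:
  fixes f :: "'a::euclidean_space \<Rightarrow> ennreal"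
  assumes [measurable]: "f \<in> borel_measurable borel" and c: "0 < c"
  shows "(\<integral>\<^sup>+x. f x \<partial>lborel) = ennreal (c ^ DIM('a)) * (\<integral>\<^sup>+x. f (c *\<^sub>R x) \<partial>lborel)"
proof -
  have "(\<integral>\<^sup>+x. f x \<partial>lborel) = (\<integral>\<^sup>+x. f x \<partial>density (distr lborel borel (\<lambda>x. 0 + c *\<^sub>R x)) (\<lambda>_. \<bar>c\<bar>^DIM('a)))"
    using c by (subst lborel_affine[of c 0, symmetric]) auto
  also have "\<dots> = ennreal (c ^ DIM('a)) * (\<integral>\<^sup>+x. f (c *\<^sub>R x) \<partial>lborel)"
    using c by (simp add: nn_integral_density nn_integral_distr nn_integral_cmult)
  finally show ?thesis .
qed

lemma nn_integral_lborel_shift: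
  fixes f :: "'a::euclidean_space \<Rightarrow> ennreal"
  assumes [measurable]: "f \<in> borel_measurable borel"
  shows "(\<integral>\<^sup>+x. f (x + c) \<partial>lborel) = (\<integral>\<^sup>+x. f x \<partial>lborel)"
proof -
  have "(\<integral>\<^sup>+x. f x \<partial>lborel) = (\<integral>\<^sup>+x. f x \<partial>distr lborel borel ((+) c))" by (simp add: lborel_distr_plus)
  also have "\<dots> = (\<integral>\<^sup>+x. f (x + c) \<partial>lborel)" by (subst nn_integral_distr) (auto simp: add.commute)
  finally show ?thesis ..
qed

lemma nn_integral_lborel_prod_shift:
  fixes f :: "'a::euclidean_space \<times> 'a \<Rightarrow> ennreal"
  assumes f[measurable]: "f \<in> borel_measurable borel"
  shows "(\<integral>\<^sup>+z. f z \<partial>lborel) = (\<integral>\<^sup>+h. (\<integral>\<^sup>+y. f (y + h, y) \<partial>lborel) \<partial>lborel)"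
proof -
  have [measurable]: "f \<in> borel_measurable (borel \<Otimes>\<^sub>M borel)" using f by (simp add: borel_prod)
  have "(\<integral>\<^sup>+z. f z \<partial>lborel) = (\<integral>\<^sup>+z. f z \<partial>(lborel \<Otimes>\<^sub>M lborel))" by (simp add: lborel_prod)
  also have "\<dots> = (\<integral>\<^sup>+y. (\<integral>\<^sup>+x. f (x, y) \<partial>lborel) \<partial>lborel)"
    by (subst lborel_pair.nn_integral_snd) (auto simp: case_prod_unfold)
  also have "\<dots> = (\<integral>\<^sup>+y. (\<integral>\<^sup>+h. f (h + y, y) \<partial>lborel) \<partial>lborel)"
    by (intro nn_integral_cong nn_integral_lborel_shift[symmetric]) measurable
  also have "\<dots> = (\<integral>\<^sup>+h. (\<integral>\<^sup>+y. f (y + h, y) \<partial>lborel) \<partial>lborel)"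
    by (subst lborel_pair.Fubini') (auto simp: add.commute case_prod_unfold)
  finally show ?thesis .
qed

text \<open>The p-th power of the L^p modulus of continuity. It carries all of the dependence on u
  in the fractional energies and is free of s.\<close>

definition modulus :: "real \<Rightarrow> ('a::euclidean_space \<Rightarrow> real) \<Rightarrow> 'a \<Rightarrow> ennreal" where
  "modulus p u h = (\<integral>\<^sup>+x. ennreal (\<bar>u (x + h) - u x\<bar> powr p) \<partial>lborel)"

definition Lp_nn :: "real \<Rightarrow> ('a::euclidean_space \<Rightarrow> real) \<Rightarrow> ennreal" where
  "Lp_nn p u = (\<integral>\<^sup>+x. ennreal (\<bar>u x\<bar> powr p) \<partial>lborel)"

text \<open>The Gagliardo double integral without c_{N,s,p}, taken over \<open>lborel\<close> rather
  than its completion so that Tonelli and translation invariance apply directly to Borel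
  functions.\<close>

definition frac_energy :: "real \<Rightarrow> real \<Rightarrow> ('a::euclidean_space \<Rightarrow> real) \<Rightarrow> ennreal" where
  "frac_energy s p u = (\<integral>\<^sup>+z. ennreal (\<bar>u (fst z) - u (snd z)\<bar> powr p /
                  norm (fst z - snd z) powr (real DIM('a) + s * p)) \<partial>lborel)"

lemma modulus_measurable[measurable]:
  assumes [measurable]: "u \<in> borel_measurable borel"
  shows "modulus p u \<in> borel_measurable borel"
  unfolding modulus_def by measurable

text \<open>The substitution x = y + h separates u from s: different orders see the same modulus and
  differ only in the weight |h|^(-N-sp).\<close>

lemma frac_energy_eq_modulus:
  fixes u :: "'a::euclidean_space \<Rightarrow> real"
  assumes [measurable]: "u \<in> borel_measurable borel"
  shows "frac_energy s p u = (\<integral>\<^sup>+h. modulus p u h * ennreal (norm h powr - (real DIM('a) + s * p)) \<partial>lborel)"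
proof -
  have "frac_energy s p u = (\<integral>\<^sup>+h. (\<integral>\<^sup>+y. ennreal (\<bar>u (y + h) - u y\<bar> powr p) *
      ennreal (norm h powr - (real DIM('a) + s * p)) \<partial>lborel) \<partial>lborel)"
    unfolding frac_energy_def
    by (subst nn_integral_lborel_prod_shift)
      (auto simp: powr_minus divide_inverse ennreal_mult' simp del: minus_add_distrib simp flip: borel_prod)
  also have "\<dots> = (\<integral>\<^sup>+h. modulus p u h * ennreal (norm h powr - (real DIM('a) + s * p)) \<partial>lborel)"
    unfolding modulus_def by (intro nn_integral_cong nn_integral_multc) measurable
  finally show ?thesis .
qed

text \<open>Insert u (x + h) and use convexity of r^p; by translation invariance both halves have
  the same integral. The constant is exactly 2^p, so that 2^(jp) times the modulus at 2^(-j) h is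
  nondecreasing in j.\<close>

lemma modulus_double_le:
  fixes u :: "'a::euclidean_space \<Rightarrow> real"
  assumes [measurable]: "u \<in> borel_measurable borel" and p: "1 < p"
  shows "modulus p u (2 *\<^sub>R h) \<le> ennreal (2 powr p) * modulus p u h"
proof -
  have pt: "\<bar>a + b\<bar> powr p \<le> 2 powr p * (\<bar>a\<bar> powr p / 2 + \<bar>b\<bar> powr p / 2)" for a b :: real
    using norm_powr_midpoint_le[OF p, of a b] by (simp add: powr_divide field_simps)
  have "modulus p u (2 *\<^sub>R h) \<le> (\<integral>\<^sup>+x. ennreal (2 powr p) * (ennreal (\<bar>u (x + h + h) - u (x + h)\<bar> powr p / 2)
      + ennreal (\<bar>u (x + h) - u x\<bar> powr p / 2)) \<partial>lborel)"
    unfolding modulus_def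
  proof (intro nn_integral_mono)
    fix x
    have eq: "x + 2 *\<^sub>R h = x + h + h" by (simp add: scaleR_2)
    have "\<bar>u (x + h + h) - u x\<bar> powr p \<le> 2 powr p * (\<bar>u (x + h + h) - u (x + h)\<bar> powr p / 2 + \<bar>u (x + h) - u x\<bar> powr p / 2)"
      using pt[of "u (x + h + h) - u (x + h)" "u (x + h) - u x"] by simp
    then show "ennreal (\<bar>u (x + 2 *\<^sub>R h) - u x\<bar> powr p) \<le> ennreal (2 powr p) * (ennreal (\<bar>u (x + h + h) - u (x + h)\<bar> powr p / 2)
      + ennreal (\<bar>u (x + h) - u x\<bar> powr p / 2))"
      unfolding eq by (simp add: ennreal_leI flip: ennreal_plus ennreal_mult')
  qed
  also have "\<dots> = ennreal (2 powr p) * ((\<integral>\<^sup>+x. ennreal (\<bar>u (x + h + h) - u (x + h)\<bar> powr p / 2) \<partial>lborel)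
      + (\<integral>\<^sup>+x. ennreal (\<bar>u (x + h) - u x\<bar> powr p / 2) \<partial>lborel))"
    by (simp add: nn_integral_cmult nn_integral_add)
  also have "(\<integral>\<^sup>+x. ennreal (\<bar>u (x + h + h) - u (x + h)\<bar> powr p / 2) \<partial>lborel) = (\<integral>\<^sup>+x. ennreal (\<bar>u (x + h) - u x\<bar> powr p / 2) \<partial>lborel)"
    using nn_integral_lborel_shift[of "\<lambda>x. ennreal (\<bar>u (x + h) - u x\<bar> powr p / 2)" h] by simp
  also have "(\<integral>\<^sup>+x. ennreal (\<bar>u (x + h) - u x\<bar> powr p / 2) \<partial>lborel) + (\<integral>\<^sup>+x. ennreal (\<bar>u (x + h) - u x\<bar> powr p / 2) \<partial>lborel)
     = modulus p u h"
    unfolding modulus_def by (subst nn_integral_add[symmetric]) (auto simp flip: ennreal_plus)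
  finally show ?thesis .
qed

lemma modulus_le_Lp:
  fixes u :: "'a::euclidean_space \<Rightarrow> real"
  assumes [measurable]: "u \<in> borel_measurable borel" and p: "0 < p"
  shows "modulus p u h \<le> ennreal (2 * 2 powr p) * Lp_nn p u"
proof -
  have "modulus p u h \<le> (\<integral>\<^sup>+x. ennreal (2 powr p) * (ennreal (\<bar>u (x + h)\<bar> powr p) + ennreal (\<bar>u x\<bar> powr p)) \<partial>lborel)"
    unfolding modulus_def
    using norm_diff_powr_le[OF p, where 'e = real]
    by (intro nn_integral_mono) (auto simp: ennreal_leI simp flip: ennreal_plus ennreal_mult')
  also have "\<dots> = ennreal (2 powr p) * ((\<integral>\<^sup>+x. ennreal (\<bar>u (x + h)\<bar> powr p) \<partial>lborel) + Lp_nn p u)"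
    unfolding Lp_nn_def by (simp add: nn_integral_cmult nn_integral_add)
  also have "(\<integral>\<^sup>+x. ennreal (\<bar>u (x + h)\<bar> powr p) \<partial>lborel) = Lp_nn p u"
    unfolding Lp_nn_def using nn_integral_lborel_shift[of "\<lambda>x. ennreal (\<bar>u x\<bar> powr p)" h] by simp
  also have "Lp_nn p u + Lp_nn p u = 2 * Lp_nn p u" by (simp add: mult_2)
  finally show ?thesis by (simp add: ennreal_mult' mult_ac)
qed

text \<open>For such h the values u (x + h) and u x are never both nonzero, so the p-th powers add
  up. This is how an L^p norm is read off from differences.\<close>

lemma modulus_far:
  fixes u :: "'a::euclidean_space \<Rightarrow> real"
  assumes [measurable]: "u \<in> borel_measurable borel" and p: "0 < p"
    and supp: "\<And>x. R \<le> norm x \<Longrightarrow> u x = 0" and h: "2 * R \<le> norm h"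
  shows "modulus p u h = 2 * Lp_nn p u"
proof -
  have pt: "\<bar>u (x + h) - u x\<bar> powr p = \<bar>u (x + h)\<bar> powr p + \<bar>u x\<bar> powr p" for x
  proof (cases "R \<le> norm x")
    case True
    then show ?thesis using supp p by simp
  next
    case False
    have "norm h \<le> norm (x + h) + norm x" using norm_triangle_ineq4[of "x + h" x] by simp
    then have "R \<le> norm (x + h)" using False h by linarith
    then show ?thesis using supp p by simp
  qed
  have "modulus p u h = (\<integral>\<^sup>+x. ennreal (\<bar>u (x + h)\<bar> powr p) \<partial>lborel) + Lp_nn p u"
    unfolding modulus_def Lp_nn_def pt by (subst nn_integral_add[symmetric]) auto
  also have "(\<integral>\<^sup>+x. ennreal (\<bar>u (x + h)\<bar> powr p) \<partial>lborel) = Lp_nn p u"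
    unfolding Lp_nn_def using nn_integral_lborel_shift[of "\<lambda>x. ennreal (\<bar>u x\<bar> powr p)" h] by simp
  finally show ?thesis by (simp add: mult_2)
qed

section \<open>Dyadic decomposition of integrals over displacements\<close>

definition annulus :: "real \<Rightarrow> 'a::real_normed_vector set" where
  "annulus R = {h. R \<le> norm h \<and> norm h < 2 * R}"

lemma annulus_measurable[measurable]: "annulus R \<in> sets borel"
  unfolding annulus_def by measurable

lemma nn_integral_annulus_scale:
  fixes f :: "'a::euclidean_space \<Rightarrow> ennreal"
  assumes [measurable]: "f \<in> borel_measurable borel" and c: "0 < c"
  shows "(\<integral>\<^sup>+x. f x * indicator (annulus (c * R)) x \<partial>lborel) =
    (\<integral>\<^sup>+x. ennreal (c ^ DIM('a)) * f (c *\<^sub>R x) * indicator (annulus R) x \<partial>lborel)"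
proof -
  have "indicator (annulus (c * R)) (c *\<^sub>R x) = (indicator (annulus R) x :: ennreal)" for x :: 'a
    using c by (auto simp: annulus_def indicator_def abs_of_pos)
  then have "(\<integral>\<^sup>+x. f x * indicator (annulus (c * R)) x \<partial>lborel) =
     ennreal (c ^ DIM('a)) * (\<integral>\<^sup>+x. f (c *\<^sub>R x) * indicator (annulus R) x \<partial>lborel)"
    by (subst nn_integral_lborel_scale[OF _ c]) auto
  then show ?thesis by (subst (asm) nn_integral_cmult[symmetric]) (auto simp: mult_ac)
qed

text \<open>The dilated annuli are disjoint because they are half-open with ratio 2 between the
  radii; the alternative in \<open>disj\<close> admits both 2^j and 2^(-j) as factors. Scaling each
  dilate back puts all contributions under one integral over a single annulus.\<close>

lemma dyadic_lower:
  fixes f :: "'a::euclidean_space \<Rightarrow> ennreal"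
  assumes [measurable]: "f \<in> borel_measurable borel" and c: "\<And>j::nat. 0 < c j"
    and disj: "\<And>i j. i < j \<Longrightarrow> 2 * c i \<le> c j \<or> 2 * c j \<le> c i" and R: "0 < R"
  shows "(\<integral>\<^sup>+x. (\<Sum>j. ennreal (c j ^ DIM('a)) * f (c j *\<^sub>R x)) * indicator (annulus R) x \<partial>lborel) \<le> (\<integral>\<^sup>+x. f x \<partial>lborel)"
proof -
  have dj: "annulus (c i * R) \<inter> (annulus (c j * R) :: 'a set) = {}" if "i < j" for i j
  proof -
    have "2 * (c i * R) \<le> c j * R \<or> 2 * (c j * R) \<le> c i * R"
      using disj[OF that] mult_right_mono[of "2 * c i" "c j" R] mult_right_mono[of "2 * c j" "c i" R] R by auto
    then show ?thesis by (auto simp: annulus_def)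
  qed
  then have "disjoint_family (\<lambda>j. annulus (c j * R) :: 'a set)"
    unfolding disjoint_family_on_def by (metis inf_commute linorder_neq_iff)
  then have le: "(\<Sum>j. f x * indicator (annulus (c j * R)) x) \<le> f x" for x :: 'a
  proof -
    have "(\<Sum>j. f x * indicator (annulus (c j * R)) x) = f x * indicator (\<Union>j. annulus (c j * R)) x"
      unfolding ennreal_suminf_cmult using suminf_indicator[OF \<open>disjoint_family _\<close>] by simp
    also have "\<dots> \<le> f x" by (simp split: split_indicator)
    finally show ?thesis .
  qed
  have "(\<integral>\<^sup>+x. (\<Sum>j. ennreal (c j ^ DIM('a)) * f (c j *\<^sub>R x)) * indicator (annulus R) x \<partial>lborel) =
      (\<Sum>j. \<integral>\<^sup>+x. ennreal (c j ^ DIM('a)) * f (c j *\<^sub>R x) * indicator (annulus R) x \<partial>lborel)"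
    by (subst nn_integral_suminf[symmetric]) auto
  also have "\<dots> = (\<Sum>j. \<integral>\<^sup>+x. f x * indicator (annulus (c j * R)) x \<partial>lborel)"
    using c by (simp add: nn_integral_annulus_scale)
  also have "\<dots> = (\<integral>\<^sup>+x. (\<Sum>j. f x * indicator (annulus (c j * R)) x) \<partial>lborel)"
    by (rule nn_integral_suminf[symmetric]) measurable
  also have "\<dots> \<le> (\<integral>\<^sup>+x. f x \<partial>lborel)" by (intro nn_integral_mono le)
  finally show ?thesis .
qed

lemma dyadic_scale_exists:
  fixes t :: real
  assumes t: "0 < t"
  obtains k :: nat where "2 ^ k \<le> t" "t < 2 * 2 ^ k" | k :: nat where "(1/2) ^ k \<le> t" "t < 2 * (1/2) ^ k"
proof (cases "1 \<le> t")
  case True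
  define n where "n = (LEAST n. t < 2 ^ n)"
  have n: "t < 2 ^ n" unfolding n_def using real_arch_pow[of 2 t] by (auto intro: LeastI_ex)
  then have "n \<noteq> 0" using True by (intro notI) simp
  then obtain k where k: "n = Suc k" using not0_implies_Suc by blast
  have "\<not> t < 2 ^ k" using not_less_Least[of k "\<lambda>n. t < 2 ^ n"] k by (simp add: n_def)
  then show ?thesis using that(1)[of k] n k by simp
next
  case False
  define n where "n = (LEAST n. (1/2) ^ n \<le> t)"
  obtain n0 where "(1/2) ^ n0 < t" using real_arch_pow_inv[of t "1/2"] t by auto
  then have n: "(1/2) ^ n \<le> t" unfolding n_def by (intro LeastI[of "\<lambda>n. (1/2) ^ n \<le> t" n0]) simp
  then have "n \<noteq> 0" using False by (intro notI) simp
  then obtain k where k: "n = Suc k" using not0_implies_Suc by blast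
  have "\<not> (1/2) ^ k \<le> t" using not_less_Least[of k "\<lambda>n. (1/2) ^ n \<le> t"] k by (simp add: n_def)
  then show ?thesis using that(2)[of n] n k by simp
qed

text \<open>The dilates cover everything except the origin, a null set. Both families contain j = 0,
  so the base annulus is counted twice, which an upper bound can afford.\<close>

lemma dyadic_upper:
  fixes f :: "'a::euclidean_space \<Rightarrow> ennreal"
  assumes [measurable]: "f \<in> borel_measurable borel" and R: "0 < R"
  shows "(\<integral>\<^sup>+x. f x \<partial>lborel) \<le>
    (\<integral>\<^sup>+x. ((\<Sum>j. ennreal (((1/2) ^ j) ^ DIM('a)) * f ((1/2) ^ j *\<^sub>R x)) +
          (\<Sum>j. ennreal ((2 ^ j) ^ DIM('a)) * f (2 ^ j *\<^sub>R x))) * indicator (annulus R) x \<partial>lborel)"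
proof -
  have *: "(\<integral>\<^sup>+x. (\<Sum>j. ennreal (c j ^ DIM('a)) * f (c j *\<^sub>R x)) * indicator (annulus R) x \<partial>lborel) =
      (\<integral>\<^sup>+x. (\<Sum>j. f x * indicator (annulus (c j * R)) x) \<partial>lborel)" if c: "\<And>j::nat. 0 < c j" for c
  proof -
    have "(\<integral>\<^sup>+x. (\<Sum>j. ennreal (c j ^ DIM('a)) * f (c j *\<^sub>R x)) * indicator (annulus R) x \<partial>lborel) =
        (\<Sum>j. \<integral>\<^sup>+x. ennreal (c j ^ DIM('a)) * f (c j *\<^sub>R x) * indicator (annulus R) x \<partial>lborel)"
      by (subst nn_integral_suminf[symmetric]) auto
    also have "\<dots> = (\<Sum>j. \<integral>\<^sup>+x. f x * indicator (annulus (c j * R)) x \<partial>lborel)"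
      using c by (simp add: nn_integral_annulus_scale)
    also have "\<dots> = (\<integral>\<^sup>+x. (\<Sum>j. f x * indicator (annulus (c j * R)) x) \<partial>lborel)"
      by (rule nn_integral_suminf[symmetric]) measurable
    finally show ?thesis .
  qed
  let ?g = "\<lambda>x. (\<Sum>j. f x * indicator (annulus ((1/2) ^ j * R)) x) + (\<Sum>j. f x * indicator (annulus (2 ^ j * R)) x)"
  have le: "f x \<le> ?g x" if "x \<noteq> 0" for x
  proof -
    have "0 < norm x / R" using that R by simp
    then show ?thesis
    proof (cases rule: dyadic_scale_exists)
      case (1 k)
      then have "x \<in> annulus (2 ^ k * R)" using R by (simp add: annulus_def field_simps)
      then have "f x \<le> f x * indicator (annulus (2 ^ k * R)) x" by simp
      also have "\<dots> \<le> (\<Sum>j. f x * indicator (annulus (2 ^ j * R)) x)" by (rule ennreal_le_suminf)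
      finally show ?thesis by (simp add: add_increasing)
    next
      case (2 k)
      then have "x \<in> annulus ((1/2) ^ k * R)" using R by (simp add: annulus_def field_simps)
      then have "f x \<le> f x * indicator (annulus ((1/2) ^ k * R)) x" by simp
      also have "\<dots> \<le> (\<Sum>j. f x * indicator (annulus ((1/2) ^ j * R)) x)"
        by (rule ennreal_le_suminf[of "\<lambda>j. f x * indicator (annulus ((1/2) ^ j * R)) x"])
      finally show ?thesis by (simp add: add_increasing2)
    qed
  qed
  have "(\<integral>\<^sup>+x. f x \<partial>lborel) \<le> (\<integral>\<^sup>+x. ?g x \<partial>lborel)"
  proof (rule nn_integral_mono_AE)
    have "AE x in lborel. x \<noteq> (0::'a)" by (rule AE_lborel_singleton)
    then show "AE x in lborel. f x \<le> ?g x" using le by (auto elim!: eventually_mono)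
  qed
  also have "\<dots> = (\<integral>\<^sup>+x. (\<Sum>j. f x * indicator (annulus ((1/2) ^ j * R)) x) \<partial>lborel) +
      (\<integral>\<^sup>+x. (\<Sum>j. f x * indicator (annulus (2 ^ j * R)) x) \<partial>lborel)"
    by (intro nn_integral_add) measurable
  also have "\<dots> = (\<integral>\<^sup>+x. ((\<Sum>j. ennreal (((1/2) ^ j) ^ DIM('a)) * f ((1/2) ^ j *\<^sub>R x)) +
          (\<Sum>j. ennreal ((2 ^ j) ^ DIM('a)) * f (2 ^ j *\<^sub>R x))) * indicator (annulus R) x \<partial>lborel)"
    using *[of "\<lambda>j. (1/2) ^ j"] *[of "\<lambda>j. 2 ^ j"] unfolding distrib_right
    by (subst nn_integral_add) auto
  finally show ?thesis .
qed

text \<open>Summation by parts: the normalized sum is the \<open>q\<close>-weighted sum of the increments of \<open>b\<close>.\<close>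

lemma weighted_sum_mono:
  fixes b :: "nat \<Rightarrow> ennreal"
  assumes b: "\<And>j. b j \<le> b (Suc j)" and q: "0 \<le> q1" "q1 \<le> q2" "q2 < 1"
  shows "ennreal (1 - q1) * (\<Sum>j. ennreal (q1 ^ j) * b j) \<le> ennreal (1 - q2) * (\<Sum>j. ennreal (q2 ^ j) * b j)"
proof -
  \<comment> \<open>Increments, with d 0 = b 0. Monotonicity ensures that summing them recovers b,
    infinite values included.\<close>
  define d where "d i = (case i of 0 \<Rightarrow> b 0 | Suc k \<Rightarrow> b (Suc k) - b k)" for i
  have bd: "b j = (\<Sum>i\<le>j. d i)" for j
  proof (induction j)
    case (Suc j)
    have "b (Suc j) = b j + (b (Suc j) - b j)" using b[of j] by (simp add: add_diff_inverse_ennreal)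
    then show ?case using Suc by (simp add: d_def)
  qed (simp add: d_def)
  have eq: "ennreal (1 - q) * (\<Sum>j. ennreal (q ^ j) * b j) = (\<Sum>i. ennreal (q ^ i) * d i)" if q: "0 \<le> q" "q < 1" for q
  proof -
    define f where "f i j = (if i \<le> j then ennreal (q ^ j) * d i else 0)" for i j
    have "(\<Sum>j. ennreal (q ^ j) * b j) = (\<Sum>j. \<Sum>i. f i j)"
    proof (intro suminf_cong)
      fix j
      have "(\<Sum>i. f i j) = (\<Sum>i\<in>{..j}. f i j)" by (intro suminf_finite) (auto simp: f_def)
      also have "\<dots> = ennreal (q ^ j) * b j" unfolding bd sum_distrib_left by (intro sum.cong) (auto simp: f_def)
      finally show "ennreal (q ^ j) * b j = (\<Sum>i. f i j)" ..
    qed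
    \<comment> \<open>Tonelli for double series: one of the two sums is read as an integral over the
      counting measure.\<close>
    also have "\<dots> = (\<integral>\<^sup>+j. (\<Sum>i. f i j) \<partial>count_space UNIV)" by (simp add: nn_integral_count_space_nat)
    also have "\<dots> = (\<Sum>i. \<integral>\<^sup>+j. f i j \<partial>count_space UNIV)" by (intro nn_integral_suminf) auto
    also have "\<dots> = (\<Sum>i. \<Sum>j. f i j)" by (simp add: nn_integral_count_space_nat)
    also have "\<dots> = (\<Sum>i. ennreal (1 / (1 - q)) * (ennreal (q ^ i) * d i))"
    proof (intro suminf_cong)
      fix i
      have "(\<lambda>j. q ^ j) sums (1 / (1 - q))" using q by (intro geometric_sums) auto
      then have "(\<lambda>j. q ^ i * q ^ j) sums (q ^ i * (1 / (1 - q)))" by (rule sums_mult)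
      then have "(\<lambda>j. if i \<le> j + i then q ^ (j + i) else 0) sums (q ^ i * (1 / (1 - q)))"
        by (simp add: power_add mult.commute)
      then have "(\<lambda>j. if i \<le> j then q ^ j else 0) sums (q ^ i * (1 / (1 - q)))"
        by (subst (asm) sums_iff_shift) simp
      then have "(\<Sum>j. ennreal (if i \<le> j then q ^ j else 0)) = ennreal (q ^ i * (1 / (1 - q)))"
        using q by (intro suminf_ennreal_eq) auto
      then have "(\<Sum>j. ennreal (if i \<le> j then q ^ j else 0)) * d i = ennreal (1 / (1 - q)) * (ennreal (q ^ i) * d i)"
        using q ennreal_mult[of "q ^ i" "1 / (1 - q)"] by (simp add: mult_ac)
      moreover have "(\<Sum>j. f i j) = (\<Sum>j. ennreal (if i \<le> j then q ^ j else 0) * d i)"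
        by (intro suminf_cong) (auto simp: f_def)
      ultimately show "(\<Sum>j. f i j) = ennreal (1 / (1 - q)) * (ennreal (q ^ i) * d i)" by simp
    qed
    also have "\<dots> = ennreal (1 / (1 - q)) * (\<Sum>i. ennreal (q ^ i) * d i)" by (rule ennreal_suminf_cmult)
    finally have "ennreal (1 - q) * (\<Sum>j. ennreal (q ^ j) * b j) =
        (ennreal (1 - q) * ennreal (1 / (1 - q))) * (\<Sum>i. ennreal (q ^ i) * d i)" by (simp add: mult_ac)
    also have "ennreal (1 - q) * ennreal (1 / (1 - q)) = 1" using q by (simp flip: ennreal_mult')
    finally show ?thesis by simp
  qed
  have "(\<Sum>i. ennreal (q1 ^ i) * d i) \<le> (\<Sum>i. ennreal (q2 ^ i) * d i)"
    using q by (intro suminf_le summableI mult_right_mono ennreal_leI power_mono) auto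
  then show ?thesis using eq[of q1] eq[of q2] q by simp
qed

lemma ennreal_geometric:
  assumes "0 \<le> q" "q < 1"
  shows "ennreal (1 - q) * (\<Sum>j. ennreal (q ^ j) * B) = B"
proof -
  have "(\<Sum>j. ennreal (q ^ j)) = ennreal (1 / (1 - q))"
    using assms by (intro suminf_ennreal_eq geometric_sums) auto
  then show ?thesis using assms by (simp add: mult.assoc[symmetric] flip: ennreal_mult')
qed

text \<open>The numbers (1 - q) q^j are the weights of a probability distribution, so the normalized
  sum is an average of values that are all at least b 0.\<close>

lemma weighted_sum_ge:
  fixes b :: "nat \<Rightarrow> ennreal"
  assumes b: "\<And>j. b j \<le> b (Suc j)" and q: "0 \<le> q" "q < 1"
  shows "b 0 \<le> ennreal (1 - q) * (\<Sum>j. ennreal (q ^ j) * b j)"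
proof -
  have "b 0 \<le> b j" for j using b by (intro lift_Suc_mono_le[of b 0 j]) auto
  then have "(\<Sum>j. ennreal (q ^ j) * b 0) \<le> (\<Sum>j. ennreal (q ^ j) * b j)"
    by (intro suminf_le summableI mult_left_mono) auto
  then have "ennreal (1 - q) * (\<Sum>j. ennreal (q ^ j) * b 0) \<le> ennreal (1 - q) * (\<Sum>j. ennreal (q ^ j) * b j)"
    by (rule mult_left_mono) simp
  then show ?thesis unfolding ennreal_geometric[OF q] .
qed

lemma weighted_sum_le:
  fixes b :: "nat \<Rightarrow> ennreal"
  assumes b: "\<And>j. b j \<le> B" and q: "0 \<le> q" "q < 1"
  shows "ennreal (1 - q) * (\<Sum>j. ennreal (q ^ j) * b j) \<le> B"
proof -
  have "(\<Sum>j. ennreal (q ^ j) * b j) \<le> (\<Sum>j. ennreal (q ^ j) * B)"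
    using b by (intro suminf_le summableI mult_left_mono) auto
  then have "ennreal (1 - q) * (\<Sum>j. ennreal (q ^ j) * b j) \<le> ennreal (1 - q) * (\<Sum>j. ennreal (q ^ j) * B)"
    by (rule mult_left_mono) simp
  then show ?thesis unfolding ennreal_geometric[OF q] .
qed

text \<open>With x = p (1 - s) and x = s p this converts the normalizations of the dyadic sums into
  the factors 1 - s and s, with constants that depend on n only.\<close>

lemma two_powr_minus_bounds:
  fixes x n :: real
  assumes "0 \<le> x" "x \<le> n" "1 \<le> n"
  shows "1 - 2 powr (- x) \<le> x" "x \<le> 2 * n * (1 - 2 powr (- x))"
proof -
  have "1 + - x * ln 2 \<le> exp (- x * ln 2)" by (rule exp_ge_add_one_self)
  also have "\<dots> = 2 powr (- x)" by (simp add: powr_def)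
  finally have "1 - 2 powr (- x) \<le> x * ln 2" by simp
  also have "\<dots> \<le> x" using assms ln2_le_25_over_36 by (intro mult_left_le) auto
  finally show "1 - 2 powr (- x) \<le> x" .
  show "x \<le> 2 * n * (1 - 2 powr (- x))"
  proof (cases "x < 1")
    case True
    have "x \<le> 2 * (1 - 2 powr (- x))"
    proof (cases "x = 0")
      case False
      then have x: "0 < x" using assms by simp
      \<comment> \<open>The tangent inequality for the exponent 1 / x > 1 at the point 1; it reads 1
        + (2^(-x) - 1) / x \<le> 1 / 2.\<close>
      have "1 powr (1 / x) + (1 / x) * 1 powr (1 / x - 1) * (2 powr (- x) - 1) \<le> (2 powr (- x)) powr (1 / x)"
        using x True by (intro powr_tangent_le) auto
      also have "\<dots> = 1 / 2" unfolding powr_powr using x by (simp add: powr_minus)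
      finally show ?thesis using x by (simp add: field_simps)
    qed simp
    also have "\<dots> \<le> n * (2 * (1 - 2 powr (- x)))"
    proof -
      have "2 powr (- x) \<le> 2 powr 0" using assms by (intro powr_mono) auto
      then show ?thesis using assms mult_right_mono[of 1 n "2 * (1 - 2 powr (- x))"] by simp
    qed
    finally show ?thesis by (simp add: mult_ac)
  next
    case False
    then have "2 powr (- x) \<le> 2 powr (- 1 :: real)" by (intro powr_mono) auto
    then have "1 / 2 \<le> 1 - 2 powr (- x)" by (simp add: powr_minus)
    then have "2 * n * (1 / 2) \<le> 2 * n * (1 - 2 powr (- x))" using assms by (intro mult_left_mono) auto
    moreover have "2 * n * (1 / 2) = n" by simp
    ultimately show ?thesis using assms by linarith
  qed
qed

section \<open>The fractional energy as an integral of dyadic sums over one annulus\<close>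

definition frac_weight :: "real \<Rightarrow> real \<Rightarrow> 'a::euclidean_space \<Rightarrow> ennreal" where
  "frac_weight s p h = ennreal (norm h powr - (real DIM('a) + s * p))"

text \<open>The scaling factor 2^(jsp) of the displacement 2^(-j) h is split into 2^(-jp(1-s)) and
  2^(jp): the first is a geometric weight, the second makes the moduli nondecreasing in j. In
  \<open>far_sum\<close> the scaling factor 2^(-jsp) is itself the weight.\<close>

definition near_sum :: "real \<Rightarrow> real \<Rightarrow> ('a::euclidean_space \<Rightarrow> real) \<Rightarrow> 'a \<Rightarrow> ennreal" where
  "near_sum s p u h = (\<Sum>j. ennreal ((2 powr (- (p * (1 - s)))) ^ j) *
     (ennreal ((2 powr p) ^ j) * modulus p u ((1/2) ^ j *\<^sub>R h)))"

definition far_sum :: "real \<Rightarrow> real \<Rightarrow> ('a::euclidean_space \<Rightarrow> real) \<Rightarrow> 'a \<Rightarrow> ennreal" where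
  "far_sum s p u h = (\<Sum>j. ennreal ((2 powr (- (s * p))) ^ j) * modulus p u (2 ^ j *\<^sub>R h))"

lemma frac_weight_measurable[measurable]: "frac_weight s p \<in> borel_measurable borel"
  unfolding frac_weight_def by measurable

lemma near_far_sum_measurable[measurable]:
  assumes [measurable]: "u \<in> borel_measurable borel"
  shows "near_sum s p u \<in> borel_measurable borel" "far_sum s p u \<in> borel_measurable borel"
  unfolding near_sum_def far_sum_def by measurable

lemma frac_weight_scale:
  fixes h :: "'a::euclidean_space"
  assumes c: "0 < c"
  shows "ennreal (c ^ DIM('a)) * frac_weight s p (c *\<^sub>R h) = ennreal (c powr (- (s * p))) * frac_weight s p h"
proof -
  have "c ^ DIM('a) * (c * norm h) powr - (real DIM('a) + s * p) =
      (c powr real DIM('a) * c powr - (real DIM('a) + s * p)) * norm h powr - (real DIM('a) + s * p)"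
    using c by (simp add: powr_mult powr_realpow del: minus_add_distrib)
  also have "c powr real DIM('a) * c powr - (real DIM('a) + s * p) = c powr (- (s * p))"
    by (simp flip: powr_add)
  finally show ?thesis
    using c unfolding frac_weight_def by (simp del: minus_add_distrib flip: ennreal_mult')
qed

lemma two_powr_power: "((2::real) ^ j) powr a = (2 powr a) ^ j" "((1/2::real) ^ j) powr a = (2 powr (- a)) ^ j"
  by (induction j) (simp_all add: powr_mult powr_divide powr_minus_divide)

lemma dyadic_frac_terms:
  fixes u :: "'a::euclidean_space \<Rightarrow> real"
  shows "(\<Sum>j. ennreal (((1/2) ^ j) ^ DIM('a)) * (modulus p u ((1/2) ^ j *\<^sub>R h) * frac_weight s p ((1/2) ^ j *\<^sub>R h)))
      = near_sum s p u h * frac_weight s p h" (is ?near)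
    and "(\<Sum>j. ennreal ((2 ^ j) ^ DIM('a)) * (modulus p u (2 ^ j *\<^sub>R h) * frac_weight s p (2 ^ j *\<^sub>R h)))
      = far_sum s p u h * frac_weight s p h" (is ?far)
proof -
  have sc: "ennreal (c ^ DIM('a)) * (m * frac_weight s p (c *\<^sub>R h)) = ennreal (c powr (- (s * p))) * m * frac_weight s p h"
    if "0 < c" for c m
    using frac_weight_scale[OF that, of s p h] by (metis mult.assoc mult.left_commute)
  have n: "ennreal (((1/2) ^ j) powr (- (s * p))) = ennreal ((2 powr (- (p * (1 - s)))) ^ j) * ennreal ((2 powr p) ^ j)" for j :: nat
  proof -
    have "(2::real) powr (s * p) = 2 powr (- (p * (1 - s))) * 2 powr p"
      by (simp add: algebra_simps flip: powr_add)
    then show ?thesis unfolding two_powr_power by (simp add: power_mult_distrib flip: ennreal_mult')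
  qed
  show ?near unfolding near_sum_def
    by (subst ennreal_suminf_multc[symmetric]) (simp add: sc n mult.assoc)
  show ?far unfolding far_sum_def
    by (subst ennreal_suminf_multc[symmetric]) (simp add: sc two_powr_power)
qed

lemma frac_energy_upper:
  fixes u :: "'a::euclidean_space \<Rightarrow> real"
  assumes [measurable]: "u \<in> borel_measurable borel" and R: "0 < R"
  shows "frac_energy s p u \<le> (\<integral>\<^sup>+h. (near_sum s p u h + far_sum s p u h) * frac_weight s p h * indicator (annulus R) h \<partial>lborel)"
proof -
  have "frac_energy s p u = (\<integral>\<^sup>+h. modulus p u h * frac_weight s p h \<partial>lborel)"
    by (simp only: frac_energy_eq_modulus[OF assms(1)] frac_weight_def)
  also have "\<dots> \<le> (\<integral>\<^sup>+h. (near_sum s p u h * frac_weight s p h + far_sum s p u h * frac_weight s p h) * indicator (annulus R) h \<partial>lborel)"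
    unfolding dyadic_frac_terms[symmetric] by (rule dyadic_upper[OF _ R]) measurable
  finally show ?thesis by (simp add: distrib_right)
qed

lemma frac_energy_lower:
  fixes u :: "'a::euclidean_space \<Rightarrow> real"
  assumes [measurable]: "u \<in> borel_measurable borel" and R: "0 < R"
  shows "(\<integral>\<^sup>+h. near_sum s p u h * frac_weight s p h * indicator (annulus R) h \<partial>lborel) \<le> frac_energy s p u" (is ?near)
    and "(\<integral>\<^sup>+h. far_sum s p u h * frac_weight s p h * indicator (annulus R) h \<partial>lborel) \<le> frac_energy s p u" (is ?far)
proof -
  have eq: "frac_energy s p u = (\<integral>\<^sup>+h. modulus p u h * frac_weight s p h \<partial>lborel)"
    by (simp only: frac_energy_eq_modulus[OF assms(1)] frac_weight_def)
  have 1: "2 * (1 / 2) ^ j \<le> (1 / 2 :: real) ^ i" if "i < j" for i j :: nat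
    using power_decreasing[of "Suc i" j "1/2 :: real"] that by simp
  have 2: "2 * 2 ^ i \<le> (2 :: real) ^ j" if "i < j" for i j :: nat
    using power_increasing[of "Suc i" j "2 :: real"] that by simp
  show ?near unfolding eq dyadic_frac_terms[symmetric]
    by (rule dyadic_lower[OF _ _ _ R]) (auto intro: 1)
  show ?far unfolding eq dyadic_frac_terms[symmetric]
    by (rule dyadic_lower[OF _ _ _ R]) (auto intro: 2)
qed

lemma near_terms_mono:
  fixes u :: "'a::euclidean_space \<Rightarrow> real"
  assumes u: "u \<in> borel_measurable borel" and p: "1 < p"
  shows "ennreal ((2 powr p) ^ j) * modulus p u ((1/2) ^ j *\<^sub>R h) \<le>
    ennreal ((2 powr p) ^ Suc j) * modulus p u ((1/2) ^ Suc j *\<^sub>R h)"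
proof -
  have "modulus p u ((1/2) ^ j *\<^sub>R h) \<le> ennreal (2 powr p) * modulus p u ((1/2) ^ Suc j *\<^sub>R h)"
    using modulus_double_le[OF u p, of "(1/2) ^ Suc j *\<^sub>R h"] by simp
  then have "ennreal ((2 powr p) ^ j) * modulus p u ((1/2) ^ j *\<^sub>R h) \<le>
      ennreal ((2 powr p) ^ j) * (ennreal (2 powr p) * modulus p u ((1/2) ^ Suc j *\<^sub>R h))"
    by (rule mult_left_mono) simp
  also have "\<dots> = ennreal ((2 powr p) ^ Suc j) * modulus p u ((1/2) ^ Suc j *\<^sub>R h)"
    by (simp add: ennreal_mult' mult_ac)
  finally show ?thesis .
qed

lemma near_sum_ge:
  assumes "u \<in> borel_measurable borel" "1 < p" "s < 1"
  shows "modulus p u h \<le> ennreal (1 - 2 powr (- (p * (1 - s)))) * near_sum s p u h"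
proof -
  have "2 powr (- (p * (1 - s))) < 2 powr 0" using assms by (intro powr_less_mono) auto
  then show ?thesis
    using weighted_sum_ge[of "\<lambda>j. ennreal ((2 powr p) ^ j) * modulus p u ((1/2) ^ j *\<^sub>R h)", OF near_terms_mono[OF assms(1,2)]]
    unfolding near_sum_def by fastforce
qed

text \<open>The ratio q = 2^(-p(1-s)) grows with s, so summation by parts applies. Without the
  factors 1 - q the inequality would be immediate; with them it is stronger, since 1 - q is smaller
  at s1.\<close>

lemma near_sum_mono:
  assumes "u \<in> borel_measurable borel" "1 < p" "s1 < 1" "s2 \<le> s1"
  shows "ennreal (1 - 2 powr (- (p * (1 - s2)))) * near_sum s2 p u h \<le>
    ennreal (1 - 2 powr (- (p * (1 - s1)))) * near_sum s1 p u h"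
proof -
  have "2 powr (- (p * (1 - s1))) < 2 powr 0" using assms by (intro powr_less_mono) auto
  then show ?thesis unfolding near_sum_def
    using assms by (intro weighted_sum_mono near_terms_mono powr_mono) auto
qed

lemma near_sum_le:
  assumes "u \<in> borel_measurable borel" "1 < p" "s < 1"
    and G: "\<And>h. modulus p u h \<le> ennreal (norm h powr p) * G"
  shows "ennreal (1 - 2 powr (- (p * (1 - s)))) * near_sum s p u h \<le> ennreal (norm h powr p) * G"
  unfolding near_sum_def
proof (rule weighted_sum_le)
  show "2 powr (- (p * (1 - s))) < (1 :: real)"
    using powr_less_mono[of "- (p * (1 - s))" 0 2] assms by simp
  fix j
  have "ennreal ((2 powr p) ^ j) * modulus p u ((1/2) ^ j *\<^sub>R h) \<le>
      ennreal ((2 powr p) ^ j) * (ennreal (norm ((1/2) ^ j *\<^sub>R h) powr p) * G)"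
    by (intro mult_left_mono G) auto
  also have "\<dots> = ennreal ((2 powr p) ^ j * norm ((1/2) ^ j *\<^sub>R h) powr p) * G"
    by (simp add: ennreal_mult' mult_ac)
  also have "(2 powr p) ^ j * norm ((1/2) ^ j *\<^sub>R h) powr p = (2 ^ j * norm ((1/2) ^ j *\<^sub>R h)) powr p"
    by (simp only: powr_mult two_powr_power)
  also have "2 ^ j * norm ((1/2) ^ j *\<^sub>R h) = norm h" by (simp add: power_divide)
  finally show "ennreal ((2 powr p) ^ j) * modulus p u ((1/2) ^ j *\<^sub>R h) \<le> ennreal (norm h powr p) * G" .
qed auto

lemma far_sum_le:
  assumes "u \<in> borel_measurable borel" "1 < p" "0 < s" and B: "\<And>h. modulus p u h \<le> B"
  shows "ennreal (1 - 2 powr (- (s * p))) * far_sum s p u h \<le> B"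
  unfolding far_sum_def
proof (rule weighted_sum_le)
  show "2 powr (- (s * p)) < (1 :: real)"
    using powr_less_mono[of "- (s * p)" 0 2] assms by simp
qed (use B in auto)

text \<open>Every 2^j h lies beyond twice the radius R, so all terms equal 2 ||u||_p^p and the
  geometric series is cancelled by its normalization.\<close>

lemma far_sum_eq:
  fixes u :: "'a::euclidean_space \<Rightarrow> real"
  assumes u: "u \<in> borel_measurable borel" and p: "1 < p" and s: "0 < s" and R: "0 \<le> R"
    and supp: "\<And>x. R \<le> norm x \<Longrightarrow> u x = 0" and h: "2 * R \<le> norm h"
  shows "ennreal (1 - 2 powr (- (s * p))) * far_sum s p u h = 2 * Lp_nn p u"
proof -
  have "modulus p u (2 ^ j *\<^sub>R h) = 2 * Lp_nn p u" for j
  proof (rule modulus_far[OF u _ supp])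
    have "1 * norm h \<le> 2 ^ j * norm h" by (intro mult_right_mono) auto
    then show "2 * R \<le> norm (2 ^ j *\<^sub>R h)" using h by simp
  qed (use p in auto)
  moreover have "2 powr (- (s * p)) < (1 :: real)"
    using powr_less_mono[of "- (s * p)" 0 2] p s by simp
  ultimately show ?thesis unfolding far_sum_def by (simp add: ennreal_geometric del: ennreal_suminf_multc)
qed

section \<open>Poincare inequality and comparison of orders, uniform in s and p\<close>

lemma annulus_measure:
  assumes R: "0 < R"
  obtains a where "0 < a" "emeasure lborel (annulus R :: 'a::euclidean_space set) = ennreal a"
proof -
  obtain e :: 'a where e: "e \<in> Basis" using nonempty_Basis by blast
  have "bounded (annulus R :: 'a set)"
    by (rule bounded_subset[of "ball 0 (2 * R)"]) (auto simp: annulus_def)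
  then have fin: "emeasure lborel (annulus R :: 'a set) < \<infinity>" by (rule emeasure_bounded_finite)
  have "ball ((3/2 * R) *\<^sub>R e) (R/2) \<subseteq> annulus R"
  proof
    fix x assume x: "x \<in> ball ((3/2 * R) *\<^sub>R e) (R/2)"
    have "norm ((3/2 * R) *\<^sub>R e) = 3/2 * R" using e R by simp
    moreover have "norm ((3/2 * R) *\<^sub>R e - x) < R/2" using x by (simp add: dist_norm)
    ultimately show "x \<in> annulus R"
      using norm_triangle_ineq2[of "(3/2 * R) *\<^sub>R e" x] norm_triangle_ineq2[of x "(3/2 * R) *\<^sub>R e"]
      by (auto simp: annulus_def norm_minus_commute)
  qed
  then have "emeasure lborel (ball ((3/2 * R) *\<^sub>R e) (R/2)) \<le> emeasure lborel (annulus R :: 'a set)"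
    by (intro emeasure_mono) auto
  moreover have "0 < emeasure lborel (ball ((3/2 * R) *\<^sub>R e) (R/2))"
    using R by (simp add: emeasure_ball unit_ball_vol_pos)
  ultimately have "0 < emeasure lborel (annulus R :: 'a set)" by (rule less_le_trans[rotated])
  then show ?thesis
    using fin that[of "enn2real (emeasure lborel (annulus R :: 'a set))"]
    by (simp add: enn2real_positive_iff)
qed

text \<open>The bounds are free of s and p: |h| is at least 1 and the exponent N + sp lies between N
  and 2N.\<close>

lemma frac_weight_bounds:
  fixes h :: "'a::euclidean_space"
  assumes "1 \<le> R" "h \<in> annulus R" "0 \<le> s" "s \<le> 1" "0 \<le> p" "p \<le> real DIM('a)"
  shows "ennreal ((2 * R) powr (- (2 * real DIM('a)))) \<le> frac_weight s p h" "frac_weight s p h \<le> 1"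
proof -
  have n: "1 \<le> norm h" "norm h \<le> 2 * R" using assms by (auto simp: annulus_def)
  have e: "0 \<le> s * p" "s * p \<le> real DIM('a)" using assms mult_left_le_one_le[of p s] by auto
  have "(2 * R) powr (- (2 * real DIM('a))) \<le> (2 * R) powr - (real DIM('a) + s * p)"
    using assms e by (intro powr_mono) auto
  also have "\<dots> \<le> norm h powr - (real DIM('a) + s * p)"
    using n e by (intro powr_mono2') auto
  finally show "ennreal ((2 * R) powr (- (2 * real DIM('a)))) \<le> frac_weight s p h"
    unfolding frac_weight_def by (rule ennreal_leI)
  have "norm h powr - (real DIM('a) + s * p) \<le> norm h powr 0" using n e by (intro powr_mono) auto
  also have "\<dots> = 1" using n by auto
  finally show "frac_weight s p h \<le> 1" unfolding frac_weight_def by (simp del: minus_add_distrib)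
qed

lemma frac_weight_ratio:
  fixes h :: "'a::euclidean_space"
  assumes "0 < R" "h \<in> annulus R" "s2 \<le> s1" "0 \<le> p"
  shows "frac_weight s2 p h \<le> ennreal ((2 * R) powr ((s1 - s2) * p)) * frac_weight s1 p h"
proof -
  have n: "0 < norm h" "norm h \<le> 2 * R" using assms by (auto simp: annulus_def)
  have "norm h powr - (real DIM('a) + s2 * p) = norm h powr ((s1 - s2) * p) * norm h powr - (real DIM('a) + s1 * p)"
    by (simp add: algebra_simps flip: powr_add)
  also have "\<dots> \<le> (2 * R) powr ((s1 - s2) * p) * norm h powr - (real DIM('a) + s1 * p)"
    using n assms by (intro mult_right_mono powr_mono2) auto
  finally show ?thesis unfolding frac_weight_def by (simp add: ennreal_leI del: minus_add_distrib flip: ennreal_mult')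
qed

lemma near_factor_bound:
  fixes n p s :: real
  assumes "0 < s" "s < 1" "1 < p" "p \<le> n"
  shows "1 - s \<le> 2 * n * (1 - 2 powr (- (p * (1 - s))))" "1 - 2 powr (- (p * (1 - s))) \<le> n * (1 - s)"
    "s \<le> 2 * n * (1 - 2 powr (- (s * p)))" "1 - 2 powr (- (s * p)) \<le> n * s"
proof -
  have a: "1 - s \<le> p * (1 - s)" "p * (1 - s) \<le> n * (1 - s)" "n * (1 - s) \<le> n"
    using assms by (auto simp: mult_le_cancel_right1 mult_le_cancel_left1)
  have b: "s \<le> s * p" "s * p \<le> n"
    using assms mult_mono[of s 1 p n] by (auto simp: mult_le_cancel_left1)
  show "1 - s \<le> 2 * n * (1 - 2 powr (- (p * (1 - s))))"
    using two_powr_minus_bounds(2)[of "p * (1 - s)" n] a assms by linarith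
  show "1 - 2 powr (- (p * (1 - s))) \<le> n * (1 - s)"
    using two_powr_minus_bounds(1)[of "p * (1 - s)" n] a assms by linarith
  show "s \<le> 2 * n * (1 - 2 powr (- (s * p)))"
    using two_powr_minus_bounds(2)[of "s * p" n] b assms by linarith
  have "s * p \<le> n * s" using assms by (simp add: mult.commute)
  then show "1 - 2 powr (- (s * p)) \<le> n * s"
    using two_powr_minus_bounds(1)[of "s * p" n] b assms by linarith
qed

text \<open>On an annulus with |h| \<ge> 2R the quantity 2 ||u||_p^p is at most the normalized near
  sum and equals the normalized far sum. The former yields the factor 1 - s, the latter the factor
  s. Using the far sum for s \<le> 1/2 and the near sum otherwise, the missing factor is at least
  1/2, which produces s (1 - s).\<close>

lemma frac_poincare:
  assumes R: "1 \<le> R"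
  obtains c where "0 < c" and "\<And>s p (u :: 'a::euclidean_space \<Rightarrow> real). 0 < s \<Longrightarrow> s < 1 \<Longrightarrow> 1 < p \<Longrightarrow> p \<le> real DIM('a) \<Longrightarrow>
    u \<in> borel_measurable borel \<Longrightarrow> (\<And>x. R \<le> norm x \<Longrightarrow> u x = 0) \<Longrightarrow>
    Lp_nn p u \<le> ennreal c * (ennreal (s * (1 - s)) * frac_energy s p u)"
proof -
  obtain a where a: "0 < a" "emeasure lborel (annulus (2 * R) :: 'a set) = ennreal a"
    using annulus_measure[of "2 * R"] R by auto
  define n where "n = real DIM('a)"
  define w where "w = (2 * (2 * R)) powr (- (2 * n))"
  have w: "0 < w" using R by (simp add: w_def)
  have n1: "1 \<le> n" using DIM_positive[where 'a = 'a] by (simp add: n_def)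
  show ?thesis
  proof (rule that[of "n / (a * w)"])
    show "0 < n / (a * w)" using a w n1 by simp
    fix s p :: real and u :: "'a \<Rightarrow> real"
    assume s: "0 < s" "s < 1" and p: "1 < p" "p \<le> real DIM('a)" and u[measurable]: "u \<in> borel_measurable borel"
      and supp: "\<And>x. R \<le> norm x \<Longrightarrow> u x = 0"
    have W: "ennreal w \<le> frac_weight s p h" if "h \<in> annulus (2 * R)" for h :: 'a
      using frac_weight_bounds(1)[OF _ that, of s p] R s p by (simp add: w_def n_def)
    have main: "ennreal (2 * a * w) * Lp_nn p u \<le> ennreal d * frac_energy s p u"
      if m[measurable]: "S \<in> borel_measurable borel" and S: "\<And>h. h \<in> annulus (2 * R) \<Longrightarrow> 2 * Lp_nn p u \<le> ennreal d * S h"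
        and le: "(\<integral>\<^sup>+h. S h * frac_weight s p h * indicator (annulus (2 * R)) h \<partial>lborel) \<le> frac_energy s p u"
      for d and S :: "'a \<Rightarrow> ennreal"
    proof -
      have "ennreal (2 * a * w) * Lp_nn p u = ennreal w * (2 * Lp_nn p u) * ennreal a"
        using a w by (simp add: ennreal_mult' mult_ac)
      also have "\<dots> = (\<integral>\<^sup>+h. ennreal w * (2 * Lp_nn p u) * indicator (annulus (2 * R)) (h::'a) \<partial>lborel)"
        using a by (simp add: nn_integral_cmult_indicator)
      also have "\<dots> \<le> (\<integral>\<^sup>+h. ennreal d * (S h * frac_weight s p h * indicator (annulus (2 * R)) h) \<partial>lborel)"
      proof (intro nn_integral_mono)
        fix h :: 'a
        show "ennreal w * (2 * Lp_nn p u) * indicator (annulus (2 * R)) h \<le>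
            ennreal d * (S h * frac_weight s p h * indicator (annulus (2 * R)) h)"
          using mult_mono[OF W S, of h h] by (auto simp: mult_ac split: split_indicator)
      qed
      also have "\<dots> = ennreal d * (\<integral>\<^sup>+h. S h * frac_weight s p h * indicator (annulus (2 * R)) h \<partial>lborel)"
        by (rule nn_integral_cmult) measurable
      also have "\<dots> \<le> ennreal d * frac_energy s p u" by (intro mult_left_mono le) auto
      finally show ?thesis .
    qed
    have p0: "0 < p" and RR: "0 < 2 * R" "0 \<le> R" using p R by auto
    have near: "ennreal (2 * a * w) * Lp_nn p u \<le> ennreal (1 - 2 powr (- (p * (1 - s)))) * frac_energy s p u"
    proof (rule main[OF _ _ frac_energy_lower(1)[OF u RR(1)]])
      fix h :: 'a assume "h \<in> annulus (2 * R)"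
      then have "2 * R \<le> norm h" by (simp add: annulus_def)
      then show "2 * Lp_nn p u \<le> ennreal (1 - 2 powr (- (p * (1 - s)))) * near_sum s p u h"
        using near_sum_ge[OF u p(1) s(2), where h = h] modulus_far[OF u p0 supp, where h = h] by simp
    qed measurable
    have far: "ennreal (2 * a * w) * Lp_nn p u \<le> ennreal (1 - 2 powr (- (s * p))) * frac_energy s p u"
    proof (rule main[OF _ _ frac_energy_lower(2)[OF u RR(1)]])
      fix h :: 'a assume "h \<in> annulus (2 * R)"
      then have "2 * R \<le> norm h" by (simp add: annulus_def)
      then show "2 * Lp_nn p u \<le> ennreal (1 - 2 powr (- (s * p))) * far_sum s p u h"
        using far_sum_eq[OF u p(1) s(1) RR(2) supp] by simp
    qed measurable
    note e1 = near_factor_bound(2)[OF s p, folded n_def] and e2 = near_factor_bound(4)[OF s p, folded n_def]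
    have "ennreal (2 * a * w) * Lp_nn p u \<le> ennreal (2 * n * (s * (1 - s))) * frac_energy s p u"
    proof (cases "s \<le> 1/2")
      case True
      have "n * s * 1 \<le> n * s * (2 * (1 - s))" using True s n1 by (intro mult_left_mono) auto
      then have "1 - 2 powr (- (s * p)) \<le> 2 * n * (s * (1 - s))" using e2 by (simp add: mult_ac)
      then show ?thesis by (intro order_trans[OF far] mult_right_mono ennreal_leI) auto
    next
      case False
      have "n * (1 - s) * 1 \<le> n * (1 - s) * (2 * s)" using False s n1 by (intro mult_left_mono) auto
      then have "1 - 2 powr (- (p * (1 - s))) \<le> 2 * n * (s * (1 - s))" using e1 by (simp add: mult_ac)
      then show ?thesis by (intro order_trans[OF near] mult_right_mono ennreal_leI) auto
    qed
    then have "ennreal (1 / (2 * a * w)) * (ennreal (2 * a * w) * Lp_nn p u) \<le>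
        ennreal (1 / (2 * a * w)) * (ennreal (2 * n * (s * (1 - s))) * frac_energy s p u)"
      by (intro mult_left_mono) auto
    also have "ennreal (1 / (2 * a * w)) * (ennreal (2 * a * w) * Lp_nn p u) = Lp_nn p u"
      using a w by (simp add: mult.assoc[symmetric] flip: ennreal_mult')
    also have "ennreal (1 / (2 * a * w)) * (ennreal (2 * n * (s * (1 - s))) * frac_energy s p u) =
        ennreal (n / (a * w)) * (ennreal (s * (1 - s)) * frac_energy s p u)"
    proof -
      have "ennreal (1 / (2 * a * w)) * ennreal (2 * n * (s * (1 - s))) = ennreal (1 / (2 * a * w) * (2 * n * (s * (1 - s))))"
        using a w n1 s by (intro ennreal_mult[symmetric]) auto
      also have "1 / (2 * a * w) * (2 * n * (s * (1 - s))) = n / (a * w) * (s * (1 - s))"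
        using a w by (simp add: field_simps)
      also have "ennreal \<dots> = ennreal (n / (a * w)) * ennreal (s * (1 - s))"
        using a w n1 s by (intro ennreal_mult) auto
      finally show ?thesis by (simp only: mult.assoc[symmetric])
    qed
    finally show "Lp_nn p u \<le> ennreal (n / (a * w)) * (ennreal (s * (1 - s)) * frac_energy s p u)" .
  qed
qed

lemma nn_integral_annulus_split:
  fixes u :: "'a::euclidean_space \<Rightarrow> real"
  assumes [measurable]: "u \<in> borel_measurable borel" and R: "0 < R"
  shows "frac_energy s p u \<le> (\<integral>\<^sup>+h. near_sum s p u h * frac_weight s p h * indicator (annulus R) h \<partial>lborel)
     + (\<integral>\<^sup>+h. far_sum s p u h * frac_weight s p h * indicator (annulus R) h \<partial>lborel)"
  using frac_energy_upper[OF assms, of s p] by (subst nn_integral_add[symmetric]) (auto simp: distrib_right)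

text \<open>The far sum is 2 ||u||_p^p / (1 - 2^(-sp)); the factor s absorbs its blow-up as s tends
  to 0.\<close>

lemma far_part_le:
  fixes u :: "'a::euclidean_space \<Rightarrow> real"
  assumes R: "1 \<le> R" and s: "0 < s" "s < 1" and p: "1 < p" "p \<le> real DIM('a)"
    and u[measurable]: "u \<in> borel_measurable borel" and supp: "\<And>x. R \<le> norm x \<Longrightarrow> u x = 0"
    and a: "emeasure lborel (annulus (2 * R) :: 'a set) = ennreal a" "0 < a"
  shows "ennreal s * (\<integral>\<^sup>+h. far_sum s p u h * frac_weight s p h * indicator (annulus (2 * R)) h \<partial>lborel)
    \<le> ennreal (4 * real DIM('a) * a) * Lp_nn p u"
proof -
  let ?n = "real DIM('a)"
  have "ennreal s * (\<integral>\<^sup>+h. far_sum s p u h * frac_weight s p h * indicator (annulus (2 * R)) h \<partial>lborel)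
     = (\<integral>\<^sup>+h. ennreal s * (far_sum s p u h * frac_weight s p h * indicator (annulus (2 * R)) h) \<partial>lborel)"
    by (rule nn_integral_cmult[symmetric]) measurable
  also have "\<dots> \<le> (\<integral>\<^sup>+h. ennreal (2 * ?n) * (2 * Lp_nn p u) * indicator (annulus (2 * R)) (h::'a) \<partial>lborel)"
  proof (intro nn_integral_mono)
    fix h :: 'a
    show "ennreal s * (far_sum s p u h * frac_weight s p h * indicator (annulus (2 * R)) h) \<le>
        ennreal (2 * ?n) * (2 * Lp_nn p u) * indicator (annulus (2 * R)) h"
    proof (cases "h \<in> annulus (2 * R)")
      case True
      then have h: "2 * R \<le> norm h" by (simp add: annulus_def)
      have "ennreal s * far_sum s p u h \<le> ennreal (2 * ?n * (1 - 2 powr (- (s * p)))) * far_sum s p u h"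
        using near_factor_bound(3)[OF s p] by (intro mult_right_mono ennreal_leI) auto
      also have "\<dots> = ennreal (2 * ?n) * (ennreal (1 - 2 powr (- (s * p))) * far_sum s p u h)"
        by (simp add: ennreal_mult' mult.assoc)
      also have "\<dots> = ennreal (2 * ?n) * (2 * Lp_nn p u)"
        using far_sum_eq[OF u p(1) s(1) _ supp h] R by simp
      finally have e: "ennreal s * far_sum s p u h \<le> ennreal (2 * ?n) * (2 * Lp_nn p u)" .
      have "ennreal s * far_sum s p u h * frac_weight s p h \<le> ennreal (2 * ?n) * (2 * Lp_nn p u) * 1"
        by (rule mult_mono[OF e]) (use frac_weight_bounds(2)[OF _ True, of s p] R s p in auto)
      then show ?thesis using True by (simp add: mult.assoc)
    qed simp
  qed
  also have "\<dots> = ennreal (2 * ?n) * (2 * Lp_nn p u) * ennreal a"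
    using a by (simp add: nn_integral_cmult_indicator)
  also have "\<dots> = ennreal (4 * ?n * a) * Lp_nn p u"
  proof -
    have "ennreal (4 * ?n * a) = ennreal (2 * ?n) * 2 * ennreal a"
      using a by (simp add: ennreal_mult'[symmetric] flip: ennreal_numeral)
    then show ?thesis by (simp add: mult_ac)
  qed
  finally show ?thesis .
qed

lemma near_part_factor:
  fixes u :: "'a::euclidean_space \<Rightarrow> real"
  assumes s: "0 < s" "s < 1" and p: "1 < p" "p \<le> real DIM('a)"
  shows "ennreal (1 - s) * near_sum s p u h \<le>
    ennreal (2 * real DIM('a)) * (ennreal (1 - 2 powr (- (p * (1 - s)))) * near_sum s p u h)"
proof -
  have "ennreal (1 - s) * near_sum s p u h \<le> ennreal (2 * real DIM('a) * (1 - 2 powr (- (p * (1 - s))))) * near_sum s p u h"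
    using near_factor_bound(1)[OF s p] by (intro mult_right_mono ennreal_leI) auto
  then show ?thesis by (simp add: ennreal_mult' mult.assoc)
qed

text \<open>Each factor 1 - s is traded for 1 - 2^(-p(1-s)), with which the near sums are monotone
  in s. The weight of order s2 exceeds that of order s1 on the annulus by at most (2R)^N.\<close>

lemma near_part_le:
  fixes u :: "'a::euclidean_space \<Rightarrow> real"
  assumes R: "1 \<le> R" and s: "0 < s2" "s2 < s1" "s1 < 1" and p: "1 < p" "p \<le> real DIM('a)"
    and u[measurable]: "u \<in> borel_measurable borel"
  shows "ennreal (1 - s2) * (\<integral>\<^sup>+h. near_sum s2 p u h * frac_weight s2 p h * indicator (annulus R) h \<partial>lborel)
    \<le> ennreal (2 * (real DIM('a))\<^sup>2 * (2 * R) powr real DIM('a)) * (ennreal (1 - s1) * frac_energy s1 p u)"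
proof -
  let ?n = "real DIM('a)"
  let ?K = "2 * ?n\<^sup>2 * (2 * R) powr ?n"
  have "ennreal (1 - s2) * (\<integral>\<^sup>+h. near_sum s2 p u h * frac_weight s2 p h * indicator (annulus R) h \<partial>lborel)
     = (\<integral>\<^sup>+h. ennreal (1 - s2) * (near_sum s2 p u h * frac_weight s2 p h * indicator (annulus R) h) \<partial>lborel)"
    by (rule nn_integral_cmult[symmetric]) measurable
  also have "\<dots> \<le> (\<integral>\<^sup>+h. ennreal (?K * (1 - s1)) * (near_sum s1 p u h * frac_weight s1 p h * indicator (annulus R) h) \<partial>lborel)"
  proof (intro nn_integral_mono)
    fix h :: 'a
    show "ennreal (1 - s2) * (near_sum s2 p u h * frac_weight s2 p h * indicator (annulus R) h) \<le>
        ennreal (?K * (1 - s1)) * (near_sum s1 p u h * frac_weight s1 p h * indicator (annulus R) h)"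
    proof (cases "h \<in> annulus R")
      case True
      have "ennreal (1 - s2) * near_sum s2 p u h \<le> ennreal (2 * ?n) * (ennreal (1 - 2 powr (- (p * (1 - s2)))) * near_sum s2 p u h)"
        using s p by (intro near_part_factor) auto
      also have "\<dots> \<le> ennreal (2 * ?n) * (ennreal (1 - 2 powr (- (p * (1 - s1)))) * near_sum s1 p u h)"
        using s p u by (intro mult_left_mono near_sum_mono) auto
      also have "\<dots> \<le> ennreal (2 * ?n) * (ennreal (?n * (1 - s1)) * near_sum s1 p u h)"
        using near_factor_bound(2)[of s1 p ?n] s p by (intro mult_left_mono mult_right_mono ennreal_leI) auto
      also have "\<dots> = ennreal (2 * ?n\<^sup>2 * (1 - s1)) * near_sum s1 p u h"
      proof -
        have "2 * ?n\<^sup>2 * (1 - s1) = (2 * ?n) * (?n * (1 - s1))" by (simp add: power2_eq_square)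
        then show ?thesis by (simp only: ennreal_mult' mult.assoc)
      qed
      finally have 1: "ennreal (1 - s2) * near_sum s2 p u h \<le> ennreal (2 * ?n\<^sup>2 * (1 - s1)) * near_sum s1 p u h" .
      have "frac_weight s2 p h \<le> ennreal ((2 * R) powr ((s1 - s2) * p)) * frac_weight s1 p h"
        using R s p True by (intro frac_weight_ratio) auto
      also have "\<dots> \<le> ennreal ((2 * R) powr ?n) * frac_weight s1 p h"
      proof (intro mult_right_mono ennreal_leI powr_mono)
        show "(s1 - s2) * p \<le> ?n" using s p mult_mono[of "s1 - s2" 1 p ?n] by simp
      qed (use R in auto)
      finally have 2: "frac_weight s2 p h \<le> ennreal ((2 * R) powr ?n) * frac_weight s1 p h" .
      have "ennreal (1 - s2) * near_sum s2 p u h * frac_weight s2 p h \<le>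
          (ennreal (2 * ?n\<^sup>2 * (1 - s1)) * near_sum s1 p u h) * (ennreal ((2 * R) powr ?n) * frac_weight s1 p h)"
        by (intro mult_mono 1 2) auto
      also have "\<dots> = ennreal (?K * (1 - s1)) * (near_sum s1 p u h * frac_weight s1 p h)"
      proof -
        have "ennreal (?K * (1 - s1)) = ennreal (2 * ?n\<^sup>2 * (1 - s1)) * ennreal ((2 * R) powr ?n)"
          using s by (simp add: mult_ac flip: ennreal_mult')
        then show ?thesis by (simp add: mult_ac)
      qed
      finally show ?thesis using True by (simp add: mult.assoc)
    qed simp
  qed
  also have "\<dots> = ennreal (?K * (1 - s1)) * (\<integral>\<^sup>+h. near_sum s1 p u h * frac_weight s1 p h * indicator (annulus R) h \<partial>lborel)"
    by (rule nn_integral_cmult) measurable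
  also have "\<dots> \<le> ennreal (?K * (1 - s1)) * frac_energy s1 p u"
    using R by (intro mult_left_mono frac_energy_lower) auto
  also have "\<dots> = ennreal ?K * (ennreal (1 - s1) * frac_energy s1 p u)"
    using s by (simp add: ennreal_mult mult.assoc)
  finally show ?thesis .
qed

text \<open>The near parts compare directly. The far part of order s2 is an L^p norm, which the
  Poincare inequality of order s1 controls. The constant is chosen before s1, s2 and p.\<close>

lemma frac_compare:
  assumes R: "1 \<le> R"
  obtains C where "0 < C" and "\<And>s1 s2 p (u :: 'a::euclidean_space \<Rightarrow> real). 0 < s2 \<Longrightarrow> s2 < s1 \<Longrightarrow> s1 < 1 \<Longrightarrow>
    1 < p \<Longrightarrow> p \<le> real DIM('a) \<Longrightarrow> u \<in> borel_measurable borel \<Longrightarrow> (\<And>x. R \<le> norm x \<Longrightarrow> u x = 0) \<Longrightarrow>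
    ennreal (s2 * (1 - s2)) * frac_energy s2 p u \<le> ennreal C * (ennreal (s1 * (1 - s1)) * frac_energy s1 p u)"
proof -
  obtain c where c: "0 < c" "\<And>s p (u :: 'a \<Rightarrow> real). 0 < s \<Longrightarrow> s < 1 \<Longrightarrow> 1 < p \<Longrightarrow> p \<le> real DIM('a) \<Longrightarrow>
    u \<in> borel_measurable borel \<Longrightarrow> (\<And>x. R \<le> norm x \<Longrightarrow> u x = 0) \<Longrightarrow>
    Lp_nn p u \<le> ennreal c * (ennreal (s * (1 - s)) * frac_energy s p u)"
    using frac_poincare[OF R, where 'a = 'a] by blast
  obtain a where a: "0 < a" "emeasure lborel (annulus (2 * R) :: 'a set) = ennreal a"
    using annulus_measure[of "2 * R"] R by auto
  define n where "n = real DIM('a)"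
  define K where "K = 2 * n\<^sup>2 * (2 * (2 * R)) powr n"
  have n1: "1 \<le> n" using DIM_positive[where 'a = 'a] by (simp add: n_def)
  have K: "0 \<le> K" by (simp add: K_def)
  show ?thesis
  proof (rule that[of "K + 4 * n * a * c"])
    have "0 < 4 * n * a * c" using n1 a c by simp
    then show "0 < K + 4 * n * a * c" using K by linarith
    fix s1 s2 p :: real and u :: "'a \<Rightarrow> real"
    assume s: "0 < s2" "s2 < s1" "s1 < 1" and p: "1 < p" "p \<le> real DIM('a)" and u[measurable]: "u \<in> borel_measurable borel"
      and supp: "\<And>x. R \<le> norm x \<Longrightarrow> u x = 0"
    let ?W = "ennreal (s1 * (1 - s1)) * frac_energy s1 p u"
    let ?near = "\<integral>\<^sup>+h. near_sum s2 p u h * frac_weight s2 p h * indicator (annulus (2 * R)) h \<partial>lborel"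
    let ?far = "\<integral>\<^sup>+h. far_sum s2 p u h * frac_weight s2 p h * indicator (annulus (2 * R)) h \<partial>lborel"
    have "ennreal (s2 * (1 - s2)) * frac_energy s2 p u \<le> ennreal (s2 * (1 - s2)) * (?near + ?far)"
      using R by (intro mult_left_mono nn_integral_annulus_split) auto
    also have "\<dots> = ennreal s2 * (ennreal (1 - s2) * ?near) + ennreal (1 - s2) * (ennreal s2 * ?far)"
      using s by (simp add: ennreal_mult distrib_left mult_ac)
    also have "\<dots> \<le> ennreal K * ?W + ennreal (4 * n * a * c) * ?W"
    proof (rule add_mono)
      have "ennreal (1 - s2) * ?near \<le> ennreal K * (ennreal (1 - s1) * frac_energy s1 p u)"
        using near_part_le[of "2 * R" s2 s1 p u] R s p u unfolding K_def n_def by simp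
      then have "ennreal s2 * (ennreal (1 - s2) * ?near) \<le> ennreal s1 * (ennreal K * (ennreal (1 - s1) * frac_energy s1 p u))"
        by (rule mult_mono[rotated]) (use s in \<open>auto intro: ennreal_leI\<close>)
      also have "\<dots> = ennreal K * ?W" using s by (simp add: ennreal_mult mult_ac)
      finally show "ennreal s2 * (ennreal (1 - s2) * ?near) \<le> ennreal K * ?W" .
      have "ennreal (1 - s2) * (ennreal s2 * ?far) \<le> 1 * (ennreal s2 * ?far)"
        using s by (intro mult_right_mono) auto
      also have "\<dots> \<le> ennreal (4 * n * a) * Lp_nn p u"
        using far_part_le[OF R _ _ p u supp a(2) a(1), of s2] s by (simp add: n_def)
      also have "\<dots> \<le> ennreal (4 * n * a) * (ennreal c * ?W)"
        using s p u supp by (intro mult_left_mono c(2)) auto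
      also have "\<dots> = ennreal (4 * n * a * c) * ?W"
        using n1 a c by (simp add: ennreal_mult mult.assoc)
      finally show "ennreal (1 - s2) * (ennreal s2 * ?far) \<le> ennreal (4 * n * a * c) * ?W" .
    qed
    also have "\<dots> = ennreal (K + 4 * n * a * c) * ?W"
      using K n1 a c by (simp add: distrib_right)
    finally show "ennreal (s2 * (1 - s2)) * frac_energy s2 p u \<le> ennreal (K + 4 * n * a * c) * ?W" .
  qed
qed

text \<open>The endpoint s1 = 1: G stands for the Dirichlet integral, and the bound of the modulus
  by |h|^p G is all that is asked of it. A single displacement with |h| \<ge> 2R yields the Poincare
  inequality; in the near sum every modulus term is at most |h|^p G.\<close>

lemma frac_gradient_compare:
  assumes R: "1 \<le> R"
  obtains C where "0 < C" and "\<And>s p G (u :: 'a::euclidean_space \<Rightarrow> real). 0 < s \<Longrightarrow> s < 1 \<Longrightarrow>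
    1 < p \<Longrightarrow> p \<le> real DIM('a) \<Longrightarrow> u \<in> borel_measurable borel \<Longrightarrow> (\<And>x. R \<le> norm x \<Longrightarrow> u x = 0) \<Longrightarrow>
    (\<And>h. modulus p u h \<le> ennreal (norm h powr p) * G) \<Longrightarrow>
    Lp_nn p u \<le> ennreal C * G \<and> ennreal (s * (1 - s)) * frac_energy s p u \<le> ennreal C * G"
proof -
  obtain a where a: "0 < a" "emeasure lborel (annulus (2 * R) :: 'a set) = ennreal a"
    using annulus_measure[of "2 * R"] R by auto
  define n where "n = real DIM('a)"
  have n1: "1 \<le> n" using DIM_positive[where 'a = 'a] by (simp add: n_def)
  define K where "K = (2 * (2 * R)) powr n"
  have K: "0 < K" using R by (simp add: K_def)
  define C where "C = K + 2 * n * K * a + 4 * n * a * K"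
  have KC: "0 < K" "K \<le> C" using K n1 a by (auto simp: C_def)
  show ?thesis
  proof (rule that[of C])
    show "0 < C" using KC by simp
    fix s p :: real and G and u :: "'a \<Rightarrow> real"
    assume s: "0 < s" "s < 1" and p: "1 < p" "p \<le> real DIM('a)" and u[measurable]: "u \<in> borel_measurable borel"
      and supp: "\<And>x. R \<le> norm x \<Longrightarrow> u x = 0" and G: "\<And>h. modulus p u h \<le> ennreal (norm h powr p) * G"
    have hK: "norm h powr p \<le> K" if "h \<in> annulus (2 * R)" for h :: 'a
    proof -
      have "norm h powr p \<le> norm h powr n" using that R p by (intro powr_mono) (auto simp: annulus_def n_def)
      also have "\<dots> \<le> K" unfolding K_def using that n1 by (intro powr_mono2) (auto simp: annulus_def)
      finally show ?thesis .
    qed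
    obtain h0 :: 'a where h0: "h0 \<in> annulus (2 * R)"
      using a by (metis emeasure_empty ennreal_eq_0_iff ex_in_conv less_le_not_le)
    have "Lp_nn p u \<le> 2 * Lp_nn p u" by (simp add: mult_2)
    also have "\<dots> = modulus p u h0"
      using h0 p by (intro modulus_far[OF u _ supp, symmetric]) (auto simp: annulus_def)
    also have "\<dots> \<le> ennreal K * G"
      by (rule order_trans[OF G]) (intro mult_right_mono ennreal_leI hK h0, simp)
    finally have L: "Lp_nn p u \<le> ennreal K * G" .
    let ?near = "\<integral>\<^sup>+h. near_sum s p u h * frac_weight s p h * indicator (annulus (2 * R)) h \<partial>lborel"
    let ?far = "\<integral>\<^sup>+h. far_sum s p u h * frac_weight s p h * indicator (annulus (2 * R)) h \<partial>lborel"
    have near: "ennreal (1 - s) * ?near \<le> ennreal (2 * n * K * a) * G"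
    proof -
      have "ennreal (1 - s) * ?near = (\<integral>\<^sup>+h. ennreal (1 - s) * (near_sum s p u h * frac_weight s p h * indicator (annulus (2 * R)) h) \<partial>lborel)"
        by (rule nn_integral_cmult[symmetric]) measurable
      also have "\<dots> \<le> (\<integral>\<^sup>+h. ennreal (2 * n) * (ennreal K * G) * indicator (annulus (2 * R)) (h::'a) \<partial>lborel)"
      proof (intro nn_integral_mono)
        fix h :: 'a
        show "ennreal (1 - s) * (near_sum s p u h * frac_weight s p h * indicator (annulus (2 * R)) h) \<le>
            ennreal (2 * n) * (ennreal K * G) * indicator (annulus (2 * R)) h"
        proof (cases "h \<in> annulus (2 * R)")
          case True
          have "ennreal (1 - s) * near_sum s p u h \<le> ennreal (2 * n) * (ennreal (1 - 2 powr (- (p * (1 - s)))) * near_sum s p u h)"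
            unfolding n_def using s p by (intro near_part_factor) auto
          also have "\<dots> \<le> ennreal (2 * n) * (ennreal (norm h powr p) * G)"
            using s p u G by (intro mult_left_mono near_sum_le) auto
          also have "\<dots> \<le> ennreal (2 * n) * (ennreal K * G)"
            by (intro mult_left_mono mult_right_mono ennreal_leI hK True) auto
          finally have e: "ennreal (1 - s) * near_sum s p u h \<le> ennreal (2 * n) * (ennreal K * G)" .
          have "ennreal (1 - s) * near_sum s p u h * frac_weight s p h \<le> ennreal (2 * n) * (ennreal K * G) * 1"
            by (rule mult_mono[OF e]) (use frac_weight_bounds(2)[OF _ True, of s p] R s p in auto)
          then show ?thesis using True by (simp add: mult.assoc)
        qed simp
      qed
      also have "\<dots> = ennreal (2 * n) * (ennreal K * G) * ennreal a"
        using a by (simp add: nn_integral_cmult_indicator)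
      also have "\<dots> = ennreal (2 * n * K * a) * G" using n1 K a by (simp add: ennreal_mult mult_ac)
      finally show ?thesis .
    qed
    have far: "ennreal s * ?far \<le> ennreal (4 * n * a * K) * G"
    proof -
      have "ennreal s * ?far \<le> ennreal (4 * n * a) * Lp_nn p u"
        using far_part_le[OF R s p u supp a(2) a(1)] by (simp add: n_def)
      also have "\<dots> \<le> ennreal (4 * n * a) * (ennreal K * G)" by (intro mult_left_mono L) auto
      also have "\<dots> = ennreal (4 * n * a * K) * G" using n1 K a by (simp add: ennreal_mult mult_ac)
      finally show ?thesis .
    qed
    have "ennreal (s * (1 - s)) * frac_energy s p u \<le> ennreal (s * (1 - s)) * (?near + ?far)"
      using R by (intro mult_left_mono nn_integral_annulus_split) auto
    also have "\<dots> = ennreal s * (ennreal (1 - s) * ?near) + ennreal (1 - s) * (ennreal s * ?far)"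
      using s by (simp add: ennreal_mult distrib_left mult_ac)
    also have "\<dots> \<le> 1 * (ennreal (2 * n * K * a) * G) + 1 * (ennreal (4 * n * a * K) * G)"
      using s by (intro add_mono mult_mono near far) auto
    also have "\<dots> = ennreal (2 * n * K * a + 4 * n * a * K) * G"
    proof -
      have "ennreal (2 * n * K * a + 4 * n * a * K) = ennreal (2 * n * K * a) + ennreal (4 * n * a * K)"
        using n1 K a by (intro ennreal_plus) auto
      then show ?thesis by (simp only: distrib_right mult_1_left)
    qed
    also have "\<dots> \<le> ennreal C * G" using K by (intro mult_right_mono ennreal_leI) (auto simp: C_def)
    finally have "ennreal (s * (1 - s)) * frac_energy s p u \<le> ennreal C * G" .
    moreover have "ennreal K * G \<le> ennreal C * G" using KC by (intro mult_right_mono ennreal_leI) auto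
    ultimately show "Lp_nn p u \<le> ennreal C * G \<and> ennreal (s * (1 - s)) * frac_energy s p u \<le> ennreal C * G"
      using L by auto
  qed
qed

text \<open>Split at the length \<delta>: short displacements gain the factor (2
  \<delta>)^((s1-s2)p) over order s1, long ones are controlled by the L^p norm alone. It serves
  compactness only, so \<open>C\<close> may depend on all parameters.\<close>

lemma frac_interpolation:
  assumes \<delta>: "0 < \<delta>" and s: "0 < s2" "s2 < s1" and p: "1 < p"
  obtains C where "0 < C" and "\<And>u :: 'a::euclidean_space \<Rightarrow> real. u \<in> borel_measurable borel \<Longrightarrow>
    frac_energy s2 p u \<le> ennreal ((2 * \<delta>) powr ((s1 - s2) * p)) * frac_energy s1 p u + ennreal C * Lp_nn p u"
proof -
  define n where "n = real DIM('a)"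
  define q where "q = 1 - 2 powr (- (s2 * p))"
  have q: "0 < q" unfolding q_def using powr_less_mono[of "- (s2 * p)" 0 2] s p by simp
  obtain a where a: "0 < a" "emeasure lborel (annulus \<delta> :: 'a set) = ennreal a"
    using annulus_measure[OF \<delta>] by auto
  define w where "w = \<delta> powr (- (n + s2 * p))"
  have w: "0 < w" using \<delta> by (simp add: w_def)
  have W: "frac_weight s2 p h \<le> ennreal w" if "h \<in> annulus \<delta>" for h :: 'a
    unfolding frac_weight_def w_def n_def using that \<delta> s p
    by (intro ennreal_leI powr_mono2') (auto simp: annulus_def intro: order_trans[of _ 0])
  define C where "C = (1 / q) * (2 * 2 powr p) * w * a"
  show ?thesis
  proof (rule that[of C])
    show "0 < C" using q w a by (simp add: C_def)
    fix u :: "'a \<Rightarrow> real" assume u[measurable]: "u \<in> borel_measurable borel"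
    let ?near = "\<integral>\<^sup>+h. near_sum s2 p u h * frac_weight s2 p h * indicator (annulus \<delta>) h \<partial>lborel"
    let ?far = "\<integral>\<^sup>+h. far_sum s2 p u h * frac_weight s2 p h * indicator (annulus \<delta>) h \<partial>lborel"
    have "?near \<le> (\<integral>\<^sup>+h. ennreal ((2 * \<delta>) powr ((s1 - s2) * p)) * (near_sum s1 p u h * frac_weight s1 p h * indicator (annulus \<delta>) h) \<partial>lborel)"
    proof (intro nn_integral_mono)
      fix h :: 'a
      have "near_sum s2 p u h \<le> near_sum s1 p u h"
        unfolding near_sum_def using s p
        by (intro suminf_le summableI mult_right_mono ennreal_leI power_mono powr_mono) auto
      moreover have "frac_weight s2 p h \<le> ennreal ((2 * \<delta>) powr ((s1 - s2) * p)) * frac_weight s1 p h" if "h \<in> annulus \<delta>"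
        using \<delta> that s p by (intro frac_weight_ratio) auto
      ultimately show "near_sum s2 p u h * frac_weight s2 p h * indicator (annulus \<delta>) h \<le>
          ennreal ((2 * \<delta>) powr ((s1 - s2) * p)) * (near_sum s1 p u h * frac_weight s1 p h * indicator (annulus \<delta>) h)"
        using mult_mono[of "near_sum s2 p u h" "near_sum s1 p u h" "frac_weight s2 p h"
            "ennreal ((2 * \<delta>) powr ((s1 - s2) * p)) * frac_weight s1 p h"]
        by (auto simp: mult_ac split: split_indicator)
    qed
    also have "\<dots> = ennreal ((2 * \<delta>) powr ((s1 - s2) * p)) * (\<integral>\<^sup>+h. near_sum s1 p u h * frac_weight s1 p h * indicator (annulus \<delta>) h \<partial>lborel)"
      by (rule nn_integral_cmult) measurable
    also have "\<dots> \<le> ennreal ((2 * \<delta>) powr ((s1 - s2) * p)) * frac_energy s1 p u"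
      using \<delta> by (intro mult_left_mono frac_energy_lower) auto
    finally have near: "?near \<le> ennreal ((2 * \<delta>) powr ((s1 - s2) * p)) * frac_energy s1 p u" .
    have far1: "far_sum s2 p u h \<le> ennreal (1 / q) * (ennreal (2 * 2 powr p) * Lp_nn p u)" for h
    proof -
      have "ennreal (1 / q) * (ennreal q * far_sum s2 p u h) \<le> ennreal (1 / q) * (ennreal (2 * 2 powr p) * Lp_nn p u)"
        unfolding q_def using u s p by (intro mult_left_mono far_sum_le modulus_le_Lp) auto
      moreover have "ennreal (1 / q) * (ennreal q * far_sum s2 p u h) = far_sum s2 p u h"
        using q by (simp add: mult.assoc[symmetric] flip: ennreal_mult')
      ultimately show ?thesis by simp
    qed
    have "?far \<le> (\<integral>\<^sup>+h. ennreal (1 / q) * (ennreal (2 * 2 powr p) * Lp_nn p u) * ennreal w * indicator (annulus \<delta>) (h::'a) \<partial>lborel)"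
      using far1 W by (intro nn_integral_mono) (auto intro!: mult_mono split: split_indicator)
    also have "\<dots> = ennreal (1 / q) * (ennreal (2 * 2 powr p) * Lp_nn p u) * ennreal w * ennreal a"
      using a by (simp add: nn_integral_cmult_indicator)
    also have "\<dots> = ennreal C * Lp_nn p u"
    proof -
      have "ennreal C = ennreal (1 / q) * ennreal (2 * 2 powr p) * ennreal w * ennreal a"
        unfolding C_def using q w a by (simp add: ennreal_mult''[symmetric] del: ennreal_mult'')
      then show ?thesis by (simp only: mult_ac)
    qed
    finally have far: "?far \<le> ennreal C * Lp_nn p u" .
    show "frac_energy s2 p u \<le> ennreal ((2 * \<delta>) powr ((s1 - s2) * p)) * frac_energy s1 p u + ennreal C * Lp_nn p u"
      using nn_integral_annulus_split[OF u \<delta>, of s2 p] add_mono[OF near far] by (rule order_trans)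
  qed
qed

section \<open>Compactness\<close>

text \<open>Restriction to \<open>Basis\<close> makes the indices extensional functions into the
  integers, so that only countably many occur.\<close>

definition cell_index :: "nat \<Rightarrow> 'a::euclidean_space \<Rightarrow> 'a \<Rightarrow> int" where
  "cell_index m x = (\<lambda>i\<in>Basis. \<lfloor>2 ^ m * (x \<bullet> i)\<rfloor>)"

lemma cell_index_eq_iff:
  "cell_index m x = cell_index m y \<longleftrightarrow> (\<forall>i\<in>Basis. \<lfloor>2 ^ m * (x \<bullet> i)\<rfloor> = \<lfloor>2 ^ m * (y \<bullet> i)\<rfloor>)"
  unfolding cell_index_def restrict_def fun_eq_iff by auto

lemma cell_index_eq_measurable[measurable]:
  "Measurable.pred (borel \<Otimes>\<^sub>M borel) (\<lambda>z :: 'a::euclidean_space \<times> 'a. cell_index m (fst z) = cell_index m (snd z))"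
  unfolding cell_index_eq_iff by (intro pred_intros_finite) (auto, measurable)

lemma cell_measurable[measurable]:
  fixes x :: "'a::euclidean_space"
  shows "{y. cell_index m x = cell_index m y} \<in> sets borel"
  using measurable_compose[OF measurable_Pair1'[of x borel borel] cell_index_eq_measurable[of m]]
  by (simp add: pred_def)

lemma cell_index_eq_norm_le:
  fixes x y :: "'a::euclidean_space"
  assumes "cell_index m x = cell_index m y"
  shows "norm (x - y) \<le> real DIM('a) / 2 ^ m"
proof -
  have "\<bar>(x - y) \<bullet> i\<bar> \<le> 1 / 2 ^ m" if "i \<in> Basis" for i
  proof -
    have f: "\<lfloor>2 ^ m * (x \<bullet> i)\<rfloor> = \<lfloor>2 ^ m * (y \<bullet> i)\<rfloor>" using assms that by (auto simp: cell_index_eq_iff)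
    have "\<bar>2 ^ m * (x \<bullet> i) - 2 ^ m * (y \<bullet> i)\<bar> \<le> 1"
      using floor_correct[of "2 ^ m * (x \<bullet> i)"] floor_correct[of "2 ^ m * (y \<bullet> i)"] f by linarith
    then have "2 ^ m * \<bar>(x - y) \<bullet> i\<bar> \<le> 1"
      by (simp add: inner_diff_left abs_mult flip: right_diff_distrib)
    then show ?thesis by (simp add: field_simps)
  qed
  then have "(\<Sum>i\<in>Basis. \<bar>(x - y) \<bullet> i\<bar>) \<le> (\<Sum>i\<in>(Basis::'a set). 1 / 2 ^ m)" by (intro sum_mono)
  then show ?thesis using norm_le_l1[of "x - y"] by simp
qed

text \<open>A cell is a half-open box: it lies between the open and the closed box with corners l
  and u, which have equal volume.\<close>

lemma emeasure_cell:
  fixes x :: "'a::euclidean_space"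
  shows "emeasure lborel {y. cell_index m x = cell_index m y} = ennreal ((1 / 2 ^ m) ^ DIM('a))"
proof -
  define l where "l = (\<Sum>i\<in>Basis. (real_of_int \<lfloor>2 ^ m * (x \<bullet> i)\<rfloor> / 2 ^ m) *\<^sub>R i)"
  define u where "u = (\<Sum>i\<in>Basis. ((real_of_int \<lfloor>2 ^ m * (x \<bullet> i)\<rfloor> + 1) / 2 ^ m) *\<^sub>R i)"
  have lu: "l \<bullet> i = real_of_int \<lfloor>2 ^ m * (x \<bullet> i)\<rfloor> / 2 ^ m" "u \<bullet> i = (real_of_int \<lfloor>2 ^ m * (x \<bullet> i)\<rfloor> + 1) / 2 ^ m"
    if "i \<in> Basis" for i
    using that by (simp_all add: l_def u_def)
  have le: "l \<bullet> i \<le> u \<bullet> i" if "i \<in> Basis" for i using lu[OF that] by (simp add: divide_right_mono)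
  have iff: "k / 2 ^ m \<le> t \<longleftrightarrow> k \<le> 2 ^ m * t" "k / 2 ^ m < t \<longleftrightarrow> k < 2 ^ m * t"
    "t \<le> k / 2 ^ m \<longleftrightarrow> 2 ^ m * t \<le> k" "t < k / 2 ^ m \<longleftrightarrow> 2 ^ m * t < k" for k t :: real
    by (auto simp: field_simps)
  have sub1: "box l u \<subseteq> {y. cell_index m x = cell_index m y}"
  proof
    fix y assume y: "y \<in> box l u"
    have "\<lfloor>2 ^ m * (x \<bullet> i)\<rfloor> = \<lfloor>2 ^ m * (y \<bullet> i)\<rfloor>" if "i \<in> Basis" for i
    proof -
      have "l \<bullet> i < y \<bullet> i" "y \<bullet> i < u \<bullet> i" using y that by (auto simp: mem_box)
      then show ?thesis unfolding lu[OF that] iff by linarith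
    qed
    then show "y \<in> {y. cell_index m x = cell_index m y}" by (simp add: cell_index_eq_iff)
  qed
  have sub2: "{y. cell_index m x = cell_index m y} \<subseteq> cbox l u"
  proof
    fix y assume "y \<in> {y. cell_index m x = cell_index m y}"
    then have f: "\<lfloor>2 ^ m * (x \<bullet> i)\<rfloor> = \<lfloor>2 ^ m * (y \<bullet> i)\<rfloor>" if "i \<in> Basis" for i
      using that by (simp add: cell_index_eq_iff)
    show "y \<in> cbox l u" unfolding mem_box
    proof
      fix i :: 'a assume i: "i \<in> Basis"
      show "l \<bullet> i \<le> y \<bullet> i \<and> y \<bullet> i \<le> u \<bullet> i" unfolding lu[OF i] iff using f[OF i] by linarith
    qed
  qed
  have pr: "(\<Prod>i\<in>Basis. (u - l) \<bullet> i) = (1 / 2 ^ m) ^ DIM('a)"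
  proof -
    have "(\<Prod>i\<in>Basis. (u - l) \<bullet> i) = (\<Prod>i\<in>(Basis::'a set). 1 / 2 ^ m)"
      by (intro prod.cong) (auto simp: inner_diff_left lu add_divide_distrib)
    then show ?thesis by simp
  qed
  have "emeasure lborel (box l u) = ennreal ((1 / 2 ^ m) ^ DIM('a))"
    "emeasure lborel (cbox l u) = ennreal ((1 / 2 ^ m) ^ DIM('a))"
    using le pr by (simp_all add: emeasure_lborel_box emeasure_lborel_cbox)
  then show ?thesis
    using emeasure_mono[OF sub1, of lborel] emeasure_mono[OF sub2, of lborel] by (simp add: order_antisym)
qed

definition cell_avg :: "nat \<Rightarrow> ('a::euclidean_space \<Rightarrow> real) \<Rightarrow> 'a \<Rightarrow> real" where
  "cell_avg m u x = (2 ^ m) ^ DIM('a) * (\<integral>y. indicator {y. cell_index m x = cell_index m y} y * u y \<partial>lborel)"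

lemma cell_avg_measurable[measurable]:
  fixes u :: "'a::euclidean_space \<Rightarrow> real"
  assumes [measurable]: "u \<in> borel_measurable borel"
  shows "cell_avg m u \<in> borel_measurable borel"
proof -
  have "(\<lambda>z. indicator {y. cell_index m (fst z) = cell_index m y} (snd z) * u (snd z)) \<in> borel_measurable (borel \<Otimes>\<^sub>M lborel)"
  proof -
    have "(\<lambda>z. indicator {y. cell_index m (fst z) = cell_index m y} (snd z) * u (snd z)) =
        (\<lambda>z. (if cell_index m (fst z) = cell_index m (snd z) then 1 else 0) * u (snd z))"
      by (auto simp: fun_eq_iff)
    also have "\<dots> \<in> borel_measurable (borel \<Otimes>\<^sub>M borel)" by measurable
    finally show ?thesis by (simp cong: measurable_cong_sets sets_pair_measure_cong)
  qed
  then show ?thesis unfolding cell_avg_def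
    by (intro borel_measurable_times borel_measurable_const)
      (rule lborel.borel_measurable_lebesgue_integral, simp add: case_prod_unfold)
qed

text \<open>Jensen's inequality for the mean t of |u x - u y| over the cell, obtained by integrating
  the tangent of r^p at t, whose linear term averages to 0. The factor in front is the reciprocal
  volume of a cell.\<close>

lemma cell_avg_jensen:
  fixes u :: "'a::euclidean_space \<Rightarrow> real"
  assumes u: "integrable lborel u" and p: "1 < p"
  shows "ennreal (\<bar>u x - cell_avg m u x\<bar> powr p) \<le> ennreal ((2 ^ m) ^ DIM('a)) *
    (\<integral>\<^sup>+y. ennreal (\<bar>u x - u y\<bar> powr p) * indicator {y. cell_index m x = cell_index m y} y \<partial>lborel)"
proof -
  define Q where "Q = {y. cell_index m x = cell_index m y}"
  have [measurable]: "Q \<in> sets borel" unfolding Q_def by (rule cell_measurable)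
  have [measurable]: "u \<in> borel_measurable borel" using u by simp
  define c where "c = (2 ^ m :: real) ^ DIM('a)"
  have c: "0 < c" by (simp add: c_def)
  have Qm: "emeasure lborel Q = ennreal (1 / c)"
    unfolding Q_def c_def emeasure_cell by (simp add: power_divide)
  then have Qi: "integrable lborel (indicator Q :: 'a \<Rightarrow> real)" and Qint: "(\<integral>y. indicator Q y \<partial>lborel) = 1 / c"
    using c by (auto simp: measure_def)
  have ui: "integrable lborel (\<lambda>y. indicator Q y * u y)"
    using integrable_mult_indicator[OF _ u, of Q] by simp
  have ki: "integrable lborel (\<lambda>y. indicator Q y * k)" for k :: real using Qi by simp
  let ?I = "\<integral>\<^sup>+y. ennreal (\<bar>u x - u y\<bar> powr p) * indicator Q y \<partial>lborel"
  show ?thesis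
  proof (cases "?I = \<infinity>")
    case True
    then show ?thesis using c unfolding Q_def[symmetric] c_def[symmetric] by (simp add: ennreal_mult_top)
  next
    case False
    define f where "f y = \<bar>u x - u y\<bar>" for y
    have [measurable]: "f \<in> borel_measurable borel" unfolding f_def by measurable
    have fi: "integrable lborel (\<lambda>y. indicator Q y * f y)"
    proof -
      have "integrable lborel (\<lambda>y. indicator Q y * u x - indicator Q y * u y)" using ki ui by simp
      then have "integrable lborel (\<lambda>y. \<bar>indicator Q y * u x - indicator Q y * u y\<bar>)" by (rule integrable_abs)
      moreover have "\<bar>indicator Q y * u x - indicator Q y * u y\<bar> = indicator Q y * f y" for y
        by (auto simp: f_def split: split_indicator)
      ultimately show ?thesis by simp
    qed
    have Ieq: "?I = (\<integral>\<^sup>+y. ennreal (indicator Q y * f y powr p) \<partial>lborel)"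
      by (intro nn_integral_cong) (auto simp: f_def split: split_indicator)
    have fpi: "integrable lborel (\<lambda>y. indicator Q y * f y powr p)"
      using False Ieq by (intro integrableI_nonneg) (auto simp: top.not_eq_extremum)
    define t where "t = c * (\<integral>y. indicator Q y * f y \<partial>lborel)"
    have t: "0 \<le> t" unfolding t_def f_def using c by (intro mult_nonneg_nonneg integral_nonneg) auto
    have "\<bar>u x - cell_avg m u x\<bar> \<le> t"
    proof -
      have "c * (\<integral>y. indicator Q y * u x - indicator Q y * u y \<partial>lborel) = u x - cell_avg m u x"
        using ki ui c Qint unfolding cell_avg_def Q_def[symmetric] c_def[symmetric] by (simp add: right_diff_distrib)
      moreover have "\<bar>\<integral>y. indicator Q y * u x - indicator Q y * u y \<partial>lborel\<bar> \<le> (\<integral>y. indicator Q y * f y \<partial>lborel)"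
        by (rule order_trans[OF integral_abs_bound])
          (auto simp: f_def split: split_indicator intro!: eq_refl Bochner_Integration.integral_cong)
      ultimately have "\<bar>c * (\<integral>y. indicator Q y * u x - indicator Q y * u y \<partial>lborel)\<bar> \<le> t"
        unfolding t_def abs_mult using c by (intro mult_mono) auto
      then show ?thesis by (simp only: \<open>c * _ = _\<close>)
    qed
    then have "\<bar>u x - cell_avg m u x\<bar> powr p \<le> t powr p" using p by (intro powr_mono2) auto
    also have "t powr p \<le> c * (\<integral>y. indicator Q y * f y powr p \<partial>lborel)"
    proof -
      have "(\<integral>y. indicator Q y * (t powr p + p * t powr (p - 1) * (f y - t)) \<partial>lborel) \<le> (\<integral>y. indicator Q y * f y powr p \<partial>lborel)"
      proof (rule integral_mono[OF _ fpi])
        have "integrable lborel (\<lambda>y. indicator Q y * (t powr p - p * t powr (p - 1) * t) + p * t powr (p - 1) * (indicator Q y * f y))"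
          using ki fi by (intro Bochner_Integration.integrable_add integrable_mult_right) auto
        then show "integrable lborel (\<lambda>y. indicator Q y * (t powr p + p * t powr (p - 1) * (f y - t)))"
          by (simp add: algebra_simps)
        show "indicator Q y * (t powr p + p * t powr (p - 1) * (f y - t)) \<le> indicator Q y * f y powr p" for y
          using powr_tangent_le[OF p t, of "f y"] by (auto simp: f_def split: split_indicator)
      qed
      also have "(\<integral>y. indicator Q y * (t powr p + p * t powr (p - 1) * (f y - t)) \<partial>lborel) =
          (\<integral>y. indicator Q y * (t powr p - p * t powr (p - 1) * t) + p * t powr (p - 1) * (indicator Q y * f y) \<partial>lborel)"
        by (intro Bochner_Integration.integral_cong) (auto simp: algebra_simps)
      also have "\<dots> = (1 / c) * (t powr p - p * t powr (p - 1) * t) + p * t powr (p - 1) * (t / c)"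
      proof -
        have "(\<integral>y. indicator Q y * k + l * (indicator Q y * f y) \<partial>lborel) = (1 / c) * k + l * (t / c)" for k l :: real
        proof -
          have "(\<integral>y. indicator Q y * k + l * (indicator Q y * f y) \<partial>lborel) =
              (\<integral>y. indicator Q y * k \<partial>lborel) + (\<integral>y. l * (indicator Q y * f y) \<partial>lborel)"
            by (intro Bochner_Integration.integral_add integrable_mult_right fi ki)
          then show ?thesis using c Qint by (simp add: t_def)
        qed
        then show ?thesis .
      qed
      also have "\<dots> = t powr p / c" by (simp add: diff_divide_distrib)
      finally show ?thesis using c by (simp add: field_simps)
    qed
    also have "ennreal (c * (\<integral>y. indicator Q y * f y powr p \<partial>lborel)) = ennreal c * ?I"
      unfolding Ieq using c fpi by (subst nn_integral_eq_integral) (auto simp: ennreal_mult')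
    finally show ?thesis unfolding Q_def[symmetric] c_def[symmetric] by (simp add: ennreal_leI)
  qed
qed

text \<open>Points of one cell are at most d = N / 2^m apart, so |u x - u y|^p is at most d^(N+sp)
  times the integrand of the energy. The part d^N compensates the reciprocal volume up to a
  constant; d^(sp) remains and decays in m.\<close>

lemma cell_avg_error:
  fixes u :: "'a::euclidean_space \<Rightarrow> real"
  assumes u: "integrable lborel u" and p: "1 < p" and s: "0 < s"
  shows "Lp_nn p (\<lambda>x. u x - cell_avg m u x) \<le>
    ennreal (real DIM('a) powr (real DIM('a) + s * p) * (2 powr (- (s * p))) ^ m) * frac_energy s p u"
proof -
  define n where "n = real DIM('a)"
  define d where "d = n / 2 ^ m"
  define E where "E = n + s * p"
  define c where "c = (2 ^ m :: real) ^ DIM('a)"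
  have n: "0 < n" and d: "0 < d" and E: "0 < E" and c: "0 < c"
    using s p by (auto simp: n_def d_def E_def c_def add_pos_pos)
  have [measurable]: "u \<in> borel_measurable borel" using u by simp
  let ?q = "\<lambda>z :: 'a \<times> 'a. ennreal (\<bar>u (fst z) - u (snd z)\<bar> powr p / norm (fst z - snd z) powr E)"
  have qm: "?q \<in> borel_measurable (borel \<Otimes>\<^sub>M borel)" by measurable
  have "Lp_nn p (\<lambda>x. u x - cell_avg m u x) \<le> (\<integral>\<^sup>+x. ennreal c *
    (\<integral>\<^sup>+y. ennreal (\<bar>u x - u y\<bar> powr p) * indicator {y. cell_index m x = cell_index m y} y \<partial>lborel) \<partial>lborel)"
    unfolding Lp_nn_def c_def by (intro nn_integral_mono cell_avg_jensen u p)
  also have "\<dots> \<le> (\<integral>\<^sup>+x. ennreal (c * d powr E) * (\<integral>\<^sup>+y. ?q (x, y) \<partial>lborel) \<partial>lborel)"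
  proof (intro nn_integral_mono)
    fix x
    have "(\<integral>\<^sup>+y. ennreal (\<bar>u x - u y\<bar> powr p) * indicator {y. cell_index m x = cell_index m y} y \<partial>lborel)
      \<le> (\<integral>\<^sup>+y. ennreal (d powr E) * ?q (x, y) \<partial>lborel)"
    proof (intro nn_integral_mono)
      fix y
      have "\<bar>u x - u y\<bar> powr p \<le> d powr E * (\<bar>u x - u y\<bar> powr p / norm (x - y) powr E)"
        if "cell_index m x = cell_index m y"
      proof (cases "x = y")
        case False
        have "norm (x - y) powr E \<le> d powr E"
          using cell_index_eq_norm_le[OF that] E by (intro powr_mono2) (auto simp: d_def n_def)
        then have "\<bar>u x - u y\<bar> powr p * norm (x - y) powr E \<le> \<bar>u x - u y\<bar> powr p * d powr E"
          by (intro mult_left_mono) auto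
        moreover have "0 < norm (x - y) powr E" using False by simp
        ultimately show ?thesis by (simp add: field_simps)
      qed (use p in simp)
      then show "ennreal (\<bar>u x - u y\<bar> powr p) * indicator {y. cell_index m x = cell_index m y} y \<le> ennreal (d powr E) * ?q (x, y)"
        by (auto simp: ennreal_leI split: split_indicator simp flip: ennreal_mult')
    qed
    also have "\<dots> = ennreal (d powr E) * (\<integral>\<^sup>+y. ?q (x, y) \<partial>lborel)"
      by (intro nn_integral_cmult) measurable
    finally show "ennreal c * (\<integral>\<^sup>+y. ennreal (\<bar>u x - u y\<bar> powr p) * indicator {y. cell_index m x = cell_index m y} y \<partial>lborel)
      \<le> ennreal (c * d powr E) * (\<integral>\<^sup>+y. ?q (x, y) \<partial>lborel)"
      using c by (simp add: ennreal_mult' mult.assoc mult_left_mono)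
  qed
  also have "\<dots> = ennreal (c * d powr E) * (\<integral>\<^sup>+x. (\<integral>\<^sup>+y. ?q (x, y) \<partial>lborel) \<partial>lborel)"
    by (rule nn_integral_cmult) measurable
  also have "(\<integral>\<^sup>+x. (\<integral>\<^sup>+y. ?q (x, y) \<partial>lborel) \<partial>lborel) = frac_energy s p u"
  proof -
    have "(\<integral>\<^sup>+x. (\<integral>\<^sup>+y. ?q (x, y) \<partial>lborel) \<partial>lborel) = (\<integral>\<^sup>+z. ?q z \<partial>(lborel \<Otimes>\<^sub>M lborel))"
      by (rule lborel.nn_integral_fst) (use qm in simp)
    then show ?thesis by (simp add: frac_energy_def lborel_prod E_def n_def)
  qed
  also have "c * d powr E = n powr E * (2 powr (- (s * p))) ^ m"
  proof -
    have "c = (2 ^ m) powr n" by (simp add: c_def n_def powr_realpow)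
    moreover have "d powr E = n powr E * (2 ^ m) powr (- E)"
      using n by (simp add: d_def powr_divide powr_minus_divide)
    ultimately have "c * d powr E = n powr E * ((2 ^ m) powr n * (2 ^ m) powr (- E))" by simp
    also have "(2 ^ m) powr n * (2 ^ m) powr (- E) = (2 ^ m :: real) powr (- (s * p))"
      by (simp add: E_def flip: powr_add)
    finally show ?thesis by (simp only: two_powr_power)
  qed
  finally show ?thesis by (simp add: n_def E_def)
qed

section \<open>Compactness in L^p\<close>

lemma Lp_nn_add_le:
  assumes [measurable]: "u \<in> borel_measurable borel" "v \<in> borel_measurable borel" and p: "0 < p"
  shows "Lp_nn p (\<lambda>x. u x + v x) \<le> ennreal (2 powr p) * (Lp_nn p u + Lp_nn p v)"
proof -
  have "Lp_nn p (\<lambda>x. u x + v x) \<le> (\<integral>\<^sup>+x. ennreal (2 powr p) * (ennreal (\<bar>u x\<bar> powr p) + ennreal (\<bar>v x\<bar> powr p)) \<partial>lborel)"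
    unfolding Lp_nn_def
    using norm_add_powr_le[OF p, where 'e = real]
    by (intro nn_integral_mono) (auto simp: ennreal_leI simp flip: ennreal_plus ennreal_mult')
  then show ?thesis by (simp add: nn_integral_cmult nn_integral_add Lp_nn_def)
qed

lemma compactly_supported_integrable:
  fixes u :: "'a::euclidean_space \<Rightarrow> real"
  assumes [measurable]: "u \<in> borel_measurable borel" and p: "1 < p" and supp: "\<And>x. R \<le> norm x \<Longrightarrow> u x = 0"
    and L: "Lp_nn p u \<le> ennreal B" and B: "0 \<le> B"
  shows "integrable lborel u" "(\<integral>x. \<bar>u x\<bar> \<partial>lborel) \<le> measure lborel (ball (0::'a) R) + B"
proof -
  have le: "\<bar>u x\<bar> \<le> indicator (ball 0 R) x + \<bar>u x\<bar> powr p" for x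
  proof (cases "R \<le> norm x")
    case False
    have "\<bar>u x\<bar> \<le> 1 + \<bar>u x\<bar> powr p"
    proof (cases "\<bar>u x\<bar> \<le> 1")
      case True
      then show ?thesis by (smt (verit) powr_ge_zero)
    next
      case False
      then have "\<bar>u x\<bar> powr 1 \<le> \<bar>u x\<bar> powr p" using p by (intro powr_mono) auto
      then show ?thesis using False by simp
    qed
    then show ?thesis using False by simp
  qed (use supp p in simp)
  have "(\<integral>\<^sup>+x. ennreal \<bar>u x\<bar> \<partial>lborel) \<le> (\<integral>\<^sup>+x. indicator (ball 0 R) x + ennreal (\<bar>u x\<bar> powr p) \<partial>lborel)"
  proof (intro nn_integral_mono)
    fix x
    have "ennreal \<bar>u x\<bar> \<le> ennreal (indicator (ball 0 R) x + \<bar>u x\<bar> powr p)" by (intro ennreal_leI le)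
    then show "ennreal \<bar>u x\<bar> \<le> indicator (ball 0 R) x + ennreal (\<bar>u x\<bar> powr p)"
      by (simp add: ennreal_plus ennreal_indicator)
  qed
  also have "\<dots> = emeasure lborel (ball (0::'a) R) + Lp_nn p u"
    unfolding Lp_nn_def by (subst nn_integral_add) (auto intro!: borel_measurable_indicator)
  also have "\<dots> \<le> ennreal (measure lborel (ball (0::'a) R) + B)"
  proof -
    have "emeasure lborel (ball (0::'a) R) = ennreal (measure lborel (ball (0::'a) R))"
      using emeasure_bounded_finite[OF bounded_ball] by (intro emeasure_eq_ennreal_measure) (auto simp: top.not_eq_extremum)
    then show ?thesis using L B by (simp add: add_left_mono)
  qed
  finally have *: "(\<integral>\<^sup>+x. ennreal \<bar>u x\<bar> \<partial>lborel) \<le> ennreal (measure lborel (ball (0::'a) R) + B)" .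
  then show ui: "integrable lborel u"
    by (intro integrableI_bounded) (auto intro: le_less_trans)
  have "ennreal (\<integral>x. \<bar>u x\<bar> \<partial>lborel) \<le> ennreal (measure lborel (ball (0::'a) R) + B)"
    using * ui by (subst nn_integral_eq_integral[symmetric]) auto
  then show "(\<integral>x. \<bar>u x\<bar> \<partial>lborel) \<le> measure lborel (ball (0::'a) R) + B"
    using B by (subst (asm) ennreal_le_iff) auto
qed

text \<open>A diagonal subsequence makes the averages over all cells of all grids converge. On each
  grid the step functions then converge in L^p by dominated convergence, while the averaging error
  is at most a constant times 2^(-msp) B for all n at once.\<close>

lemma rellich:
  fixes u :: "nat \<Rightarrow> 'a::euclidean_space \<Rightarrow> real"
  assumes p: "1 < p" and s: "0 < s" and u[measurable]: "\<And>n. u n \<in> borel_measurable borel"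
    and supp: "\<And>n x. R \<le> norm x \<Longrightarrow> u n x = 0" and B: "0 \<le> B"
    and L: "\<And>n. Lp_nn p (u n) \<le> ennreal B" and W: "\<And>n. frac_energy s p (u n) \<le> ennreal B"
  shows "\<exists>r :: nat \<Rightarrow> nat. strict_mono r \<and>
    (\<forall>e>0. \<exists>N. \<forall>m\<ge>N. \<forall>n\<ge>N. Lp_nn p (\<lambda>x. u (r m) x - u (r n) x) \<le> ennreal e)"
proof -
  define M where "M = measure lborel (ball (0::'a) R) + B"
  have ui: "integrable lborel (u n)" and uM: "(\<integral>x. \<bar>u n x\<bar> \<partial>lborel) \<le> M" for n
    using compactly_supported_integrable[OF u p supp L B] by (auto simp: M_def)
  have M0: "0 \<le> M" using B by (simp add: M_def)
  \<comment> \<open>The integrals over cells are indexed by grid level and cell instead of by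
    points: countably many indices, as the extraction of a subsequence demands.\<close>
  define I where "I n = (\<lambda>(m, k). \<integral>y. indicator {y. k = cell_index m y} y * u n y \<partial>lborel)" for n
  have Ib: "\<bar>\<integral>y. indicator {y. cell_index m x = cell_index m y} y * u n y \<partial>lborel\<bar> \<le> M" for m n x
  proof -
    have "\<bar>\<integral>y. indicator {y. cell_index m x = cell_index m y} y * u n y \<partial>lborel\<bar> \<le>
        (\<integral>y. \<bar>indicator {y. cell_index m x = cell_index m y} y * u n y\<bar> \<partial>lborel)" by (rule integral_abs_bound)
    also have "\<dots> \<le> (\<integral>y. \<bar>u n y\<bar> \<partial>lborel)"
      using ui integrable_mult_indicator[OF _ ui, of "{y. cell_index m x = cell_index m y}"]
      by (intro integral_mono) (auto split: split_indicator)
    finally show ?thesis using uM[of n] by simp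
  qed
  define S where "S = (\<Union>m. range (\<lambda>x::'a. (m, cell_index m x)))"
  have "countable S"
  proof -
    have "S \<subseteq> UNIV \<times> (Basis \<rightarrow>\<^sub>E UNIV)" by (auto simp: S_def cell_index_def)
    moreover have "countable ((UNIV :: nat set) \<times> ((Basis :: 'a set) \<rightarrow>\<^sub>E (UNIV :: int set)))"
      by (intro countable_SIGMA countable_PiE) auto
    ultimately show ?thesis by (rule countable_subset)
  qed
  moreover have "norm (I n z) \<le> M" if "z \<in> S" for n z using that Ib by (auto simp: S_def I_def)
  ultimately obtain r :: "nat \<Rightarrow> nat" where r: "strict_mono r" and conv: "\<And>z. z \<in> S \<Longrightarrow> \<exists>l. (\<lambda>n. I (r n) z) \<longlonglongrightarrow> l"
    using function_convergent_subsequence[of S I M] by blast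
  define w where "w m x = lim (\<lambda>n. cell_avg m (u (r n)) x)" for m x
  have lim: "(\<lambda>n. cell_avg m (u (r n)) x) \<longlonglongrightarrow> w m x" for m x
  proof -
    obtain l where "(\<lambda>n. I (r n) (m, cell_index m x)) \<longlonglongrightarrow> l" using conv[of "(m, cell_index m x)"] by (auto simp: S_def)
    then have "(\<lambda>n. cell_avg m (u (r n)) x) \<longlonglongrightarrow> (2 ^ m) ^ DIM('a) * l"
      unfolding cell_avg_def I_def by (auto intro!: tendsto_intros)
    then show ?thesis unfolding w_def by (metis limI)
  qed
  have [measurable]: "w m \<in> borel_measurable borel" for m
    unfolding w_def by (rule borel_measurable_lim_metric) measurable
  \<comment> \<open>A cell has diameter at most N, the value at m = 0. So the averages on all grids
    vanish off one ball, on which they are dominated by a constant.\<close>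
  have avg0: "cell_avg m (u n) x = 0" if "R + real DIM('a) \<le> norm x" for m n x
  proof -
    have "indicator {y. cell_index m x = cell_index m y} y * u n y = 0" for y
    proof (cases "cell_index m x = cell_index m y")
      case True
      have "norm (x - y) \<le> real DIM('a) / 2 ^ m" by (rule cell_index_eq_norm_le[OF True])
      also have "\<dots> \<le> real DIM('a)" by (simp add: divide_le_eq mult_le_cancel_left1)
      finally have "R \<le> norm y" using that norm_triangle_ineq2[of x y] by linarith
      then show ?thesis using supp by simp
    qed simp
    then show ?thesis unfolding cell_avg_def by (simp only: Bochner_Integration.integral_zero mult_zero_right)
  qed
  have avgM: "\<bar>cell_avg m (u n) x\<bar> \<le> (2 ^ m) ^ DIM('a) * M" for m n x
    unfolding cell_avg_def abs_mult using Ib by (intro mult_mono) auto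
  have dom: "(\<lambda>n. Lp_nn p (\<lambda>x. cell_avg m (u (r n)) x - w m x)) \<longlonglongrightarrow> 0" for m
  proof -
    let ?K = "2 * ((2 ^ m) ^ DIM('a) * M)"
    let ?U = "ball (0::'a) (R + real DIM('a))"
    have wM: "\<bar>w m x\<bar> \<le> (2 ^ m) ^ DIM('a) * M" for x
      using avgM by (intro tendsto_le[OF _ tendsto_const tendsto_rabs[OF lim]]) auto
    have w0: "w m x = 0" if "R + real DIM('a) \<le> norm x" for x
      using lim[of m x] avg0[OF that] by (simp add: LIMSEQ_const_iff)
    have "(\<lambda>n. \<integral>\<^sup>+x. ennreal (\<bar>cell_avg m (u (r n)) x - w m x\<bar> powr p) \<partial>lborel) \<longlonglongrightarrow> (\<integral>\<^sup>+x. 0 \<partial>(lborel :: 'a measure))"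
    proof (rule nn_integral_dominated_convergence[where w = "\<lambda>x. ennreal (?K powr p) * indicator ?U x"])
      have "(\<integral>\<^sup>+x. ennreal (?K powr p) * indicator ?U x \<partial>lborel) = ennreal (?K powr p) * emeasure lborel ?U"
        by (simp add: nn_integral_cmult_indicator)
      also have "\<dots> < \<infinity>" by (simp add: ennreal_mult_less_top emeasure_bounded_finite[OF bounded_ball, unfolded infinity_ennreal_def])
      finally show "(\<integral>\<^sup>+x. ennreal (?K powr p) * indicator ?U x \<partial>lborel) < \<infinity>" .
      have "ennreal (\<bar>cell_avg m (u (r n)) x - w m x\<bar> powr p) \<le> ennreal (?K powr p) * indicator ?U x" for n x
      proof (cases "x \<in> ?U")
        case True
        have "\<bar>cell_avg m (u (r n)) x - w m x\<bar> \<le> ?K" using avgM[of m "r n" x] wM[of x] by linarith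
        then show ?thesis using True p by (auto intro!: ennreal_leI powr_mono2)
      next
        case False
        then show ?thesis using avg0 w0 p by simp
      qed
      then show "AE x in lborel. ennreal (\<bar>cell_avg m (u (r n)) x - w m x\<bar> powr p) \<le> ennreal (?K powr p) * indicator ?U x" for n
        by (intro AE_I2)
      have "(\<lambda>n. \<bar>cell_avg m (u (r n)) x - w m x\<bar> powr p) \<longlonglongrightarrow> 0" for x
        using lim[of m x] p by (intro tendsto_eq_intros tendsto_powr2 | simp)+
      then show "AE x in lborel. (\<lambda>n. ennreal (\<bar>cell_avg m (u (r n)) x - w m x\<bar> powr p)) \<longlonglongrightarrow> 0"
        by (intro AE_I2) (metis ennreal_0 tendsto_ennrealI)
      have [measurable]: "cell_avg m (u (r n)) \<in> borel_measurable borel" for n by (rule cell_avg_measurable[OF u])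
      show "(\<lambda>x. ennreal (\<bar>cell_avg m (u (r n)) x - w m x\<bar> powr p)) \<in> borel_measurable lborel" for n by simp
      have U: "?U \<in> sets lborel" unfolding sets_lborel by (rule borel_open[OF open_ball])
      show "(\<lambda>x. ennreal (?K powr p) * indicator ?U x) \<in> borel_measurable lborel"
        by (rule borel_measurable_times_ennreal[OF borel_measurable_const borel_measurable_indicator[OF U]])
    qed simp
    then show ?thesis by (simp add: Lp_nn_def)
  qed
  define K where "K = real DIM('a) powr (real DIM('a) + s * p)"
  have K: "0 < K" by (simp add: K_def)
  have "\<exists>N. \<forall>i\<ge>N. \<forall>j\<ge>N. Lp_nn p (\<lambda>x. u (r i) x - u (r j) x) \<le> ennreal e" if e: "0 < e" for e
  proof -
    \<comment> \<open>Two triangle inequalities for p-th powers, each with a factor 2^p and two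
      summands.\<close>
    define d where "d = e / (4 * (2 powr p * 2 powr p))"
    have d: "0 < d" using e by (simp add: d_def)
    obtain m where m: "(2 powr (- (s * p))) ^ m < d / (K * (B + 1))"
      using real_arch_pow_inv[of "d / (K * (B + 1))" "2 powr (- (s * p))"] powr_less_mono[of "- (s * p)" 0 2] d K B s p by auto
    have err: "Lp_nn p (\<lambda>x. u n x - cell_avg m (u n) x) \<le> ennreal d" for n
    proof -
      have "Lp_nn p (\<lambda>x. u n x - cell_avg m (u n) x) \<le> ennreal (K * (2 powr (- (s * p))) ^ m) * frac_energy s p (u n)"
        unfolding K_def by (rule cell_avg_error[OF ui p s])
      also have "\<dots> \<le> ennreal (K * (2 powr (- (s * p))) ^ m) * ennreal B" by (intro mult_left_mono W) auto
      also have "\<dots> = ennreal (K * (2 powr (- (s * p))) ^ m * B)" using K B by (simp add: ennreal_mult')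
      also have "\<dots> \<le> ennreal d"
      proof (rule ennreal_leI)
        have "(2 powr (- (s * p))) ^ m * (K * B) \<le> d / (K * (B + 1)) * (K * (B + 1))"
          using m K B d by (intro mult_mono) auto
        also have "\<dots> = d" using K B by simp
        finally show "K * (2 powr (- (s * p))) ^ m * B \<le> d" by (simp add: mult_ac)
      qed
      finally show ?thesis .
    qed
    have "eventually (\<lambda>n. Lp_nn p (\<lambda>x. cell_avg m (u (r n)) x - w m x) < ennreal d) sequentially"
      using order_tendstoD(2)[OF dom[of m], of "ennreal d"] d by simp
    then obtain N where N: "\<And>n. n \<ge> N \<Longrightarrow> Lp_nn p (\<lambda>x. cell_avg m (u (r n)) x - w m x) \<le> ennreal d"
      unfolding eventually_sequentially by (auto intro: less_imp_le)
    have half: "Lp_nn p (\<lambda>x. u (r n) x - w m x) \<le> ennreal (2 powr p * (2 * d))" if "n \<ge> N" for n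
    proof -
      have "Lp_nn p (\<lambda>x. (u (r n) x - cell_avg m (u (r n)) x) + (cell_avg m (u (r n)) x - w m x)) \<le>
          ennreal (2 powr p) * (Lp_nn p (\<lambda>x. u (r n) x - cell_avg m (u (r n)) x) + Lp_nn p (\<lambda>x. cell_avg m (u (r n)) x - w m x))"
        using p by (intro Lp_nn_add_le) auto
      also have "\<dots> \<le> ennreal (2 powr p) * (ennreal d + ennreal d)"
        using err N[OF that] by (intro mult_left_mono add_mono) auto
      also have "\<dots> = ennreal (2 powr p * (2 * d))" using d by (simp flip: ennreal_plus ennreal_mult')
      finally show ?thesis by simp
    qed
    have "Lp_nn p (\<lambda>x. u (r i) x - u (r j) x) \<le> ennreal e" if ij: "i \<ge> N" "j \<ge> N" for i j
    proof -
      have "Lp_nn p (\<lambda>x. (u (r i) x - w m x) + (w m x - u (r j) x)) \<le>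
          ennreal (2 powr p) * (Lp_nn p (\<lambda>x. u (r i) x - w m x) + Lp_nn p (\<lambda>x. w m x - u (r j) x))"
        using p by (intro Lp_nn_add_le) auto
      also have "Lp_nn p (\<lambda>x. w m x - u (r j) x) = Lp_nn p (\<lambda>x. u (r j) x - w m x)"
        by (simp add: Lp_nn_def abs_minus_commute)
      also have "ennreal (2 powr p) * (Lp_nn p (\<lambda>x. u (r i) x - w m x) + Lp_nn p (\<lambda>x. u (r j) x - w m x)) \<le>
          ennreal (2 powr p) * (ennreal (2 powr p * (2 * d)) + ennreal (2 powr p * (2 * d)))"
        using half ij by (intro mult_left_mono add_mono) auto
      also have "\<dots> = ennreal (2 powr p * (4 * (2 powr p * d)))" using d by (simp flip: ennreal_plus ennreal_mult')
      also have "2 powr p * (4 * (2 powr p * d)) = e" by (simp add: d_def)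
      finally show ?thesis by simp
    qed
    then show ?thesis by blast
  qed
  then show ?thesis using r by blast
qed

section \<open>Smooth functions and bump functions\<close>

lemma Ck_on_Suc_imp: "Ck_on (Suc k) f UNIV \<Longrightarrow> Ck_on k f UNIV"
proof (induction k arbitrary: f)
  case 0
  then show ?case by (auto intro: differentiable_imp_continuous_on)
next
  case (Suc k)
  then show ?case by auto
qed

lemma Ck_on_const: "Ck_on k (\<lambda>x. c) UNIV"
  by (induction k arbitrary: c) (auto simp: frechet_derivative_const)

lemma frechet_derivative_plus_at:
  fixes f g :: "'a::euclidean_space \<Rightarrow> real"
  assumes "f differentiable at x" "g differentiable at x"
  shows "frechet_derivative (\<lambda>x. f x + g x) (at x) i = frechet_derivative f (at x) i + frechet_derivative g (at x) i"
proof -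
  have "((\<lambda>x. f x + g x) has_derivative (\<lambda>h. frechet_derivative f (at x) h + frechet_derivative g (at x) h)) (at x)"
    using assms by (intro has_derivative_add) (auto simp: frechet_derivative_works)
  from frechet_derivative_at[OF this, symmetric] show ?thesis by simp
qed

lemma frechet_derivative_mult_at:
  fixes f g :: "'a::euclidean_space \<Rightarrow> real"
  assumes "f differentiable at x" "g differentiable at x"
  shows "frechet_derivative (\<lambda>x. f x * g x) (at x) i = f x * frechet_derivative g (at x) i + frechet_derivative f (at x) i * g x"
proof -
  have "((\<lambda>x. f x * g x) has_derivative (\<lambda>h. f x * frechet_derivative g (at x) h + frechet_derivative f (at x) h * g x)) (at x)"
    using assms by (intro has_derivative_mult) (auto simp: frechet_derivative_works)
  from frechet_derivative_at[OF this, symmetric] show ?thesis by simp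
qed

lemma Ck_on_add: "Ck_on k f UNIV \<Longrightarrow> Ck_on k g UNIV \<Longrightarrow> Ck_on k (\<lambda>x. f x + g x) UNIV"
proof (induction k arbitrary: f g)
  case (Suc k)
  then have d: "f differentiable at x" "g differentiable at x" for x
    by (auto simp: differentiable_on_def)
  show ?case using Suc d by (auto simp: frechet_derivative_plus_at differentiable_on_def intro!: differentiable_add)
qed (auto intro: continuous_intros)

lemma Ck_on_mult: "Ck_on k f UNIV \<Longrightarrow> Ck_on k g UNIV \<Longrightarrow> Ck_on k (\<lambda>x. f x * g x) UNIV"
proof (induction k arbitrary: f g)
  case (Suc k)
  then have d: "f differentiable at x" "g differentiable at x" for x
    by (auto simp: differentiable_on_def)
  have m: "Ck_on k f UNIV" "Ck_on k g UNIV" using Suc.prems by (auto intro: Ck_on_Suc_imp)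
  show ?case using Suc m d
    by (auto simp: frechet_derivative_mult_at differentiable_on_def intro!: differentiable_mult Ck_on_add)
qed (auto intro: continuous_intros)

lemma Ck_on_prod: "finite I \<Longrightarrow> (\<And>i. i \<in> I \<Longrightarrow> Ck_on k (f i) UNIV) \<Longrightarrow> Ck_on k (\<lambda>x. \<Prod>i\<in>I. f i x) UNIV"
  by (induction I rule: finite_induct) (auto simp: Ck_on_const intro!: Ck_on_mult)

lemma Ck_on_translation: "Ck_on k f UNIV \<Longrightarrow> Ck_on k (\<lambda>x. f (x + c)) UNIV"
proof (induction k arbitrary: f)
  case 0
  then show ?case by (auto intro!: continuous_on_compose2[of UNIV f] continuous_intros)
next
  case (Suc k)
  have D: "((\<lambda>x. f (x + c)) has_derivative frechet_derivative f (at (x + c))) (at x)" for x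
  proof -
    have "f differentiable at (x + c)" using Suc.prems by (auto simp: differentiable_on_def)
    then have "(f has_derivative frechet_derivative f (at (x + c))) (at (x + c))" by (simp add: frechet_derivative_works)
    then have "((f \<circ> (\<lambda>x. x + c)) has_derivative (frechet_derivative f (at (x + c)) \<circ> (\<lambda>h. h))) (at x)"
      by (intro diff_chain_at) (auto intro!: derivative_eq_intros)
    then show ?thesis by (simp add: o_def)
  qed
  have eq: "frechet_derivative (\<lambda>x. f (x + c)) (at x) = frechet_derivative f (at (x + c))" for x
    using frechet_derivative_at[OF D] by simp
  have "(\<lambda>x. f (x + c)) differentiable_on UNIV"
    using D by (auto simp: differentiable_on_def differentiable_def)
  then show ?case using Suc by (auto simp: eq)
qed

lemma smooth_const: "smooth (\<lambda>x. k)"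
  and smooth_add: "smooth f \<Longrightarrow> smooth g \<Longrightarrow> smooth (\<lambda>x. f x + g x)"
  and smooth_mult: "smooth f \<Longrightarrow> smooth g \<Longrightarrow> smooth (\<lambda>x. f x * g x)"
  and smooth_translation: "smooth f \<Longrightarrow> smooth (\<lambda>x. f (x + c))"
  by (auto simp: smooth_def Ck_on_const Ck_on_add Ck_on_mult Ck_on_translation)

lemma smooth_partial:
  assumes "smooth f" "i \<in> Basis"
  shows "smooth (\<lambda>x. frechet_derivative f (at x) i)"
  unfolding smooth_def
proof
  fix k
  have "Ck_on (Suc k) f UNIV" using assms by (simp add: smooth_def)
  then show "Ck_on k (\<lambda>x. frechet_derivative f (at x) i) UNIV" using assms by simp
qed

lemma smooth_differentiable: "smooth f \<Longrightarrow> f differentiable at x"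
  unfolding smooth_def by (drule spec[of _ "Suc 0"]) (auto simp: differentiable_on_def)

lemma smooth_continuous: "smooth f \<Longrightarrow> continuous_on UNIV f"
  unfolding smooth_def by (drule spec[of _ 0]) auto

lemma smooth_borel: "smooth f \<Longrightarrow> f \<in> borel_measurable borel"
  by (rule borel_measurable_continuous_onI[OF smooth_continuous])

section \<open>Bump functions on boxes\<close>

definition exp_flat :: "nat \<Rightarrow> real \<Rightarrow> real" where
  "exp_flat n t = (if 0 < t then exp (- (1 / t)) / t ^ n else 0)"

text \<open>The term of order n + 2 in the series of exp (1/t) gives the factorial and the decay
  t^2, which makes the difference quotient at 0 tend to 0.\<close>

lemma exp_flat_bound:
  assumes "0 < t"
  shows "exp_flat n t \<le> fact (n + 2) * t\<^sup>2"
proof -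
  have "(1 / t) ^ (n + 2) / fact (n + 2) \<le> exp (1 / t)"
  proof -
    have "(\<lambda>k. (1 / t) ^ k /\<^sub>R fact k) sums exp (1 / t)" by (rule exp_converges)
    then have "sum (\<lambda>k. (1 / t) ^ k /\<^sub>R fact k) {n + 2} \<le> exp (1 / t)"
      unfolding sums_iff using assms
      by (metis (no_types, lifting) sum_le_suminf finite.emptyI finite.insertI scaleR_nonneg_nonneg
          inverse_nonnegative_iff_nonnegative fact_ge_zero zero_le_power zero_le_divide_1_iff less_imp_le)
    then show ?thesis by (simp add: scaleR_conv_of_real divide_inverse mult.commute)
  qed
  then have "inverse (exp (1 / t)) \<le> inverse ((1 / t) ^ (n + 2) / fact (n + 2))"
    using assms by (intro le_imp_inverse_le) auto
  also have "\<dots> = fact (n + 2) * t\<^sup>2 * t ^ n"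
    using assms by (simp add: power_divide power_add power2_eq_square field_simps)
  finally show ?thesis using assms by (simp add: exp_flat_def exp_minus pos_divide_le_eq mult_ac)
qed

lemma exp_flat_nonneg: "0 \<le> exp_flat n t"
  by (simp add: exp_flat_def)

text \<open>The reason for the parameter n: the family is closed under differentiation up to linear
  combinations, so that smoothness follows by induction on the order.\<close>

lemma exp_flat_has_derivative:
  "(exp_flat n has_real_derivative exp_flat (n + 2) t - real n * exp_flat (n + 1) t) (at t)"
proof -
  consider "t < 0" | "t = 0" | "0 < t" by linarith
  then show ?thesis
  proof cases
    case 1
    have "((\<lambda>x. 0) has_real_derivative 0) (at t)" by simp
    then have "(exp_flat n has_real_derivative 0) (at t)"
      by (rule has_field_derivative_transform_within_open[where S = "{..<0}"]) (use 1 in \<open>auto simp: exp_flat_def\<close>)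
    then show ?thesis using 1 by (simp add: exp_flat_def)
  next
    case 2
    have "((\<lambda>h. exp_flat n h / h) \<longlongrightarrow> 0) (at 0)"
    proof (rule Lim_null_comparison)
      have "norm (exp_flat n h / h) \<le> fact (n + 2) * \<bar>h\<bar>" if "h \<noteq> 0" for h
      proof (cases "0 < h")
        case True
        then show ?thesis using exp_flat_bound[OF True, of n] exp_flat_nonneg[of n h]
          by (simp add: field_simps power2_eq_square)
      next
        case False
        then have "norm (exp_flat n h / h) = 0" by (simp add: exp_flat_def)
        moreover have "0 \<le> fact (n + 2) * \<bar>h\<bar>" by (intro mult_nonneg_nonneg) auto
        ultimately show ?thesis by linarith
      qed
      then show "\<forall>\<^sub>F h in at 0. norm (exp_flat n h / h) \<le> fact (n + 2) * \<bar>h\<bar>"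
        by (auto simp: eventually_at_filter)
      show "((\<lambda>h. fact (n + 2) * \<bar>h\<bar>) \<longlongrightarrow> (0::real)) (at 0)"
        by (auto intro!: tendsto_eq_intros)
    qed
    then show ?thesis using 2 by (simp add: DERIV_def exp_flat_def)
  next
    case 3
    have "((\<lambda>x. exp (- (1 / x)) / x ^ n) has_real_derivative
        (exp (- (1 / t)) * (1 / t\<^sup>2) * t ^ n - exp (- (1 / t)) * (real n * t ^ (n - 1))) / (t ^ n * t ^ n)) (at t)"
      using 3 by (auto intro!: derivative_eq_intros simp: power2_eq_square)
    also have "(exp (- (1 / t)) * (1 / t\<^sup>2) * t ^ n - exp (- (1 / t)) * (real n * t ^ (n - 1))) / (t ^ n * t ^ n) =
        exp_flat (n + 2) t - real n * exp_flat (n + 1) t"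
      using 3 by (cases n) (auto simp: exp_flat_def field_simps power2_eq_square)
    finally show ?thesis
      by (rule has_field_derivative_transform_within_open[where S = "{0<..}"]) (use 3 in \<open>auto simp: exp_flat_def\<close>)
  qed
qed

lemma Ck_on_exp_flat: "Ck_on k (\<lambda>x :: 'a::euclidean_space. exp_flat n (c * (x \<bullet> i) + d)) UNIV"
proof (induction k arbitrary: n)
  case 0
  have "continuous_on UNIV (exp_flat n)"
    using exp_flat_has_derivative by (intro continuous_at_imp_continuous_on) (auto intro: DERIV_isCont)
  then show ?case by (auto intro!: continuous_on_compose2[of UNIV "exp_flat n"] continuous_intros)
next
  case (Suc k)
  have D: "((\<lambda>x. exp_flat n (c * (x \<bullet> i) + d)) has_derivative
      (\<lambda>h. (exp_flat (n + 2) (c * (x \<bullet> i) + d) - real n * exp_flat (n + 1) (c * (x \<bullet> i) + d)) * (c * (h \<bullet> i)))) (at x)" for x :: 'a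
  proof -
    have "((\<lambda>x. c * (x \<bullet> i) + d) has_derivative (\<lambda>h. c * (h \<bullet> i))) (at x)"
      by (auto intro!: derivative_eq_intros)
    from DERIV_compose_FDERIV[OF exp_flat_has_derivative this, of n] show ?thesis by (simp only: mult.commute)
  qed
  have eq: "frechet_derivative (\<lambda>x. exp_flat n (c * (x \<bullet> i) + d)) (at x) j =
      (c * (j \<bullet> i)) * exp_flat (n + 2) (c * (x \<bullet> i) + d) + (- (real n * (c * (j \<bullet> i)))) * exp_flat (n + 1) (c * (x \<bullet> i) + d)" for x j :: 'a
    unfolding frechet_derivative_at[OF D, symmetric] by (simp add: algebra_simps)
  have "(\<lambda>x :: 'a. exp_flat n (c * (x \<bullet> i) + d)) differentiable_on UNIV"
    using D by (auto simp: differentiable_on_def differentiable_def)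
  moreover have "Ck_on k (\<lambda>x. (c * (j \<bullet> i)) * exp_flat (n + 2) (c * (x \<bullet> i) + d) +
      (- (real n * (c * (j \<bullet> i)))) * exp_flat (n + 1) (c * (x \<bullet> i) + d)) UNIV" for j :: 'a
    by (intro Ck_on_add Ck_on_mult Ck_on_const Suc)
  ultimately show ?case by (simp add: eq)
qed

text \<open>With growing n the slopes increase while the support stays the same, so the bumps tend
  to the indicator of the box without ever leaving it.\<close>

definition box_bump :: "'a::euclidean_space \<Rightarrow> 'a \<Rightarrow> nat \<Rightarrow> 'a \<Rightarrow> real" where
  "box_bump a b n x = (\<Prod>i\<in>Basis. exp_flat 0 (real (Suc n) * (x \<bullet> i) - real (Suc n) * (a \<bullet> i)) *
     exp_flat 0 (real (Suc n) * (b \<bullet> i) - real (Suc n) * (x \<bullet> i)))"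

lemma box_bump_zero: "x \<notin> box a b \<Longrightarrow> box_bump a b n x = 0"
  unfolding box_bump_def mem_box
  by (auto simp: exp_flat_def right_diff_distrib[symmetric] zero_less_mult_iff intro!: prod_zero)

lemma box_bump_bounds: "0 \<le> box_bump a b n x" "box_bump a b n x \<le> 1"
proof -
  have *: "exp_flat 0 t \<le> 1" for t by (simp add: exp_flat_def)
  show "0 \<le> box_bump a b n x" unfolding box_bump_def by (intro prod_nonneg mult_nonneg_nonneg ballI exp_flat_nonneg)
  show "box_bump a b n x \<le> 1" unfolding box_bump_def
    by (intro prod_le_1) (auto intro!: mult_le_one * exp_flat_nonneg mult_nonneg_nonneg)
qed

lemma box_bump_tendsto: "(\<lambda>n. box_bump a b n x) \<longlonglongrightarrow> indicator (box a b) x"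
proof (cases "x \<in> box a b")
  case True
  have e: "(\<lambda>n. exp_flat 0 (real (Suc n) * s - real (Suc n) * t)) \<longlonglongrightarrow> 1" if "t < s" for s t
  proof -
    have "(\<lambda>n. exp (- (1 / (s - t)) * inverse (real (Suc n)))) \<longlonglongrightarrow> exp (- (1 / (s - t)) * 0)"
      by (intro tendsto_intros LIMSEQ_inverse_real_of_nat)
    moreover have "exp_flat 0 (real (Suc n) * s - real (Suc n) * t) = exp (- (1 / (s - t)) * inverse (real (Suc n)))" for n
    proof -
      have "real (Suc n) * s - real (Suc n) * t = real (Suc n) * (s - t)" by (simp only: right_diff_distrib)
      moreover have "0 < real (Suc n) * (s - t)" using that by simp
      moreover have "1 / (real (Suc n) * (s - t)) = 1 / (s - t) * inverse (real (Suc n))" by (simp add: divide_inverse mult.commute)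
      ultimately show ?thesis by (simp only: exp_flat_def if_True power_0 div_by_1 mult_minus_left)
    qed
    ultimately show ?thesis by simp
  qed
  have "(\<lambda>n. box_bump a b n x) \<longlonglongrightarrow> (\<Prod>i\<in>(Basis :: 'a set). 1 * 1)"
    unfolding box_bump_def using True by (intro tendsto_prod tendsto_mult e) (auto simp: mem_box)
  then show ?thesis using True by simp
qed (simp add: box_bump_zero)

lemma box_bump_test_function:
  assumes "cbox a b \<subseteq> \<Omega>"
  shows "test_function \<Omega> (box_bump a b n)"
proof -
  have "Ck_on k (box_bump a b n) UNIV" for k
  proof -
    have "Ck_on k (\<lambda>x. \<Prod>i\<in>Basis. exp_flat 0 (real (Suc n) * (x \<bullet> i) + (- (real (Suc n) * (a \<bullet> i)))) *
       exp_flat 0 ((- real (Suc n)) * (x \<bullet> i) + real (Suc n) * (b \<bullet> i))) UNIV"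
      by (intro Ck_on_prod Ck_on_mult Ck_on_exp_flat) auto
    then show ?thesis by (simp add: box_bump_def[abs_def] add.commute del: of_nat_Suc)
  qed
  moreover have "closure {x. box_bump a b n x \<noteq> 0} \<subseteq> cbox a b"
    using box_bump_zero[of _ a b n] box_subset_cbox[of a b] by (intro closure_minimal) auto
  moreover have "bounded {x. box_bump a b n x \<noteq> 0}"
    using box_bump_zero[of _ a b n] by (intro bounded_subset[OF bounded_box[of a b]]) auto
  ultimately show ?thesis
    using assms unfolding test_function_def smooth_def by (auto simp: compact_closure)
qed

section \<open>The fundamental lemma of the calculus of variations\<close>

text \<open>The positive and the negative part of f are densities of two finite measures. These
  agree on boxes, a generator of the Borel sets stable under intersection, hence everywhere, and so
  do the densities up to a null set.\<close>

lemma integral_boxes_zero_imp_AE_zero: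
  fixes f :: "'a::euclidean_space \<Rightarrow> real"
  assumes f: "integrable lborel f" and z: "\<And>a b. (\<integral>x. indicator (box a b) x * f x \<partial>lborel) = 0"
  shows "AE x in lborel. f x = 0"
proof -
  have [measurable]: "f \<in> borel_measurable borel" using f by simp
  define P where "P x = ennreal (f x)" for x
  define M where "M x = ennreal (- f x)" for x
  have [measurable]: "P \<in> borel_measurable borel" "M \<in> borel_measurable borel" unfolding P_def M_def by measurable
  have fin: "(\<integral>\<^sup>+x. P x \<partial>lborel) < \<infinity>" "(\<integral>\<^sup>+x. M x \<partial>lborel) < \<infinity>"
    using f unfolding P_def M_def real_integrable_def by (auto simp: top.not_eq_extremum)
  have boxeq: "(\<integral>\<^sup>+x. P x * indicator (box a b) x \<partial>lborel) = (\<integral>\<^sup>+x. M x * indicator (box a b) x \<partial>lborel)" for a b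
  proof -
    have i: "integrable lborel (\<lambda>x. indicator (box a b) x * f x)"
      using integrable_mult_indicator[OF _ f, of "box a b"] by simp
    have e: "(\<integral>\<^sup>+x. ennreal (indicator (box a b) x * f x) \<partial>lborel) = (\<integral>\<^sup>+x. P x * indicator (box a b) x \<partial>lborel)"
      "(\<integral>\<^sup>+x. ennreal (- (indicator (box a b) x * f x)) \<partial>lborel) = (\<integral>\<^sup>+x. M x * indicator (box a b) x \<partial>lborel)"
      unfolding P_def M_def by (auto intro!: nn_integral_cong split: split_indicator)
    have "enn2real (\<integral>\<^sup>+x. P x * indicator (box a b) x \<partial>lborel) = enn2real (\<integral>\<^sup>+x. M x * indicator (box a b) x \<partial>lborel)"
      using z[of a b] real_lebesgue_integral_def[OF i] e by simp
    moreover have "(\<integral>\<^sup>+x. P x * indicator (box a b) x \<partial>lborel) \<le> (\<integral>\<^sup>+x. P x \<partial>lborel)"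
      "(\<integral>\<^sup>+x. M x * indicator (box a b) x \<partial>lborel) \<le> (\<integral>\<^sup>+x. M x \<partial>lborel)"
      by (auto intro!: nn_integral_mono split: split_indicator)
    ultimately show ?thesis using fin by (metis ennreal_enn2real le_less_trans infinity_ennreal_def)
  qed
  have "density lborel P = density lborel M"
  proof (rule measure_eqI_generator_eq[where E = "range (\<lambda>(a, b). box a b)" and \<Omega> = UNIV
        and A = "\<lambda>n. box (- (real n *\<^sub>R One)) (real n *\<^sub>R One)"])
    show "Int_stable (range (\<lambda>(a, b). box a b :: 'a set))"
      by (auto simp: Int_stable_def box_Int_box)
    show "emeasure (density lborel P) X = emeasure (density lborel M) X" if "X \<in> range (\<lambda>(a, b). box a b)" for X
      using that boxeq by (auto simp: emeasure_density)
    show "sets (density lborel P) = sigma_sets UNIV (range (\<lambda>(a, b). box a b))"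
      "sets (density lborel M) = sigma_sets UNIV (range (\<lambda>(a, b). box a b))"
      by (simp_all add: borel_eq_box)
    show "(\<Union>n. box (- (real n *\<^sub>R One)) (real n *\<^sub>R One)) = (UNIV :: 'a set)"
      by (rule UN_box_eq_UNIV)
    show "emeasure (density lborel P) (box (- (real n *\<^sub>R One)) (real n *\<^sub>R One)) \<noteq> \<infinity>" for n
    proof -
      have "emeasure (density lborel P) (box (- (real n *\<^sub>R One)) (real n *\<^sub>R One)) \<le> (\<integral>\<^sup>+x. P x \<partial>lborel)"
        by (auto simp: emeasure_density intro!: nn_integral_mono split: split_indicator)
      then show ?thesis using fin by (auto simp: top_unique)
    qed
  qed auto
  then have "AE x in lborel. P x = M x"
    using fin by (intro finite_density_unique[THEN iffD1]) auto
  then show ?thesis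
  proof eventually_elim
    fix x assume "P x = M x"
    then show "f x = 0" unfolding P_def M_def
      by (cases "0 \<le> f x") (auto simp: ennreal_neg ennreal_eq_0_iff)
  qed
qed

lemma lebesgue_boxes_zero_imp_AE_zero:
  fixes f :: "'a::euclidean_space \<Rightarrow> real"
  assumes f: "integrable lebesgue f" and z: "\<And>a b. (\<integral>x. indicator (box a b) x * f x \<partial>lebesgue) = 0"
  shows "AE x in lebesgue. f x = 0"
proof -
  obtain f' where f'[measurable]: "f' \<in> borel_measurable lborel" and eq: "AE x in lborel. f x = f' x"
    using completion_ex_borel_measurable_real[of f lborel] f by auto
  have eq': "AE x in lebesgue. f x = f' x" using eq by (rule AE_completion)
  have [measurable]: "f \<in> borel_measurable lebesgue" using f by simp
  have f'l: "f' \<in> borel_measurable lebesgue" using f' by (simp add: measurable_completion)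
  have "integrable lebesgue f'" using integrable_cong_AE[OF _ f'l eq'] f by simp
  then have "integrable lborel f'" by (simp add: integrable_completion)
  moreover have "(\<integral>x. indicator (box a b) x * f' x \<partial>lborel) = 0" for a b
  proof -
    have "(\<integral>x. indicator (box a b) x * f' x \<partial>lborel) = (\<integral>x. indicator (box a b) x * f' x \<partial>lebesgue)"
      by (rule integral_completion[symmetric]) measurable
    also have "\<dots> = (\<integral>x. indicator (box a b) x * f x \<partial>lebesgue)"
    proof (rule integral_cong_AE)
      show "(\<lambda>x. indicator (box a b) x * f' x) \<in> borel_measurable lebesgue"
        by (rule borel_measurable_times[OF borel_measurable_indicator f'l]) auto
      show "(\<lambda>x. indicator (box a b) x * f x) \<in> borel_measurable lebesgue"
        by (rule borel_measurable_times[OF borel_measurable_indicator \<open>f \<in> _\<close>]) auto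
      show "AE x in lebesgue. indicator (box a b) x * f' x = indicator (box a b) x * f x"
        using eq' by eventually_elim simp
    qed
    finally show ?thesis using z by simp
  qed
  ultimately have "AE x in lborel. f' x = 0" by (rule integral_boxes_zero_imp_AE_zero)
  then have "AE x in lebesgue. f' x = 0" by (rule AE_completion)
  then show ?thesis using eq' by eventually_elim simp
qed

text \<open>Bumps tend boundedly to indicators of boxes, so the integral of g over a box vanishes if
  the closed box lies in \<Omega>. As g is only locally integrable, the previous lemma is applied to
  g cut off to one closed box; countably many of these fill \<Omega>.\<close>

lemma test_functions_zero_imp_AE_zero:
  fixes g :: "'a::euclidean_space \<Rightarrow> real"
  assumes \<Omega>: "open \<Omega>" and g: "\<And>K. compact K \<Longrightarrow> K \<subseteq> \<Omega> \<Longrightarrow> set_integrable lebesgue K g"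
    and z: "\<And>\<phi>. test_function \<Omega> \<phi> \<Longrightarrow> (\<integral>x. g x * \<phi> x \<partial>lebesgue) = 0"
  shows "AE x in lebesgue. x \<in> \<Omega> \<longrightarrow> g x = 0"
proof -
  have bx: "(\<integral>x. indicator (box a b) x * g x \<partial>lebesgue) = 0" if ab: "cbox a b \<subseteq> \<Omega>" for a b
  proof -
    have gi: "integrable lebesgue (\<lambda>x. indicator (cbox a b) x * g x)"
      using g[OF compact_cbox ab] by (simp add: set_integrable_def)
    have gm: "(\<lambda>x. indicator (cbox a b) x * g x) \<in> borel_measurable lebesgue" using gi by simp
    have ind: "indicator (cbox a b) x * g x * box_bump a b n x = g x * box_bump a b n x" for n x
      using box_bump_zero[of x a b n] box_subset_cbox[of a b] by (auto split: split_indicator)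
    have ind2: "indicator (cbox a b) x * g x * indicator (box a b) x = indicator (box a b) x * g x" for x
      using box_subset_cbox[of a b] by (auto split: split_indicator)
    have "(\<lambda>n. \<integral>x. indicator (cbox a b) x * g x * box_bump a b n x \<partial>lebesgue) \<longlonglongrightarrow>
        (\<integral>x. indicator (cbox a b) x * g x * indicator (box a b) x \<partial>lebesgue)"
    proof (rule integral_dominated_convergence[where w = "\<lambda>x. norm (indicator (cbox a b) x * g x)"])
      show "(\<lambda>x. indicator (cbox a b) x * g x * indicator (box a b) x) \<in> borel_measurable lebesgue"
        by (rule borel_measurable_times[OF gm borel_measurable_indicator]) auto
      have "box_bump a b n \<in> borel_measurable lebesgue" for n
        using box_bump_test_function[OF ab, of n] smooth_borel[of "box_bump a b n"]
        by (auto simp: test_function_def intro: measurable_completion)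
      then show "(\<lambda>x. indicator (cbox a b) x * g x * box_bump a b n x) \<in> borel_measurable lebesgue" for n
        by (rule borel_measurable_times[OF gm])
      show "integrable lebesgue (\<lambda>x. norm (indicator (cbox a b) x * g x))" using gi by (rule integrable_norm)
      show "AE x in lebesgue. (\<lambda>n. indicator (cbox a b) x * g x * box_bump a b n x) \<longlonglongrightarrow> indicator (cbox a b) x * g x * indicator (box a b) x"
        by (intro AE_I2 tendsto_intros box_bump_tendsto)
      show "AE x in lebesgue. norm (indicator (cbox a b) x * g x * box_bump a b n x) \<le> norm (indicator (cbox a b) x * g x)" for n
        using box_bump_bounds[of a b n]
        by (intro AE_I2) (auto simp: abs_mult intro!: mult_left_le)
    qed
    then show ?thesis using z[OF box_bump_test_function[OF ab]] unfolding ind ind2 by (simp add: LIMSEQ_const_iff)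
  qed
  have cb: "AE x in lebesgue. x \<in> cbox c d \<longrightarrow> g x = 0" if cd: "cbox c d \<subseteq> \<Omega>" for c d
  proof -
    have gi: "integrable lebesgue (\<lambda>x. indicator (cbox c d) x * g x)"
      using g[OF compact_cbox cd] by (simp add: set_integrable_def)
    have "AE x in lebesgue. indicator (cbox c d) x * g x = 0"
    proof (rule lebesgue_boxes_zero_imp_AE_zero[OF gi])
      fix a b :: 'a
      \<comment> \<open>Boxes are stable under intersection, so \<open>bx\<close> also covers test
        boxes that stick out of the cut-off box. Open and closed boxes differ by a null set.\<close>
      obtain a' b' where ab': "box c d \<inter> box a b = box a' b'" "cbox c d \<inter> cbox a b = cbox a' b'"
        by (simp add: box_Int_box Int_interval)
      have "AE x in lebesgue. x \<notin> cbox c d - box c d"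
      proof -
        have "negligible (cbox c d - box c d)" by (rule negligible_frontier_interval)
        then show ?thesis by (intro AE_not_in) (simp add: negligible_iff_null_sets)
      qed
      then have "(\<integral>x. indicator (box a b) x * (indicator (cbox c d) x * g x) \<partial>lebesgue) = (\<integral>x. indicator (box a' b') x * g x \<partial>lebesgue)"
      proof (intro integral_cong_AE)
        show m: "(\<lambda>x. indicator (box a b) x * (indicator (cbox c d) x * g x)) \<in> borel_measurable lebesgue"
          by (rule borel_measurable_times[OF borel_measurable_indicator borel_measurable_integrable[OF gi]]) auto
        have "(\<lambda>x. indicator (box c d \<inter> box a b) x * (indicator (cbox c d) x * g x)) \<in> borel_measurable lebesgue"
          by (rule borel_measurable_times[OF borel_measurable_indicator borel_measurable_integrable[OF gi]]) auto
        moreover have "(\<lambda>x. indicator (box c d \<inter> box a b) x * (indicator (cbox c d) x * g x)) = (\<lambda>x. indicator (box a' b') x * g x)"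
          unfolding ab'(1)[symmetric] using box_subset_cbox[of c d] by (auto simp: fun_eq_iff split: split_indicator)
        ultimately show "(\<lambda>x. indicator (box a' b') x * g x) \<in> borel_measurable lebesgue" by simp
        show "AE x in lebesgue. indicator (box a b) x * (indicator (cbox c d) x * g x) = indicator (box a' b') x * g x"
          using \<open>AE x in lebesgue. x \<notin> cbox c d - box c d\<close>
          unfolding ab'(1)[symmetric]
          by eventually_elim (use box_subset_cbox[of c d] in \<open>auto split: split_indicator\<close>)
      qed
      also have "\<dots> = 0" using ab'(2) cd by (intro bx) auto
      finally show "(\<integral>x. indicator (box a b) x * (indicator (cbox c d) x * g x) \<partial>lebesgue) = 0" .
    qed
    then show ?thesis by eventually_elim (auto split: split_indicator_asm)
  qed
  obtain \<D> where D: "countable \<D>" "\<And>X. X \<in> \<D> \<Longrightarrow> X \<subseteq> \<Omega>" "\<And>X. X \<in> \<D> \<Longrightarrow> \<exists>a b. X = cbox a b" "\<Union>\<D> = \<Omega>"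
    using open_countable_Union_open_cbox[OF \<Omega>] by (metis PowD subsetD)
  have "AE x in lebesgue. \<forall>X\<in>\<D>. x \<in> X \<longrightarrow> g x = 0"
    using D cb by (subst AE_ball_countable) (auto, metis)
  then show ?thesis using D(4) by (auto elim!: eventually_mono)
qed

section \<open>Weak gradients\<close>

definition grad :: "('a::euclidean_space \<Rightarrow> real) \<Rightarrow> 'a \<Rightarrow> 'a" where
  "grad f x = (\<Sum>i\<in>Basis. frechet_derivative f (at x) i *\<^sub>R i)"

lemma grad_inner_Basis: "i \<in> Basis \<Longrightarrow> grad f x \<bullet> i = frechet_derivative f (at x) i"
  by (simp add: grad_def)

lemma has_derivative_grad:
  assumes "f differentiable at x"
  shows "(f has_derivative (\<lambda>h. grad f x \<bullet> h)) (at x)"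
proof -
  have D: "(f has_derivative frechet_derivative f (at x)) (at x)" using assms by (simp add: frechet_derivative_works)
  then have l: "linear (frechet_derivative f (at x))" by (rule has_derivative_linear)
  have "frechet_derivative f (at x) h = grad f x \<bullet> h" for h
  proof -
    have "frechet_derivative f (at x) h = frechet_derivative f (at x) (\<Sum>i\<in>Basis. (h \<bullet> i) *\<^sub>R i)" by (simp add: euclidean_representation)
    also have "\<dots> = (\<Sum>i\<in>Basis. (h \<bullet> i) * frechet_derivative f (at x) i)"
      by (simp add: linear_sum[OF l] linear_scale[OF l])
    also have "\<dots> = grad f x \<bullet> h" by (simp add: grad_def inner_sum_left inner_commute[of h] mult.commute)
    finally show ?thesis .
  qed
  then have "frechet_derivative f (at x) = (\<lambda>h. grad f x \<bullet> h)" by auto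
  then show ?thesis using D by simp
qed

lemma smooth_grad_continuous:
  assumes "smooth f" shows "continuous_on UNIV (grad f)"
  unfolding grad_def[abs_def]
  by (intro continuous_intros smooth_continuous smooth_partial[OF assms])

lemma grad_zero_off_support:
  assumes "x \<notin> closure {x. f x \<noteq> 0}"
  shows "grad f x = 0"
proof -
  have "(f has_derivative (\<lambda>h. 0)) (at x)"
    by (rule has_derivative_transform_within_open[where f = "\<lambda>_. 0" and s = "- closure {x. f x \<noteq> 0}"])
      (use assms closure_subset[of "{x. f x \<noteq> 0}"] in auto)
  from frechet_derivative_at[OF this, symmetric] show ?thesis by (simp add: grad_def)
qed

section \<open>Test functions and their difference quotients\<close>

lemma test_function_smooth: "test_function \<Omega> \<phi> \<Longrightarrow> smooth \<phi>"
  by (simp add: test_function_def)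

lemma test_function_zero: "test_function \<Omega> (\<lambda>x. 0)"
  by (simp add: test_function_def smooth_const)

lemma test_function_linear:
  assumes "test_function \<Omega> \<phi>" "test_function \<Omega> \<psi>"
  shows "test_function \<Omega> (\<lambda>x. a * \<phi> x + b * \<psi> x)"
proof -
  have "closure {x. a * \<phi> x + b * \<psi> x \<noteq> 0} \<subseteq> closure ({x. \<phi> x \<noteq> 0} \<union> {x. \<psi> x \<noteq> 0})"
    by (intro closure_mono) auto
  also have "\<dots> = closure {x. \<phi> x \<noteq> 0} \<union> closure {x. \<psi> x \<noteq> 0}" by (rule closure_Un)
  finally have sub: "closure {x. a * \<phi> x + b * \<psi> x \<noteq> 0} \<subseteq> closure {x. \<phi> x \<noteq> 0} \<union> closure {x. \<psi> x \<noteq> 0}" .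
  have "bounded (closure {x. \<phi> x \<noteq> 0} \<union> closure {x. \<psi> x \<noteq> 0})"
    using assms by (auto simp: test_function_def dest: compact_imp_bounded)
  then have "bounded (closure {x. a * \<phi> x + b * \<psi> x \<noteq> 0})" using sub by (rule bounded_subset)
  then show ?thesis using assms sub unfolding test_function_def
    by (auto intro!: smooth_add smooth_mult smooth_const simp: compact_eq_bounded_closed)
qed

lemma test_function_mult:
  assumes "test_function \<Omega> \<phi>" "smooth \<psi>"
  shows "test_function \<Omega> (\<lambda>x. \<phi> x * \<psi> x)"
proof -
  have sub: "closure {x. \<phi> x * \<psi> x \<noteq> 0} \<subseteq> closure {x. \<phi> x \<noteq> 0}" by (intro closure_mono) auto
  then have "bounded (closure {x. \<phi> x * \<psi> x \<noteq> 0})"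
    using assms by (auto simp: test_function_def compact_imp_bounded intro: bounded_subset)
  then show ?thesis using assms sub unfolding test_function_def
    by (auto intro!: smooth_mult simp: compact_eq_bounded_closed)
qed

lemma test_function_translation:
  assumes "test_function UNIV \<phi>"
  shows "test_function UNIV (\<lambda>x. \<phi> (x + c))"
proof -
  have "bounded {x. \<phi> x \<noteq> 0}" using assms bounded_subset[OF compact_imp_bounded closure_subset]
    by (auto simp: test_function_def)
  then have "bounded ((\<lambda>x. - c + x) ` {x. \<phi> x \<noteq> 0})" by (rule bounded_translation)
  moreover have "{x. \<phi> (x + c) \<noteq> 0} = (\<lambda>x. - c + x) ` {x. \<phi> x \<noteq> 0}"
    by (auto simp: image_iff intro!: exI[of _ "_ + c"])
  ultimately have "bounded {x. \<phi> (x + c) \<noteq> 0}" by simp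
  then show ?thesis using assms by (auto simp: test_function_def smooth_translation compact_closure)
qed

lemma test_function_bounds:
  assumes \<phi>: "test_function \<Omega> \<phi>"
  obtains R L where "0 < R" "0 < L" "\<And>x. R \<le> norm x \<Longrightarrow> \<phi> x = 0 \<and> grad \<phi> x = 0"
    "\<And>x. \<bar>\<phi> x\<bar> \<le> L" "\<And>x. norm (grad \<phi> x) \<le> L" "\<And>x h. \<bar>\<phi> (x + h) - \<phi> x\<bar> \<le> L * norm h"
proof -
  have sm: "smooth \<phi>" and cp: "compact (closure {x. \<phi> x \<noteq> 0})" using \<phi> by (auto simp: test_function_def)
  obtain R where R: "0 < R" "closure {x. \<phi> x \<noteq> 0} \<subseteq> ball 0 R"
    using bounded_subset_ballD[OF compact_imp_bounded[OF cp], of 0] by auto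
  have out: "\<phi> x = 0 \<and> grad \<phi> x = 0" if "R \<le> norm x" for x
  proof -
    have "x \<notin> closure {x. \<phi> x \<noteq> 0}" using R that by auto
    then show ?thesis using grad_zero_off_support closure_subset[of "{x. \<phi> x \<noteq> 0}"] by auto
  qed
  have "bounded (\<phi> ` cball 0 R)" "bounded (grad \<phi> ` cball 0 R)"
    by (auto intro!: compact_imp_bounded compact_continuous_image
        continuous_on_subset[OF smooth_continuous[OF sm]] continuous_on_subset[OF smooth_grad_continuous[OF sm]])
  then obtain L1 L2 where "\<forall>y\<in>\<phi> ` cball 0 R. norm y \<le> L1" "\<forall>y\<in>grad \<phi> ` cball 0 R. norm y \<le> L2"
    unfolding bounded_iff by blast
  then have L1: "\<And>x. x \<in> cball 0 R \<Longrightarrow> norm (\<phi> x) \<le> L1" and L2: "\<And>x. x \<in> cball 0 R \<Longrightarrow> norm (grad \<phi> x) \<le> L2"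
    by blast+
  define L where "L = max 1 (max L1 L2)"
  have L: "\<bar>\<phi> x\<bar> \<le> L" "norm (grad \<phi> x) \<le> L" for x
    using L1[of x] L2[of x] out[of x] by (cases "norm x \<le> R"; force simp: L_def)+
  have "norm (\<phi> (x + h) - \<phi> x) \<le> L * norm (x + h - x)" for x h
  proof (rule differentiable_bound[OF convex_UNIV])
    show "(\<phi> has_derivative (\<lambda>h. grad \<phi> x \<bullet> h)) (at x within UNIV)" for x
      by (simp add: has_derivative_grad smooth_differentiable[OF sm])
    show "onorm (\<lambda>h. grad \<phi> x \<bullet> h) \<le> L" for x
    proof (rule onorm_le)
      fix h
      have "norm (grad \<phi> x \<bullet> h) \<le> norm (grad \<phi> x) * norm h" using Cauchy_Schwarz_ineq2[of "grad \<phi> x" h] by simp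
      also have "\<dots> \<le> L * norm h" using L by (intro mult_right_mono) auto
      finally show "norm (grad \<phi> x \<bullet> h) \<le> L * norm h" .
    qed
  qed auto
  then show ?thesis using that[of R L] R out L by (auto simp: L_def)
qed

lemma test_function_borel:
  "test_function \<Omega> \<phi> \<Longrightarrow> \<phi> \<in> borel_measurable borel"
  "test_function \<Omega> \<phi> \<Longrightarrow> grad \<phi> \<in> borel_measurable borel"
  by (auto simp: test_function_def intro!: borel_measurable_continuous_onI smooth_continuous smooth_grad_continuous)

lemma difference_quotient_tendsto:
  fixes f :: "'a::euclidean_space \<Rightarrow> real"
  assumes f: "f differentiable at x" and t: "\<And>n. t n \<noteq> 0" "t \<longlonglongrightarrow> 0"
  shows "(\<lambda>n. (f (x + t n *\<^sub>R h) - f x) / t n) \<longlonglongrightarrow> grad f x \<bullet> h"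
proof -
  have "((\<lambda>s. f (x + s *\<^sub>R h)) has_derivative (\<lambda>s. grad f x \<bullet> (s *\<^sub>R h))) (at 0)"
  proof -
    have "((\<lambda>s. x + s *\<^sub>R h) has_derivative (\<lambda>s. s *\<^sub>R h)) (at (0::real))" by (auto intro!: derivative_eq_intros)
    moreover have "(f has_derivative (\<lambda>h. grad f x \<bullet> h)) (at (x + 0 *\<^sub>R h))" using has_derivative_grad[OF f] by simp
    ultimately show ?thesis by (rule has_derivative_compose)
  qed
  then have "((\<lambda>s. f (x + s *\<^sub>R h)) has_real_derivative (grad f x \<bullet> h)) (at 0)"
    unfolding has_field_derivative_def by (simp add: mult_commute_abs)
  then have "((\<lambda>s. (f (x + s *\<^sub>R h) - f x) / s) \<longlongrightarrow> grad f x \<bullet> h) (at 0)" by (simp add: DERIV_def)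
  moreover have "filterlim t (at 0) sequentially" using t by (auto simp: filterlim_at)
  ultimately show ?thesis by (rule filterlim_compose)
qed

lemma bounded_support_integrable:
  fixes f :: "'a::euclidean_space \<Rightarrow> 'b::{banach, second_countable_topology}"
  assumes "f \<in> borel_measurable borel" "\<And>x. norm (f x) \<le> L" "\<And>x. R \<le> norm x \<Longrightarrow> f x = 0"
  shows "integrable lborel f"
proof (rule Bochner_Integration.integrable_bound)
  have "emeasure lborel (ball (0::'a) R) < \<infinity>" by (rule emeasure_bounded_finite) simp
  then show "integrable lborel (\<lambda>x. L * indicator (ball (0::'a) R) x)" by (intro integrable_mult_right) auto
  show "AE x in lborel. norm (f x) \<le> norm (L * indicator (ball (0::'a) R) x)"
  proof (intro AE_I2)
    fix x
    show "norm (f x) \<le> norm (L * indicator (ball (0::'a) R) x)"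
      using assms(2)[of x] assms(3)[of x] norm_ge_zero[of "f x"] by (cases "R \<le> norm x") auto
  qed
qed (use assms in simp)

lemma integral_lborel_shift:
  fixes f :: "'a::euclidean_space \<Rightarrow> real"
  assumes "f \<in> borel_measurable borel"
  shows "(\<integral>x. f (x + c) \<partial>lborel) = (\<integral>x. f x \<partial>lborel)"
proof -
  have "(\<integral>x. f x \<partial>lborel) = (\<integral>x. f x \<partial>distr lborel borel ((+) c))" by (simp add: lborel_distr_plus)
  also have "\<dots> = (\<integral>x. f (x + c) \<partial>lborel)" using assms by (subst integral_distr) (auto simp: add.commute)
  finally show ?thesis ..
qed

text \<open>Both integration by parts and the bound for translates are read off from difference
  quotients, using translation invariance and dominated convergence.\<close>

lemma integral_grad_zero:
  assumes \<phi>: "test_function \<Omega> \<phi>"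
  shows "(\<integral>x. grad \<phi> x \<bullet> h \<partial>lborel) = 0"
proof -
  obtain R L where RL: "0 < R" "0 < L" "\<And>x. R \<le> norm x \<Longrightarrow> \<phi> x = 0 \<and> grad \<phi> x = 0"
    "\<And>x. \<bar>\<phi> x\<bar> \<le> L" "\<And>x. norm (grad \<phi> x) \<le> L" "\<And>x h. \<bar>\<phi> (x + h) - \<phi> x\<bar> \<le> L * norm h"
    using test_function_bounds[OF \<phi>] by blast
  note [measurable] = test_function_borel[OF \<phi>]
  define t where "t n = inverse (real (Suc n))" for n
  have t: "t n \<noteq> 0" "\<bar>t n\<bar> \<le> 1" for n by (auto simp: t_def inverse_eq_divide)
  have "t \<longlonglongrightarrow> 0" unfolding t_def by (rule LIMSEQ_inverse_real_of_nat)
  have int: "integrable lborel \<phi>" using RL by (intro bounded_support_integrable[of _ L R]) auto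
  have int2: "integrable lborel (\<lambda>x. \<phi> (x + c))" for c
    using RL(4) RL(3) by (intro bounded_support_integrable[of _ L "R + norm c"])
      (auto, metis add_le_cancel_right norm_triangle_sub order_trans diff_add_cancel norm_diff_ineq le_diff_eq)
  have "(\<lambda>n. \<integral>x. (\<phi> (x + t n *\<^sub>R h) - \<phi> x) / t n \<partial>lborel) \<longlonglongrightarrow> (\<integral>x. grad \<phi> x \<bullet> h \<partial>lborel)"
  proof (rule integral_dominated_convergence[where w = "\<lambda>x. L * norm h * indicator (ball 0 (R + norm h)) x"])
    have "emeasure lborel (ball (0::'a) (R + norm h)) < \<infinity>" by (rule emeasure_bounded_finite) simp
    then show "integrable lborel (\<lambda>x. L * norm h * indicator (ball (0::'a) (R + norm h)) x)" by (intro integrable_mult_right) auto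
    show "AE x in lborel. (\<lambda>n. (\<phi> (x + t n *\<^sub>R h) - \<phi> x) / t n) \<longlonglongrightarrow> grad \<phi> x \<bullet> h"
      using t \<open>t \<longlonglongrightarrow> 0\<close> smooth_differentiable[OF test_function_smooth[OF \<phi>]]
      by (intro AE_I2 difference_quotient_tendsto) auto
    show "AE x in lborel. norm ((\<phi> (x + t n *\<^sub>R h) - \<phi> x) / t n) \<le> L * norm h * indicator (ball 0 (R + norm h)) x" for n
    proof (intro AE_I2)
      fix x
      show "norm ((\<phi> (x + t n *\<^sub>R h) - \<phi> x) / t n) \<le> L * norm h * indicator (ball 0 (R + norm h)) x"
      proof (cases "R + norm h \<le> norm x")
        case True
        have "norm (t n *\<^sub>R h) \<le> norm h" using t(2)[of n] by (simp add: mult_left_le_one_le)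
        then have "R \<le> norm (x + t n *\<^sub>R h)" using True norm_diff_ineq[of x "t n *\<^sub>R h"] by linarith
        moreover have "R \<le> norm x" using True norm_ge_zero[of h] by linarith
        ultimately show ?thesis using RL(2,3) by (auto split: split_indicator)
      next
        case False
        have "\<bar>\<phi> (x + t n *\<^sub>R h) - \<phi> x\<bar> \<le> L * (\<bar>t n\<bar> * norm h)" using RL(6)[of x "t n *\<^sub>R h"] by simp
        then show ?thesis using t(1)[of n] False by (simp add: abs_divide pos_divide_le_eq mult_ac)
      qed
    qed
  qed measurable
  moreover have "(\<integral>x. (\<phi> (x + t n *\<^sub>R h) - \<phi> x) / t n \<partial>lborel) = 0" for n
    using int int2 integral_lborel_shift[of \<phi> "t n *\<^sub>R h"] by simp
  ultimately have "(\<lambda>n. 0) \<longlonglongrightarrow> (\<integral>x. grad \<phi> x \<bullet> h \<partial>lborel)" by (simp only:)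
  then show ?thesis by (simp add: LIMSEQ_const_iff)
qed

lemma modulus_test_function_le:
  assumes \<phi>: "test_function \<Omega> \<phi>" and p: "1 < p"
  shows "modulus p \<phi> h \<le> ennreal (norm h powr p) * (\<integral>\<^sup>+x. ennreal (norm (grad \<phi> x) powr p) \<partial>lborel)"
proof -
  obtain R L where RL: "0 < R" "0 < L" "\<And>x. R \<le> norm x \<Longrightarrow> \<phi> x = 0 \<and> grad \<phi> x = 0"
    "\<And>x. \<bar>\<phi> x\<bar> \<le> L" "\<And>x. norm (grad \<phi> x) \<le> L" "\<And>x h. \<bar>\<phi> (x + h) - \<phi> x\<bar> \<le> L * norm h"
    using test_function_bounds[OF \<phi>] by blast
  note [measurable] = test_function_borel[OF \<phi>]
  \<comment> \<open>Halving the displacement n times bounds the modulus at h by 2^(np) times the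
    modulus at 2^(-n) h. This is the integral of the p-th power of a difference quotient of step
    2^(-n), whose limit is the integral of |grad \<phi> x \<bullet> h|^p.\<close>
  define t :: "nat \<Rightarrow> real" where "t n = (1/2) ^ n" for n
  have t: "t n \<noteq> 0" "0 < t n" "\<bar>t n\<bar> \<le> 1" for n by (auto simp: t_def power_le_one)
  have "t \<longlonglongrightarrow> 0" unfolding t_def by (rule LIMSEQ_realpow_zero) auto
  have it: "modulus p \<phi> h \<le> ennreal ((2 powr p) ^ n) * modulus p \<phi> (t n *\<^sub>R h)" for n
  proof (induction n)
    case (Suc n)
    have "modulus p \<phi> (t n *\<^sub>R h) \<le> ennreal (2 powr p) * modulus p \<phi> (t (Suc n) *\<^sub>R h)"
      using modulus_double_le[of \<phi> p "t (Suc n) *\<^sub>R h"] p by (simp add: t_def)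
    then have "ennreal ((2 powr p) ^ n) * modulus p \<phi> (t n *\<^sub>R h) \<le> ennreal ((2 powr p) ^ n) * (ennreal (2 powr p) * modulus p \<phi> (t (Suc n) *\<^sub>R h))"
      by (rule mult_left_mono) simp
    also have "\<dots> = ennreal ((2 powr p) ^ Suc n) * modulus p \<phi> (t (Suc n) *\<^sub>R h)" by (simp add: ennreal_mult' mult_ac)
    finally show ?case using Suc by simp
  qed (simp add: t_def)
  have eq: "ennreal ((2 powr p) ^ n) * modulus p \<phi> (t n *\<^sub>R h) = (\<integral>\<^sup>+x. ennreal (\<bar>(\<phi> (x + t n *\<^sub>R h) - \<phi> x) / t n\<bar> powr p) \<partial>lborel)" for n
  proof -
    have "ennreal ((2 powr p) ^ n) * ennreal (\<bar>a\<bar> powr p) = ennreal (\<bar>a / t n\<bar> powr p)" for a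
    proof -
      have "\<bar>a / t n\<bar> powr p = (2 ^ n * \<bar>a\<bar>) powr p" by (simp add: t_def abs_mult power_divide mult.commute)
      also have "\<dots> = (2 powr p) ^ n * \<bar>a\<bar> powr p" by (simp only: powr_mult two_powr_power)
      finally show ?thesis by (simp flip: ennreal_mult')
    qed
    then show ?thesis unfolding modulus_def by (subst nn_integral_cmult[symmetric]) auto
  qed
  have "(\<lambda>n. \<integral>\<^sup>+x. ennreal (\<bar>(\<phi> (x + t n *\<^sub>R h) - \<phi> x) / t n\<bar> powr p) \<partial>lborel) \<longlonglongrightarrow> (\<integral>\<^sup>+x. ennreal (\<bar>grad \<phi> x \<bullet> h\<bar> powr p) \<partial>lborel)"
  proof (rule nn_integral_dominated_convergence[where w = "\<lambda>x. ennreal ((L * norm h) powr p) * indicator (ball 0 (R + norm h)) x"])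
    have U: "ball (0::'a) (R + norm h) \<in> sets lborel" unfolding sets_lborel by (rule borel_open[OF open_ball])
    show "(\<lambda>x. ennreal ((L * norm h) powr p) * indicator (ball (0::'a) (R + norm h)) x) \<in> borel_measurable lborel"
      by (rule borel_measurable_times_ennreal[OF borel_measurable_const borel_measurable_indicator[OF U]])
    have "(\<integral>\<^sup>+x. ennreal ((L * norm h) powr p) * indicator (ball (0::'a) (R + norm h)) x \<partial>lborel) =
        ennreal ((L * norm h) powr p) * emeasure lborel (ball (0::'a) (R + norm h))"
      by (rule nn_integral_cmult_indicator[OF U])
    also have "\<dots> < \<infinity>" by (simp add: ennreal_mult_less_top emeasure_bounded_finite[OF bounded_ball, unfolded infinity_ennreal_def])
    finally show "(\<integral>\<^sup>+x. ennreal ((L * norm h) powr p) * indicator (ball (0::'a) (R + norm h)) x \<partial>lborel) < \<infinity>" .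
    show "AE x in lborel. (\<lambda>n. ennreal (\<bar>(\<phi> (x + t n *\<^sub>R h) - \<phi> x) / t n\<bar> powr p)) \<longlonglongrightarrow> ennreal (\<bar>grad \<phi> x \<bullet> h\<bar> powr p)"
    proof (intro AE_I2)
      fix x
      have "(\<lambda>n. (\<phi> (x + t n *\<^sub>R h) - \<phi> x) / t n) \<longlonglongrightarrow> grad \<phi> x \<bullet> h"
        using t \<open>t \<longlonglongrightarrow> 0\<close> smooth_differentiable[OF test_function_smooth[OF \<phi>]]
        by (intro difference_quotient_tendsto) auto
      then show "(\<lambda>n. ennreal (\<bar>(\<phi> (x + t n *\<^sub>R h) - \<phi> x) / t n\<bar> powr p)) \<longlonglongrightarrow> ennreal (\<bar>grad \<phi> x \<bullet> h\<bar> powr p)"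
        using p by (intro tendsto_ennrealI tendsto_powr2 tendsto_rabs tendsto_const) auto
    qed
    show "AE x in lborel. ennreal (\<bar>(\<phi> (x + t n *\<^sub>R h) - \<phi> x) / t n\<bar> powr p) \<le> ennreal ((L * norm h) powr p) * indicator (ball 0 (R + norm h)) x" for n
    proof (intro AE_I2)
      fix x
      show "ennreal (\<bar>(\<phi> (x + t n *\<^sub>R h) - \<phi> x) / t n\<bar> powr p) \<le> ennreal ((L * norm h) powr p) * indicator (ball 0 (R + norm h)) x"
      proof (cases "R + norm h \<le> norm x")
        case True
        have "norm (t n *\<^sub>R h) \<le> norm h" using t(3)[of n] by (simp add: mult_left_le_one_le)
        then have "R \<le> norm (x + t n *\<^sub>R h)" using True norm_diff_ineq[of x "t n *\<^sub>R h"] by linarith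
        moreover have "R \<le> norm x" using True norm_ge_zero[of h] by linarith
        ultimately show ?thesis using RL(3) p by simp
      next
        case False
        have "\<bar>\<phi> (x + t n *\<^sub>R h) - \<phi> x\<bar> \<le> L * (\<bar>t n\<bar> * norm h)" using RL(6)[of x "t n *\<^sub>R h"] by simp
        then have "\<bar>(\<phi> (x + t n *\<^sub>R h) - \<phi> x) / t n\<bar> \<le> L * norm h"
          using t(1)[of n] by (simp add: abs_divide pos_divide_le_eq mult_ac)
        then show ?thesis using False p by (auto intro!: ennreal_leI powr_mono2)
      qed
    qed
  qed measurable
  then have "modulus p \<phi> h \<le> (\<integral>\<^sup>+x. ennreal (\<bar>grad \<phi> x \<bullet> h\<bar> powr p) \<partial>lborel)"
    using it unfolding eq by (intro LIMSEQ_le_const) auto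
  also have "\<dots> \<le> (\<integral>\<^sup>+x. ennreal (norm h powr p) * ennreal (norm (grad \<phi> x) powr p) \<partial>lborel)"
  proof (intro nn_integral_mono)
    fix x
    have "\<bar>grad \<phi> x \<bullet> h\<bar> powr p \<le> (norm (grad \<phi> x) * norm h) powr p"
      using p Cauchy_Schwarz_ineq2[of "grad \<phi> x" h] by (intro powr_mono2) auto
    then show "ennreal (\<bar>grad \<phi> x \<bullet> h\<bar> powr p) \<le> ennreal (norm h powr p) * ennreal (norm (grad \<phi> x) powr p)"
      by (simp add: powr_mult mult.commute ennreal_leI flip: ennreal_mult')
  qed
  also have "\<dots> = ennreal (norm h powr p) * (\<integral>\<^sup>+x. ennreal (norm (grad \<phi> x) powr p) \<partial>lborel)"
    by (rule nn_integral_cmult) measurable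
  finally show ?thesis .
qed

section \<open>Weak gradients: consistency, uniqueness and closedness\<close>

text \<open>The product \<phi> \<psi> is a test function, so the integral of its gradient vanishes;
  the product rule splits it into the two sides.\<close>

lemma test_function_has_weak_gradient:
  assumes \<phi>: "test_function \<Omega> \<phi>"
  shows "has_weak_gradient \<phi> (grad \<phi>)"
  unfolding has_weak_gradient_def
proof (intro conjI allI impI ballI)
  note sm = test_function_smooth[OF \<phi>] and mb = test_function_borel[OF \<phi>]
  fix K :: "'a set" assume K: "compact K"
  have "integrable lborel (\<lambda>x. indicator K x *\<^sub>R \<phi> x)" "integrable lborel (\<lambda>x. indicator K x *\<^sub>R grad \<phi> x)"
    by (rule borel_integrable_compact[OF K continuous_on_subset[OF smooth_continuous[OF sm] subset_UNIV]],
        rule borel_integrable_compact[OF K continuous_on_subset[OF smooth_grad_continuous[OF sm] subset_UNIV]])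
  moreover have "K \<in> sets borel" using K by (rule borel_compact)
  ultimately show "set_integrable lebesgue K \<phi>" "set_integrable lebesgue K (grad \<phi>)"
    using mb unfolding set_integrable_def by (auto simp: integrable_completion)
next
  note mb = test_function_borel[OF \<phi>]
  fix \<psi> :: "'a \<Rightarrow> real" and i :: 'a
  assume \<psi>: "test_function UNIV \<psi>" and i: "i \<in> Basis"
  note mb' = test_function_borel[OF \<psi>]
  note [measurable] = mb mb'
  have dm[measurable]: "(\<lambda>x. frechet_derivative \<psi> (at x) i) \<in> borel_measurable borel"
    using smooth_borel[OF smooth_partial[OF test_function_smooth[OF \<psi>] i]] .
  obtain R L where RL: "0 < R" "0 < L" "\<And>x. R \<le> norm x \<Longrightarrow> \<phi> x = 0 \<and> grad \<phi> x = 0"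
    "\<And>x. \<bar>\<phi> x\<bar> \<le> L" "\<And>x. norm (grad \<phi> x) \<le> L"
    using test_function_bounds[OF \<phi>] by metis
  obtain L' where RL': "0 < L'" "\<And>x. \<bar>\<psi> x\<bar> \<le> L'" "\<And>x. norm (grad \<psi> x) \<le> L'"
    by (rule test_function_bounds[OF \<psi>]) (rule that)
  have i1: "integrable lborel (\<lambda>x. \<phi> x * frechet_derivative \<psi> (at x) i)"
  proof (rule bounded_support_integrable)
    show "norm (\<phi> x * frechet_derivative \<psi> (at x) i) \<le> L * L'" for x
    proof -
      have "\<bar>frechet_derivative \<psi> (at x) i\<bar> \<le> L'"
        using Basis_le_norm[OF i, of "grad \<psi> x"] RL'(3)[of x]  by (simp add: grad_inner_Basis[OF i])
      then show ?thesis using RL(4)[of x] RL(2) by (auto simp: abs_mult intro!: mult_mono)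
    qed
    show "\<phi> x * frechet_derivative \<psi> (at x) i = 0" if "R \<le> norm x" for x using RL(3)[OF that] by simp
  qed measurable
  have i2: "integrable lborel (\<lambda>x. (grad \<phi> x \<bullet> i) * \<psi> x)"
  proof (rule bounded_support_integrable)
    show "norm ((grad \<phi> x \<bullet> i) * \<psi> x) \<le> L * L'" for x
      using Basis_le_norm[OF i, of "grad \<phi> x"] RL(5)[of x] RL(2) RL'(2)[of x] by (auto simp: abs_mult intro!: mult_mono)
    show "(grad \<phi> x \<bullet> i) * \<psi> x = 0" if "R \<le> norm x" for x using RL(3)[OF that] by simp
  qed measurable
  have "grad (\<lambda>x. \<phi> x * \<psi> x) x \<bullet> i = \<phi> x * frechet_derivative \<psi> (at x) i + (grad \<phi> x \<bullet> i) * \<psi> x" for x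
    using i frechet_derivative_mult_at[of \<phi> x \<psi> i] smooth_differentiable[OF test_function_smooth[OF \<phi>], of x]
      smooth_differentiable[OF test_function_smooth[OF \<psi>], of x] by (simp add: grad_inner_Basis)
  then have "(\<integral>x. \<phi> x * frechet_derivative \<psi> (at x) i + (grad \<phi> x \<bullet> i) * \<psi> x \<partial>lborel) = 0"
    using integral_grad_zero[OF test_function_mult[OF \<phi> test_function_smooth[OF \<psi>]], of i] by simp
  then have "(\<integral>x. \<phi> x * frechet_derivative \<psi> (at x) i \<partial>lborel) = - (\<integral>x. (grad \<phi> x \<bullet> i) * \<psi> x \<partial>lborel)"
    using i1 i2 by simp
  then show "(\<integral>x. \<phi> x * frechet_derivative \<psi> (at x) i \<partial>lebesgue) = - (\<integral>x. (grad \<phi> x \<bullet> i) * \<psi> x \<partial>lebesgue)"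
    by (simp add: integral_completion)
qed

lemma set_integrable_mult_test:
  fixes g :: "'a::euclidean_space \<Rightarrow> real"
  assumes g: "set_integrable lebesgue (cball 0 R) g" and f: "f \<in> borel_measurable borel"
    and b: "\<And>x. \<bar>f x\<bar> \<le> L" and z: "\<And>x. R \<le> norm x \<Longrightarrow> f x = (0::real)"
  shows "integrable lebesgue (\<lambda>x. g x * f x)"
proof -
  have gi: "integrable lebesgue (\<lambda>x. indicator (cball 0 R) x * g x)" using g by (simp add: set_integrable_def)
  have "integrable lebesgue (\<lambda>x. indicator (cball 0 R) x * g x * f x)"
  proof (rule Bochner_Integration.integrable_bound)
    show "integrable lebesgue (\<lambda>x. L * (indicator (cball 0 R) x * g x))" using gi by (rule integrable_mult_right)
    show "(\<lambda>x. indicator (cball 0 R) x * g x * f x) \<in> borel_measurable lebesgue"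
    proof -
      have "f \<in> borel_measurable lebesgue" using f by (simp add: measurable_completion)
      with borel_measurable_integrable[OF gi] show ?thesis by (rule borel_measurable_times)
    qed
    have "0 \<le> L" using b[of 0] by linarith
    then show "AE x in lebesgue. norm (indicator (cball 0 R) x * g x * f x) \<le> norm (L * (indicator (cball 0 R) x * g x))"
      using b by (intro AE_I2) (auto simp: abs_mult mult.commute intro: mult_right_mono split: split_indicator)
  qed
  moreover have "indicator (cball 0 R) x * g x * f x = g x * f x" for x
    using z[of x] by (auto split: split_indicator)
  ultimately show ?thesis by simp
qed

lemma has_weak_gradient_set_integrable:
  assumes "has_weak_gradient u G" "compact K"
  shows "set_integrable lebesgue K u" "set_integrable lebesgue K G" "set_integrable lebesgue K (\<lambda>x. G x \<bullet> i)"
proof -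
  show "set_integrable lebesgue K u" and G: "set_integrable lebesgue K G"
    using assms by (auto simp: has_weak_gradient_def)
  have "integrable lebesgue (\<lambda>x. (indicator K x *\<^sub>R G x) \<bullet> i)"
    using G unfolding set_integrable_def by (rule integrable_inner_left)
  then show "set_integrable lebesgue K (\<lambda>x. G x \<bullet> i)" unfolding set_integrable_def by simp
qed

lemma has_weak_gradient_pairing_integrable:
  assumes "has_weak_gradient u G" "test_function \<Omega> \<phi>" "i \<in> Basis"
  shows "integrable lebesgue (\<lambda>x. u x * frechet_derivative \<phi> (at x) i)" "integrable lebesgue (\<lambda>x. (G x \<bullet> j) * \<phi> x)"
proof -
  obtain R L where RL: "0 < R" "0 < L" "\<And>x. R \<le> norm x \<Longrightarrow> \<phi> x = 0 \<and> grad \<phi> x = 0"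
    "\<And>x. \<bar>\<phi> x\<bar> \<le> L" "\<And>x. norm (grad \<phi> x) \<le> L"
    using test_function_bounds[OF assms(2)] by metis
  show "integrable lebesgue (\<lambda>x. u x * frechet_derivative \<phi> (at x) i)"
  proof (rule set_integrable_mult_test[of R _ _ L])
    show "set_integrable lebesgue (cball 0 R) u" using has_weak_gradient_set_integrable[OF assms(1)] by simp
    show "(\<lambda>x. frechet_derivative \<phi> (at x) i) \<in> borel_measurable borel"
      using smooth_borel[OF smooth_partial[OF test_function_smooth[OF assms(2)] assms(3)]] .
    show "\<bar>frechet_derivative \<phi> (at x) i\<bar> \<le> L" for x
      using Basis_le_norm[OF assms(3), of "grad \<phi> x"] RL(5)[of x] by (simp add: grad_inner_Basis[OF assms(3)])
    show "frechet_derivative \<phi> (at x) i = 0" if "R \<le> norm x" for x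
      using RL(3)[OF that] grad_inner_Basis[OF assms(3), of \<phi> x] by simp
  qed
  show "integrable lebesgue (\<lambda>x. (G x \<bullet> j) * \<phi> x)"
    by (rule set_integrable_mult_test[of R _ _ L])
      (use has_weak_gradient_set_integrable[OF assms(1)] test_function_borel[OF assms(2)] RL in auto)
qed

text \<open>Each component of the difference is locally integrable and orthogonal to all test
  functions.\<close>

lemma has_weak_gradient_unique:
  assumes "has_weak_gradient u G" "has_weak_gradient u H"
  shows "AE x in lebesgue. G x = H x"
proof -
  have "AE x in lebesgue. x \<in> UNIV \<longrightarrow> G x \<bullet> i - H x \<bullet> i = 0" if i: "i \<in> Basis" for i
  proof (rule test_functions_zero_imp_AE_zero[OF open_UNIV])
    show "set_integrable lebesgue K (\<lambda>x. G x \<bullet> i - H x \<bullet> i)" if "compact K" for K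
      using has_weak_gradient_set_integrable(3)[OF assms(1) that] has_weak_gradient_set_integrable(3)[OF assms(2) that]
      by (rule set_integral_diff)
    fix \<phi> :: "'a \<Rightarrow> real" assume \<phi>: "test_function UNIV \<phi>"
    have "(\<integral>x. (G x \<bullet> i) * \<phi> x \<partial>lebesgue) = (\<integral>x. (H x \<bullet> i) * \<phi> x \<partial>lebesgue)"
    proof -
      have "(\<integral>x. u x * frechet_derivative \<phi> (at x) i \<partial>lebesgue) = - (\<integral>x. (G x \<bullet> i) * \<phi> x \<partial>lebesgue)"
        "(\<integral>x. u x * frechet_derivative \<phi> (at x) i \<partial>lebesgue) = - (\<integral>x. (H x \<bullet> i) * \<phi> x \<partial>lebesgue)"
        using assms \<phi> i unfolding has_weak_gradient_def by blast+
      then show ?thesis by simp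
    qed
    then show "(\<integral>x. (G x \<bullet> i - H x \<bullet> i) * \<phi> x \<partial>lebesgue) = 0"
      using has_weak_gradient_pairing_integrable(2)[OF assms(1) \<phi> i] has_weak_gradient_pairing_integrable(2)[OF assms(2) \<phi> i]
      by (simp add: left_diff_distrib)
  qed
  then have "AE x in lebesgue. \<forall>i\<in>Basis. G x \<bullet> i - H x \<bullet> i = 0"
    by (intro AE_finite_allI) auto
  then show ?thesis by eventually_elim (auto intro: euclidean_eqI)
qed

lemma has_weak_gradient_linear:
  assumes u: "has_weak_gradient u G" and v: "has_weak_gradient v H"
  shows "has_weak_gradient (\<lambda>x. a * u x + b * v x) (\<lambda>x. a *\<^sub>R G x + b *\<^sub>R H x)"
  unfolding has_weak_gradient_def
proof (intro conjI allI impI ballI)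
  fix K :: "'a set" assume K: "compact K"
  note s = has_weak_gradient_set_integrable[OF u K] has_weak_gradient_set_integrable[OF v K]
  show "set_integrable lebesgue K (\<lambda>x. a * u x + b * v x)"
    using s by (intro set_integral_add set_integrable_mult_right) auto
  have "integrable lebesgue (\<lambda>x. a *\<^sub>R (indicator K x *\<^sub>R G x) + b *\<^sub>R (indicator K x *\<^sub>R H x))"
    using s unfolding set_integrable_def by (intro Bochner_Integration.integrable_add integrable_scaleR_right) auto
  then show "set_integrable lebesgue K (\<lambda>x. a *\<^sub>R G x + b *\<^sub>R H x)"
    unfolding set_integrable_def by (simp add: scaleR_add_right mult.commute)
next
  fix \<phi> :: "'a \<Rightarrow> real" and i :: 'a assume \<phi>: "test_function UNIV \<phi>" and i: "i \<in> Basis"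
  note I = has_weak_gradient_pairing_integrable[OF u \<phi> i] has_weak_gradient_pairing_integrable[OF v \<phi> i]
  have "(\<integral>x. (a * u x + b * v x) * frechet_derivative \<phi> (at x) i \<partial>lebesgue) =
      a * (\<integral>x. u x * frechet_derivative \<phi> (at x) i \<partial>lebesgue) + b * (\<integral>x. v x * frechet_derivative \<phi> (at x) i \<partial>lebesgue)"
    using I by (simp add: distrib_right mult.assoc)
  also have "\<dots> = a * (- (\<integral>x. (G x \<bullet> i) * \<phi> x \<partial>lebesgue)) + b * (- (\<integral>x. (H x \<bullet> i) * \<phi> x \<partial>lebesgue))"
    using u v \<phi> i unfolding has_weak_gradient_def by simp
  also have "\<dots> = - (\<integral>x. ((a *\<^sub>R G x + b *\<^sub>R H x) \<bullet> i) * \<phi> x \<partial>lebesgue)"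
    using I by (simp add: inner_add_left distrib_right mult.assoc)
  finally show "(\<integral>x. (a * u x + b * v x) * frechet_derivative \<phi> (at x) i \<partial>lebesgue) =
      - (\<integral>x. ((a *\<^sub>R G x + b *\<^sub>R H x) \<bullet> i) * \<phi> x \<partial>lebesgue)" .
qed

text \<open>The pairing with a translated test function is constant in the translation, and it
  vanishes once the supports are disjoint.\<close>

lemma weak_gradient_zero_imp_zero:
  assumes u: "has_weak_gradient u G" and G: "AE x in lebesgue. G x = 0"
    and supp: "AE x in lebesgue. R \<le> norm x \<longrightarrow> u x = 0"
  shows "AE x in lebesgue. u x = 0"
proof -
  have ui: "integrable lebesgue u"
  proof -
    have c: "integrable lebesgue (\<lambda>x. indicator (cball 0 R) x * u x)"
      using has_weak_gradient_set_integrable(1)[OF u, of "cball 0 R"] by (simp add: set_integrable_def)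
    have eq: "AE x in lebesgue. indicator (cball 0 R) x * u x = u x"
      using supp by eventually_elim (auto split: split_indicator)
    have um: "u \<in> borel_measurable lebesgue"
    proof (rule borel_measurable_LIMSEQ_real)
      show "(\<lambda>n. indicator (cball 0 (real n)) x * u x) \<longlonglongrightarrow> u x" for x
      proof (rule tendsto_eventually)
        obtain N :: nat where "norm x \<le> real N" using real_arch_simple by blast
        then show "\<forall>\<^sub>F n in sequentially. indicator (cball 0 (real n)) x * u x = u x"
          unfolding eventually_sequentially by (intro exI[of _ N]) (auto split: split_indicator)
      qed
      show "(\<lambda>x. indicator (cball 0 (real n)) x * u x) \<in> borel_measurable lebesgue" for n
        using has_weak_gradient_set_integrable(1)[OF u, of "cball 0 (real n)"] by (auto simp: set_integrable_def)
    qed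
    show ?thesis using integrable_cong_AE[OF borel_measurable_integrable[OF c] um eq] c by simp
  qed
  have um: "u \<in> borel_measurable lebesgue" using ui by simp
  obtain e :: 'a where e: "e \<in> Basis" using nonempty_Basis by blast
  have main: "(\<integral>x. u x * \<phi> x \<partial>lebesgue) = 0" if \<phi>: "test_function UNIV \<phi>" for \<phi>
  proof -
    obtain R' L where RL: "0 < R'" "0 < L" "\<And>x. R' \<le> norm x \<Longrightarrow> \<phi> x = 0 \<and> grad \<phi> x = 0"
      "\<And>x. \<bar>\<phi> x\<bar> \<le> L" "\<And>x h. \<bar>\<phi> (x + h) - \<phi> x\<bar> \<le> L * norm h"
      using test_function_bounds[OF \<phi>] by metis
    have pm: "(\<lambda>x. \<phi> (x + c)) \<in> borel_measurable lebesgue" for c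
      using test_function_borel(1)[OF test_function_translation[OF \<phi>, of c]] by (simp add: measurable_completion)
    define I where "I t = (\<integral>x. u x * \<phi> (x + t *\<^sub>R e) \<partial>lebesgue)" for t
    have Ii: "integrable lebesgue (\<lambda>x. u x * \<phi> (x + t *\<^sub>R e))" for t
    proof (rule Bochner_Integration.integrable_bound)
      show "integrable lebesgue (\<lambda>x. L * u x)" using ui by simp
      show "AE x in lebesgue. norm (u x * \<phi> (x + t *\<^sub>R e)) \<le> norm (L * u x)"
        using RL(2,4) by (intro AE_I2) (auto simp: abs_mult mult.commute[of L] intro!: mult_left_mono)
    qed (intro borel_measurable_times um pm)
    \<comment> \<open>The derivative pairs u with a partial derivative of the translated test
      function; the weak gradient turns this into an integral against G, which vanishes.\<close>
    have "(I has_real_derivative 0) (at t)" for t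
    proof -
      let ?\<psi> = "\<lambda>x. \<phi> (x + t *\<^sub>R e)"
      have \<psi>: "test_function UNIV ?\<psi>" by (rule test_function_translation[OF \<phi>])
      have "(\<lambda>n. (I (t + s n) - I t) / s n) \<longlonglongrightarrow> 0" if s: "\<And>n. s n \<noteq> 0" "s \<longlonglongrightarrow> 0" for s
      proof -
        have "(\<lambda>n. \<integral>x. u x * ((?\<psi> (x + s n *\<^sub>R e) - ?\<psi> x) / s n) \<partial>lebesgue) \<longlonglongrightarrow> (\<integral>x. u x * (grad ?\<psi> x \<bullet> e) \<partial>lebesgue)"
        proof (rule integral_dominated_convergence[where w = "\<lambda>x. L * \<bar>u x\<bar>"])
          show "integrable lebesgue (\<lambda>x. L * \<bar>u x\<bar>)" using ui by simp
          show "(\<lambda>x. u x * (grad ?\<psi> x \<bullet> e)) \<in> borel_measurable lebesgue"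
            using has_weak_gradient_pairing_integrable(1)[OF u \<psi> e] by (simp add: grad_inner_Basis[OF e])
          show "(\<lambda>x. u x * ((?\<psi> (x + s n *\<^sub>R e) - ?\<psi> x) / s n)) \<in> borel_measurable lebesgue" for n
            using pm[of "s n *\<^sub>R e + t *\<^sub>R e"] pm[of "t *\<^sub>R e"]
            by (intro borel_measurable_times um borel_measurable_divide borel_measurable_diff borel_measurable_const) (auto simp: add.assoc)
          show "AE x in lebesgue. (\<lambda>n. u x * ((?\<psi> (x + s n *\<^sub>R e) - ?\<psi> x) / s n)) \<longlonglongrightarrow> u x * (grad ?\<psi> x \<bullet> e)"
            by (intro AE_I2 tendsto_mult tendsto_const difference_quotient_tendsto s
                smooth_differentiable test_function_smooth[OF \<psi>])
          show "AE x in lebesgue. norm (u x * ((?\<psi> (x + s n *\<^sub>R e) - ?\<psi> x) / s n)) \<le> L * \<bar>u x\<bar>" for n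
          proof (intro AE_I2)
            fix x
            have "\<bar>?\<psi> (x + s n *\<^sub>R e) - ?\<psi> x\<bar> \<le> L * \<bar>s n\<bar>"
              using RL(5)[of "x + t *\<^sub>R e" "s n *\<^sub>R e"] e by (simp add: algebra_simps)
            then have "\<bar>(?\<psi> (x + s n *\<^sub>R e) - ?\<psi> x) / s n\<bar> \<le> L" using s(1)[of n] by (simp add: abs_divide pos_divide_le_eq)
            then show "norm (u x * ((?\<psi> (x + s n *\<^sub>R e) - ?\<psi> x) / s n)) \<le> L * \<bar>u x\<bar>"
              unfolding real_norm_def abs_mult by (subst mult.commute) (intro mult_right_mono, auto)
          qed
        qed
        moreover have "(\<integral>x. u x * (grad ?\<psi> x \<bullet> e) \<partial>lebesgue) = 0"
        proof -
          have "(\<integral>x. u x * (grad ?\<psi> x \<bullet> e) \<partial>lebesgue) = - (\<integral>x. (G x \<bullet> e) * ?\<psi> x \<partial>lebesgue)"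
            using u \<psi> e unfolding has_weak_gradient_def grad_inner_Basis[OF e] by blast
          also have "(\<integral>x. (G x \<bullet> e) * ?\<psi> x \<partial>lebesgue) = 0"
            using G by (intro integral_eq_zero_AE) (auto elim!: eventually_mono)
          finally show ?thesis by simp
        qed
        moreover have "(\<integral>x. u x * ((?\<psi> (x + s n *\<^sub>R e) - ?\<psi> x) / s n) \<partial>lebesgue) = (I (t + s n) - I t) / s n" for n
        proof -
          have "(\<integral>x. u x * ((?\<psi> (x + s n *\<^sub>R e) - ?\<psi> x) / s n) \<partial>lebesgue) =
              (\<integral>x. (u x * \<phi> (x + (t + s n) *\<^sub>R e) - u x * \<phi> (x + t *\<^sub>R e)) / s n \<partial>lebesgue)"
            by (intro Bochner_Integration.integral_cong) (auto simp: algebra_simps)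
          then show ?thesis using Ii unfolding I_def by simp
        qed
        ultimately show ?thesis by (simp only:)
      qed
      then show ?thesis unfolding DERIV_def by (auto simp: tendsto_at_iff_sequentially o_def)
    qed
    then have const: "I 0 = I t" for t by (intro DERIV_isconst_all) auto
    \<comment> \<open>A shift by this length moves the support of \<phi>, of radius R', out of the
      ball that carries u.\<close>
    define T where "T = \<bar>R\<bar> + R'"
    have "I T = 0" unfolding I_def
    proof (rule integral_eq_zero_AE)
      show "AE x in lebesgue. u x * \<phi> (x + T *\<^sub>R e) = 0"
        using supp
      proof eventually_elim
        fix x assume x: "R \<le> norm x \<longrightarrow> u x = 0"
        show "u x * \<phi> (x + T *\<^sub>R e) = 0"
        proof (cases "R \<le> norm x")
          case False
          have "norm (T *\<^sub>R e) = T" using e RL(1) by (simp add: T_def)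
          moreover have "norm (T *\<^sub>R e) \<le> norm (x + T *\<^sub>R e) + norm x"
            using norm_triangle_ineq4[of "x + T *\<^sub>R e" x] by simp
          ultimately have "R' \<le> norm (x + T *\<^sub>R e)" using False by (simp add: T_def)
          then show ?thesis using RL(3) by simp
        qed (use x in simp)
      qed
    qed
    then show ?thesis using const[of T] by (simp add: I_def)
  qed
  have "AE x in lebesgue. x \<in> UNIV \<longrightarrow> u x = 0"
    by (rule test_functions_zero_imp_AE_zero[OF open_UNIV has_weak_gradient_set_integrable(1)[OF u] main])
  then show ?thesis by simp
qed

lemma Lp_tendsto_imp_set_L1_tendsto:
  fixes v :: "nat \<Rightarrow> 'a::euclidean_space \<Rightarrow> 'e::euclidean_space"
  assumes p: "1 < p" and K: "compact K" and m: "\<And>n. v n \<in> borel_measurable lebesgue"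
    and lim: "(\<lambda>n. \<integral>\<^sup>+x. ennreal (norm (v n x) powr p) \<partial>lebesgue) \<longlonglongrightarrow> 0"
  shows "(\<lambda>n. \<integral>\<^sup>+x. ennreal (norm (v n x)) * indicator K x \<partial>lebesgue) \<longlonglongrightarrow> 0"
proof (rule tendsto_zero_ennreal)
  fix r :: real assume r: "0 < r"
  have Km: "K \<in> sets lebesgue" using K by (simp add: borel_compact sets_completionI_sets)
  have "emeasure lebesgue K < \<infinity>" using K emeasure_compact_finite[OF K] borel_compact[OF K] by simp
  then obtain k where k: "0 \<le> k" "emeasure lebesgue K = ennreal k" by (cases "emeasure lebesgue K") auto
  define e where "e = r / (2 * (k + 1))"
  have e: "0 < e" using r k by (simp add: e_def)
  \<comment> \<open>Where |y| > e one has |y| = |y|^(1-p) |y|^p \<le> e^(1-p) |y|^p. Integrated over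
    a set of measure k, the first summand costs e k < r by the choice of e, and the second tends to
    0.\<close>
  have pt: "norm y \<le> e + e powr (1 - p) * norm y powr p" for y :: 'e
  proof (cases "norm y \<le> e")
    case False
    then have y: "0 < norm y" using e by linarith
    have "norm y = norm y powr (1 - p) * norm y powr p" using y by (simp flip: powr_add)
    also have "\<dots> \<le> e powr (1 - p) * norm y powr p" using False e p by (intro mult_right_mono powr_mono2') auto
    finally show ?thesis using e by simp
  qed (simp add: add_increasing2)
  have bound: "(\<integral>\<^sup>+x. ennreal (norm (v n x)) * indicator K x \<partial>lebesgue) \<le>
      ennreal (e * k) + ennreal (e powr (1 - p)) * (\<integral>\<^sup>+x. ennreal (norm (v n x) powr p) \<partial>lebesgue)" for n
  proof -
    have mm: "(\<lambda>x. ennreal (norm (v n x) powr p)) \<in> borel_measurable lebesgue" using m[of n] by measurable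
    have "(\<integral>\<^sup>+x. ennreal (norm (v n x)) * indicator K x \<partial>lebesgue) \<le>
        (\<integral>\<^sup>+x. ennreal e * indicator K x + ennreal (e powr (1 - p)) * ennreal (norm (v n x) powr p) \<partial>lebesgue)"
      using pt e by (intro nn_integral_mono) (auto simp: ennreal_leI split: split_indicator simp flip: ennreal_plus ennreal_mult')
    also have "\<dots> = ennreal e * emeasure lebesgue K + ennreal (e powr (1 - p)) * (\<integral>\<^sup>+x. ennreal (norm (v n x) powr p) \<partial>lebesgue)"
      using Km mm by (subst nn_integral_add) (auto simp: nn_integral_cmult nn_integral_cmult_indicator)
    finally show ?thesis using k e by (simp add: ennreal_mult')
  qed
  have "(\<lambda>n. ennreal (e * k) + ennreal (e powr (1 - p)) * (\<integral>\<^sup>+x. ennreal (norm (v n x) powr p) \<partial>lebesgue)) \<longlonglongrightarrow>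
      ennreal (e * k) + ennreal (e powr (1 - p)) * 0"
    using lim by (intro tendsto_add tendsto_const ennreal_tendsto_cmult) auto
  moreover have "ennreal (e * k) + ennreal (e powr (1 - p)) * 0 < ennreal r"
  proof -
    have "e * k < r" using r k mult_nonneg_nonneg[of k r] by (simp add: e_def field_simps add_nonneg_pos)
    then show ?thesis using r by (simp add: ennreal_lessI)
  qed
  ultimately have "\<forall>\<^sub>F n in sequentially. ennreal (e * k) + ennreal (e powr (1 - p)) * (\<integral>\<^sup>+x. ennreal (norm (v n x) powr p) \<partial>lebesgue) < ennreal r"
    by (rule order_tendstoD)
  then show "\<forall>\<^sub>F n in sequentially. (\<integral>\<^sup>+x. ennreal (norm (v n x)) * indicator K x \<partial>lebesgue) < ennreal r"
    by (rule eventually_mono) (use bound in \<open>auto intro: le_less_trans\<close>)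
qed

lemma set_integrable_Lp_limit:
  fixes v w :: "'a::euclidean_space \<Rightarrow> 'e::euclidean_space"
  assumes "set_integrable lebesgue K v" "w \<in> borel_measurable lebesgue" "K \<in> sets lebesgue"
    and "(\<integral>\<^sup>+x. ennreal (norm (v x - w x)) * indicator K x \<partial>lebesgue) < \<infinity>" and m: "v \<in> borel_measurable lebesgue"
  shows "set_integrable lebesgue K w"
proof -
  have "integrable lebesgue (\<lambda>x. indicator K x *\<^sub>R (v x - w x))"
  proof (rule integrableI_bounded)
    have "(\<integral>\<^sup>+x. ennreal (norm (indicator K x *\<^sub>R (v x - w x))) \<partial>lebesgue) = (\<integral>\<^sup>+x. ennreal (norm (v x - w x)) * indicator K x \<partial>lebesgue)"
      by (intro nn_integral_cong) (auto split: split_indicator)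
    then show "(\<integral>\<^sup>+x. ennreal (norm (indicator K x *\<^sub>R (v x - w x))) \<partial>lebesgue) < \<infinity>" using assms(4) by simp
    show "(\<lambda>x. indicator K x *\<^sub>R (v x - w x)) \<in> borel_measurable lebesgue"
      by (intro borel_measurable_scaleR borel_measurable_indicator borel_measurable_diff assms m)
  qed
  then have "integrable lebesgue (\<lambda>x. indicator K x *\<^sub>R v x - indicator K x *\<^sub>R (v x - w x))"
    using assms(1) unfolding set_integrable_def by (rule Bochner_Integration.integrable_diff[rotated])
  then show ?thesis unfolding set_integrable_def by (simp add: scaleR_diff_right)
qed

lemma set_L1_tendsto_pairing:
  fixes v :: "nat \<Rightarrow> 'a::euclidean_space \<Rightarrow> real"
  assumes lim: "(\<lambda>n. \<integral>\<^sup>+x. ennreal \<bar>v n x - w x\<bar> * indicator (cball 0 R) x \<partial>lebesgue) \<longlonglongrightarrow> 0"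
    and v: "\<And>n. set_integrable lebesgue (cball 0 R) (v n)" and w: "set_integrable lebesgue (cball 0 R) w"
    and f: "f \<in> borel_measurable borel" and b: "\<And>x. \<bar>f x\<bar> \<le> L" and z: "\<And>x. R \<le> norm x \<Longrightarrow> f x = (0::real)"
  shows "(\<lambda>n. \<integral>x. v n x * f x \<partial>lebesgue) \<longlonglongrightarrow> (\<integral>x. w x * f x \<partial>lebesgue)"
proof -
  have L0: "0 \<le> L" using b[of 0] by linarith
  have vi: "integrable lebesgue (\<lambda>x. v n x * f x)" for n by (rule set_integrable_mult_test[OF v f b z])
  have wi: "integrable lebesgue (\<lambda>x. w x * f x)" by (rule set_integrable_mult_test[OF w f b z])
  have le: "ennreal \<bar>(\<integral>x. v n x * f x \<partial>lebesgue) - (\<integral>x. w x * f x \<partial>lebesgue)\<bar> \<le>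
      ennreal L * (\<integral>\<^sup>+x. ennreal \<bar>v n x - w x\<bar> * indicator (cball 0 R) x \<partial>lebesgue)" for n
  proof -
    have m: "(\<lambda>x. indicator (cball 0 R) x *\<^sub>R v n x - indicator (cball 0 R) x *\<^sub>R w x) \<in> borel_measurable lebesgue"
      using v[of n] w unfolding set_integrable_def by (intro borel_measurable_diff) auto
    have "(\<lambda>x. ennreal \<bar>indicator (cball 0 R) x *\<^sub>R v n x - indicator (cball 0 R) x *\<^sub>R w x\<bar>) \<in> borel_measurable lebesgue"
      using m by measurable
    moreover have "(\<lambda>x. ennreal \<bar>indicator (cball 0 R) x *\<^sub>R v n x - indicator (cball 0 R) x *\<^sub>R w x\<bar>) =
        (\<lambda>x. ennreal \<bar>v n x - w x\<bar> * indicator (cball 0 R) x)"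
      by (auto simp: fun_eq_iff split: split_indicator)
    ultimately have mm: "(\<lambda>x. ennreal \<bar>v n x - w x\<bar> * indicator (cball 0 R) x) \<in> borel_measurable lebesgue" by metis
    have "ennreal \<bar>(\<integral>x. v n x * f x \<partial>lebesgue) - (\<integral>x. w x * f x \<partial>lebesgue)\<bar> = ennreal (norm (\<integral>x. v n x * f x - w x * f x \<partial>lebesgue))"
      using vi wi by simp
    also have "\<dots> \<le> (\<integral>\<^sup>+x. ennreal (norm (v n x * f x - w x * f x)) \<partial>lebesgue)"
      using vi wi by (intro integral_norm_bound_ennreal) auto
    also have "\<dots> \<le> (\<integral>\<^sup>+x. ennreal L * (ennreal \<bar>v n x - w x\<bar> * indicator (cball 0 R) x) \<partial>lebesgue)"
    proof (intro nn_integral_mono)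
      fix x
      have "\<bar>v n x * f x - w x * f x\<bar> = \<bar>f x\<bar> * \<bar>v n x - w x\<bar>" by (simp add: algebra_simps flip: abs_mult)
      also have "\<dots> \<le> L * \<bar>v n x - w x\<bar>" using b by (intro mult_right_mono) auto
      finally have *: "\<bar>v n x * f x - w x * f x\<bar> \<le> L * \<bar>v n x - w x\<bar>" .
      show "ennreal (norm (v n x * f x - w x * f x)) \<le> ennreal L * (ennreal \<bar>v n x - w x\<bar> * indicator (cball 0 R) x)"
      proof (cases "norm x \<le> R")
        case True
        then show ?thesis using * L0 by (simp add: ennreal_leI flip: ennreal_mult')
      next
        case False
        then show ?thesis using z[of x] by simp
      qed
    qed
    also have "\<dots> = ennreal L * (\<integral>\<^sup>+x. ennreal \<bar>v n x - w x\<bar> * indicator (cball 0 R) x \<partial>lebesgue)"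
      by (rule nn_integral_cmult[OF mm])
    finally show ?thesis .
  qed
  have "(\<lambda>n. ennreal L * (\<integral>\<^sup>+x. ennreal \<bar>v n x - w x\<bar> * indicator (cball 0 R) x \<partial>lebesgue)) \<longlonglongrightarrow> ennreal L * 0"
    using lim by (intro ennreal_tendsto_cmult) auto
  then have lim0: "(\<lambda>n. ennreal L * (\<integral>\<^sup>+x. ennreal \<bar>v n x - w x\<bar> * indicator (cball 0 R) x \<partial>lebesgue)) \<longlonglongrightarrow> ennreal 0" by simp
  have "(\<lambda>n. ennreal \<bar>(\<integral>x. v n x * f x \<partial>lebesgue) - (\<integral>x. w x * f x \<partial>lebesgue)\<bar>) \<longlonglongrightarrow> ennreal 0"
    by (rule tendsto_sandwich[OF _ _ tendsto_const lim0]) (use le in auto)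
  then have "(\<lambda>n. \<bar>(\<integral>x. v n x * f x \<partial>lebesgue) - (\<integral>x. w x * f x \<partial>lebesgue)\<bar>) \<longlonglongrightarrow> 0"
    by (subst (asm) tendsto_ennreal_iff) auto
  then show ?thesis by (simp add: tendsto_rabs_zero_iff LIM_zero_iff)
qed

text \<open>Convergence in L^p implies convergence in L^1 on compact sets, which suffices for
  pairings with bounded functions of bounded support. This closedness identifies all limits at order
  1.\<close>

lemma has_weak_gradient_limit:
  fixes u :: "nat \<Rightarrow> 'a::euclidean_space \<Rightarrow> real"
  assumes p: "1 < p" and w: "\<And>n. has_weak_gradient (u n) (G n)"
    and um: "\<And>n. u n \<in> borel_measurable lebesgue" "\<And>n. G n \<in> borel_measurable lebesgue"
    and m: "v \<in> borel_measurable lebesgue" "H \<in> borel_measurable lebesgue"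
    and u: "(\<lambda>n. \<integral>\<^sup>+x. ennreal (\<bar>u n x - v x\<bar> powr p) \<partial>lebesgue) \<longlonglongrightarrow> 0"
    and G: "(\<lambda>n. \<integral>\<^sup>+x. ennreal (norm (G n x - H x) powr p) \<partial>lebesgue) \<longlonglongrightarrow> 0"
  shows "has_weak_gradient v H"
proof -
  have L1u: "(\<lambda>n. \<integral>\<^sup>+x. ennreal \<bar>u n x - v x\<bar> * indicator K x \<partial>lebesgue) \<longlonglongrightarrow> 0" if "compact K" for K
    using Lp_tendsto_imp_set_L1_tendsto[OF p that, of "\<lambda>n x. u n x - v x"] um m u by (simp add: borel_measurable_diff)
  have L1G: "(\<lambda>n. \<integral>\<^sup>+x. ennreal (norm (G n x - H x)) * indicator K x \<partial>lebesgue) \<longlonglongrightarrow> 0" if "compact K" for K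
    using Lp_tendsto_imp_set_L1_tendsto[OF p that, of "\<lambda>n x. G n x - H x"] um m G by (simp add: borel_measurable_diff)
  have Ks: "K \<in> sets lebesgue" if "compact K" for K :: "'a set" using that by (simp add: borel_compact sets_completionI_sets)
  have fin: "\<exists>n. f n < \<infinity>" if "f \<longlonglongrightarrow> 0" for f :: "nat \<Rightarrow> ennreal"
    using order_tendstoD(2)[OF that, of \<infinity>] eventually_happens'[of sequentially] by auto
  have si: "set_integrable lebesgue K v" "set_integrable lebesgue K H" if K: "compact K" for K
  proof -
    obtain n where "(\<integral>\<^sup>+x. ennreal \<bar>u n x - v x\<bar> * indicator K x \<partial>lebesgue) < \<infinity>" using fin[OF L1u[OF K]] by blast
    then show "set_integrable lebesgue K v"
      using has_weak_gradient_set_integrable(1)[OF w K, of n] um(1)[of n] m(1) Ks[OF K] by (intro set_integrable_Lp_limit[of K "u n" v]) auto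
    obtain n where "(\<integral>\<^sup>+x. ennreal (norm (G n x - H x)) * indicator K x \<partial>lebesgue) < \<infinity>" using fin[OF L1G[OF K]] by blast
    then show "set_integrable lebesgue K H"
      using has_weak_gradient_set_integrable(2)[OF w K, of n] um(2)[of n] m(2) Ks[OF K] by (intro set_integrable_Lp_limit[of K "G n" H]) auto
  qed
  show ?thesis unfolding has_weak_gradient_def
  proof (intro conjI allI impI ballI)
    fix \<phi> :: "'a \<Rightarrow> real" and i :: 'a assume \<phi>: "test_function UNIV \<phi>" and i: "i \<in> Basis"
    obtain R L where RL: "0 < R" "0 < L" "\<And>x. R \<le> norm x \<Longrightarrow> \<phi> x = 0 \<and> grad \<phi> x = 0"
      "\<And>x. \<bar>\<phi> x\<bar> \<le> L" "\<And>x. norm (grad \<phi> x) \<le> L"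
      using test_function_bounds[OF \<phi>] by metis
    have c: "compact (cball (0::'a) R)" by simp
    have 1: "(\<lambda>n. \<integral>x. u n x * frechet_derivative \<phi> (at x) i \<partial>lebesgue) \<longlonglongrightarrow> (\<integral>x. v x * frechet_derivative \<phi> (at x) i \<partial>lebesgue)"
    proof (rule set_L1_tendsto_pairing[OF L1u[OF c] has_weak_gradient_set_integrable(1)[OF w c] si(1)[OF c]])
      show "(\<lambda>x. frechet_derivative \<phi> (at x) i) \<in> borel_measurable borel"
        using smooth_borel[OF smooth_partial[OF test_function_smooth[OF \<phi>] i]] .
      show "\<bar>frechet_derivative \<phi> (at x) i\<bar> \<le> L" for x
        using Basis_le_norm[OF i, of "grad \<phi> x"] RL(5)[of x] by (simp add: grad_inner_Basis[OF i])
      show "frechet_derivative \<phi> (at x) i = 0" if "R \<le> norm x" for x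
        using RL(3)[OF that] grad_inner_Basis[OF i, of \<phi> x] by simp
    qed
    have 2: "(\<lambda>n. \<integral>x. (G n x \<bullet> i) * \<phi> x \<partial>lebesgue) \<longlonglongrightarrow> (\<integral>x. (H x \<bullet> i) * \<phi> x \<partial>lebesgue)"
    proof (rule set_L1_tendsto_pairing[OF _ has_weak_gradient_set_integrable(3)[OF w c]])
      have "(\<integral>\<^sup>+x. ennreal \<bar>G n x \<bullet> i - H x \<bullet> i\<bar> * indicator (cball 0 R) x \<partial>lebesgue) \<le>
         (\<integral>\<^sup>+x. ennreal (norm (G n x - H x)) * indicator (cball 0 R) x \<partial>lebesgue)" for n
        using Basis_le_norm[OF i] by (intro nn_integral_mono mult_right_mono ennreal_leI) (auto simp flip: inner_diff_left)
      then show "(\<lambda>n. \<integral>\<^sup>+x. ennreal \<bar>G n x \<bullet> i - H x \<bullet> i\<bar> * indicator (cball 0 R) x \<partial>lebesgue) \<longlonglongrightarrow> 0"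
        by (intro tendsto_sandwich[OF _ _ tendsto_const L1G[OF c]]) auto
      have "integrable lebesgue (\<lambda>x. (indicator (cball 0 R) x *\<^sub>R H x) \<bullet> i)"
        using si(2)[OF c] unfolding set_integrable_def by (rule integrable_inner_left)
      then show "set_integrable lebesgue (cball 0 R) (\<lambda>x. H x \<bullet> i)" unfolding set_integrable_def by simp
    qed (use test_function_borel(1)[OF \<phi>] RL in auto)
    have "(\<integral>x. u n x * frechet_derivative \<phi> (at x) i \<partial>lebesgue) = - (\<integral>x. (G n x \<bullet> i) * \<phi> x \<partial>lebesgue)" for n
      using w[of n] \<phi> i unfolding has_weak_gradient_def by blast
    then show "(\<integral>x. v x * frechet_derivative \<phi> (at x) i \<partial>lebesgue) = - (\<integral>x. (H x \<bullet> i) * \<phi> x \<partial>lebesgue)"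
      using LIMSEQ_unique[OF 1] tendsto_minus[OF 2] by simp
  qed (use si in auto)
qed

section \<open>The normalizing constant\<close>

text \<open>Gamma (2 - s) = (1 - s) Gamma (1 - s) turns c_{N,s,p} into s (1 - s) h (s,p), where h is
  continuous and positive on the compact rectangle [0,1] x [1,N]; its extrema are the two constants.
  For n \<ge> 2 and p \<ge> 1 the argument of the other Gamma factor stays positive.\<close>

lemma frac_const_bounds:
  assumes n: "2 \<le> n"
  obtains c C where "0 < c" "0 < C" "\<And>s p. 0 < s \<Longrightarrow> s < 1 \<Longrightarrow> 1 < p \<Longrightarrow> p \<le> real n \<Longrightarrow>
    c * (s * (1 - s)) \<le> frac_const n s p \<and> frac_const n s p \<le> C * (s * (1 - s))"
proof -
  define h :: "real \<times> real \<Rightarrow> real" where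
    "h z = 2 powr (2 * fst z) * Gamma ((snd z * fst z + snd z + real n - 2) / 2) / (pi powr (real n / 2) * Gamma (2 - fst z))" for z
  let ?K = "{0..1 :: real} \<times> {1..real n}"
  have K: "0 \<le> fst z" "fst z \<le> 1" "1 \<le> snd z" "snd z \<le> real n" if "z \<in> ?K" for z
    using that by auto
  have pos1: "0 < (snd z * fst z + snd z + real n - 2) / 2" if "z \<in> ?K" for z
  proof -
    have "0 \<le> snd z * fst z" using K[OF that] by (intro mult_nonneg_nonneg) auto
    moreover have "2 \<le> real n" using n by simp
    moreover have "0 < (q + snd z + real n - 2) / 2" if "0 \<le> q" "2 \<le> real n" "1 \<le> snd z" for q using that by simp
    ultimately show ?thesis using K[OF that] by blast
  qed
  have pos2: "0 < 2 - fst z" if "z \<in> ?K" for z using K[OF that] by simp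
  have np: "x \<notin> \<int>\<^sub>\<le>\<^sub>0" if "0 < x" for x :: real using that by (auto elim!: nonpos_Ints_cases)
  have G: "continuous_on ?K (\<lambda>z. Gamma (f z))" if "continuous_on ?K f" "\<And>z. z \<in> ?K \<Longrightarrow> 0 < f z" for f :: "real \<times> real \<Rightarrow> real"
  proof (rule continuous_on_compose2[OF _ that(1)])
    show "continuous_on {0<..} (Gamma :: real \<Rightarrow> real)" using np by (intro continuous_on_Gamma) auto
  qed (use that(2) in auto)
  have "continuous_on ?K (\<lambda>z. Gamma ((snd z * fst z + snd z + real n - 2) / 2))" "continuous_on ?K (\<lambda>z. Gamma (2 - fst z))"
    using pos1 pos2 by (auto intro!: G continuous_intros)
  moreover have "pi powr (real n / 2) * Gamma (2 - fst z) \<noteq> 0" if "z \<in> ?K" for z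
    using Gamma_real_pos[OF pos2[OF that]] by simp
  ultimately have cont: "continuous_on ?K h"
    unfolding h_def by (intro continuous_on_divide continuous_on_mult continuous_on_powr continuous_intros) auto
  have hpos: "0 < h z" if "z \<in> ?K" for z
    unfolding h_def using pos1[OF that] pos2[OF that] by (intro divide_pos_pos mult_pos_pos Gamma_real_pos) auto
  have ne: "?K \<noteq> {}" and cp: "compact ?K" using n by (auto intro!: compact_Times)
  obtain z0 where z0: "z0 \<in> ?K" "\<And>z. z \<in> ?K \<Longrightarrow> h z0 \<le> h z"
    using continuous_attains_inf[OF cp ne cont] by blast
  obtain z1 where z1: "z1 \<in> ?K" "\<And>z. z \<in> ?K \<Longrightarrow> h z \<le> h z1"
    using continuous_attains_sup[OF cp ne cont] by blast
  show ?thesis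
  proof (rule that[of "h z0" "h z1"])
    show "0 < h z0" "0 < h z1" using hpos z0 z1 by auto
    fix s p :: real assume s: "0 < s" "s < 1" and p: "1 < p" "p \<le> real n"
    have z: "(s, p) \<in> ?K" using s p by simp
    have "Gamma (2 - s) = (1 - s) * Gamma (1 - s)"
      using Gamma_plus1[of "1 - s"] np[of "1 - s"] s by (simp add: algebra_simps)
    moreover have "Gamma (1 - s) \<noteq> 0" "1 - s \<noteq> 0" using s np[of "1 - s"] by (auto simp: Gamma_eq_zero_iff)
    ultimately have "frac_const n s p = h (s, p) * (s * (1 - s))"
      by (simp add: frac_const_def h_def)
    then show "h z0 * (s * (1 - s)) \<le> frac_const n s p \<and> frac_const n s p \<le> h z1 * (s * (1 - s))"
      using z0(2)[OF z] z1(2)[OF z] s by (auto intro!: mult_right_mono)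
  qed
qed

lemma frac_const_pos:
  assumes "0 < s" "s < 1" "1 < p" "2 \<le> n"
  shows "0 < frac_const n s p"
proof -
  have "0 < p * s" "2 \<le> real n" using assms by auto
  moreover have "0 < (q + p + real n - 2) / 2" if "0 < q" "2 \<le> real n" for q using that assms(3) by simp
  ultimately have "0 < (p * s + p + real n - 2) / 2" by blast
  then show ?thesis unfolding frac_const_def using assms
    by (intro divide_pos_pos mult_pos_pos Gamma_real_pos) auto
qed

section \<open>Lebesgue measurable functions and difference quotients\<close>

text \<open>Measurability between completed measures also asks that null sets pull back to null
  sets; here the preimages are products of a null set with the whole space. It makes u (fst z)
  Lebesgue measurable whenever u is.\<close>

lemma fst_snd_lebesgue:
  shows "fst \<in> (lebesgue :: ('a::euclidean_space \<times> 'b::euclidean_space) measure) \<rightarrow>\<^sub>M lebesgue"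
    and "snd \<in> (lebesgue :: ('a \<times> 'b) measure) \<rightarrow>\<^sub>M lebesgue"
    and "N \<in> null_sets lborel \<Longrightarrow> fst -` N \<in> null_sets (lborel :: ('a \<times> 'b) measure)"
    and "N' \<in> null_sets lborel \<Longrightarrow> snd -` N' \<in> null_sets (lborel :: ('a \<times> 'b) measure)"
proof -
  have 1: "fst -` N \<in> null_sets (lborel :: ('a \<times> 'b) measure)" if N: "N \<in> null_sets lborel" for N :: "'a set"
  proof -
    have "emeasure (lborel \<Otimes>\<^sub>M lborel) (N \<times> (UNIV :: 'b set)) = emeasure lborel N * emeasure lborel (UNIV :: 'b set)"
      using N by (intro lborel.emeasure_pair_measure_Times) auto
    also have "\<dots> = 0" using N by (simp add: null_setsD1)
    finally have "emeasure lborel (N \<times> (UNIV :: 'b set)) = 0" by (simp add: lborel_prod)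
    moreover have "N \<times> (UNIV :: 'b set) \<in> sets lborel"
    proof -
      have "N \<times> (UNIV :: 'b set) \<in> sets (borel \<Otimes>\<^sub>M borel)" by (rule pair_measureI) (use null_setsD2[OF N] in simp_all)
      then show ?thesis by (simp only: borel_prod sets_lborel)
    qed
    moreover have "fst -` N = N \<times> (UNIV :: 'b set)" by auto
    ultimately show ?thesis by (simp add: null_sets_def)
  qed
  have 2: "snd -` N \<in> null_sets (lborel :: ('a \<times> 'b) measure)" if N: "N \<in> null_sets lborel" for N :: "'b set"
  proof -
    have "emeasure (lborel \<Otimes>\<^sub>M lborel) ((UNIV :: 'a set) \<times> N) = emeasure lborel (UNIV :: 'a set) * emeasure lborel N"
      using N by (intro lborel.emeasure_pair_measure_Times) auto
    also have "\<dots> = 0" using N by (simp add: null_setsD1)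
    finally have "emeasure lborel ((UNIV :: 'a set) \<times> N) = 0" by (simp add: lborel_prod)
    moreover have "(UNIV :: 'a set) \<times> N \<in> sets lborel"
    proof -
      have "(UNIV :: 'a set) \<times> N \<in> sets (borel \<Otimes>\<^sub>M borel)" by (rule pair_measureI) (use null_setsD2[OF N] in simp_all)
      then show ?thesis by (simp only: borel_prod sets_lborel)
    qed
    moreover have "snd -` N = (UNIV :: 'a set) \<times> N" by auto
    ultimately show ?thesis by (simp add: null_sets_def)
  qed
  show "N \<in> null_sets lborel \<Longrightarrow> fst -` N \<in> null_sets (lborel :: ('a \<times> 'b) measure)" by (rule 1)
  show "N' \<in> null_sets lborel \<Longrightarrow> snd -` N' \<in> null_sets (lborel :: ('a \<times> 'b) measure)" by (rule 2)
  have "fst \<in> (borel :: ('a \<times> 'b) measure) \<rightarrow>\<^sub>M borel" "snd \<in> (borel :: ('a \<times> 'b) measure) \<rightarrow>\<^sub>M borel"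
    by (auto intro!: borel_measurable_continuous_onI continuous_intros)
  then have "fst \<in> (lebesgue :: ('a \<times> 'b) measure) \<rightarrow>\<^sub>M lborel" "snd \<in> (lebesgue :: ('a \<times> 'b) measure) \<rightarrow>\<^sub>M lborel"
    by (auto intro!: measurable_completion)
  note m = this
  have "null_sets (lborel :: 'a measure) \<subseteq> null_sets (distr (lebesgue :: ('a \<times> 'b) measure) lborel fst)"
  proof
    fix N :: "'a set" assume N: "N \<in> null_sets lborel"
    have "fst -` N \<in> null_sets (lebesgue :: ('a \<times> 'b) measure)" using 1[OF N] by (rule null_sets_completionI)
    then show "N \<in> null_sets (distr (lebesgue :: ('a \<times> 'b) measure) lborel fst)"
      using null_setsD2[OF N] by (subst null_sets_distr_iff[OF m(1)]) simp
  qed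
  then show "fst \<in> (lebesgue :: ('a \<times> 'b) measure) \<rightarrow>\<^sub>M lebesgue"
    by (rule completion.measurable_completion2[OF m(1)])
  have "null_sets (lborel :: 'b measure) \<subseteq> null_sets (distr (lebesgue :: ('a \<times> 'b) measure) lborel snd)"
  proof
    fix N :: "'b set" assume N: "N \<in> null_sets lborel"
    have "snd -` N \<in> null_sets (lebesgue :: ('a \<times> 'b) measure)" using 2[OF N] by (rule null_sets_completionI)
    then show "N \<in> null_sets (distr (lebesgue :: ('a \<times> 'b) measure) lborel snd)"
      using null_setsD2[OF N] by (subst null_sets_distr_iff[OF m(2)]) simp
  qed
  then show "snd \<in> (lebesgue :: ('a \<times> 'b) measure) \<rightarrow>\<^sub>M lebesgue"
    by (rule completion.measurable_completion2[OF m(2)])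
qed

lemma AE_lebesgue_prod:
  fixes P :: "'a::euclidean_space \<Rightarrow> bool"
  assumes "AE x in lebesgue. P x"
  shows "AE z in (lebesgue :: ('a \<times> 'a) measure). P (fst z) \<and> P (snd z)"
proof -
  have "AE x in lborel. P x" using assms by (simp add: AE_completion_iff)
  then obtain N where N: "N \<in> null_sets lborel" "{x \<in> space lborel. \<not> P x} \<subseteq> N" unfolding eventually_ae_filter by auto
  have "AE z in (lborel :: ('a \<times> 'a) measure). z \<notin> fst -` N" "AE z in (lborel :: ('a \<times> 'a) measure). z \<notin> snd -` N"
    by (rule AE_not_in[OF fst_snd_lebesgue(3)[OF N(1)]], rule AE_not_in[OF fst_snd_lebesgue(4)[OF N(1)]])
  then have "AE z in (lborel :: ('a \<times> 'a) measure). P (fst z) \<and> P (snd z)"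
    by eventually_elim (use N(2) in auto)
  then show ?thesis by (simp add: AE_completion_iff)
qed

definition supported_in :: "'a::euclidean_space set \<Rightarrow> ('a \<Rightarrow> real) \<Rightarrow> bool" where
  "supported_in \<Omega> u \<longleftrightarrow> u \<in> borel_measurable lebesgue \<and> (AE x in lebesgue. x \<notin> \<Omega> \<longrightarrow> u x = 0)"

lemma supported_in_linear:
  assumes "supported_in \<Omega> u" "supported_in \<Omega> v"
  shows "supported_in \<Omega> (\<lambda>x. a * u x + b * v x)"
proof -
  have "AE x in lebesgue. x \<notin> \<Omega> \<longrightarrow> u x = 0" "AE x in lebesgue. x \<notin> \<Omega> \<longrightarrow> v x = 0"
    using assms by (auto simp: supported_in_def)
  then have "AE x in lebesgue. x \<notin> \<Omega> \<longrightarrow> a * u x + b * v x = 0" by eventually_elim auto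
  then show ?thesis using assms by (auto simp: supported_in_def)
qed

lemma test_function_supported_in:
  assumes "test_function \<Omega> \<phi>" shows "supported_in \<Omega> \<phi>"
proof -
  have "x \<notin> \<Omega> \<Longrightarrow> \<phi> x = 0" for x
    using assms closure_subset[of "{x. \<phi> x \<noteq> 0}"] unfolding test_function_def by auto
  then show ?thesis using test_function_borel(1)[OF assms] by (auto simp: supported_in_def measurable_completion)
qed

text \<open>The estimates through moduli are stated for Borel functions that vanish everywhere off a
  ball, not merely almost everywhere. A Borel representative, cut off to the open set \<Omega>,
  provides this.\<close>

lemma supported_in_borel_version:
  assumes u: "supported_in \<Omega> u" and \<Omega>: "open \<Omega>"
  obtains u' where "u' \<in> borel_measurable borel" "AE x in lebesgue. u x = u' x" "\<And>x. x \<notin> \<Omega> \<Longrightarrow> u' x = 0"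
proof -
  obtain v where v: "v \<in> borel_measurable lborel" "AE x in lborel. u x = v x"
    using completion_ex_borel_measurable_real[of u lborel] u by (auto simp: supported_in_def)
  define u' where "u' x = (if x \<in> \<Omega> then v x else 0)" for x
  have "u' \<in> borel_measurable borel" unfolding u'_def using v(1) \<Omega> by (intro measurable_If_set) auto
  moreover have "AE x in lebesgue. u x = u' x"
  proof -
    have "AE x in lebesgue. u x = v x" "AE x in lebesgue. x \<notin> \<Omega> \<longrightarrow> u x = 0"
      using v(2) u by (auto simp: AE_completion_iff supported_in_def)
    then show ?thesis by eventually_elim (auto simp: u'_def)
  qed
  ultimately show ?thesis using that[of u'] by (auto simp: u'_def)
qed

lemma Lp_nn_lebesgue: "Lp_nn p u = (\<integral>\<^sup>+x. ennreal (\<bar>u x\<bar> powr p) \<partial>lebesgue)"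
  by (simp add: Lp_nn_def nn_integral_completion)

section \<open>Difference quotients on the product space\<close>

text \<open>The exponent (N + sp) / p is chosen so that the p-th power is the Gagliardo integrand.
  The fractional energy thus becomes the p-th power of the L^p norm of a linear image of u, on a par
  with the gradient.\<close>

definition diff_quotient :: "real \<Rightarrow> real \<Rightarrow> ('a::euclidean_space \<Rightarrow> real) \<Rightarrow> 'a \<times> 'a \<Rightarrow> real" where
  "diff_quotient s p u z = (u (fst z) - u (snd z)) / norm (fst z - snd z) powr ((real DIM('a) + s * p) / p)"

lemma diff_quotient_powr:
  fixes u :: "'a::euclidean_space \<Rightarrow> real"
  assumes "0 < p"
  shows "norm (diff_quotient s p u z) powr p = \<bar>u (fst z) - u (snd z)\<bar> powr p / norm (fst z - snd z) powr (real DIM('a) + s * p)"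
  using assms unfolding diff_quotient_def by (simp add: abs_divide powr_divide powr_powr)

lemma frac_energy_lebesgue:
  fixes u :: "'a::euclidean_space \<Rightarrow> real"
  assumes "0 < p"
  shows "frac_energy s p u = (\<integral>\<^sup>+z. ennreal (norm (diff_quotient s p u z) powr p) \<partial>(lebesgue :: ('a \<times> 'a) measure))"
  unfolding frac_energy_def diff_quotient_powr[OF assms] by (simp add: nn_integral_completion)

lemma diff_quotient_measurable:
  fixes u :: "'a::euclidean_space \<Rightarrow> real"
  assumes u: "u \<in> borel_measurable lebesgue"
  shows "diff_quotient s p u \<in> borel_measurable (lebesgue :: ('a \<times> 'a) measure)"
proof -
  have "(\<lambda>z. u (fst z)) \<in> borel_measurable (lebesgue :: ('a \<times> 'a) measure)" "(\<lambda>z. u (snd z)) \<in> borel_measurable (lebesgue :: ('a \<times> 'a) measure)"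
    using measurable_compose[OF fst_snd_lebesgue(1) u] measurable_compose[OF fst_snd_lebesgue(2) u] by auto
  moreover have "(\<lambda>z. norm (fst z - snd z) powr ((real DIM('a) + s * p) / p)) \<in> borel_measurable (lebesgue :: ('a \<times> 'a) measure)"
  proof (rule measurable_completion)
    have "(\<lambda>z :: 'a \<times> 'a. norm (fst z - snd z)) \<in> borel_measurable borel"
      by (intro borel_measurable_continuous_onI continuous_intros)
    then show "(\<lambda>z. norm (fst z - snd z) powr ((real DIM('a) + s * p) / p)) \<in> borel_measurable (lborel :: ('a \<times> 'a) measure)"
      by measurable
  qed
  ultimately show ?thesis unfolding diff_quotient_def by (intro borel_measurable_divide borel_measurable_diff)
qed

lemma diff_quotient_linear:
  "diff_quotient s p (\<lambda>x. a * u x + b * v x) z = a *\<^sub>R diff_quotient s p u z + b *\<^sub>R diff_quotient s p v z"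
  by (simp add: diff_quotient_def add_divide_distrib[symmetric] algebra_simps)

lemma diff_quotient_AE_cong:
  assumes "AE x in lebesgue. u x = v x"
  shows "AE z in lebesgue. diff_quotient s p u z = diff_quotient s p v z"
  using AE_lebesgue_prod[OF assms] by eventually_elim (simp add: diff_quotient_def)

lemma Lp_nn_cong_AE: "AE x in lebesgue. u x = v x \<Longrightarrow> Lp_nn p u = Lp_nn p v"
  unfolding Lp_nn_lebesgue by (rule nn_integral_cong_AE) (auto elim!: eventually_mono)

lemma frac_energy_cong_AE:
  assumes "0 < p" "AE x in lebesgue. u x = v x" shows "frac_energy s p u = frac_energy s p v"
  unfolding frac_energy_lebesgue[OF assms(1)]
  by (rule nn_integral_cong_AE) (use diff_quotient_AE_cong[OF assms(2), of s p] in \<open>auto elim!: eventually_mono\<close>)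

lemma nn_integral_norm_powr_add_le:
  fixes f g :: "'m \<Rightarrow> 'e::euclidean_space"
  assumes "0 < p" "f \<in> borel_measurable M" "g \<in> borel_measurable M"
  shows "(\<integral>\<^sup>+x. ennreal (norm (f x + g x) powr p) \<partial>M) \<le>
    ennreal (2 powr p) * ((\<integral>\<^sup>+x. ennreal (norm (f x) powr p) \<partial>M) + (\<integral>\<^sup>+x. ennreal (norm (g x) powr p) \<partial>M))"
proof -
  note [measurable] = assms(2,3)
  have "(\<integral>\<^sup>+x. ennreal (norm (f x + g x) powr p) \<partial>M) \<le>
      (\<integral>\<^sup>+x. ennreal (2 powr p) * (ennreal (norm (f x) powr p) + ennreal (norm (g x) powr p)) \<partial>M)"
    using norm_add_powr_le[OF assms(1), where 'e = 'e]
    by (intro nn_integral_mono) (auto simp: ennreal_leI simp flip: ennreal_plus ennreal_mult')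
  then show ?thesis by (simp add: nn_integral_cmult nn_integral_add)
qed

lemma nn_integral_norm_powr_scale:
  fixes f :: "'m \<Rightarrow> 'e::euclidean_space"
  assumes "f \<in> borel_measurable M"
  shows "(\<integral>\<^sup>+x. ennreal (norm (a *\<^sub>R f x) powr p) \<partial>M) = ennreal (\<bar>a\<bar> powr p) * (\<integral>\<^sup>+x. ennreal (norm (f x) powr p) \<partial>M)"
proof -
  have "(\<integral>\<^sup>+x. ennreal (norm (a *\<^sub>R f x) powr p) \<partial>M) = (\<integral>\<^sup>+x. ennreal (\<bar>a\<bar> powr p) * ennreal (norm (f x) powr p) \<partial>M)"
    by (intro nn_integral_cong) (simp add: powr_mult ennreal_mult')
  also have "\<dots> = ennreal (\<bar>a\<bar> powr p) * (\<integral>\<^sup>+x. ennreal (norm (f x) powr p) \<partial>M)"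
    using assms by (intro nn_integral_cmult) measurable
  finally show ?thesis .
qed

lemma frac_energy_diff_le:
  fixes u v :: "'a::euclidean_space \<Rightarrow> real"
  assumes p: "0 < p" and "u \<in> borel_measurable lebesgue" "v \<in> borel_measurable lebesgue"
  shows "frac_energy s p (\<lambda>x. u x - v x) \<le> ennreal (2 powr p) * (frac_energy s p u + frac_energy s p v)"
proof -
  have "frac_energy s p (\<lambda>x. u x - v x) = (\<integral>\<^sup>+z. ennreal (norm (diff_quotient s p u z + (- 1) *\<^sub>R diff_quotient s p v z) powr p) \<partial>lebesgue)"
    using diff_quotient_linear[of s p 1 u "-1" v] by (simp add: frac_energy_lebesgue[OF p])
  also have "\<dots> \<le> ennreal (2 powr p) * ((\<integral>\<^sup>+z. ennreal (norm (diff_quotient s p u z) powr p) \<partial>lebesgue) +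
      (\<integral>\<^sup>+z. ennreal (norm ((- 1) *\<^sub>R diff_quotient s p v z) powr p) \<partial>lebesgue))"
    using diff_quotient_measurable[OF assms(2)] diff_quotient_measurable[OF assms(3)]
    by (intro nn_integral_norm_powr_add_le p) auto
  finally show ?thesis by (simp add: frac_energy_lebesgue[OF p])
qed

text \<open>A subsequence is Cauchy in L^p; interpolation with the bounded energy of order s1
  upgrades this to the energy of order s2.\<close>

lemma frac_energy_compact:
  fixes f :: "nat \<Rightarrow> 'a::euclidean_space \<Rightarrow> real"
  assumes \<Omega>: "open \<Omega>" "\<Omega> \<subseteq> ball 0 R" and s: "0 < s2" "s2 < s1" and p: "1 < p"
    and f: "\<And>n. supported_in \<Omega> (f n)" and B: "0 \<le> B"
    and L: "\<And>n. Lp_nn p (f n) \<le> ennreal B" and W: "\<And>n. frac_energy s1 p (f n) \<le> ennreal B"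
  shows "\<exists>r :: nat \<Rightarrow> nat. strict_mono r \<and>
    (\<forall>e>0. \<exists>N. \<forall>m\<ge>N. \<forall>n\<ge>N. frac_energy s2 p (\<lambda>x. f (r m) x - f (r n) x) \<le> ennreal e)"
proof -
  have p0: "0 < p" using p by simp
  have "\<forall>n. \<exists>u. u \<in> borel_measurable borel \<and> (AE x in lebesgue. f n x = u x) \<and> (\<forall>x. x \<notin> \<Omega> \<longrightarrow> u x = 0)"
    using supported_in_borel_version[OF f \<Omega>(1)] by metis
  then obtain u where u: "\<And>n. u n \<in> borel_measurable borel" "\<And>n. AE x in lebesgue. f n x = u n x" "\<And>n x. x \<notin> \<Omega> \<Longrightarrow> u n x = 0"
    by metis
  have z: "u n x = 0" if "R \<le> norm x" for n x
  proof -
    have "x \<notin> \<Omega>" using \<Omega>(2) that by auto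
    then show ?thesis by (rule u(3))
  qed
  have Lu: "Lp_nn p (u n) \<le> ennreal B" and Wu: "frac_energy s1 p (u n) \<le> ennreal B" for n
    using L[of n] W[of n] Lp_nn_cong_AE[OF u(2)[of n]] frac_energy_cong_AE[OF p0 u(2)[of n]] by auto
  obtain r :: "nat \<Rightarrow> nat" where r: "strict_mono r"
    "\<forall>e>0. \<exists>N. \<forall>m\<ge>N. \<forall>n\<ge>N. Lp_nn p (\<lambda>x. u (r m) x - u (r n) x) \<le> ennreal e"
  proof -
    have "\<exists>r :: nat \<Rightarrow> nat. strict_mono r \<and>
        (\<forall>e>0. \<exists>N. \<forall>m\<ge>N. \<forall>n\<ge>N. Lp_nn p (\<lambda>x. u (r m) x - u (r n) x) \<le> ennreal e)"
      by (rule rellich[OF p _ u(1) _ B Lu Wu, where R = R]) (use s z in auto)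
    then show ?thesis using that by blast
  qed
  have "\<exists>N. \<forall>m\<ge>N. \<forall>n\<ge>N. frac_energy s2 p (\<lambda>x. f (r m) x - f (r n) x) \<le> ennreal e" if e: "0 < e" for e
  proof -
    define M where "M = 2 powr p * (2 * B) + 1"
    have M: "0 < M" using B by (simp add: M_def add_nonneg_pos)
    define k where "k = (s1 - s2) * p"
    have k: "0 < k" using s p by (simp add: k_def)
    \<comment> \<open>M bounds the energy of order s1 of all differences, and (2 \<delta>)^k M = e /
      2; the other half of e is left for the L^p term.\<close>
    define \<delta> where "\<delta> = (e / (2 * M)) powr (1 / k) / 2"
    have \<delta>: "0 < \<delta>" "(2 * \<delta>) powr k = e / (2 * M)" using e M k by (auto simp: \<delta>_def powr_powr)
    obtain C where C: "0 < C" "\<And>v :: 'a \<Rightarrow> real. v \<in> borel_measurable borel \<Longrightarrow>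
        frac_energy s2 p v \<le> ennreal ((2 * \<delta>) powr k) * frac_energy s1 p v + ennreal C * Lp_nn p v"
      using frac_interpolation[OF \<delta>(1) s p, where 'a = 'a] unfolding k_def by metis
    obtain N where N: "\<And>m n. m \<ge> N \<Longrightarrow> n \<ge> N \<Longrightarrow> Lp_nn p (\<lambda>x. u (r m) x - u (r n) x) \<le> ennreal (e / (2 * C))"
      using r(2)[rule_format, of "e / (2 * C)"] e C by auto
    have "frac_energy s2 p (\<lambda>x. f (r m) x - f (r n) x) \<le> ennreal e" if mn: "m \<ge> N" "n \<ge> N" for m n
    proof -
      have um: "u k \<in> borel_measurable lebesgue" for k using u(1) by (simp add: measurable_completion)
      have "AE x in lebesgue. f (r m) x - f (r n) x = u (r m) x - u (r n) x"
        using u(2)[of "r m"] u(2)[of "r n"] by eventually_elim simp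
      then have "frac_energy s2 p (\<lambda>x. f (r m) x - f (r n) x) = frac_energy s2 p (\<lambda>x. u (r m) x - u (r n) x)"
        by (rule frac_energy_cong_AE[OF p0])
      also have "\<dots> \<le> ennreal ((2 * \<delta>) powr k) * frac_energy s1 p (\<lambda>x. u (r m) x - u (r n) x) + ennreal C * Lp_nn p (\<lambda>x. u (r m) x - u (r n) x)"
        using u(1) by (intro C(2) borel_measurable_diff)
      also have "\<dots> \<le> ennreal (e / (2 * M)) * ennreal M + ennreal C * ennreal (e / (2 * C))"
      proof (intro add_mono mult_mono)
        have "frac_energy s1 p (\<lambda>x. u (r m) x - u (r n) x) \<le> ennreal (2 powr p) * (frac_energy s1 p (u (r m)) + frac_energy s1 p (u (r n)))"
          by (intro frac_energy_diff_le p0 um)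
        also have "\<dots> \<le> ennreal (2 powr p) * (ennreal B + ennreal B)" by (intro mult_left_mono add_mono Wu) auto
        also have "\<dots> = ennreal (2 powr p * (2 * B))" using B by (simp flip: ennreal_plus ennreal_mult')
        also have "\<dots> \<le> ennreal M" by (intro ennreal_leI) (simp add: M_def)
        finally show "frac_energy s1 p (\<lambda>x. u (r m) x - u (r n) x) \<le> ennreal M" .
        show "Lp_nn p (\<lambda>x. u (r m) x - u (r n) x) \<le> ennreal (e / (2 * C))" by (rule N[OF mn])
      qed (use \<delta> in auto)
      also have "\<dots> = ennreal e"
      proof -
        have "e / (2 * M) * M + C * (e / (2 * C)) = e" using M C by (simp add: field_simps)
        then show ?thesis using e M C by (simp flip: ennreal_plus ennreal_mult')
      qed
      finally show ?thesis .
    qed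
    then show ?thesis by blast
  qed
  then show ?thesis using r(1) by blast
qed

section \<open>The seminorm\<close>

lemma seminorm_pow_frac:
  fixes u :: "'a::euclidean_space \<Rightarrow> real"
  assumes "s < 1"
  shows "seminorm_pow s p u = ennreal (frac_const DIM('a) s p) * frac_energy s p u"
  using assms by (simp add: seminorm_pow_def frac_energy_def nn_integral_completion)

text \<open>\<open>weak_gradient\<close> is an arbitrary choice, but uniqueness almost everywhere
  lets the seminorm be computed with any weak gradient at hand.\<close>

lemma seminorm_pow_one:
  assumes "has_weak_gradient u G"
  shows "seminorm_pow 1 p u = (\<integral>\<^sup>+x. ennreal (norm (G x) powr p) \<partial>lebesgue)"
    and "AE x in lebesgue. weak_gradient u x = G x"
proof -
  have ex: "\<exists>G. has_weak_gradient u G" using assms by blast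
  then have "has_weak_gradient u (weak_gradient u)" unfolding weak_gradient_def by (rule someI_ex)
  then show eq: "AE x in lebesgue. weak_gradient u x = G x" using assms by (rule has_weak_gradient_unique)
  then show "seminorm_pow 1 p u = (\<integral>\<^sup>+x. ennreal (norm (G x) powr p) \<partial>lebesgue)"
    unfolding seminorm_pow_def using ex by (auto intro!: nn_integral_cong_AE elim!: eventually_mono)
qed

lemma weak_gradient_works: "\<exists>G. has_weak_gradient u G \<Longrightarrow> has_weak_gradient u (weak_gradient u)"
  unfolding weak_gradient_def by (rule someI_ex[of "has_weak_gradient u"])

lemma has_weak_gradient_if_finite: "seminorm_pow 1 p u < \<infinity> \<Longrightarrow> has_weak_gradient u (weak_gradient u)"
  by (rule weak_gradient_works) (auto simp: seminorm_pow_def split: if_splits)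

lemma has_weak_gradient_measurable:
  assumes w: "has_weak_gradient u G"
  shows "G \<in> borel_measurable lebesgue"
proof (rule borel_measurable_LIMSEQ_metric)
  show "(\<lambda>n. indicator (cball 0 (real n)) x *\<^sub>R G x) \<longlonglongrightarrow> G x" for x
  proof (rule tendsto_eventually)
    obtain N :: nat where "norm x \<le> real N" using real_arch_simple by blast
    then show "\<forall>\<^sub>F n in sequentially. indicator (cball 0 (real n)) x *\<^sub>R G x = G x"
      unfolding eventually_sequentially by (intro exI[of _ N]) (auto split: split_indicator)
  qed
  show "(\<lambda>x. indicator (cball 0 (real n)) x *\<^sub>R G x) \<in> borel_measurable lebesgue" for n
    using has_weak_gradient_set_integrable(2)[OF w, of "cball 0 (real n)"] by (auto simp: set_integrable_def)
qed

lemma has_weak_gradient_zero: "has_weak_gradient (\<lambda>x. 0) (\<lambda>x. 0)"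
  by (simp add: has_weak_gradient_def set_integrable_def)

lemma seminorm_pow_linear_le:
  fixes u v :: "'a::euclidean_space \<Rightarrow> real"
  assumes s: "s \<le> 1" and p: "0 < p" and m: "u \<in> borel_measurable lebesgue" "v \<in> borel_measurable lebesgue"
    and fin: "seminorm_pow s p u < \<infinity>" "seminorm_pow s p v < \<infinity>"
  shows "seminorm_pow s p (\<lambda>x. a * u x + b * v x) \<le>
    ennreal (2 powr p) * (ennreal (\<bar>a\<bar> powr p) * seminorm_pow s p u + ennreal (\<bar>b\<bar> powr p) * seminorm_pow s p v)"
proof (cases "s = 1")
  case True
  define G where "G = weak_gradient u"
  define H where "H = weak_gradient v"
  have G: "has_weak_gradient u G" and H: "has_weak_gradient v H"
    using fin True by (auto simp: G_def H_def intro: has_weak_gradient_if_finite)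
  note gm = has_weak_gradient_measurable[OF G] has_weak_gradient_measurable[OF H]
  have "seminorm_pow s p (\<lambda>x. a * u x + b * v x) = (\<integral>\<^sup>+x. ennreal (norm (a *\<^sub>R G x + b *\<^sub>R H x) powr p) \<partial>lebesgue)"
    using seminorm_pow_one(1)[OF has_weak_gradient_linear[OF G H]] True by simp
  also have "\<dots> \<le> ennreal (2 powr p) * ((\<integral>\<^sup>+x. ennreal (norm (a *\<^sub>R G x) powr p) \<partial>lebesgue) + (\<integral>\<^sup>+x. ennreal (norm (b *\<^sub>R H x) powr p) \<partial>lebesgue))"
    using gm by (intro nn_integral_norm_powr_add_le p) auto
  finally show ?thesis
    unfolding nn_integral_norm_powr_scale[OF gm(1)] nn_integral_norm_powr_scale[OF gm(2)]
    using seminorm_pow_one(1)[OF G] seminorm_pow_one(1)[OF H] True by simp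
next
  case False
  then have s1: "s < 1" using s by simp
  note dm = diff_quotient_measurable[OF m(1), of s p] diff_quotient_measurable[OF m(2), of s p]
  have "frac_energy s p (\<lambda>x. a * u x + b * v x) =
      (\<integral>\<^sup>+z. ennreal (norm (a *\<^sub>R diff_quotient s p u z + b *\<^sub>R diff_quotient s p v z) powr p) \<partial>lebesgue)"
    by (simp only: frac_energy_lebesgue[OF p] diff_quotient_linear)
  also have "\<dots> \<le> ennreal (2 powr p) * ((\<integral>\<^sup>+z. ennreal (norm (a *\<^sub>R diff_quotient s p u z) powr p) \<partial>lebesgue) +
      (\<integral>\<^sup>+z. ennreal (norm (b *\<^sub>R diff_quotient s p v z) powr p) \<partial>lebesgue))"
    using dm by (intro nn_integral_norm_powr_add_le p) auto
  finally have "frac_energy s p (\<lambda>x. a * u x + b * v x) \<le>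
      ennreal (2 powr p) * (ennreal (\<bar>a\<bar> powr p) * frac_energy s p u + ennreal (\<bar>b\<bar> powr p) * frac_energy s p v)"
    unfolding nn_integral_norm_powr_scale[OF dm(1)] nn_integral_norm_powr_scale[OF dm(2)] frac_energy_lebesgue[OF p, symmetric] .
  then have "ennreal (frac_const DIM('a) s p) * frac_energy s p (\<lambda>x. a * u x + b * v x) \<le> ennreal (frac_const DIM('a) s p) *
      (ennreal (2 powr p) * (ennreal (\<bar>a\<bar> powr p) * frac_energy s p u + ennreal (\<bar>b\<bar> powr p) * frac_energy s p v))"
    by (rule mult_left_mono) simp
  then show ?thesis unfolding seminorm_pow_frac[OF s1] by (simp add: distrib_left mult_ac)
qed

lemma seminorm_pow_zero: "0 < p \<Longrightarrow> seminorm_pow s p (\<lambda>x :: 'a::euclidean_space. 0) = 0"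
proof (cases "s < 1")
  case False
  assume "0 < p"
  moreover have "seminorm_pow s p (\<lambda>x :: 'a. 0) = seminorm_pow 1 p (\<lambda>x :: 'a. 0)" unfolding seminorm_pow_def using False by (simp only: if_False less_irrefl)
  ultimately show ?thesis using seminorm_pow_one(1)[OF has_weak_gradient_zero, of p] by simp
qed (simp add: seminorm_pow_frac frac_energy_def)

lemma seminorm_finite_iff: "seminorm s p u < \<infinity> \<longleftrightarrow> seminorm_pow s p u < \<infinity>"
  by (auto simp: seminorm_def top.not_eq_extremum)

lemma seminorm_powr:
  assumes "0 < p" "seminorm_pow s p u < \<infinity>"
  shows "enn2real (seminorm s p u) powr p = enn2real (seminorm_pow s p u)"
  using assms by (auto simp: seminorm_def powr_powr)

lemma seminorm_tendsto_zero_iff: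
  fixes u :: "nat \<Rightarrow> 'a::euclidean_space \<Rightarrow> real"
  assumes p: "0 < p"
  shows "(\<lambda>n. seminorm s p (u n)) \<longlonglongrightarrow> 0 \<longleftrightarrow> (\<lambda>n. seminorm_pow s p (u n)) \<longlonglongrightarrow> 0"
proof -
  have iff: "seminorm s p v < ennreal e \<longleftrightarrow> seminorm_pow s p v < ennreal (e powr p)" if e: "0 < e" for v :: "'a \<Rightarrow> real" and e
  proof (cases "seminorm_pow s p v")
    case (real x)
    have "x powr (1 / p) < e \<longleftrightarrow> x < e powr p"
    proof
      assume "x powr (1 / p) < e"
      then have "(x powr (1 / p)) powr p < e powr p" using p by (intro powr_less_mono2) auto
      then show "x < e powr p" using p real by (simp add: powr_powr)
    next
      assume "x < e powr p"
      then have "x powr (1 / p) < (e powr p) powr (1 / p)" using p real by (intro powr_less_mono2) auto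
      then show "x powr (1 / p) < e" using p e by (simp add: powr_powr)
    qed
    then show ?thesis using real e by (simp add: seminorm_def ennreal_less_iff)
  qed (simp add: seminorm_def)
  have ev: "(f \<longlonglongrightarrow> 0) \<longleftrightarrow> (\<forall>e>0. \<forall>\<^sub>F n in sequentially. f n < ennreal e)" for f :: "nat \<Rightarrow> ennreal"
    using order_tendstoD(2)[of f 0 sequentially] tendsto_zero_ennreal[of f] by auto
  have "(\<forall>e>0. \<forall>\<^sub>F n in sequentially. seminorm s p (u n) < ennreal e) \<longleftrightarrow>
      (\<forall>e>0. \<forall>\<^sub>F n in sequentially. seminorm_pow s p (u n) < ennreal e)"
  proof (intro iffI allI impI)
    fix e :: real assume a: "\<forall>e>0. \<forall>\<^sub>F n in sequentially. seminorm s p (u n) < ennreal e" and e: "0 < e"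
    have "0 < e powr (1 / p)" "(e powr (1 / p)) powr p = e" using e p by (auto simp: powr_powr)
    then show "\<forall>\<^sub>F n in sequentially. seminorm_pow s p (u n) < ennreal e"
      using a[rule_format, of "e powr (1 / p)"] iff[of "e powr (1 / p)"] by simp
  next
    fix e :: real assume a: "\<forall>e>0. \<forall>\<^sub>F n in sequentially. seminorm_pow s p (u n) < ennreal e" and e: "0 < e"
    have "0 < e powr p" using e by simp
    then show "\<forall>\<^sub>F n in sequentially. seminorm s p (u n) < ennreal e"
      using a[rule_format, of "e powr p"] by (simp only: iff[OF e])
  qed
  then show ?thesis unfolding ev .
qed

lemma energy_space_iff:
  assumes "0 < p"
  shows "u \<in> energy_space \<Omega> s p \<longleftrightarrow> supported_in \<Omega> u \<and> seminorm_pow s p u < \<infinity> \<and>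
    (\<exists>\<phi> :: nat \<Rightarrow> 'a::euclidean_space \<Rightarrow> real. (\<forall>n. test_function \<Omega> (\<phi> n)) \<and>
       (\<lambda>n. seminorm_pow s p (\<lambda>x. \<phi> n x - u x)) \<longlonglongrightarrow> 0)"
  unfolding energy_space_def supported_in_def seminorm_finite_iff seminorm_tendsto_zero_iff[OF assms] by blast

section \<open>Energy spaces on bounded domains\<close>

lemma test_function_seminorm_pow_one:
  fixes \<phi> :: "'a::euclidean_space \<Rightarrow> real"
  assumes "test_function \<Omega> \<phi>"
  shows "seminorm_pow 1 p \<phi> = (\<integral>\<^sup>+x. ennreal (norm (grad \<phi> x) powr p) \<partial>lborel)"
  using seminorm_pow_one(1)[OF test_function_has_weak_gradient[OF assms], of p] by (simp add: nn_integral_completion)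

lemma test_function_seminorm_pow_one_finite:
  fixes \<phi> :: "'a::euclidean_space \<Rightarrow> real"
  assumes \<phi>: "test_function \<Omega> \<phi>" and p: "0 < p"
  shows "seminorm_pow 1 p \<phi> < \<infinity>"
proof -
  obtain R L where RL: "0 < R" "0 < L" "\<And>x. R \<le> norm x \<Longrightarrow> \<phi> x = 0 \<and> grad \<phi> x = 0" "\<And>x. norm (grad \<phi> x) \<le> L"
    by (rule test_function_bounds[OF \<phi>]) (rule that)
  note [measurable] = test_function_borel[OF \<phi>]
  have "integrable lborel (\<lambda>x. norm (grad \<phi> x) powr p)"
  proof (rule bounded_support_integrable[of _ "L powr p" R])
    show "norm (norm (grad \<phi> x) powr p) \<le> L powr p" for x using RL(4)[of x] p by (auto intro!: powr_mono2)
    show "norm (grad \<phi> x) powr p = 0" if "R \<le> norm x" for x using RL(3)[OF that] by simp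
  qed measurable
  then show ?thesis unfolding test_function_seminorm_pow_one[OF \<phi>] by (simp add: nn_integral_eq_integral)
qed

lemma seminorm_pow_diff_le:
  fixes u v :: "'a::euclidean_space \<Rightarrow> real"
  assumes "s \<le> 1" "0 < p" "u \<in> borel_measurable lebesgue" "v \<in> borel_measurable lebesgue"
    and "seminorm_pow s p u < \<infinity>" "seminorm_pow s p v < \<infinity>"
  shows "seminorm_pow s p (\<lambda>x. u x - v x) \<le> ennreal (2 powr p) * (seminorm_pow s p u + seminorm_pow s p v)"
    and "seminorm_pow s p (\<lambda>x. u x - v x) < \<infinity>"
proof -
  show *: "seminorm_pow s p (\<lambda>x. u x - v x) \<le> ennreal (2 powr p) * (seminorm_pow s p u + seminorm_pow s p v)"
    using seminorm_pow_linear_le[OF assms, of 1 "-1"] by simp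
  show "seminorm_pow s p (\<lambda>x. u x - v x) < \<infinity>"
    by (rule le_less_trans[OF *]) (use assms in \<open>simp add: ennreal_mult_less_top\<close>)
qed

lemma seminorm_pow_triangle:
  fixes u v w :: "'a::euclidean_space \<Rightarrow> real"
  assumes "s \<le> 1" "0 < p" "u \<in> borel_measurable lebesgue" "v \<in> borel_measurable lebesgue" "w \<in> borel_measurable lebesgue"
    and "seminorm_pow s p (\<lambda>x. u x - v x) < \<infinity>" "seminorm_pow s p (\<lambda>x. w x - v x) < \<infinity>"
  shows "seminorm_pow s p (\<lambda>x. u x - w x) \<le>
    ennreal (2 powr p) * (seminorm_pow s p (\<lambda>x. u x - v x) + seminorm_pow s p (\<lambda>x. w x - v x))"
  using seminorm_pow_diff_le(1)[OF assms(1,2) _ _ assms(6,7)] assms(3-5) by simp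

lemma seminorm_pow_Fatou:
  fixes f :: "nat \<Rightarrow> 'a::euclidean_space \<Rightarrow> real"
  assumes s: "s < 1" and p: "0 < p" and m: "\<And>n. f n \<in> borel_measurable lebesgue"
    and h: "h \<in> borel_measurable lebesgue" and l: "AE x in lebesgue. (\<lambda>n. f n x) \<longlonglongrightarrow> h x"
    and B: "eventually (\<lambda>n. seminorm_pow s p (f n) \<le> B) sequentially"
  shows "seminorm_pow s p h \<le> B"
proof -
  let ?c = "ennreal (frac_const DIM('a) s p)"
  have eq: "seminorm_pow s p v = (\<integral>\<^sup>+z. ?c * ennreal (norm (diff_quotient s p v z) powr p) \<partial>lebesgue)"
    if "diff_quotient s p v \<in> borel_measurable lebesgue" for v :: "'a \<Rightarrow> real"
    unfolding seminorm_pow_frac[OF s] frac_energy_lebesgue[OF p] using that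
    by (intro nn_integral_cmult[symmetric]) measurable
  have dl: "AE z in lebesgue. (\<lambda>n. diff_quotient s p (f n) z) \<longlonglongrightarrow> diff_quotient s p h z"
    using AE_lebesgue_prod[OF l] by eventually_elim (auto simp: diff_quotient_def divide_inverse intro!: tendsto_intros)
  have "(\<integral>\<^sup>+z. ?c * ennreal (norm (diff_quotient s p h z) powr p) \<partial>lebesgue) \<le> B"
  proof (rule nn_integral_Fatou_le)
    show "(\<lambda>z. ?c * ennreal (norm (diff_quotient s p (f n) z) powr p)) \<in> borel_measurable lebesgue" for n
      using diff_quotient_measurable[OF m[of n], of s p] by measurable
    show "AE z in lebesgue. (\<lambda>n. ?c * ennreal (norm (diff_quotient s p (f n) z) powr p)) \<longlonglongrightarrow> ?c * ennreal (norm (diff_quotient s p h z) powr p)"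
      using dl by eventually_elim (intro ennreal_tendsto_cmult tendsto_ennrealI tendsto_powr2 tendsto_norm tendsto_const; use p in auto)
    show "\<forall>\<^sub>F n in sequentially. (\<integral>\<^sup>+z. ?c * ennreal (norm (diff_quotient s p (f n) z) powr p) \<partial>lebesgue) \<le> B"
      using B by (simp add: eq[OF diff_quotient_measurable[OF m]])
  qed
  then show ?thesis by (simp add: eq[OF diff_quotient_measurable[OF h]])
qed

text \<open>R is the only trace of \<Omega> in the constants. Being at least 1, it keeps |h| \<ge> 1
  on the annuli of radii R and 2R, where powers of |h| are then monotone in the exponent.\<close>

locale bounded_domain =
  fixes \<Omega> :: "'a::euclidean_space set" and R :: real
  assumes open_domain: "open \<Omega>" and domain_subset: "\<Omega> \<subseteq> ball 0 R" and R1: "1 \<le> R" and dim: "2 \<le> DIM('a)"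
begin

text \<open>Since c_{N,s,p} is comparable to s (1 - s), the normalized estimates become estimates of
  seminorms with one constant for all s and p. The gradient enters for test functions only, because
  the bound of the modulus by |h|^p G is available for these.\<close>

lemma seminorm_pow_compare_frac:
  obtains C where "0 < C"
    "\<And>s p (u :: 'a \<Rightarrow> real). 0 < s \<Longrightarrow> s < 1 \<Longrightarrow> 1 < p \<Longrightarrow> p \<le> real DIM('a) \<Longrightarrow> supported_in \<Omega> u \<Longrightarrow>
      Lp_nn p u \<le> ennreal C * seminorm_pow s p u"
    "\<And>s1 s2 p (u :: 'a \<Rightarrow> real). 0 < s2 \<Longrightarrow> s2 < s1 \<Longrightarrow> s1 < 1 \<Longrightarrow> 1 < p \<Longrightarrow> p \<le> real DIM('a) \<Longrightarrow> supported_in \<Omega> u \<Longrightarrow>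
      seminorm_pow s2 p u \<le> ennreal C * seminorm_pow s1 p u"
    "\<And>s p (\<phi> :: 'a \<Rightarrow> real). 0 < s \<Longrightarrow> s < 1 \<Longrightarrow> 1 < p \<Longrightarrow> p \<le> real DIM('a) \<Longrightarrow> test_function \<Omega> \<phi> \<Longrightarrow>
      Lp_nn p \<phi> \<le> ennreal C * seminorm_pow 1 p \<phi> \<and> seminorm_pow s p \<phi> \<le> ennreal C * seminorm_pow 1 p \<phi>"
proof -
  obtain a b where ab: "0 < a" "0 < b" "\<And>s p. 0 < s \<Longrightarrow> s < 1 \<Longrightarrow> 1 < p \<Longrightarrow> p \<le> real DIM('a) \<Longrightarrow>
    a * (s * (1 - s)) \<le> frac_const DIM('a) s p \<and> frac_const DIM('a) s p \<le> b * (s * (1 - s))"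
    using frac_const_bounds[OF dim] by blast
  obtain c1 where c1: "0 < c1" "\<And>s p (u :: 'a \<Rightarrow> real). 0 < s \<Longrightarrow> s < 1 \<Longrightarrow> 1 < p \<Longrightarrow> p \<le> real DIM('a) \<Longrightarrow>
    u \<in> borel_measurable borel \<Longrightarrow> (\<And>x. R \<le> norm x \<Longrightarrow> u x = 0) \<Longrightarrow>
    Lp_nn p u \<le> ennreal c1 * (ennreal (s * (1 - s)) * frac_energy s p u)"
    using frac_poincare[OF R1, where 'a = 'a] by blast
  obtain c2 where c2: "0 < c2" "\<And>s1 s2 p (u :: 'a \<Rightarrow> real). 0 < s2 \<Longrightarrow> s2 < s1 \<Longrightarrow> s1 < 1 \<Longrightarrow>
    1 < p \<Longrightarrow> p \<le> real DIM('a) \<Longrightarrow> u \<in> borel_measurable borel \<Longrightarrow> (\<And>x. R \<le> norm x \<Longrightarrow> u x = 0) \<Longrightarrow>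
    ennreal (s2 * (1 - s2)) * frac_energy s2 p u \<le> ennreal c2 * (ennreal (s1 * (1 - s1)) * frac_energy s1 p u)"
    using frac_compare[OF R1, where 'a = 'a] by blast
  obtain c3 where c3: "0 < c3" "\<And>s p G (u :: 'a \<Rightarrow> real). 0 < s \<Longrightarrow> s < 1 \<Longrightarrow>
    1 < p \<Longrightarrow> p \<le> real DIM('a) \<Longrightarrow> u \<in> borel_measurable borel \<Longrightarrow> (\<And>x. R \<le> norm x \<Longrightarrow> u x = 0) \<Longrightarrow>
    (\<And>h. modulus p u h \<le> ennreal (norm h powr p) * G) \<Longrightarrow>
    Lp_nn p u \<le> ennreal c3 * G \<and> ennreal (s * (1 - s)) * frac_energy s p u \<le> ennreal c3 * G"
    using frac_gradient_compare[OF R1, where 'a = 'a] by blast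
  have up: "seminorm_pow s p u \<le> ennreal b * (ennreal (s * (1 - s)) * frac_energy s p u)"
    if "0 < s" "s < 1" "1 < p" "p \<le> real DIM('a)" for s p and u :: "'a \<Rightarrow> real"
  proof -
    have "ennreal (frac_const DIM('a) s p) * frac_energy s p u \<le> ennreal (b * (s * (1 - s))) * frac_energy s p u"
      using ab(3)[OF that] by (intro mult_right_mono ennreal_leI) auto
    then show ?thesis using that ab by (simp add: seminorm_pow_frac ennreal_mult mult.assoc)
  qed
  have low: "ennreal (s * (1 - s)) * frac_energy s p u \<le> ennreal (1 / a) * seminorm_pow s p u"
    if "0 < s" "s < 1" "1 < p" "p \<le> real DIM('a)" for s p and u :: "'a \<Rightarrow> real"
  proof -
    have "s * (1 - s) \<le> 1 / a * frac_const DIM('a) s p" using ab(1) ab(3)[OF that] by (simp add: field_simps)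
    then have "ennreal (s * (1 - s)) * frac_energy s p u \<le> ennreal (1 / a * frac_const DIM('a) s p) * frac_energy s p u"
      by (intro mult_right_mono ennreal_leI) auto
    also have "\<dots> = ennreal (1 / a) * seminorm_pow s p u"
      using that ab by (simp only: seminorm_pow_frac mult.assoc[symmetric]) (simp add: ennreal_mult'[symmetric])
    finally show ?thesis .
  qed
  have em: "ennreal x * (ennreal y * w) = ennreal (x * y) * w" if "0 \<le> x" "0 \<le> y" for x y w
    using that by (simp add: ennreal_mult mult.assoc)
  define C where "C = Max {c1 * (1 / a), b * (c2 * (1 / a)), c3, b * c3}"
  have C: "c1 * (1 / a) \<le> C" "b * (c2 * (1 / a)) \<le> C" "c3 \<le> C" "b * c3 \<le> C" unfolding C_def by (auto intro!: Max_ge)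
  have weaken: "x \<le> ennreal C * y" if "x \<le> ennreal k * y" "k \<le> C" for x y k
    using that by (meson ennreal_leI mult_right_mono order_trans zero_le)
  have z: "u x = 0" if "\<And>x. x \<notin> \<Omega> \<Longrightarrow> u x = 0" "R \<le> norm x" for u :: "'a \<Rightarrow> real" and x
  proof -
    have "x \<notin> \<Omega>" using domain_subset that(2) by auto
    then show ?thesis by (rule that(1))
  qed
  show ?thesis
  proof (rule that[of C])
    show "0 < C" using C(3) c3(1) by linarith
    fix s p :: real and u :: "'a \<Rightarrow> real"
    assume sp: "0 < s" "s < 1" "1 < p" "p \<le> real DIM('a)" and u: "supported_in \<Omega> u"
    obtain v where v: "v \<in> borel_measurable borel" "AE x in lebesgue. u x = v x" "\<And>x. x \<notin> \<Omega> \<Longrightarrow> v x = 0"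
      by (rule supported_in_borel_version[OF u open_domain]) (rule that)
    have vz: "\<And>x. R \<le> norm x \<Longrightarrow> v x = 0" using z[of v] v(3) by blast
    have "Lp_nn p u = Lp_nn p v" by (rule Lp_nn_cong_AE[OF v(2)])
    also have "\<dots> \<le> ennreal c1 * (ennreal (s * (1 - s)) * frac_energy s p v)" by (rule c1(2)[OF sp v(1) vz])
    also have "frac_energy s p v = frac_energy s p u" using sp v(2) by (intro frac_energy_cong_AE[symmetric]) auto
    also have "ennreal c1 * (ennreal (s * (1 - s)) * frac_energy s p u) \<le> ennreal c1 * (ennreal (1 / a) * seminorm_pow s p u)"
      by (intro mult_left_mono low sp) auto
    also have "\<dots> = ennreal (c1 * (1 / a)) * seminorm_pow s p u" using c1(1) ab(1) by (intro em) auto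
    finally show "Lp_nn p u \<le> ennreal C * seminorm_pow s p u" using C(1) by (rule weaken)
  next
    fix s1 s2 p :: real and u :: "'a \<Rightarrow> real"
    assume sp: "0 < s2" "s2 < s1" "s1 < 1" "1 < p" "p \<le> real DIM('a)" and u: "supported_in \<Omega> u"
    obtain v where v: "v \<in> borel_measurable borel" "AE x in lebesgue. u x = v x" "\<And>x. x \<notin> \<Omega> \<Longrightarrow> v x = 0"
      by (rule supported_in_borel_version[OF u open_domain]) (rule that)
    have vz: "\<And>x. R \<le> norm x \<Longrightarrow> v x = 0" using z[of v] v(3) by blast
    have p0: "0 < p" using sp by simp
    have "seminorm_pow s2 p u \<le> ennreal b * (ennreal (s2 * (1 - s2)) * frac_energy s2 p u)" using sp by (intro up) auto
    also have "frac_energy s2 p u = frac_energy s2 p v" by (rule frac_energy_cong_AE[OF p0 v(2)])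
    also have "ennreal b * (ennreal (s2 * (1 - s2)) * frac_energy s2 p v) \<le>
        ennreal b * (ennreal c2 * (ennreal (s1 * (1 - s1)) * frac_energy s1 p v))"
      by (rule mult_left_mono[OF c2(2)[OF sp v(1) vz]]) auto
    also have "frac_energy s1 p v = frac_energy s1 p u" by (rule frac_energy_cong_AE[OF p0 v(2), symmetric])
    also have "ennreal b * (ennreal c2 * (ennreal (s1 * (1 - s1)) * frac_energy s1 p u)) \<le>
        ennreal b * (ennreal c2 * (ennreal (1 / a) * seminorm_pow s1 p u))"
      using sp by (intro mult_left_mono low) auto
    also have "\<dots> = ennreal (b * (c2 * (1 / a))) * seminorm_pow s1 p u" using c2(1) ab(1,2) by (simp add: em)
    finally show "seminorm_pow s2 p u \<le> ennreal C * seminorm_pow s1 p u" using C(2) by (rule weaken)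
  next
    fix s p :: real and \<phi> :: "'a \<Rightarrow> real"
    assume sp: "0 < s" "s < 1" "1 < p" "p \<le> real DIM('a)" and \<phi>: "test_function \<Omega> \<phi>"
    have "\<phi> x = 0" if "x \<notin> \<Omega>" for x
      using \<phi> that closure_subset[of "{x. \<phi> x \<noteq> 0}"] unfolding test_function_def by auto
    then have z': "\<And>x. R \<le> norm x \<Longrightarrow> \<phi> x = 0" using z[of \<phi>] by blast
    have "modulus p \<phi> h \<le> ennreal (norm h powr p) * seminorm_pow 1 p \<phi>" for h
      using modulus_test_function_le[OF \<phi>, of p h] sp unfolding test_function_seminorm_pow_one[OF \<phi>] by simp
    from c3(2)[OF sp test_function_borel(1)[OF \<phi>] z' this]
    have L: "Lp_nn p \<phi> \<le> ennreal c3 * seminorm_pow 1 p \<phi>"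
      and W: "ennreal (s * (1 - s)) * frac_energy s p \<phi> \<le> ennreal c3 * seminorm_pow 1 p \<phi>" by auto
    have "seminorm_pow s p \<phi> \<le> ennreal b * (ennreal (s * (1 - s)) * frac_energy s p \<phi>)" using sp by (intro up) auto
    also have "\<dots> \<le> ennreal b * (ennreal c3 * seminorm_pow 1 p \<phi>)" by (intro mult_left_mono W) auto
    also have "\<dots> = ennreal (b * c3) * seminorm_pow 1 p \<phi>" using ab(2) c3(1) by (intro em) auto
    finally show "Lp_nn p \<phi> \<le> ennreal C * seminorm_pow 1 p \<phi> \<and> seminorm_pow s p \<phi> \<le> ennreal C * seminorm_pow 1 p \<phi>"
      using weaken[OF L C(3)] weaken[OF _ C(4)] by blast
  qed
qed

text \<open>Convergence of gradients says nothing directly about the functions. The Poincare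
  inequality for differences of test functions yields an L^p limit h; by closedness h and u have the
  same gradient, and as both vanish off a ball, h = u. The pointwise convergence prepares for
  Fatou's lemma.\<close>

lemma energy_space_one_approx:
  assumes p: "1 < p" "p \<le> real DIM('a)" and u: "u \<in> energy_space \<Omega> 1 p"
  obtains \<phi> where "\<And>n::nat. test_function \<Omega> (\<phi> n)" "(\<lambda>n. seminorm_pow 1 p (\<lambda>x. \<phi> n x - u x)) \<longlonglongrightarrow> 0"
    "AE x in lebesgue. (\<lambda>n. \<phi> n x) \<longlonglongrightarrow> u x"
proof -
  have p0: "0 < p" using p by simp
  obtain C where C: "0 < C" "\<And>\<phi> :: 'a \<Rightarrow> real. test_function \<Omega> \<phi> \<Longrightarrow> Lp_nn p \<phi> \<le> ennreal C * seminorm_pow 1 p \<phi>"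
  proof (rule seminorm_pow_compare_frac)
    fix C assume "0 < C" and *: "\<And>s p (\<phi> :: 'a \<Rightarrow> real). 0 < s \<Longrightarrow> s < 1 \<Longrightarrow> 1 < p \<Longrightarrow> p \<le> real DIM('a) \<Longrightarrow> test_function \<Omega> \<phi> \<Longrightarrow>
      Lp_nn p \<phi> \<le> ennreal C * seminorm_pow 1 p \<phi> \<and> seminorm_pow s p \<phi> \<le> ennreal C * seminorm_pow 1 p \<phi>"
    show thesis using that[OF \<open>0 < C\<close>] *[of "1/2" p] p by auto
  qed
  from u have um: "supported_in \<Omega> u" and uf: "seminorm_pow 1 p u < \<infinity>" by (auto simp: energy_space_iff[OF p0])
  from um have ul: "u \<in> borel_measurable lebesgue" by (simp add: supported_in_def)
  obtain \<phi> where \<phi>: "\<And>n::nat. test_function \<Omega> (\<phi> n)" and lim: "(\<lambda>n. seminorm_pow 1 p (\<lambda>x. \<phi> n x - u x)) \<longlonglongrightarrow> 0"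
    using u unfolding energy_space_iff[OF p0] by blast
  have \<phi>l: "\<phi> n \<in> borel_measurable lebesgue" for n using test_function_supported_in[OF \<phi>] by (simp add: supported_in_def)
  have \<phi>f: "seminorm_pow 1 p (\<phi> n) < \<infinity>" for n by (rule test_function_seminorm_pow_one_finite[OF \<phi> p0])
  have df: "seminorm_pow 1 p (\<lambda>x. \<phi> n x - u x) < \<infinity>" for n
    by (rule seminorm_pow_diff_le(2)[OF order_refl p0 \<phi>l ul \<phi>f uf])
  define G where "G = weak_gradient u"
  have G: "has_weak_gradient u G" unfolding G_def by (rule has_weak_gradient_if_finite[OF uf])
  have gradl: "grad (\<phi> n) \<in> borel_measurable lebesgue" for n
    using test_function_borel(2)[OF \<phi>] by (simp add: measurable_completion)
  have eq: "seminorm_pow 1 p (\<lambda>x. \<phi> n x - u x) = (\<integral>\<^sup>+x. ennreal (norm (grad (\<phi> n) x - G x) powr p) \<partial>lebesgue)" for n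
    using seminorm_pow_one(1)[OF has_weak_gradient_linear[OF test_function_has_weak_gradient[OF \<phi>[of n]] G, of 1 "-1"], of p] by simp
  have cauchy: "\<exists>N. \<forall>m\<ge>N. \<forall>n\<ge>N. (\<integral>\<^sup>+x. ennreal (norm (\<phi> m x - \<phi> n x) powr p) \<partial>lebesgue) \<le> ennreal e" if e: "0 < e" for e
  proof -
    define d where "d = e / (2 * (C * 2 powr p))"
    have d: "0 < d" using e C by (simp add: d_def)
    then obtain N where N: "\<And>n. n \<ge> N \<Longrightarrow> seminorm_pow 1 p (\<lambda>x. \<phi> n x - u x) < ennreal d"
      using order_tendstoD(2)[OF lim, of "ennreal d"] unfolding eventually_sequentially by auto
    have "(\<integral>\<^sup>+x. ennreal (norm (\<phi> m x - \<phi> n x) powr p) \<partial>lebesgue) \<le> ennreal e" if mn: "m \<ge> N" "n \<ge> N" for m n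
    proof -
      have "test_function \<Omega> (\<lambda>x. \<phi> m x - \<phi> n x)" using test_function_linear[OF \<phi>[of m] \<phi>[of n], of 1 "-1"] by simp
      then have "Lp_nn p (\<lambda>x. \<phi> m x - \<phi> n x) \<le> ennreal C * seminorm_pow 1 p (\<lambda>x. \<phi> m x - \<phi> n x)" by (rule C(2))
      also have "\<dots> \<le> ennreal C * (ennreal (2 powr p) * (seminorm_pow 1 p (\<lambda>x. \<phi> m x - u x) + seminorm_pow 1 p (\<lambda>x. \<phi> n x - u x)))"
        by (intro mult_left_mono seminorm_pow_triangle order_refl p0 \<phi>l ul df) auto
      also have "\<dots> \<le> ennreal C * (ennreal (2 powr p) * (ennreal d + ennreal d))"
        using N[OF mn(1)] N[OF mn(2)] by (intro mult_left_mono add_mono) auto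
      also have "\<dots> = ennreal (C * (2 powr p * (d + d)))" using C d by (simp flip: ennreal_plus ennreal_mult')
      also have "C * (2 powr p * (d + d)) = e" using C by (simp add: d_def)
      finally show ?thesis by (simp add: Lp_nn_lebesgue)
    qed
    then show ?thesis by blast
  qed
  obtain h r where h: "h \<in> borel_measurable lebesgue" "strict_mono r" "AE x in lebesgue. (\<lambda>n. \<phi> (r n) x) \<longlonglongrightarrow> h x"
    "(\<lambda>n. \<integral>\<^sup>+x. ennreal (norm (\<phi> n x - h x) powr p) \<partial>lebesgue) \<longlonglongrightarrow> 0"
    using Lp_complete[OF p0 \<phi>l cauchy] by blast
  have "has_weak_gradient h G"
  proof (rule has_weak_gradient_limit[OF p(1) test_function_has_weak_gradient[OF \<phi>] \<phi>l gradl h(1) has_weak_gradient_measurable[OF G]])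
    show "(\<lambda>n. \<integral>\<^sup>+x. ennreal (\<bar>\<phi> n x - h x\<bar> powr p) \<partial>lebesgue) \<longlonglongrightarrow> 0" using h(4) by simp
    show "(\<lambda>n. \<integral>\<^sup>+x. ennreal (norm (grad (\<phi> n) x - G x) powr p) \<partial>lebesgue) \<longlonglongrightarrow> 0" using lim unfolding eq .
  qed
  then have "has_weak_gradient (\<lambda>x. u x - h x) (\<lambda>x. G x - G x)" using has_weak_gradient_linear[OF G, of h G 1 "-1"] by simp
  moreover have h0: "AE x in lebesgue. R \<le> norm x \<longrightarrow> u x - h x = 0"
  proof -
    have "AE x in lebesgue. x \<notin> \<Omega> \<longrightarrow> u x = 0" using um by (simp add: supported_in_def)
    then show ?thesis using h(3)
    proof eventually_elim
      fix x assume a: "x \<notin> \<Omega> \<longrightarrow> u x = 0" "(\<lambda>n. \<phi> (r n) x) \<longlonglongrightarrow> h x"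
      show "R \<le> norm x \<longrightarrow> u x - h x = 0"
      proof
        assume "R \<le> norm x"
        then have x: "x \<notin> \<Omega>" using domain_subset by auto
        then have "\<phi> (r n) x = 0" for n
          using \<phi>[of "r n"] closure_subset[of "{x. \<phi> (r n) x \<noteq> 0}"] unfolding test_function_def by auto
        then show "u x - h x = 0" using a x by (simp add: LIMSEQ_const_iff)
      qed
    qed
  qed
  ultimately have "AE x in lebesgue. u x - h x = 0" by (intro weak_gradient_zero_imp_zero[of _ _ R]) auto
  then have "AE x in lebesgue. (\<lambda>n. \<phi> (r n) x) \<longlonglongrightarrow> u x" using h(3) by eventually_elim simp
  moreover have "(\<lambda>n. seminorm_pow 1 p (\<lambda>x. \<phi> (r n) x - u x)) \<longlonglongrightarrow> 0"
    using LIMSEQ_subseq_LIMSEQ[OF lim h(2)] by (simp add: o_def)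
  ultimately show ?thesis using that[of "\<lambda>n. \<phi> (r n)"] \<phi> by blast
qed

text \<open>The source of the threshold: one constant for all orders and exponents. Below order 1
  the estimates hold for every function supported in \<Omega>; at order 1 they are carried over from
  test functions by Fatou's lemma.\<close>

lemma energy_space_embedding:
  obtains C where "0 < C"
    "\<And>s p u. 0 < s \<Longrightarrow> s \<le> 1 \<Longrightarrow> 1 < p \<Longrightarrow> p \<le> real DIM('a) \<Longrightarrow> u \<in> energy_space \<Omega> s p \<Longrightarrow>
      Lp_nn p u \<le> ennreal C * seminorm_pow s p u"
    "\<And>s1 s2 p u. 0 < s2 \<Longrightarrow> s2 < s1 \<Longrightarrow> s1 \<le> 1 \<Longrightarrow> 1 < p \<Longrightarrow> p \<le> real DIM('a) \<Longrightarrow> u \<in> energy_space \<Omega> s1 p \<Longrightarrow>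
      seminorm_pow s2 p u \<le> ennreal C * seminorm_pow s1 p u"
proof (rule seminorm_pow_compare_frac)
  fix C assume C: "0 < C"
    and 1: "\<And>s p (u :: 'a \<Rightarrow> real). 0 < s \<Longrightarrow> s < 1 \<Longrightarrow> 1 < p \<Longrightarrow> p \<le> real DIM('a) \<Longrightarrow> supported_in \<Omega> u \<Longrightarrow>
      Lp_nn p u \<le> ennreal C * seminorm_pow s p u"
    and 2: "\<And>s1 s2 p (u :: 'a \<Rightarrow> real). 0 < s2 \<Longrightarrow> s2 < s1 \<Longrightarrow> s1 < 1 \<Longrightarrow> 1 < p \<Longrightarrow> p \<le> real DIM('a) \<Longrightarrow> supported_in \<Omega> u \<Longrightarrow>
      seminorm_pow s2 p u \<le> ennreal C * seminorm_pow s1 p u"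
    and 3: "\<And>s p (\<phi> :: 'a \<Rightarrow> real). 0 < s \<Longrightarrow> s < 1 \<Longrightarrow> 1 < p \<Longrightarrow> p \<le> real DIM('a) \<Longrightarrow> test_function \<Omega> \<phi> \<Longrightarrow>
      Lp_nn p \<phi> \<le> ennreal C * seminorm_pow 1 p \<phi> \<and> seminorm_pow s p \<phi> \<le> ennreal C * seminorm_pow 1 p \<phi>"
  \<comment> \<open>The triangle inequality for p-th powers loses a factor 2^p, at most 2^N for all
    admissible p.\<close>
  define C' where "C' = C * 2 powr (real DIM('a))"
  have C': "0 < C'" "C \<le> C'" using C by (auto simp: C'_def mult_le_cancel_left1 ge_one_powr_ge_zero)
  have weaken: "x \<le> ennreal C' * y" if "x \<le> ennreal C * y" for x y
    using that C'(2) by (meson ennreal_leI mult_right_mono order_trans zero_le)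
  have one: "Lp_nn p u \<le> ennreal C' * seminorm_pow 1 p u \<and> (0 < s \<and> s < 1 \<longrightarrow> seminorm_pow s p u \<le> ennreal C' * seminorm_pow 1 p u)"
    if p: "1 < p" "p \<le> real DIM('a)" and u: "u \<in> energy_space \<Omega> 1 p" for s p u
  proof -
    have p0: "0 < p" using p by simp
    obtain \<phi> where \<phi>: "\<And>n::nat. test_function \<Omega> (\<phi> n)" "(\<lambda>n. seminorm_pow 1 p (\<lambda>x. \<phi> n x - u x)) \<longlonglongrightarrow> 0"
      "AE x in lebesgue. (\<lambda>n. \<phi> n x) \<longlonglongrightarrow> u x"
      by (rule energy_space_one_approx[OF p u]) (rule that)
    from u have ul: "u \<in> borel_measurable lebesgue" and uf: "seminorm_pow 1 p u < \<infinity>"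
      by (auto simp: energy_space_iff[OF p0] supported_in_def)
    have \<phi>l: "\<phi> n \<in> borel_measurable lebesgue" for n using test_function_supported_in[OF \<phi>(1)] by (simp add: supported_in_def)
    have df: "seminorm_pow 1 p (\<lambda>x. \<phi> n x - u x) < \<infinity>" for n
      by (rule seminorm_pow_diff_le(2)[OF order_refl p0 \<phi>l ul test_function_seminorm_pow_one_finite[OF \<phi>(1) p0] uf])
    have ev: "\<forall>\<^sub>F n in sequentially. ennreal C * seminorm_pow 1 p (\<phi> n) \<le> ennreal C' * seminorm_pow 1 p u + ennreal e" if e: "0 < e" for e
    proof -
      have "0 < e / C'" using e C' by simp
      then have "\<forall>\<^sub>F n in sequentially. seminorm_pow 1 p (\<lambda>x. \<phi> n x - u x) < ennreal (e / C')"
        by (intro order_tendstoD(2)[OF \<phi>(2)]) simp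
      then show ?thesis
      proof eventually_elim
        fix n assume n: "seminorm_pow 1 p (\<lambda>x. \<phi> n x - u x) < ennreal (e / C')"
        have "seminorm_pow 1 p (\<phi> n) \<le> ennreal (2 powr p) * (seminorm_pow 1 p (\<lambda>x. \<phi> n x - u x) + seminorm_pow 1 p u)"
          using seminorm_pow_linear_le[OF order_refl p0 _ ul df[of n] uf, of 1 1] \<phi>l ul by simp
        also have "\<dots> \<le> ennreal (2 powr real DIM('a)) * (ennreal (e / C') + seminorm_pow 1 p u)"
          using n p by (intro mult_mono add_mono ennreal_leI powr_mono) auto
        finally have "ennreal C * seminorm_pow 1 p (\<phi> n) \<le> ennreal C * (ennreal (2 powr real DIM('a)) * (ennreal (e / C') + seminorm_pow 1 p u))"
          by (rule mult_left_mono) simp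
        also have "\<dots> = ennreal C' * (ennreal (e / C') + seminorm_pow 1 p u)"
          using C by (simp add: C'_def ennreal_mult mult.assoc)
        also have "\<dots> = ennreal C' * seminorm_pow 1 p u + ennreal e"
          using C' e by (simp add: distrib_left add.commute flip: ennreal_mult')
        finally show "ennreal C * seminorm_pow 1 p (\<phi> n) \<le> ennreal C' * seminorm_pow 1 p u + ennreal e" .
      qed
    qed
    have A: "Lp_nn p u \<le> ennreal C' * seminorm_pow 1 p u"
    proof (rule ennreal_le_epsilon)
      fix e :: real assume e: "0 < e"
      have "(\<integral>\<^sup>+x. ennreal (norm (u x) powr p) \<partial>lebesgue) \<le> ennreal C' * seminorm_pow 1 p u + ennreal e"
      proof (rule nn_integral_powr_Fatou[OF p0 \<phi>l \<phi>(3)])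
        have "(\<integral>\<^sup>+x. ennreal (norm (\<phi> n x) powr p) \<partial>lebesgue) \<le> ennreal C * seminorm_pow 1 p (\<phi> n)" for n
          using 3[of "1/2", OF _ _ p \<phi>(1)[of n]] by (simp add: Lp_nn_lebesgue)
        then show "\<forall>\<^sub>F n in sequentially. (\<integral>\<^sup>+x. ennreal (norm (\<phi> n x) powr p) \<partial>lebesgue) \<le> ennreal C' * seminorm_pow 1 p u + ennreal e"
          using ev[OF e] by (auto elim!: eventually_mono intro: order_trans)
      qed
      then show "Lp_nn p u \<le> ennreal C' * seminorm_pow 1 p u + ennreal e" by (simp add: Lp_nn_lebesgue)
    qed
    have B: "seminorm_pow s p u \<le> ennreal C' * seminorm_pow 1 p u" if s: "0 < s" "s < 1"
    proof (rule ennreal_le_epsilon)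
      fix e :: real assume e: "0 < e"
      show "seminorm_pow s p u \<le> ennreal C' * seminorm_pow 1 p u + ennreal e"
      proof (rule seminorm_pow_Fatou[OF s(2) p0 \<phi>l ul \<phi>(3)])
        have "seminorm_pow s p (\<phi> n) \<le> ennreal C * seminorm_pow 1 p (\<phi> n)" for n
          using 3[OF s p \<phi>(1)[of n]] by simp
        then show "\<forall>\<^sub>F n in sequentially. seminorm_pow s p (\<phi> n) \<le> ennreal C' * seminorm_pow 1 p u + ennreal e"
          using ev[OF e] by (auto elim!: eventually_mono intro: order_trans)
      qed
    qed
    show ?thesis using A B by blast
  qed
  show thesis
  proof (rule that[OF C'(1)])
    fix s p u assume s: "0 < s" "s \<le> 1" and p: "1 < p" "p \<le> real DIM('a)" and u: "u \<in> energy_space \<Omega> s p"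
    have "supported_in \<Omega> u" using u p by (simp add: energy_space_iff)
    then show "Lp_nn p u \<le> ennreal C' * seminorm_pow s p u"
      using one[OF p, of u] 1[of s p u] weaken s p u by (cases "s = 1") auto
  next
    fix s1 s2 p u assume s: "0 < s2" "s2 < s1" "s1 \<le> 1" and p: "1 < p" "p \<le> real DIM('a)" and u: "u \<in> energy_space \<Omega> s1 p"
    have "supported_in \<Omega> u" using u p by (simp add: energy_space_iff)
    then show "seminorm_pow s2 p u \<le> ennreal C' * seminorm_pow s1 p u"
      using one[OF p, of u s2] 2[of s2 s1 p u] weaken s p u by (cases "s1 = 1") auto
  qed
qed

lemma test_function_in_energy_space:
  assumes s: "0 < s" "s \<le> 1" and p: "1 < p" "p \<le> real DIM('a)" and \<phi>: "test_function \<Omega> \<phi>"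
  shows "\<phi> \<in> energy_space \<Omega> s p"
proof -
  have p0: "0 < p" using p by simp
  have f1: "seminorm_pow 1 p \<phi> < \<infinity>" by (rule test_function_seminorm_pow_one_finite[OF \<phi> p0])
  have "seminorm_pow s p \<phi> < \<infinity>"
  proof (cases "s = 1")
    case False
    obtain C where "seminorm_pow s p \<phi> \<le> ennreal C * seminorm_pow 1 p \<phi>"
    proof (rule seminorm_pow_compare_frac)
      fix C assume "\<And>s p (\<phi> :: 'a \<Rightarrow> real). 0 < s \<Longrightarrow> s < 1 \<Longrightarrow> 1 < p \<Longrightarrow> p \<le> real DIM('a) \<Longrightarrow> test_function \<Omega> \<phi> \<Longrightarrow>
        Lp_nn p \<phi> \<le> ennreal C * seminorm_pow 1 p \<phi> \<and> seminorm_pow s p \<phi> \<le> ennreal C * seminorm_pow 1 p \<phi>"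
      then show thesis using that[of C] s p \<phi> False by auto
    qed
    then show ?thesis by (rule le_less_trans) (use f1 in \<open>simp add: ennreal_mult_less_top\<close>)
  qed (use f1 in simp)
  then show ?thesis unfolding energy_space_iff[OF p0]
    using \<phi> test_function_supported_in[OF \<phi>] by (auto simp: seminorm_pow_zero[OF p0] intro!: exI[of _ "\<lambda>_. \<phi>"])
qed

lemma energy_space_linear:
  assumes s: "0 < s" "s \<le> 1" and p: "1 < p" "p \<le> real DIM('a)" and u: "u \<in> energy_space \<Omega> s p" and v: "v \<in> energy_space \<Omega> s p"
  shows "(\<lambda>x. a * u x + b * v x) \<in> energy_space \<Omega> s p"
proof -
  have p0: "0 < p" using p by simp
  have um: "supported_in \<Omega> u" "supported_in \<Omega> v" and uf: "seminorm_pow s p u < \<infinity>" "seminorm_pow s p v < \<infinity>"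
    using u v by (auto simp: energy_space_iff[OF p0])
  have ul: "u \<in> borel_measurable lebesgue" "v \<in> borel_measurable lebesgue" using um by (auto simp: supported_in_def)
  obtain \<phi> where \<phi>: "\<And>n::nat. test_function \<Omega> (\<phi> n)" "(\<lambda>n. seminorm_pow s p (\<lambda>x. \<phi> n x - u x)) \<longlonglongrightarrow> 0"
    using u unfolding energy_space_iff[OF p0] by blast
  obtain \<psi> where \<psi>: "\<And>n::nat. test_function \<Omega> (\<psi> n)" "(\<lambda>n. seminorm_pow s p (\<lambda>x. \<psi> n x - v x)) \<longlonglongrightarrow> 0"
    using v unfolding energy_space_iff[OF p0] by blast
  have fl: "\<phi> n \<in> borel_measurable lebesgue" "\<psi> n \<in> borel_measurable lebesgue"
    and ff: "seminorm_pow s p (\<phi> n) < \<infinity>" "seminorm_pow s p (\<psi> n) < \<infinity>" for n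
    using test_function_in_energy_space[OF s p \<phi>(1)] test_function_in_energy_space[OF s p \<psi>(1)]
    by (auto simp: energy_space_iff[OF p0] supported_in_def)
  have le: "seminorm_pow s p (\<lambda>x. (a * \<phi> n x + b * \<psi> n x) - (a * u x + b * v x)) \<le>
      ennreal (2 powr p) * (ennreal (\<bar>a\<bar> powr p) * seminorm_pow s p (\<lambda>x. \<phi> n x - u x) + ennreal (\<bar>b\<bar> powr p) * seminorm_pow s p (\<lambda>x. \<psi> n x - v x))" for n
  proof -
    have "(\<lambda>x. (a * \<phi> n x + b * \<psi> n x) - (a * u x + b * v x)) = (\<lambda>x. a * (\<phi> n x - u x) + b * (\<psi> n x - v x))"
      by (auto simp: algebra_simps)
    then show ?thesis
      using seminorm_pow_linear_le[OF s(2) p0 _ _ seminorm_pow_diff_le(2)[OF s(2) p0 fl(1) ul(1) ff(1) uf(1)]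
          seminorm_pow_diff_le(2)[OF s(2) p0 fl(2) ul(2) ff(2) uf(2)]] fl ul by simp
  qed
  have lim0: "(\<lambda>n. ennreal (2 powr p) * (ennreal (\<bar>a\<bar> powr p) * seminorm_pow s p (\<lambda>x. \<phi> n x - u x) +
      ennreal (\<bar>b\<bar> powr p) * seminorm_pow s p (\<lambda>x. \<psi> n x - v x))) \<longlonglongrightarrow> ennreal (2 powr p) * (ennreal (\<bar>a\<bar> powr p) * 0 + ennreal (\<bar>b\<bar> powr p) * 0)"
    using \<phi>(2) \<psi>(2) by (intro ennreal_tendsto_cmult tendsto_add) auto
  have "(\<lambda>n. seminorm_pow s p (\<lambda>x. (a * \<phi> n x + b * \<psi> n x) - (a * u x + b * v x))) \<longlonglongrightarrow> 0"
    by (rule tendsto_sandwich[OF _ _ tendsto_const]) (use le lim0 in auto)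
  moreover have "seminorm_pow s p (\<lambda>x. a * u x + b * v x) < \<infinity>"
    by (rule le_less_trans[OF seminorm_pow_linear_le[OF s(2) p0 ul uf]]) (use uf in \<open>simp add: ennreal_mult_less_top\<close>)
  ultimately show ?thesis
    unfolding energy_space_iff[OF p0] using supported_in_linear[OF um] test_function_linear[OF \<phi>(1) \<psi>(1)]
    by (intro conjI exI[of _ "\<lambda>n x. a * \<phi> n x + b * \<psi> n x"]) auto
qed

lemma energy_space_diff:
  assumes "0 < s" "s \<le> 1" "1 < p" "p \<le> real DIM('a)" "u \<in> energy_space \<Omega> s p" "v \<in> energy_space \<Omega> s p"
  shows "(\<lambda>x. u x - v x) \<in> energy_space \<Omega> s p"
  using energy_space_linear[OF assms, of 1 "-1"] by simp

text \<open>The Poincare inequality provides an L^p limit u. Below order 1, Fatou's lemma along an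
  almost everywhere convergent subsequence bounds the distance to u; at order 1 the weak gradients
  converge in L^p and closedness identifies their limit.\<close>

lemma energy_space_complete:
  assumes s: "0 < s" "s \<le> 1" and p: "1 < p" "p \<le> real DIM('a)" and f: "\<And>n. f n \<in> energy_space \<Omega> s p"
    and cauchy: "\<And>e. 0 < e \<Longrightarrow> \<exists>N. \<forall>m\<ge>N. \<forall>n\<ge>N. seminorm_pow s p (\<lambda>x. f m x - f n x) \<le> ennreal e"
  shows "\<exists>u\<in>energy_space \<Omega> s p. (\<lambda>n. seminorm_pow s p (\<lambda>x. f n x - u x)) \<longlonglongrightarrow> 0"
proof -
  have p0: "0 < p" using p by simp
  have fs: "supported_in \<Omega> (f n)" and ff: "seminorm_pow s p (f n) < \<infinity>" for n
    using f[of n] by (auto simp: energy_space_iff[OF p0])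
  have fl: "f n \<in> borel_measurable lebesgue" for n using fs[of n] by (auto simp: supported_in_def)
  obtain C where C: "0 < C" "\<And>u. u \<in> energy_space \<Omega> s p \<Longrightarrow> Lp_nn p u \<le> ennreal C * seminorm_pow s p u"
    using energy_space_embedding s p by metis
  have Lc: "\<exists>N. \<forall>m\<ge>N. \<forall>n\<ge>N. (\<integral>\<^sup>+x. ennreal (norm (f m x - f n x) powr p) \<partial>lebesgue) \<le> ennreal e" if e: "0 < e" for e
  proof -
    obtain N where N: "\<And>m n. m \<ge> N \<Longrightarrow> n \<ge> N \<Longrightarrow> seminorm_pow s p (\<lambda>x. f m x - f n x) \<le> ennreal (e / C)"
      using cauchy[of "e / C"] e C by auto
    have "(\<integral>\<^sup>+x. ennreal (norm (f m x - f n x) powr p) \<partial>lebesgue) \<le> ennreal e" if "m \<ge> N" "n \<ge> N" for m n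
    proof -
      have "Lp_nn p (\<lambda>x. f m x - f n x) \<le> ennreal C * seminorm_pow s p (\<lambda>x. f m x - f n x)"
        by (intro C(2) energy_space_diff s p f)
      also have "\<dots> \<le> ennreal C * ennreal (e / C)" by (intro mult_left_mono N that) auto
      also have "\<dots> = ennreal e" using C e by (simp flip: ennreal_mult')
      finally show ?thesis by (simp add: Lp_nn_lebesgue)
    qed
    then show ?thesis by blast
  qed
  obtain u r where u: "u \<in> borel_measurable lebesgue" "strict_mono r" "AE x in lebesgue. (\<lambda>n. f (r n) x) \<longlonglongrightarrow> u x"
    "(\<lambda>n. \<integral>\<^sup>+x. ennreal (norm (f n x - u x) powr p) \<partial>lebesgue) \<longlonglongrightarrow> 0"
    using Lp_complete[OF p0 fl Lc] by blast
  have us: "supported_in \<Omega> u"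
  proof -
    have "AE x in lebesgue. \<forall>n. x \<notin> \<Omega> \<longrightarrow> f n x = 0"
      unfolding AE_all_countable using fs by (simp add: supported_in_def)
    then have "AE x in lebesgue. x \<notin> \<Omega> \<longrightarrow> u x = 0"
      using u(3) by eventually_elim (auto simp: LIMSEQ_const_iff)
    then show ?thesis using u(1) by (simp add: supported_in_def)
  qed
  have main: "(\<lambda>n. seminorm_pow s p (\<lambda>x. f n x - u x)) \<longlonglongrightarrow> 0"
  proof (cases "s = 1")
    case False
    then have s1: "s < 1" using s by simp
    show ?thesis
    proof (rule tendsto_zero_ennreal)
      fix e :: real assume e: "0 < e"
      obtain N where N: "\<And>m n. m \<ge> N \<Longrightarrow> n \<ge> N \<Longrightarrow> seminorm_pow s p (\<lambda>x. f m x - f n x) \<le> ennreal (e / 2)"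
        using cauchy[of "e / 2"] e by auto
      have "seminorm_pow s p (\<lambda>x. f n x - u x) < ennreal e" if n: "n \<ge> N" for n
      proof -
        have "seminorm_pow s p (\<lambda>x. f n x - u x) \<le> ennreal (e / 2)"
        proof (rule seminorm_pow_Fatou[OF s1 p0])
          show "(\<lambda>x. f n x - f (r k) x) \<in> borel_measurable lebesgue" for k using fl by (intro borel_measurable_diff)
          show "(\<lambda>x. f n x - u x) \<in> borel_measurable lebesgue" using fl u(1) by (intro borel_measurable_diff)
          show "AE x in lebesgue. (\<lambda>k. f n x - f (r k) x) \<longlonglongrightarrow> f n x - u x"
            using u(3) by eventually_elim (intro tendsto_intros)
          have "seminorm_pow s p (\<lambda>x. f n x - f (r k) x) \<le> ennreal (e / 2)" if "k \<ge> N" for k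
            using that n seq_suble[OF u(2), of k] by (intro N) auto
          then show "\<forall>\<^sub>F k in sequentially. seminorm_pow s p (\<lambda>x. f n x - f (r k) x) \<le> ennreal (e / 2)"
            unfolding eventually_sequentially by blast
        qed
        also have "\<dots> < ennreal e" using e by (simp add: ennreal_lessI)
        finally show ?thesis .
      qed
      then show "\<forall>\<^sub>F n in sequentially. seminorm_pow s p (\<lambda>x. f n x - u x) < ennreal e"
        unfolding eventually_sequentially by blast
    qed
  next
    case True
    define G where "G n = weak_gradient (f n)" for n
    have G: "has_weak_gradient (f n) (G n)" for n unfolding G_def using ff True by (intro has_weak_gradient_if_finite) simp
    note Gl = has_weak_gradient_measurable[OF G]
    have "\<exists>N. \<forall>m\<ge>N. \<forall>n\<ge>N. (\<integral>\<^sup>+x. ennreal (norm (G m x - G n x) powr p) \<partial>lebesgue) \<le> ennreal e" if "0 < e" for e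
    proof -
      have "seminorm_pow s p (\<lambda>x. f m x - f n x) = (\<integral>\<^sup>+x. ennreal (norm (G m x - G n x) powr p) \<partial>lebesgue)" for m n
        using seminorm_pow_one(1)[OF has_weak_gradient_linear[OF G[of m] G[of n], of 1 "-1"], of p] True by simp
      then show ?thesis using cauchy[OF that] by simp
    qed
    note Gc = this
    obtain H where H: "H \<in> borel_measurable lebesgue" "(\<lambda>n. \<integral>\<^sup>+x. ennreal (norm (G n x - H x) powr p) \<partial>lebesgue) \<longlonglongrightarrow> 0"
      using Lp_complete[OF p0 Gl Gc] by blast
    have wH: "has_weak_gradient u H"
      by (rule has_weak_gradient_limit[OF p(1) G fl Gl u(1) H(1) _ H(2)]) (use u(4) in simp)
    have "seminorm_pow s p (\<lambda>x. f n x - u x) = (\<integral>\<^sup>+x. ennreal (norm (G n x - H x) powr p) \<partial>lebesgue)" for n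
      using seminorm_pow_one(1)[OF has_weak_gradient_linear[OF G[of n] wH, of 1 "-1"], of p] True by simp
    then show ?thesis using H(2) by simp
  qed
  have dfin: "\<exists>N. \<forall>n\<ge>N. seminorm_pow s p (\<lambda>x. f n x - u x) < ennreal e" if "0 < e" for e
    using order_tendstoD(2)[OF main, of "ennreal e"] that unfolding eventually_sequentially by simp
  obtain n0 where n0: "seminorm_pow s p (\<lambda>x. f n0 x - u x) < \<infinity>"
    using dfin[of 1] by (metis ennreal_less_top infinity_ennreal_def less_trans order_refl zero_less_one)
  have uf: "seminorm_pow s p u < \<infinity>"
    using seminorm_pow_diff_le(2)[OF s(2) p0 fl _ ff[of n0] n0] fl u(1) by simp
  have df: "seminorm_pow s p (\<lambda>x. f n x - u x) < \<infinity>" for n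
    by (rule seminorm_pow_diff_le(2)[OF s(2) p0 fl u(1) ff uf])
  \<comment> \<open>Membership of u requires test functions of its own: each f n is approximated
    within 1 / (n + 1), and these approximations converge to u.\<close>
  have "\<exists>\<phi>. test_function \<Omega> \<phi> \<and> seminorm_pow s p (\<lambda>x. \<phi> x - f n x) < ennreal (inverse (real (Suc n)))" for n
  proof -
    obtain \<phi> where \<phi>: "\<And>k::nat. test_function \<Omega> (\<phi> k)" "(\<lambda>k. seminorm_pow s p (\<lambda>x. \<phi> k x - f n x)) \<longlonglongrightarrow> 0"
      using f[of n] unfolding energy_space_iff[OF p0] by blast
    have "\<forall>\<^sub>F k in sequentially. seminorm_pow s p (\<lambda>x. \<phi> k x - f n x) < ennreal (inverse (real (Suc n)))"
      by (rule order_tendstoD(2)[OF \<phi>(2)]) simp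
    then obtain k where "seminorm_pow s p (\<lambda>x. \<phi> k x - f n x) < ennreal (inverse (real (Suc n)))"
      unfolding eventually_sequentially by blast
    then show ?thesis using \<phi>(1)[of k] by (intro exI[of _ "\<phi> k"]) simp
  qed
  then obtain \<phi> where \<phi>: "\<And>n. test_function \<Omega> (\<phi> n)" "\<And>n. seminorm_pow s p (\<lambda>x. \<phi> n x - f n x) < ennreal (inverse (real (Suc n)))"
    by metis
  have \<phi>l: "\<phi> n \<in> borel_measurable lebesgue" for n using test_function_supported_in[OF \<phi>(1)] by (simp add: supported_in_def)
  have le: "seminorm_pow s p (\<lambda>x. \<phi> n x - u x) \<le> ennreal (2 powr p) * (ennreal (inverse (real (Suc n))) + seminorm_pow s p (\<lambda>x. f n x - u x))" for n
  proof -
    have fin: "seminorm_pow s p (\<lambda>x. \<phi> n x - f n x) < \<infinity>" by (rule less_trans[OF \<phi>(2)]) simp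
    have "seminorm_pow s p (\<lambda>x. \<phi> n x - u x) \<le> ennreal (2 powr p) * (seminorm_pow s p (\<lambda>x. \<phi> n x - f n x) + seminorm_pow s p (\<lambda>x. f n x - u x))"
      using seminorm_pow_linear_le[OF s(2) p0 _ _ fin df[of n], of 1 1] \<phi>l fl u(1) by simp
    also have "\<dots> \<le> ennreal (2 powr p) * (ennreal (inverse (real (Suc n))) + seminorm_pow s p (\<lambda>x. f n x - u x))"
      using \<phi>(2)[of n] by (intro mult_left_mono add_mono) auto
    finally show ?thesis .
  qed
  have "(\<lambda>n. ennreal (inverse (real (Suc n)))) \<longlonglongrightarrow> ennreal 0"
    by (intro tendsto_ennrealI LIMSEQ_inverse_real_of_nat)
  then have lim0: "(\<lambda>n. ennreal (2 powr p) * (ennreal (inverse (real (Suc n))) + seminorm_pow s p (\<lambda>x. f n x - u x))) \<longlonglongrightarrow> ennreal (2 powr p) * (ennreal 0 + 0)"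
    using main by (intro ennreal_tendsto_cmult tendsto_add) auto
  have "(\<lambda>n. seminorm_pow s p (\<lambda>x. \<phi> n x - u x)) \<longlonglongrightarrow> 0"
    by (rule tendsto_sandwich[OF _ _ tendsto_const]) (use le lim0 in auto)
  then have "u \<in> energy_space \<Omega> s p" unfolding energy_space_iff[OF p0] using us uf \<phi>(1) by blast
  then show ?thesis using main by blast
qed

text \<open>The bounded sequence is first embedded into an order strictly between s2 and s1, where
  both the L^p compactness and the interpolation are available.\<close>

lemma energy_space_compact:
  assumes s: "0 < s2" "s2 < s1" "s1 \<le> 1" and p: "1 < p" "p \<le> real DIM('a)"
    and f: "\<And>n. f n \<in> energy_space \<Omega> s1 p" and B: "0 \<le> B" "\<And>n. seminorm_pow s1 p (f n) \<le> ennreal B"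
  shows "\<exists>r :: nat \<Rightarrow> nat. strict_mono r \<and>
    (\<forall>e>0. \<exists>N. \<forall>m\<ge>N. \<forall>n\<ge>N. seminorm_pow s2 p (\<lambda>x. f (r m) x - f (r n) x) \<le> ennreal e)"
proof -
  have p0: "0 < p" using p by simp
  have fs: "supported_in \<Omega> (f n)" for n using f[of n] by (auto simp: energy_space_iff[OF p0])
  \<comment> \<open>The detour through t < 1 is needed because s1 may equal 1, where the energy is
    not a double integral.\<close>
  define t where "t = (s2 + s1) / 2"
  have t: "s2 < t" "t < s1" "0 < t" "t < 1" using s by (auto simp: t_def)
  obtain C where C: "0 < C" "\<And>u. u \<in> energy_space \<Omega> s1 p \<Longrightarrow> Lp_nn p u \<le> ennreal C * seminorm_pow s1 p u"
    "\<And>u. u \<in> energy_space \<Omega> s1 p \<Longrightarrow> seminorm_pow t p u \<le> ennreal C * seminorm_pow s1 p u"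
  proof (rule energy_space_embedding)
    fix C assume "0 < C" and 1: "\<And>s p u. 0 < s \<Longrightarrow> s \<le> 1 \<Longrightarrow> 1 < p \<Longrightarrow> p \<le> real DIM('a) \<Longrightarrow> u \<in> energy_space \<Omega> s p \<Longrightarrow>
      Lp_nn p u \<le> ennreal C * seminorm_pow s p u"
     and 2: "\<And>s1 s2 p u. 0 < s2 \<Longrightarrow> s2 < s1 \<Longrightarrow> s1 \<le> 1 \<Longrightarrow> 1 < p \<Longrightarrow> p \<le> real DIM('a) \<Longrightarrow> u \<in> energy_space \<Omega> s1 p \<Longrightarrow>
      seminorm_pow s2 p u \<le> ennreal C * seminorm_pow s1 p u"
    show thesis using \<open>0 < C\<close> s t p by (intro that[of C] 1 2) auto
  qed
  let ?c = "frac_const DIM('a) t p" and ?c2 = "frac_const DIM('a) s2 p"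
  have c: "0 < ?c" "0 < ?c2" using t s p dim by (auto intro!: frac_const_pos)
  define B' where "B' = C * B + (1 / ?c) * (C * B)"
  have B': "0 \<le> B'" "C * B \<le> B'" "(1 / ?c) * (C * B) \<le> B'" using C B c by (auto simp: B'_def)
  have L: "Lp_nn p (f n) \<le> ennreal B'" for n
  proof -
    have "Lp_nn p (f n) \<le> ennreal C * ennreal B" by (rule order_trans[OF C(2)[OF f]]) (intro mult_left_mono B(2), simp)
    also have "\<dots> \<le> ennreal B'" using C B B' by (simp add: ennreal_leI flip: ennreal_mult')
    finally show ?thesis .
  qed
  have W: "frac_energy t p (f n) \<le> ennreal B'" for n
  proof -
    have "frac_energy t p (f n) = ennreal (1 / ?c) * seminorm_pow t p (f n)"
      using c t by (simp add: seminorm_pow_frac mult.assoc[symmetric] flip: ennreal_mult')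
    also have "\<dots> \<le> ennreal (1 / ?c) * (ennreal C * ennreal B)"
      by (rule mult_left_mono[OF order_trans[OF C(3)[OF f]]]) (intro mult_left_mono B(2), auto)
    also have "\<dots> = ennreal ((1 / ?c) * (C * B))"
    proof -
      have "ennreal k * (ennreal C * ennreal B) = ennreal (k * (C * B))" if "0 \<le> k" for k
        using that C B by (simp add: ennreal_mult)
      then show ?thesis using c by simp
    qed
    also have "\<dots> \<le> ennreal B'" by (rule ennreal_leI[OF B'(3)])
    finally show ?thesis .
  qed
  obtain r :: "nat \<Rightarrow> nat" where r: "strict_mono r"
    "\<forall>e>0. \<exists>N. \<forall>m\<ge>N. \<forall>n\<ge>N. frac_energy s2 p (\<lambda>x. f (r m) x - f (r n) x) \<le> ennreal e"
  proof -
    have "\<exists>r :: nat \<Rightarrow> nat. strict_mono r \<and>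
        (\<forall>e>0. \<exists>N. \<forall>m\<ge>N. \<forall>n\<ge>N. frac_energy s2 p (\<lambda>x. f (r m) x - f (r n) x) \<le> ennreal e)"
      by (rule frac_energy_compact[OF open_domain domain_subset s(1) t(1) p(1) fs B'(1) L W])
    then show ?thesis by (elim exE conjE) (rule that)
  qed
  have "\<exists>N. \<forall>m\<ge>N. \<forall>n\<ge>N. seminorm_pow s2 p (\<lambda>x. f (r m) x - f (r n) x) \<le> ennreal e" if e: "0 < e" for e
  proof -
    obtain N where N: "\<forall>m\<ge>N. \<forall>n\<ge>N. frac_energy s2 p (\<lambda>x. f (r m) x - f (r n) x) \<le> ennreal (e / ?c2)"
      using r(2)[rule_format, of "e / ?c2"] e c by auto
    have "seminorm_pow s2 p (\<lambda>x. f (r m) x - f (r n) x) \<le> ennreal e" if "m \<ge> N" "n \<ge> N" for m n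
    proof -
      have "seminorm_pow s2 p (\<lambda>x. f (r m) x - f (r n) x) = ennreal ?c2 * frac_energy s2 p (\<lambda>x. f (r m) x - f (r n) x)"
        using s by (intro seminorm_pow_frac) auto
      also have "\<dots> \<le> ennreal ?c2 * ennreal (e / ?c2)" using N that by (intro mult_left_mono) auto
      also have "\<dots> = ennreal e" using c e by (simp flip: ennreal_mult')
      finally show ?thesis .
    qed
    then show ?thesis by blast
  qed
  then show ?thesis using r(1) by blast
qed

end

section \<open>Weak solutions\<close>

text \<open>D is the differentiation-like map, M the measure on its target and c the normalizing
  constant. The instances are \<open>diff_quotient\<close> with c_{N,s,p} and
  \<open>weak_gradient\<close> with c = 1.\<close>

definition dirichlet :: "(('a \<Rightarrow> real) \<Rightarrow> 'm \<Rightarrow> 'e::euclidean_space) \<Rightarrow> 'm measure \<Rightarrow> real \<Rightarrow> real \<Rightarrow> ('a \<Rightarrow> real) \<Rightarrow> real" where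
  "dirichlet D M c p u = c * Lp_pow M p (D u)"

definition dirichlet_form ::
  "(('a \<Rightarrow> real) \<Rightarrow> 'm \<Rightarrow> 'e::euclidean_space) \<Rightarrow> 'm measure \<Rightarrow> real \<Rightarrow> real \<Rightarrow> ('a \<Rightarrow> real) \<Rightarrow> ('a \<Rightarrow> real) \<Rightarrow> real" where
  "dirichlet_form D M c p u v = c * (\<integral>z. norm (D u z) powr (p - 2) * (D u z \<bullet> D v z) \<partial>M)"

text \<open>Linearity of D is demanded almost everywhere only, since weak gradients are chosen by
  \<open>SOME\<close>. Everything the minimization asks of a single energy, apart from compactness,
  completeness and comparison, follows from these axioms.\<close>

locale energy_structure =
  fixes X :: "('a \<Rightarrow> real) set" and D :: "('a \<Rightarrow> real) \<Rightarrow> 'm \<Rightarrow> 'e::euclidean_space"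
    and M :: "'m measure" and c p :: real
  assumes lin: "\<And>u v a b. u \<in> X \<Longrightarrow> v \<in> X \<Longrightarrow> (\<lambda>x. a * u x + b * v x) \<in> X"
    and D_linear: "\<And>u v a b. u \<in> X \<Longrightarrow> v \<in> X \<Longrightarrow>
      AE z in M. D (\<lambda>x. a * u x + b * v x) z = a *\<^sub>R D u z + b *\<^sub>R D v z"
    and D_Lp: "\<And>u. u \<in> X \<Longrightarrow> Lp_fun M p (D u)"
    and c: "0 < c" and p: "1 < p"
begin

lemma dirichlet_linear:
  assumes "u \<in> X" "v \<in> X"
  shows "dirichlet D M c p (\<lambda>x. a * u x + b * v x) = c * Lp_pow M p (\<lambda>z. a *\<^sub>R D u z + b *\<^sub>R D v z)"
proof -
  have m: "D u \<in> borel_measurable M" "D v \<in> borel_measurable M" "D (\<lambda>x. a * u x + b * v x) \<in> borel_measurable M"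
    using D_Lp[OF assms(1)] D_Lp[OF assms(2)] D_Lp[OF lin[OF assms]] by (auto simp: Lp_fun_def)
  have "Lp_pow M p (D (\<lambda>x. a * u x + b * v x)) = Lp_pow M p (\<lambda>z. a *\<^sub>R D u z + b *\<^sub>R D v z)"
    unfolding Lp_pow_def
  proof (rule integral_cong_AE)
    show "(\<lambda>x. norm (D (\<lambda>x. a * u x + b * v x) x) powr p) \<in> borel_measurable M" using m(3) by measurable
    show "(\<lambda>x. norm (a *\<^sub>R D u x + b *\<^sub>R D v x) powr p) \<in> borel_measurable M" using m(1,2) by measurable
    show "AE x in M. norm (D (\<lambda>x. a * u x + b * v x) x) powr p = norm (a *\<^sub>R D u x + b *\<^sub>R D v x) powr p"
      using D_linear[OF assms, of a b] by eventually_elim simp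
  qed
  then show ?thesis by (simp add: dirichlet_def)
qed

lemma dirichlet_diff: "u \<in> X \<Longrightarrow> v \<in> X \<Longrightarrow> dirichlet D M c p (\<lambda>x. u x - v x) = c * Lp_pow M p (\<lambda>z. D u z - D v z)"
  using dirichlet_linear[of u v 1 "-1"] by simp

lemma dirichlet_nonneg: "0 \<le> dirichlet D M c p u"
  using c by (simp add: dirichlet_def Lp_pow_nonneg)

lemma dirichlet_uniformly_convex:
  assumes "0 < \<epsilon>"
  shows "\<exists>C>0. \<forall>u\<in>X. \<forall>v\<in>X. dirichlet D M c p (\<lambda>x. u x - v x) \<le>
    \<epsilon> * (dirichlet D M c p u + dirichlet D M c p v) +
    C * ((dirichlet D M c p u + dirichlet D M c p v) / 2 - dirichlet D M c p (\<lambda>x. (u x + v x) / 2))"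
proof -
  obtain C where C: "0 < C" "\<And>f g :: 'm \<Rightarrow> 'e. Lp_fun M p f \<Longrightarrow> Lp_fun M p g \<Longrightarrow>
      Lp_pow M p (\<lambda>x. f x - g x) \<le> \<epsilon> * (Lp_pow M p f + Lp_pow M p g) +
      C * ((Lp_pow M p f + Lp_pow M p g) / 2 - Lp_pow M p (\<lambda>x. (1/2) *\<^sub>R (f x + g x)))"
    by (rule Lp_uniformly_convex[OF p assms, where 'm = 'm and 'e = 'e]) (rule that)
  have "dirichlet D M c p (\<lambda>x. u x - v x) \<le>
    \<epsilon> * (dirichlet D M c p u + dirichlet D M c p v) +
    C * ((dirichlet D M c p u + dirichlet D M c p v) / 2 - dirichlet D M c p (\<lambda>x. (u x + v x) / 2))"
    if uv: "u \<in> X" "v \<in> X" for u v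
  proof -
    have mid: "dirichlet D M c p (\<lambda>x. (u x + v x) / 2) = c * Lp_pow M p (\<lambda>x. (1/2) *\<^sub>R (D u x + D v x))"
      using dirichlet_linear[OF uv, of "1/2" "1/2"] by (simp add: add_divide_distrib scaleR_add_right)
    have "c * Lp_pow M p (\<lambda>x. D u x - D v x) \<le> c * (\<epsilon> * (Lp_pow M p (D u) + Lp_pow M p (D v)) +
        C * ((Lp_pow M p (D u) + Lp_pow M p (D v)) / 2 - Lp_pow M p (\<lambda>x. (1/2) *\<^sub>R (D u x + D v x))))"
      using c by (intro mult_left_mono C(2) D_Lp uv) auto
    then show ?thesis unfolding dirichlet_diff[OF uv] mid unfolding dirichlet_def by (rule order_trans) (simp add: field_simps)
  qed
  then show ?thesis using C(1) by blast
qed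

lemma dirichlet_continuity:
  assumes "0 < \<epsilon>"
  shows "\<exists>C>0. \<forall>u\<in>X. \<forall>v\<in>X. \<bar>dirichlet D M c p u - dirichlet D M c p v\<bar> \<le>
    \<epsilon> * dirichlet D M c p u + C * dirichlet D M c p (\<lambda>x. u x - v x)"
proof -
  have p0: "0 < p" using p by simp
  obtain C where C: "0 < C" "\<And>f g :: 'm \<Rightarrow> 'e. Lp_fun M p f \<Longrightarrow> Lp_fun M p g \<Longrightarrow>
      \<bar>Lp_pow M p f - Lp_pow M p g\<bar> \<le> \<epsilon> * Lp_pow M p f + C * Lp_pow M p (\<lambda>x. f x - g x)"
    by (rule Lp_pow_continuity[OF p0 assms, where 'm = 'm and 'e = 'e]) (rule that)
  have "\<bar>dirichlet D M c p u - dirichlet D M c p v\<bar> \<le>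
    \<epsilon> * dirichlet D M c p u + C * dirichlet D M c p (\<lambda>x. u x - v x)" if uv: "u \<in> X" "v \<in> X" for u v
  proof -
    have "\<bar>dirichlet D M c p u - dirichlet D M c p v\<bar> = c * \<bar>Lp_pow M p (D u) - Lp_pow M p (D v)\<bar>"
      using c by (simp add: dirichlet_def abs_mult flip: right_diff_distrib)
    also have "\<dots> \<le> c * (\<epsilon> * Lp_pow M p (D u) + C * Lp_pow M p (\<lambda>x. D u x - D v x))"
      using c by (intro mult_left_mono C(2) D_Lp uv) auto
    also have "\<dots> = \<epsilon> * dirichlet D M c p u + C * dirichlet D M c p (\<lambda>x. u x - v x)"
      unfolding dirichlet_diff[OF uv] by (simp add: dirichlet_def algebra_simps)
    finally show ?thesis .
  qed
  then show ?thesis using C(1) by blast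
qed

lemma dirichlet_half_le: "u \<in> X \<Longrightarrow> dirichlet D M c p (\<lambda>x. u x / 2) \<le> dirichlet D M c p u"
proof -
  assume u: "u \<in> X"
  have "dirichlet D M c p (\<lambda>x. u x / 2) = \<bar>1/2\<bar> powr p * dirichlet D M c p u"
    using dirichlet_linear[OF u u, of "1/2" 0] Lp_pow_scaleR[of M p "1/2" "D u"] by (simp add: dirichlet_def)
  also have "\<dots> \<le> 1 * dirichlet D M c p u"
    using p by (intro mult_right_mono dirichlet_nonneg powr_le1) auto
  finally show ?thesis by simp
qed

lemma dirichlet_has_derivative:
  assumes "u \<in> X" "v \<in> X"
  shows "((\<lambda>t. dirichlet D M c p (\<lambda>x. u x + t * v x)) has_real_derivative p * dirichlet_form D M c p u v) (at 0)"
proof -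
  have "((\<lambda>t. c * Lp_pow M p (\<lambda>x. D u x + t *\<^sub>R D v x)) has_real_derivative
      c * (p * (\<integral>x. norm (D u x) powr (p - 2) * (D u x \<bullet> D v x) \<partial>M))) (at 0)"
    by (intro DERIV_cmult Lp_pow_has_derivative p D_Lp assms)
  moreover have "dirichlet D M c p (\<lambda>x. u x + t * v x) = c * Lp_pow M p (\<lambda>x. D u x + t *\<^sub>R D v x)" for t
    using dirichlet_linear[OF assms, of 1 t] by simp
  ultimately show ?thesis by (simp add: dirichlet_form_def mult_ac)
qed

lemma dirichlet_form_monotone:
  assumes u: "u \<in> X" and v: "v \<in> X"
    and eq: "dirichlet_form D M c p u (\<lambda>x. u x - v x) = dirichlet_form D M c p v (\<lambda>x. u x - v x)"
  shows "dirichlet D M c p (\<lambda>x. u x - v x) = 0"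
proof -
  have d: "AE z in M. D (\<lambda>x. u x - v x) z = D u z - D v z" using D_linear[OF u v, of 1 "-1"] by simp
  have dX: "(\<lambda>x. u x - v x) \<in> X" using lin[OF u v, of 1 "-1"] by simp
  note L = D_Lp[OF u] D_Lp[OF v] D_Lp[OF dX]
  have p0: "0 < p" using p by simp
  have cong: "(\<integral>z. norm (f z) powr (p - 2) * (f z \<bullet> D (\<lambda>x. u x - v x) z) \<partial>M) =
      (\<integral>z. norm (f z) powr (p - 2) * (f z \<bullet> (D u z - D v z)) \<partial>M)" if f: "Lp_fun M p f" for f
    using d borel_measurable_integrable[OF Lp_pairing_integrable[OF p f L(3)]]
      borel_measurable_integrable[OF Lp_pairing_integrable[OF p f Lp_fun_diff[OF p0 L(1,2)]]]
    by (intro integral_cong_AE) (auto elim!: eventually_mono)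
  have "AE z in M. D u z = D v z"
    using eq c unfolding dirichlet_form_def cong[OF L(1)] cong[OF L(2)] by (intro Lp_monotone_eq[OF p L(1,2)]) simp
  then have "AE z in M. norm (D u z - D v z) powr p = 0" by eventually_elim simp
  then have "Lp_pow M p (\<lambda>z. D u z - D v z) = 0" unfolding Lp_pow_def by (rule integral_eq_zero_AE)
  then show ?thesis by (simp add: dirichlet_diff[OF u v])
qed

end

text \<open>Stationarity in the direction v is the vanishing of the derivative of the functional
  along u + t v at its minimum t = 0. The functional is taken without the factor 1 / (2p), hence the
  factors p in the equation.\<close>

lemma variational_solution:
  fixes L :: "('a \<Rightarrow> real) \<Rightarrow> real"
  assumes P: "energy_structure X D M c p" and Q: "energy_structure X D' M' c' p" and zero: "(\<lambda>x. 0) \<in> X"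
    and QP: "\<And>u. u \<in> X \<Longrightarrow> dirichlet D' M' c' p u \<le> K * dirichlet D M c p u" and K: "0 < K" and \<alpha>: "\<alpha> * K < 1"
    and L: "\<And>u v a b. u \<in> X \<Longrightarrow> v \<in> X \<Longrightarrow> L (\<lambda>x. a * u x + b * v x) = a * L u + b * L v"
    and Lcoerc: "\<And>\<epsilon>. 0 < \<epsilon> \<Longrightarrow> \<exists>C. \<forall>u\<in>X. \<bar>L u\<bar> \<le> \<epsilon> * dirichlet D M c p u + C"
    and Lcont: "\<And>\<epsilon>. 0 < \<epsilon> \<Longrightarrow> \<exists>C>0. \<forall>u\<in>X. \<bar>L u\<bar> \<le> \<epsilon> + C * dirichlet D M c p u"
    and compact: "\<And>f B. (\<And>n::nat. f n \<in> X) \<Longrightarrow> (\<And>n. dirichlet D M c p (f n) \<le> B) \<Longrightarrow>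
        \<exists>r :: nat \<Rightarrow> nat. strict_mono r \<and> (\<forall>e>0. \<exists>N. \<forall>m\<ge>N. \<forall>n\<ge>N. dirichlet D' M' c' p (\<lambda>x. f (r m) x - f (r n) x) \<le> e)"
    and complete: "\<And>f. (\<And>n::nat. f n \<in> X) \<Longrightarrow>
        (\<And>e. 0 < e \<Longrightarrow> \<exists>N. \<forall>m\<ge>N. \<forall>n\<ge>N. dirichlet D M c p (\<lambda>x. f m x - f n x) \<le> e) \<Longrightarrow>
        \<exists>u\<in>X. (\<lambda>n. dirichlet D M c p (\<lambda>x. f n x - u x)) \<longlonglongrightarrow> 0"
  obtains u where "u \<in> X"
    "\<And>w. w \<in> X \<Longrightarrow> dirichlet D M c p u - \<alpha> * dirichlet D' M' c' p u - L u \<le> dirichlet D M c p w - \<alpha> * dirichlet D' M' c' p w - L w"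
    "\<And>v. v \<in> X \<Longrightarrow> p * dirichlet_form D M c p u v - \<alpha> * (p * dirichlet_form D' M' c' p u v) = L v"
proof -
  interpret P: energy_structure X D M c p by (rule P)
  interpret Q: energy_structure X D' M' c' p by (rule Q)
  have "\<exists>u\<in>X. \<forall>w\<in>X. dirichlet D M c p u - \<alpha> * dirichlet D' M' c' p u - L u \<le> dirichlet D M c p w - \<alpha> * dirichlet D' M' c' p w - L w"
    by (rule minimizer_exists[where K = K];
      (rule P.dirichlet_nonneg Q.dirichlet_nonneg | fact zero P.lin QP K \<alpha> P.dirichlet_uniformly_convex P.dirichlet_continuity
          Q.dirichlet_continuity Q.dirichlet_half_le L Lcoerc Lcont compact complete))
  then obtain u where u: "u \<in> X" "\<And>w. w \<in> X \<Longrightarrow> dirichlet D M c p u - \<alpha> * dirichlet D' M' c' p u - L u \<le> dirichlet D M c p w - \<alpha> * dirichlet D' M' c' p w - L w"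
    by blast
  have "p * dirichlet_form D M c p u v - \<alpha> * (p * dirichlet_form D' M' c' p u v) = L v" if v: "v \<in> X" for v
  proof -
    define J where "J t = dirichlet D M c p (\<lambda>x. u x + t * v x) - \<alpha> * dirichlet D' M' c' p (\<lambda>x. u x + t * v x) - L (\<lambda>x. u x + t * v x)" for t
    have Lt: "L (\<lambda>x. u x + t * v x) = L u + t * L v" for t using L[OF u(1) v, of 1 t] by simp
    have "((\<lambda>t. dirichlet D M c p (\<lambda>x. u x + t * v x) - \<alpha> * dirichlet D' M' c' p (\<lambda>x. u x + t * v x) - (L u + t * L v)) has_real_derivative
        p * dirichlet_form D M c p u v - \<alpha> * (p * dirichlet_form D' M' c' p u v) - L v) (at 0)"
      using P.dirichlet_has_derivative[OF u(1) v] Q.dirichlet_has_derivative[OF u(1) v]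
      by (auto intro!: derivative_eq_intros)
    then have "(J has_real_derivative p * dirichlet_form D M c p u v - \<alpha> * (p * dirichlet_form D' M' c' p u v) - L v) (at 0)"
      unfolding J_def Lt .
    moreover have "J 0 \<le> J t" for t
      using u(2)[of "\<lambda>x. u x + t * v x"] P.lin[OF u(1) v, of 1 t] by (simp add: J_def)
    ultimately have "p * dirichlet_form D M c p u v - \<alpha> * (p * dirichlet_form D' M' c' p u v) - L v = 0"
      by (intro DERIV_local_min[of J _ 0 1]) auto
    then show ?thesis by simp
  qed
  then show ?thesis using that u by blast
qed

context bounded_domain
begin

section \<open>The fractional and the gradient energy as instances\<close>

lemma domain_sets: "\<Omega> \<inter> space lebesgue \<in> sets lebesgue"
  using open_domain by (simp add: borel_open sets_completionI_sets)

text \<open>The space has order t and the energy order s \<le> t: with s = t = s1 this is the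
  leading term, with s = s2 and t = s1 the perturbation, whose finiteness on the space comes from
  the embedding.\<close>

lemma frac_energy_structure:
  assumes s: "0 < s" "s < 1" "s \<le> t" "t \<le> 1" and p: "1 < p" "p \<le> real DIM('a)"
  shows "energy_structure (energy_space \<Omega> t p) (diff_quotient s p) lebesgue (frac_const DIM('a) s p) p"
    and "u \<in> energy_space \<Omega> t p \<Longrightarrow> seminorm_pow s p u = ennreal (dirichlet (diff_quotient s p) lebesgue (frac_const DIM('a) s p) p u)"
proof -
  have p0: "0 < p" using p by simp
  have c: "0 < frac_const DIM('a) s p" using s p dim by (intro frac_const_pos) auto
  have Lp: "Lp_fun lebesgue p (diff_quotient s p u)" if u: "u \<in> energy_space \<Omega> t p" for u
  proof -
    have um: "u \<in> borel_measurable lebesgue" and uf: "seminorm_pow t p u < \<infinity>"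
      using u by (auto simp: energy_space_iff[OF p0] supported_in_def)
    have "seminorm_pow s p u < \<infinity>"
    proof (cases "s = t")
      case False
      obtain C where "seminorm_pow s p u \<le> ennreal C * seminorm_pow t p u"
        using energy_space_embedding s p u False by (metis less_le)
      then show ?thesis by (rule le_less_trans) (use uf in \<open>simp add: ennreal_mult_less_top\<close>)
    qed (use uf in simp)
    then have "frac_energy s p u < \<infinity>" using c s by (auto simp: seminorm_pow_frac ennreal_mult_less_top)
    then show ?thesis using diff_quotient_measurable[OF um] by (simp add: Lp_fun_iff frac_energy_lebesgue[OF p0])
  qed
  show "energy_structure (energy_space \<Omega> t p) (diff_quotient s p) lebesgue (frac_const DIM('a) s p) p"
  proof
    show "(\<lambda>x. a * u x + b * v x) \<in> energy_space \<Omega> t p" if "u \<in> energy_space \<Omega> t p" "v \<in> energy_space \<Omega> t p" for u v a b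
      using s p that by (intro energy_space_linear) auto
  qed (use c p Lp in \<open>auto simp: diff_quotient_linear\<close>)
  show "seminorm_pow s p u = ennreal (dirichlet (diff_quotient s p) lebesgue (frac_const DIM('a) s p) p u)"
    if u: "u \<in> energy_space \<Omega> t p"
    using nn_integral_Lp_fun[OF Lp[OF u]] s c
    by (simp add: seminorm_pow_frac frac_energy_lebesgue[OF p0] dirichlet_def ennreal_mult Lp_pow_nonneg)
qed

lemma frac_energy_form:
  assumes "0 < s" "s < 1" "1 < p"
  shows "energy_form \<Omega> s p u v = dirichlet_form (diff_quotient s p) lebesgue (frac_const DIM('a) s p) p u v / 2"
proof -
  have "\<bar>u (fst z) - u (snd z)\<bar> powr (p - 2) * (u (fst z) - u (snd z)) * (v (fst z) - v (snd z)) /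
      norm (fst z - snd z) powr (real DIM('a) + s * p) =
      norm (diff_quotient s p u z) powr (p - 2) * (diff_quotient s p u z \<bullet> diff_quotient s p v z)" for z :: "'a \<times> 'a"
  proof (cases "fst z = snd z")
    case False
    define k where "k = norm (fst z - snd z) powr ((real DIM('a) + s * p) / p)"
    have k: "0 < k" using False by (simp add: k_def)
    have kp: "norm (fst z - snd z) powr (real DIM('a) + s * p) = k powr p" using assms by (simp add: k_def powr_powr)
    have "k powr p = k powr (p - 2) * k powr 2" by (simp flip: powr_add)
    then have kp2: "k powr p = k powr (p - 2) * (k * k)" using k by (simp add: power2_eq_square)
    have "\<bar>a / k\<bar> powr (p - 2) * ((a / k) * (b / k)) = \<bar>a\<bar> powr (p - 2) * a * b / k powr p" for a b
      using k by (simp add: kp2 abs_divide powr_divide)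
    then show ?thesis unfolding kp diff_quotient_def k_def[symmetric] by simp
  qed (simp add: diff_quotient_def)
  then show ?thesis using assms by (simp add: energy_form_def dirichlet_form_def)
qed

text \<open>The form of order 1 integrates over \<Omega>, the seminorm over the whole space; this
  reconciles the two. Gradients of test functions vanish off \<Omega>, so the energy of u there is
  at most the p-th power of the distance from u to any approximating test function.\<close>

lemma weak_gradient_zero_off_domain:
  assumes p: "1 < p" and u: "u \<in> energy_space \<Omega> 1 p"
  shows "AE x in lebesgue. x \<notin> \<Omega> \<longrightarrow> weak_gradient u x = 0"
proof -
  have p0: "0 < p" using p by simp
  have uf: "seminorm_pow 1 p u < \<infinity>" using u by (simp add: energy_space_iff[OF p0])
  obtain \<phi> where \<phi>: "\<And>n::nat. test_function \<Omega> (\<phi> n)" "(\<lambda>n. seminorm_pow 1 p (\<lambda>x. \<phi> n x - u x)) \<longlonglongrightarrow> 0"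
    using u unfolding energy_space_iff[OF p0] by blast
  define G where "G = weak_gradient u"
  have G: "has_weak_gradient u G" unfolding G_def by (rule has_weak_gradient_if_finite[OF uf])
  have Gm: "(\<lambda>x. ennreal (norm (G x) powr p) * indicator (- \<Omega>) x) \<in> borel_measurable lebesgue"
  proof (rule borel_measurable_times_ennreal)
    show "(\<lambda>x. ennreal (norm (G x) powr p)) \<in> borel_measurable lebesgue"
      using has_weak_gradient_measurable[OF G] by measurable
    have "- \<Omega> \<in> sets lebesgue" using open_domain by (intro sets_completionI_sets) auto
    then show "indicator (- \<Omega>) \<in> borel_measurable lebesgue" by (rule borel_measurable_indicator)
  qed
  have "(\<integral>\<^sup>+x. ennreal (norm (G x) powr p) * indicator (- \<Omega>) x \<partial>lebesgue) \<le> seminorm_pow 1 p (\<lambda>x. \<phi> n x - u x)" for n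
  proof -
    have "(\<integral>\<^sup>+x. ennreal (norm (G x) powr p) * indicator (- \<Omega>) x \<partial>lebesgue) \<le> (\<integral>\<^sup>+x. ennreal (norm (grad (\<phi> n) x - G x) powr p) \<partial>lebesgue)"
    proof (intro nn_integral_mono)
      fix x
      have "grad (\<phi> n) x = 0" if "x \<notin> \<Omega>"
        using \<phi>(1)[of n] that by (intro grad_zero_off_support) (auto simp: test_function_def)
      then show "ennreal (norm (G x) powr p) * indicator (- \<Omega>) x \<le> ennreal (norm (grad (\<phi> n) x - G x) powr p)"
        by (auto split: split_indicator)
    qed
    also have "\<dots> = seminorm_pow 1 p (\<lambda>x. \<phi> n x - u x)"
      using seminorm_pow_one(1)[OF has_weak_gradient_linear[OF test_function_has_weak_gradient[OF \<phi>(1)[of n]] G, of 1 "-1"], of p] by simp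
    finally show ?thesis .
  qed
  then have "(\<integral>\<^sup>+x. ennreal (norm (G x) powr p) * indicator (- \<Omega>) x \<partial>lebesgue) \<le> 0"
    by (intro LIMSEQ_le_const[OF \<phi>(2)]) auto
  then have "(\<integral>\<^sup>+x. ennreal (norm (G x) powr p) * indicator (- \<Omega>) x \<partial>lebesgue) = 0" by simp
  then have "AE x in lebesgue. ennreal (norm (G x) powr p) * indicator (- \<Omega>) x = 0"
    by (subst (asm) nn_integral_0_iff_AE[OF Gm])
  then show ?thesis unfolding G_def by eventually_elim (auto split: split_indicator_asm)
qed

lemma gradient_energy_structure:
  assumes p: "1 < p" "p \<le> real DIM('a)"
  shows "energy_structure (energy_space \<Omega> 1 p) weak_gradient lebesgue 1 p"
    and "u \<in> energy_space \<Omega> 1 p \<Longrightarrow> seminorm_pow 1 p u = ennreal (dirichlet weak_gradient lebesgue 1 p u)"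
proof -
  have p0: "0 < p" using p by simp
  have G: "has_weak_gradient u (weak_gradient u)" if "u \<in> energy_space \<Omega> 1 p" for u
    using that by (intro has_weak_gradient_if_finite[of p]) (simp add: energy_space_iff[OF p0])
  have Lp: "Lp_fun lebesgue p (weak_gradient u)" if u: "u \<in> energy_space \<Omega> 1 p" for u
    using u has_weak_gradient_measurable[OF G[OF u]] seminorm_pow_one(1)[OF G[OF u], of p]
    by (simp add: Lp_fun_iff energy_space_iff[OF p0])
  show "energy_structure (energy_space \<Omega> 1 p) weak_gradient lebesgue 1 p"
  proof
    show "(\<lambda>x. a * u x + b * v x) \<in> energy_space \<Omega> 1 p" if "u \<in> energy_space \<Omega> 1 p" "v \<in> energy_space \<Omega> 1 p" for u v a b
      using p that by (intro energy_space_linear) auto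
    show "AE z in lebesgue. weak_gradient (\<lambda>x. a * u x + b * v x) z = a *\<^sub>R weak_gradient u z + b *\<^sub>R weak_gradient v z"
      if "u \<in> energy_space \<Omega> 1 p" "v \<in> energy_space \<Omega> 1 p" for u v a b
      by (rule seminorm_pow_one(2)[OF has_weak_gradient_linear[OF G G]]) (use that in auto)
  qed (use p Lp in auto)
  show "seminorm_pow 1 p u = ennreal (dirichlet weak_gradient lebesgue 1 p u)" if u: "u \<in> energy_space \<Omega> 1 p"
    using nn_integral_Lp_fun[OF Lp[OF u]] seminorm_pow_one(1)[OF G[OF u], of p] by (simp add: dirichlet_def)
qed

lemma gradient_energy_form:
  assumes p: "1 < p" "p \<le> real DIM('a)" and u: "u \<in> energy_space \<Omega> 1 p" and v: "v \<in> energy_space \<Omega> 1 p"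
  shows "energy_form \<Omega> 1 p u v = dirichlet_form weak_gradient lebesgue 1 p u v / 2"
proof -
  interpret E: energy_structure "energy_space \<Omega> 1 p" weak_gradient lebesgue 1 p
    by (rule gradient_energy_structure[OF p])
  let ?f = "\<lambda>x. norm (weak_gradient u x) powr (p - 2) * (weak_gradient u x \<bullet> weak_gradient v x)"
  have fm: "?f \<in> borel_measurable lebesgue"
    by (rule borel_measurable_integrable[OF Lp_pairing_integrable[OF p(1) E.D_Lp[OF u] E.D_Lp[OF v]]])
  have "(\<integral>x. ?f x \<partial>lebesgue_on \<Omega>) = (\<integral>x. indicator \<Omega> x *\<^sub>R ?f x \<partial>lebesgue)"
    by (rule integral_restrict_space[OF domain_sets])
  also have "\<dots> = (\<integral>x. ?f x \<partial>lebesgue)"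
  proof (rule integral_cong_AE)
    have "\<Omega> \<in> sets lebesgue" using domain_sets by simp
    then show "(\<lambda>x. indicator \<Omega> x *\<^sub>R ?f x) \<in> borel_measurable lebesgue"
      by (intro borel_measurable_scaleR borel_measurable_indicator fm)
    show "AE x in lebesgue. indicator \<Omega> x *\<^sub>R ?f x = ?f x"
      using weak_gradient_zero_off_domain[OF p(1) u] by eventually_elim (auto split: split_indicator)
  qed (rule fm)
  finally show ?thesis by (simp add: energy_form_def dirichlet_form_def)
qed

section \<open>The pairing with g\<close>

text \<open>Young's inequality with a free parameter: a small \<epsilon> makes the pairing
  subordinate to the energy, a large one makes the constant term small. Coercivity and continuity of
  the functional both follow by choosing it.\<close>

lemma in_Lp_pairing:
  assumes p: "1 < p" and g: "in_Lp (p / (p - 1)) \<Omega> g" and u: "u \<in> borel_measurable lebesgue" and fin: "Lp_nn p u < \<infinity>"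
  shows "integrable (lebesgue_on \<Omega>) (\<lambda>x. g x * u x)"
    and "0 < \<epsilon> \<Longrightarrow> \<bar>\<integral>x. g x * u x \<partial>lebesgue_on \<Omega>\<bar> \<le>
      (1 / \<epsilon>) powr (p / (p - 1)) * (\<integral>x. \<bar>g x\<bar> powr (p / (p - 1)) \<partial>lebesgue_on \<Omega>) + \<epsilon> powr p * enn2real (Lp_nn p u)"
proof -
  let ?q = "p / (p - 1)" and ?M = "lebesgue_on \<Omega>"
  have gm: "g \<in> borel_measurable ?M" and gi: "integrable ?M (\<lambda>x. \<bar>g x\<bar> powr ?q)" using g by (auto simp: in_Lp_def)
  have um: "u \<in> borel_measurable ?M" using u by (rule measurable_restrict_space1)
  have upm: "(\<lambda>x. \<bar>u x\<bar> powr p) \<in> borel_measurable ?M" using um by measurable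
  have le: "(\<integral>\<^sup>+x. ennreal (\<bar>u x\<bar> powr p) \<partial>?M) \<le> Lp_nn p u"
    unfolding nn_integral_restrict_space[OF domain_sets] Lp_nn_lebesgue by (intro nn_integral_mono) (auto split: split_indicator)
  have ui: "integrable ?M (\<lambda>x. \<bar>u x\<bar> powr p)"
    using upm le fin by (intro integrableI_bounded) auto
  have upi: "(\<integral>x. \<bar>u x\<bar> powr p \<partial>?M) \<le> enn2real (Lp_nn p u)"
    using le fin ui by (subst (asm) nn_integral_eq_integral) (auto intro: enn2real_leI simp: ennreal_le_iff2 top.not_eq_extremum dest!: enn2real_mono[rotated])
  have y: "\<bar>g x * u x\<bar> \<le> (1 / e) powr ?q * \<bar>g x\<bar> powr ?q + e powr p * \<bar>u x\<bar> powr p" if "0 < e" for x e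
    using young_eps_le[OF p abs_ge_zero abs_ge_zero that, of "g x" "u x"] by (simp add: abs_mult)
  show i: "integrable ?M (\<lambda>x. g x * u x)"
  proof (rule Bochner_Integration.integrable_bound)
    show "integrable ?M (\<lambda>x. \<bar>g x\<bar> powr ?q + \<bar>u x\<bar> powr p)" using gi ui by simp
    show "(\<lambda>x. g x * u x) \<in> borel_measurable ?M" using gm um by (rule borel_measurable_times)
    show "AE x in ?M. norm (g x * u x) \<le> norm (\<bar>g x\<bar> powr ?q + \<bar>u x\<bar> powr p)"
      using y[of 1] by (intro AE_I2) simp
  qed
  show "\<bar>\<integral>x. g x * u x \<partial>?M\<bar> \<le> (1 / \<epsilon>) powr ?q * (\<integral>x. \<bar>g x\<bar> powr ?q \<partial>?M) + \<epsilon> powr p * enn2real (Lp_nn p u)" if \<epsilon>: "0 < \<epsilon>"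
  proof -
    have "\<bar>\<integral>x. g x * u x \<partial>?M\<bar> \<le> (\<integral>x. \<bar>g x * u x\<bar> \<partial>?M)" by (rule integral_abs_bound)
    also have "\<dots> \<le> (\<integral>x. (1 / \<epsilon>) powr ?q * \<bar>g x\<bar> powr ?q + \<epsilon> powr p * \<bar>u x\<bar> powr p \<partial>?M)"
      using i gi ui y[OF \<epsilon>] by (intro integral_mono) auto
    also have "\<dots> = (1 / \<epsilon>) powr ?q * (\<integral>x. \<bar>g x\<bar> powr ?q \<partial>?M) + \<epsilon> powr p * (\<integral>x. \<bar>u x\<bar> powr p \<partial>?M)"
      using gi ui by simp
    also have "\<dots> \<le> (1 / \<epsilon>) powr ?q * (\<integral>x. \<bar>g x\<bar> powr ?q \<partial>?M) + \<epsilon> powr p * enn2real (Lp_nn p u)"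
      using upi by (intro add_left_mono mult_left_mono) auto
    finally show ?thesis .
  qed
qed

text \<open>On the bounded set \<Omega> the estimate |g| \<le> |g|^(p/(p-1)) + 1 makes g integrable,
  so the fundamental lemma of the calculus of variations applies.\<close>

lemma in_Lp_zero_if_pairing_zero:
  assumes p: "1 < p" and g: "in_Lp (p / (p - 1)) \<Omega> g"
    and z: "\<And>\<phi>. test_function \<Omega> \<phi> \<Longrightarrow> (\<integral>x. g x * \<phi> x \<partial>lebesgue_on \<Omega>) = 0"
  shows "AE x in lebesgue_on \<Omega>. g x = 0"
proof -
  let ?q = "p / (p - 1)" and ?M = "lebesgue_on \<Omega>"
  have gm: "g \<in> borel_measurable ?M" and gi: "integrable ?M (\<lambda>x. \<bar>g x\<bar> powr ?q)" using g by (auto simp: in_Lp_def)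
  have one: "integrable ?M (\<lambda>x. 1 :: real)"
  proof -
    have "\<Omega> \<in> lmeasurable" using open_domain domain_subset by (intro lmeasurable_open bounded_subset[OF bounded_ball])
    then have "integrable lebesgue (indicat_real \<Omega>)" by (intro integrable_real_indicator) (auto simp: fmeasurable_def)
    then show ?thesis by (simp add: integrable_restrict_space[OF domain_sets])
  qed
  have "integrable ?M g"
  proof (rule Bochner_Integration.integrable_bound[OF Bochner_Integration.integrable_add[OF gi one] gm])
    have "\<bar>g x\<bar> \<le> \<bar>g x\<bar> powr ?q + 1" for x using young_le[OF p, of "\<bar>g x\<bar>" 1] by simp
    then show "AE x in ?M. norm (g x) \<le> norm (\<bar>g x\<bar> powr ?q + 1)" by (intro AE_I2) simp
  qed
  then have gl: "integrable lebesgue (\<lambda>x. indicator \<Omega> x * g x)" by (simp add: integrable_restrict_space[OF domain_sets])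
  have "AE x in lebesgue. x \<in> \<Omega> \<longrightarrow> indicator \<Omega> x * g x = 0"
  proof (rule test_functions_zero_imp_AE_zero[OF open_domain])
    show "set_integrable lebesgue K (\<lambda>x. indicator \<Omega> x * g x)" if "compact K" for K
      unfolding set_integrable_def using that by (intro integrable_mult_indicator gl sets_completionI_sets) (auto intro: borel_compact)
    show "(\<integral>x. indicator \<Omega> x * g x * \<phi> x \<partial>lebesgue) = 0" if "test_function \<Omega> \<phi>" for \<phi>
      using z[OF that] by (simp add: integral_restrict_space[OF domain_sets] mult.assoc)
  qed
  then show ?thesis by (subst AE_restrict_space_iff[OF domain_sets]) (auto elim!: eventually_mono)
qed

section \<open>Existence, nontriviality and uniqueness\<close>

text \<open>The leading energy is left abstract so that s1 = 1 and s1 < 1 share one proof; the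
  perturbation has order s2 < 1 and is always a difference quotient energy. The assumption
  \<open>null\<close> serves nontriviality: if u vanished almost everywhere, both forms would vanish
  and g would be orthogonal to all test functions.\<close>

lemma weak_solution_exists_aux:
  assumes s: "0 < s2" "s2 < s1" "s1 \<le> 1" and p: "1 < p" "p \<le> real DIM('a)" and g: "in_Lp (p / (p - 1)) \<Omega> g"
    and E: "energy_structure (energy_space \<Omega> s1 p) D M c p"
    and pow: "\<And>u. u \<in> energy_space \<Omega> s1 p \<Longrightarrow> seminorm_pow s1 p u = ennreal (dirichlet D M c p u)"
    and form: "\<And>u v. u \<in> energy_space \<Omega> s1 p \<Longrightarrow> v \<in> energy_space \<Omega> s1 p \<Longrightarrow> energy_form \<Omega> s1 p u v = dirichlet_form D M c p u v / 2"
    and null: "\<And>u. u \<in> energy_space \<Omega> s1 p \<Longrightarrow> AE x in lebesgue. u x = 0 \<Longrightarrow> AE z in M. D u z = 0"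
    and C: "0 < C" "\<And>u. u \<in> energy_space \<Omega> s1 p \<Longrightarrow> Lp_nn p u \<le> ennreal C * seminorm_pow s1 p u"
      "\<And>u. u \<in> energy_space \<Omega> s1 p \<Longrightarrow> seminorm_pow s2 p u \<le> ennreal C * seminorm_pow s1 p u"
    and \<alpha>: "\<alpha> * C < 1"
  shows "\<exists>u. weak_solution \<Omega> s1 s2 p \<alpha> g u \<and> global_minimizer \<Omega> s1 s2 p \<alpha> g u \<and>
      (\<not> (AE x in lebesgue_on \<Omega>. g x = 0) \<longrightarrow> nontrivial u)"
    and "weak_solution \<Omega> s1 s2 p 0 g u \<Longrightarrow> weak_solution \<Omega> s1 s2 p 0 g w \<Longrightarrow> AE x in lebesgue. w x = u x"
proof -
  interpret E: energy_structure "energy_space \<Omega> s1 p" D M c p by (rule E)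
  define X where "X = energy_space \<Omega> s1 p"
  define D' where "D' = (diff_quotient s2 p :: ('a \<Rightarrow> real) \<Rightarrow> 'a \<times> 'a \<Rightarrow> real)"
  define c' where "c' = frac_const DIM('a) s2 p"
  define M' where "M' = (lebesgue :: ('a \<times> 'a) measure)"
  have p0: "0 < p" using p by simp
  have s0: "0 < s1" "s2 < 1" using s by auto
  have E': "energy_structure X D' M' c' p" unfolding X_def D'_def M'_def c'_def
    by (rule frac_energy_structure) (use s p in auto)
  have pow': "seminorm_pow s2 p u = ennreal (dirichlet D' M' c' p u)" if "u \<in> X" for u
    using that unfolding X_def D'_def M'_def c'_def by (intro frac_energy_structure) (use s p in auto)
  have form': "energy_form \<Omega> s2 p u v = dirichlet_form D' M' c' p u v / 2" for u v
    unfolding D'_def M'_def c'_def by (rule frac_energy_form) (use s p in auto)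
  interpret E': energy_structure X D' M' c' p by (rule E')
  let ?P = "dirichlet D M c p" and ?Q = "dirichlet D' M' c' p"
  define L where "L u = (\<integral>x. g x * u x \<partial>lebesgue_on \<Omega>)" for u :: "'a \<Rightarrow> real"
  have Xl: "u \<in> borel_measurable lebesgue" if "u \<in> X" for u using that by (simp add: X_def energy_space_iff[OF p0] supported_in_def)
  have Xd: "(\<lambda>x. u x - v x) \<in> X" if "u \<in> X" "v \<in> X" for u v
    using that s0 s(3) p unfolding X_def by (intro energy_space_diff) auto
  have LpP: "Lp_nn p u \<le> ennreal (C * ?P u)" if "u \<in> X" for u
    using C(2)[of u] pow[of u] that C(1) E.dirichlet_nonneg[of u] by (simp add: X_def ennreal_mult)
  have Lpf: "Lp_nn p u < \<infinity>" and Lpr: "enn2real (Lp_nn p u) \<le> C * ?P u" if "u \<in> X" for u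
  proof -
    show "Lp_nn p u < \<infinity>" by (rule le_less_trans[OF LpP[OF that]]) simp
    show "enn2real (Lp_nn p u) \<le> C * ?P u"
      using LpP[OF that] C(1) E.dirichlet_nonneg[of u] by (intro enn2real_leI) auto
  qed
  have gi: "integrable (lebesgue_on \<Omega>) (\<lambda>x. g x * u x)" if "u \<in> X" for u
    by (rule in_Lp_pairing(1)[OF p(1) g Xl[OF that] Lpf[OF that]])
  define Gp where "Gp = (\<integral>x. \<bar>g x\<bar> powr (p / (p - 1)) \<partial>lebesgue_on \<Omega>)"
  have Gp: "0 \<le> Gp" unfolding Gp_def by (rule Bochner_Integration.integral_nonneg) auto
  have Lb: "\<bar>L u\<bar> \<le> (1 / e) powr (p / (p - 1)) * Gp + e powr p * (C * ?P u)" if "u \<in> X" "0 < e" for u e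
  proof -
    have "e powr p * enn2real (Lp_nn p u) \<le> e powr p * (C * ?P u)" by (intro mult_left_mono Lpr that) auto
    then show ?thesis using in_Lp_pairing(2)[OF p(1) g Xl[OF that(1)] Lpf[OF that(1)] that(2)] unfolding L_def Gp_def by linarith
  qed
  have L_linear: "L (\<lambda>x. a * u x + b * v x) = a * L u + b * L v" if "u \<in> X" "v \<in> X" for u v a b
  proof -
    have "L (\<lambda>x. a * u x + b * v x) = (\<integral>x. a * (g x * u x) + b * (g x * v x) \<partial>lebesgue_on \<Omega>)"
      unfolding L_def by (intro Bochner_Integration.integral_cong) (auto simp: algebra_simps)
    then show ?thesis using gi[OF that(1)] gi[OF that(2)] by (simp add: L_def)
  qed
  have Lcoerc: "\<exists>K. \<forall>u\<in>X. \<bar>2 * p * L u\<bar> \<le> \<epsilon> * ?P u + K" if \<epsilon>: "0 < \<epsilon>" for \<epsilon>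
  proof -
    \<comment> \<open>The parameter for which the coefficient 2p e^p C of the energy is exactly
      \<epsilon>; the constant term may be as large as it likes.\<close>
    define e where "e = (\<epsilon> / (2 * p * C)) powr (1 / p)"
    have e: "0 < e" "2 * p * (e powr p * C) = \<epsilon>" using \<epsilon> p0 C(1) by (auto simp: e_def powr_powr)
    have "\<bar>2 * p * L u\<bar> \<le> \<epsilon> * ?P u + 2 * p * ((1 / e) powr (p / (p - 1)) * Gp)" if u: "u \<in> X" for u
    proof -
      have "\<bar>2 * p * L u\<bar> = 2 * p * \<bar>L u\<bar>" using p0 by (simp add: abs_mult)
      also have "\<dots> \<le> 2 * p * ((1 / e) powr (p / (p - 1)) * Gp + e powr p * (C * ?P u))"
        using p0 by (intro mult_left_mono Lb u e) auto
      also have "\<dots> = 2 * p * (e powr p * C) * ?P u + 2 * p * ((1 / e) powr (p / (p - 1)) * Gp)"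
        by (simp add: algebra_simps)
      finally show ?thesis by (simp only: e(2))
    qed
    then show ?thesis by blast
  qed
  have Lcont: "\<exists>K>0. \<forall>u\<in>X. \<bar>2 * p * L u\<bar> \<le> \<epsilon> + K * ?P u" if \<epsilon>: "0 < \<epsilon>" for \<epsilon>
  proof -
    let ?q = "p / (p - 1)"
    have q: "0 < ?q" using p by simp
    \<comment> \<open>The opposite choice: the constant term becomes \<epsilon> Gp / (Gp + 1) \<le>
      \<epsilon>, at the price of a large coefficient of the energy. The summand 1 keeps e positive
      when Gp = 0.\<close>
    define e where "e = (2 * p * (Gp + 1) / \<epsilon>) powr (1 / ?q)"
    have e: "0 < e" using \<epsilon> p0 Gp by (auto simp: e_def)
    have eq: "(1 / e) powr ?q = \<epsilon> / (2 * p * (Gp + 1))"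
      using \<epsilon> p(1) Gp q by (simp add: e_def powr_divide powr_powr)
    have small: "2 * p * ((1 / e) powr ?q * Gp) \<le> \<epsilon>"
    proof -
      have "2 * p * (\<epsilon> / (2 * p * x) * Gp) = \<epsilon> * (Gp / x)" for x using p0 by simp
      then have "2 * p * (\<epsilon> / (2 * p * (Gp + 1)) * Gp) = \<epsilon> * (Gp / (Gp + 1))" .
      also have "\<dots> \<le> \<epsilon> * 1" using \<epsilon> Gp by (intro mult_left_mono) auto
      finally show ?thesis unfolding eq by simp
    qed
    have "\<bar>2 * p * L u\<bar> \<le> \<epsilon> + (2 * p * (e powr p * C)) * ?P u" if u: "u \<in> X" for u
    proof -
      have "\<bar>2 * p * L u\<bar> = 2 * p * \<bar>L u\<bar>" using p0 by (simp add: abs_mult)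
      also have "\<dots> \<le> 2 * p * ((1 / e) powr ?q * Gp + e powr p * (C * ?P u))"
        using p0 by (intro mult_left_mono Lb u e) auto
      also have "\<dots> = 2 * p * ((1 / e) powr ?q * Gp) + (2 * p * (e powr p * C)) * ?P u"
        by (simp add: algebra_simps)
      finally show ?thesis using small by linarith
    qed
    moreover have "0 < 2 * p * (e powr p * C)" using p0 e C(1) by simp
    ultimately show ?thesis by blast
  qed
  have QP: "?Q u \<le> C * ?P u" if "u \<in> X" for u
    using C(3)[of u] pow[of u] pow'[OF that] that C(1) E.dirichlet_nonneg[of u]
    by (simp add: X_def ennreal_mult[symmetric] ennreal_le_iff)
  have zero: "(\<lambda>x. 0) \<in> X" unfolding X_def
    by (rule test_function_in_energy_space) (use s p test_function_zero in auto)
  have compact: "\<exists>r :: nat \<Rightarrow> nat. strict_mono r \<and> (\<forall>e>0. \<exists>N. \<forall>m\<ge>N. \<forall>n\<ge>N. ?Q (\<lambda>x. f (r m) x - f (r n) x) \<le> e)"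
    if f: "\<And>n::nat. f n \<in> X" and B: "\<And>n. ?P (f n) \<le> B" for f B
  proof -
    have B0: "0 \<le> B" using B[of 0] E.dirichlet_nonneg[of "f 0"] by linarith
    have "\<exists>r :: nat \<Rightarrow> nat. strict_mono r \<and>
      (\<forall>e>0. \<exists>N. \<forall>m\<ge>N. \<forall>n\<ge>N. seminorm_pow s2 p (\<lambda>x. f (r m) x - f (r n) x) \<le> ennreal e)"
    proof (rule energy_space_compact[OF s p _ B0])
      show "f n \<in> energy_space \<Omega> s1 p" for n using f by (simp add: X_def)
      show "seminorm_pow s1 p (f n) \<le> ennreal B" for n using pow[of "f n"] f[of n] B[of n] by (simp add: X_def ennreal_leI)
    qed
    then obtain r :: "nat \<Rightarrow> nat" where r: "strict_mono r"
      "\<forall>e>0. \<exists>N. \<forall>m\<ge>N. \<forall>n\<ge>N. seminorm_pow s2 p (\<lambda>x. f (r m) x - f (r n) x) \<le> ennreal e" by (elim exE conjE) (rule that)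
    have "\<forall>e>0. \<exists>N. \<forall>m\<ge>N. \<forall>n\<ge>N. ?Q (\<lambda>x. f (r m) x - f (r n) x) \<le> e"
      using r(2) by (simp add: pow'[OF Xd[OF f f]])
    then show ?thesis using r(1) by blast
  qed
  have complete: "\<exists>u\<in>X. (\<lambda>n. ?P (\<lambda>x. f n x - u x)) \<longlonglongrightarrow> 0"
    if f: "\<And>n::nat. f n \<in> X" and ca: "\<And>e. 0 < e \<Longrightarrow> \<exists>N. \<forall>m\<ge>N. \<forall>n\<ge>N. ?P (\<lambda>x. f m x - f n x) \<le> e" for f
  proof -
    have powd: "seminorm_pow s1 p (\<lambda>x. u x - v x) = ennreal (?P (\<lambda>x. u x - v x))" if "u \<in> X" "v \<in> X" for u v
      using pow[of "\<lambda>x. u x - v x"] Xd[OF that] by (simp add: X_def)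
    have "\<exists>u\<in>energy_space \<Omega> s1 p. (\<lambda>n. seminorm_pow s1 p (\<lambda>x. f n x - u x)) \<longlonglongrightarrow> 0"
    proof (rule energy_space_complete[OF s0(1) s(3) p])
      show "f n \<in> energy_space \<Omega> s1 p" for n using f by (simp add: X_def)
      show "\<exists>N. \<forall>m\<ge>N. \<forall>n\<ge>N. seminorm_pow s1 p (\<lambda>x. f m x - f n x) \<le> ennreal e" if "0 < e" for e
        using ca[OF that] that by (simp add: powd[OF f f])
    qed
    then obtain u where u: "u \<in> X" "(\<lambda>n. seminorm_pow s1 p (\<lambda>x. f n x - u x)) \<longlonglongrightarrow> 0" unfolding X_def by blast
    have "(\<lambda>n. ennreal (?P (\<lambda>x. f n x - u x))) \<longlonglongrightarrow> ennreal 0" using u(2) by (simp add: powd[OF f u(1)])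
    then have "(\<lambda>n. ?P (\<lambda>x. f n x - u x)) \<longlonglongrightarrow> 0" using E.dirichlet_nonneg by (subst (asm) tendsto_ennreal_iff) auto
    then show ?thesis using u(1) by blast
  qed
  \<comment> \<open>Multiplying the energy by 2p removes its prefactors, so the linear functional in
    the abstract problem is 2p L. In the resulting equation the factor 2 is compensated by the 1/2
    in both forms.\<close>
  have energy_eq: "energy \<Omega> s1 s2 p \<alpha> g u = (?P u - \<alpha> * ?Q u - 2 * p * L u) / (2 * p)" if u: "u \<in> X" for u
  proof -
    have "enn2real (seminorm s1 p u) powr p = ?P u"
      using seminorm_powr[OF p0, of s1 u] pow[of u] u E.dirichlet_nonneg[of u] by (simp add: X_def)
    moreover have "enn2real (seminorm s2 p u) powr p = ?Q u"
      using seminorm_powr[OF p0, of s2 u] pow'[OF u] E'.dirichlet_nonneg[of u] by simp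
    ultimately show ?thesis using p0 by (simp add: energy_def L_def field_simps)
  qed
  obtain u where u: "u \<in> X" "\<And>w. w \<in> X \<Longrightarrow> ?P u - \<alpha> * ?Q u - 2 * p * L u \<le> ?P w - \<alpha> * ?Q w - 2 * p * L w"
    "\<And>v. v \<in> X \<Longrightarrow> p * dirichlet_form D M c p u v - \<alpha> * (p * dirichlet_form D' M' c' p u v) = 2 * p * L v"
  proof (rule variational_solution[where L = "\<lambda>u. 2 * p * L u", OF E[folded X_def] E' zero QP C(1) \<alpha> _ Lcoerc Lcont compact complete])
    show "2 * p * L (\<lambda>x. a * u x + b * v x) = a * (2 * p * L u) + b * (2 * p * L v)" if "u \<in> X" "v \<in> X" for u v a b
      by (simp add: L_linear[OF that] algebra_simps)
  qed (auto intro: that)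
  have weak: "energy_form \<Omega> s1 p u v - \<alpha> * energy_form \<Omega> s2 p u v = L v" if v: "v \<in> X" for v
  proof -
    have "p * (dirichlet_form D M c p u v - \<alpha> * dirichlet_form D' M' c' p u v) = p * (2 * L v)"
      using u(3)[OF v] by (simp add: algebra_simps)
    then have "dirichlet_form D M c p u v - \<alpha> * dirichlet_form D' M' c' p u v = 2 * L v" using p0 by simp
    then show ?thesis using form[of u v] u(1) v by (simp add: X_def form')
  qed
  have "weak_solution \<Omega> s1 s2 p \<alpha> g u" using u(1) weak by (simp add: weak_solution_def X_def L_def)
  moreover have "global_minimizer \<Omega> s1 s2 p \<alpha> g u"
    unfolding global_minimizer_def X_def[symmetric] using u(1,2) p0 by (auto simp: energy_eq intro!: divide_right_mono)
  moreover have "nontrivial u" if "\<not> (AE x in lebesgue_on \<Omega>. g x = 0)"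
    unfolding nontrivial_def
  proof
    assume z: "AE x in lebesgue. u x = 0"
    have Dz: "AE z in M. D u z = 0" using null[of u] u(1) z by (simp add: X_def)
    have "AE z in M'. D' u z = D' (\<lambda>x. 0) z" unfolding D'_def M'_def by (rule diff_quotient_AE_cong[OF z])
    then have D'z: "AE z in M'. D' u z = 0" by (simp add: D'_def diff_quotient_def)
    have "(\<integral>x. g x * \<phi> x \<partial>lebesgue_on \<Omega>) = 0" if \<phi>: "test_function \<Omega> \<phi>" for \<phi>
    proof -
      have X: "\<phi> \<in> X" unfolding X_def by (rule test_function_in_energy_space) (use s p \<phi> in auto)
      have "dirichlet_form D M c p u \<phi> = 0"
        unfolding dirichlet_form_def using Dz by (intro mult_eq_0_iff[THEN iffD2] disjI2 integral_eq_zero_AE) (auto elim!: eventually_mono)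
      moreover have "dirichlet_form D' M' c' p u \<phi> = 0"
        unfolding dirichlet_form_def using D'z by (intro mult_eq_0_iff[THEN iffD2] disjI2 integral_eq_zero_AE) (auto elim!: eventually_mono)
      ultimately show ?thesis using weak[OF X] form[of u \<phi>] u(1) X by (simp add: X_def form' L_def)
    qed
    then have "AE x in lebesgue_on \<Omega>. g x = 0" by (rule in_Lp_zero_if_pairing_zero[OF p(1) g])
    then show False using that by contradiction
  qed
  ultimately show "\<exists>u. weak_solution \<Omega> s1 s2 p \<alpha> g u \<and> global_minimizer \<Omega> s1 s2 p \<alpha> g u \<and>
      (\<not> (AE x in lebesgue_on \<Omega>. g x = 0) \<longrightarrow> nontrivial u)" by blast
  show "AE x in lebesgue. w x = u x" if "weak_solution \<Omega> s1 s2 p 0 g u" "weak_solution \<Omega> s1 s2 p 0 g w" for u w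
  proof -
    have uw: "u \<in> X" "w \<in> X" using that by (auto simp: weak_solution_def X_def)
    note d = Xd[OF uw]
    \<comment> \<open>Both solutions are tested with their difference. Strict monotonicity makes the
      energy of the difference vanish, and the Poincare inequality turns this into equality almost
      everywhere.\<close>
    have "energy_form \<Omega> s1 p u (\<lambda>x. u x - w x) = energy_form \<Omega> s1 p w (\<lambda>x. u x - w x)"
      using that d by (simp add: weak_solution_def X_def)
    then have "dirichlet_form D M c p u (\<lambda>x. u x - w x) = dirichlet_form D M c p w (\<lambda>x. u x - w x)"
      using form[of u "\<lambda>x. u x - w x"] form[of w "\<lambda>x. u x - w x"] uw d by (simp add: X_def)
    then have "?P (\<lambda>x. u x - w x) = 0" using uw by (intro E.dirichlet_form_monotone) (auto simp: X_def)
    then have "Lp_nn p (\<lambda>x. u x - w x) = 0" using LpP[OF d] by simp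
    then have "AE x in lebesgue. ennreal (\<bar>u x - w x\<bar> powr p) = 0"
      unfolding Lp_nn_lebesgue using Xl[OF d] by (subst (asm) nn_integral_0_iff_AE) (auto, measurable)
    then show ?thesis by eventually_elim auto
  qed
qed

lemma weak_solution_exists:
  assumes s: "0 < s2" "s2 < s1" "s1 \<le> 1" and p: "1 < p" "p \<le> real DIM('a)" and g: "in_Lp (p / (p - 1)) \<Omega> g"
    and C: "0 < C" "\<And>u. u \<in> energy_space \<Omega> s1 p \<Longrightarrow> Lp_nn p u \<le> ennreal C * seminorm_pow s1 p u"
      "\<And>u. u \<in> energy_space \<Omega> s1 p \<Longrightarrow> seminorm_pow s2 p u \<le> ennreal C * seminorm_pow s1 p u"
    and \<alpha>: "\<alpha> * C < 1"
  shows "(\<exists>u. weak_solution \<Omega> s1 s2 p \<alpha> g u \<and> global_minimizer \<Omega> s1 s2 p \<alpha> g u \<and>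
      (\<not> (AE x in lebesgue_on \<Omega>. g x = 0) \<longrightarrow> nontrivial u)) \<and>
    (\<forall>u w. weak_solution \<Omega> s1 s2 p 0 g u \<longrightarrow> weak_solution \<Omega> s1 s2 p 0 g w \<longrightarrow> (AE x in lebesgue. w x = u x))"
proof (cases "s1 = 1")
  case True
  \<comment> \<open>The zero field is a weak gradient of any function that vanishes almost
    everywhere; by uniqueness the chosen gradient agrees with it.\<close>
  have null: "AE z in lebesgue. weak_gradient u z = 0" if u: "u \<in> energy_space \<Omega> 1 p" and z: "AE x in lebesgue. u x = 0" for u
  proof -
    have um: "u \<in> borel_measurable lebesgue" using u p by (simp add: energy_space_iff supported_in_def)
    have i0: "AE x in lebesgue. f x * u x = 0" for f :: "'a \<Rightarrow> real" using z by eventually_elim simp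
    have "has_weak_gradient u (\<lambda>x. 0)"
      unfolding has_weak_gradient_def
    proof (intro conjI allI impI ballI)
      show "set_integrable lebesgue K u" if "compact K" for K
      proof -
        have "(\<lambda>x. indicator K x *\<^sub>R u x) \<in> borel_measurable lebesgue"
          using that um by (intro borel_measurable_scaleR borel_measurable_indicator sets_completionI_sets) (auto intro: borel_compact)
        then show ?thesis unfolding set_integrable_def
          using integrable_cong_AE[of "\<lambda>x. indicator K x *\<^sub>R u x" lebesgue "\<lambda>x. 0"] i0[of "indicator K"] by simp
      qed
      show "(\<integral>x. u x * frechet_derivative \<phi> (at x) i \<partial>lebesgue) = - (\<integral>x. (0 \<bullet> i) * \<phi> x \<partial>lebesgue)" for \<phi> and i :: 'a
        using i0[of "\<lambda>x. frechet_derivative \<phi> (at x) i"] by (simp add: mult.commute integral_eq_zero_AE)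
    qed (simp add: set_integrable_def)
    then show ?thesis by (rule seminorm_pow_one(2))
  qed
  note st = gradient_energy_structure[OF p] and fm = gradient_energy_form[OF p]
  show ?thesis
    using weak_solution_exists_aux[OF s p g, unfolded True, OF st fm null C(1) C(2,3)[unfolded True] \<alpha>] True by blast
next
  case False
  then have s1: "0 < s1" "s1 < 1" using s by auto
  note st = frac_energy_structure[OF s1 order_refl s(3) p]
  have null: "AE z in lebesgue. diff_quotient s1 p u z = 0" if z: "AE x in lebesgue. u x = 0" for u :: "'a \<Rightarrow> real"
  proof -
    have "AE z in lebesgue. diff_quotient s1 p u z = diff_quotient s1 p (\<lambda>x. 0) z" by (rule diff_quotient_AE_cong[OF z])
    then show ?thesis by (simp add: diff_quotient_def)
  qed
  show ?thesis
    using weak_solution_exists_aux[OF s p g st frac_energy_form[OF s1 p(1)] null C \<alpha>] by blast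
qed

end

theorem corollary1p2:
  fixes \<Omega> :: "(real ^ 'n) set"
  assumes "CARD('n) \<ge> 2"
    and "open \<Omega>" and "bounded \<Omega>" and "smooth_boundary \<Omega>"
  shows "(\<exists>\<alpha>0>0. \<forall>s1 s2 p \<alpha> :: real. \<forall>g :: real ^ 'n \<Rightarrow> real.
            0 < s2 \<and> s2 < s1 \<and> s1 \<le> 1 \<and> 1 < p \<and> p < real CARD('n) \<and>
            in_Lp (p / (p - 1)) \<Omega> g \<and> \<alpha> < \<alpha>0 \<longrightarrow>
            (\<exists>u. weak_solution \<Omega> s1 s2 p \<alpha> g u \<and> global_minimizer \<Omega> s1 s2 p \<alpha> g u \<and>
                 (\<not> (AE x in lebesgue_on \<Omega>. g x = 0) \<longrightarrow> nontrivial u)))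
       \<and> (\<forall>s1 s2 p :: real. \<forall>g :: real ^ 'n \<Rightarrow> real.
            0 < s2 \<and> s2 < s1 \<and> s1 \<le> 1 \<and> 1 < p \<and> p < real CARD('n) \<and>
            in_Lp (p / (p - 1)) \<Omega> g \<longrightarrow>
            (\<exists>u. weak_solution \<Omega> s1 s2 p 0 g u \<and>
                 (\<forall>w. weak_solution \<Omega> s1 s2 p 0 g w \<longrightarrow> (AE x in lebesgue. w x = u x))))"
proof -
  obtain R0 where R0: "\<Omega> \<subseteq> ball 0 R0" using bounded_subset_ballD[OF assms(3), of 0] by auto
  interpret bounded_domain \<Omega> "max 1 R0"
    using assms(1,2) R0 by unfold_locales auto
  have dim: "DIM(real ^ 'n) = CARD('n)" by simp
  \<comment> \<open>Only the dimension and a ball around \<Omega> enter this constant, and it is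
    fixed before s1, s2, p and g; hence 1 / C is an admissible \<alpha>0.\<close>
  obtain C where C: "0 < C"
    "\<And>s p u. 0 < s \<Longrightarrow> s \<le> 1 \<Longrightarrow> 1 < p \<Longrightarrow> p \<le> real DIM(real ^ 'n) \<Longrightarrow> u \<in> energy_space \<Omega> s p \<Longrightarrow>
      Lp_nn p u \<le> ennreal C * seminorm_pow s p u"
    "\<And>s1 s2 p u. 0 < s2 \<Longrightarrow> s2 < s1 \<Longrightarrow> s1 \<le> 1 \<Longrightarrow> 1 < p \<Longrightarrow> p \<le> real DIM(real ^ 'n) \<Longrightarrow> u \<in> energy_space \<Omega> s1 p \<Longrightarrow>
      seminorm_pow s2 p u \<le> ennreal C * seminorm_pow s1 p u"
    by (rule energy_space_embedding) (rule that)
  have sol: "(\<exists>u. weak_solution \<Omega> s1 s2 p \<alpha> g u \<and> global_minimizer \<Omega> s1 s2 p \<alpha> g u \<and>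
      (\<not> (AE x in lebesgue_on \<Omega>. g x = 0) \<longrightarrow> nontrivial u)) \<and>
    (\<forall>u w. weak_solution \<Omega> s1 s2 p 0 g u \<longrightarrow> weak_solution \<Omega> s1 s2 p 0 g w \<longrightarrow> (AE x in lebesgue. w x = u x))"
    if "0 < s2" "s2 < s1" "s1 \<le> 1" "1 < p" "p < real CARD('n)" "in_Lp (p / (p - 1)) \<Omega> g" "\<alpha> < 1 / C" for s1 s2 p \<alpha> g
  proof (rule weak_solution_exists[of s2 s1 p g C \<alpha>])
    show "\<alpha> * C < 1" using that(7) C(1) by (simp add: field_simps)
  qed (use that C in auto)
  show ?thesis
  proof (intro conjI exI[of _ "1 / C"] allI impI)
    show "0 < 1 / C" using C(1) by simp
  next
    fix s1 s2 p \<alpha> :: real and g :: "real ^ 'n \<Rightarrow> real"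
    assume "0 < s2 \<and> s2 < s1 \<and> s1 \<le> 1 \<and> 1 < p \<and> p < real CARD('n) \<and> in_Lp (p / (p - 1)) \<Omega> g \<and> \<alpha> < 1 / C"
    then show "\<exists>u. weak_solution \<Omega> s1 s2 p \<alpha> g u \<and> global_minimizer \<Omega> s1 s2 p \<alpha> g u \<and>
        (\<not> (AE x in lebesgue_on \<Omega>. g x = 0) \<longrightarrow> nontrivial u)"
      using sol[of s2 s1 p g \<alpha>] by blast
  next
    fix s1 s2 p :: real and g :: "real ^ 'n \<Rightarrow> real"
    assume a: "0 < s2 \<and> s2 < s1 \<and> s1 \<le> 1 \<and> 1 < p \<and> p < real CARD('n) \<and> in_Lp (p / (p - 1)) \<Omega> g"
    \<comment> \<open>The second problem is the case \<alpha> = 0, which lies below the threshold,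
      so existence needs no separate argument.\<close>
    have "0 < 1 / C" using C(1) by simp
    then show "\<exists>u. weak_solution \<Omega> s1 s2 p 0 g u \<and>
        (\<forall>w. weak_solution \<Omega> s1 s2 p 0 g w \<longrightarrow> (AE x in lebesgue. w x = u x))"
      using sol[of s2 s1 p g 0] a by blast
  qed
qed

end
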